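(* Let $\Lambda$ be an $n$-Koszul algebra, with $n>2$, let $\Lambda^!$ be its $n$-homogeneous dual and $E=E(\Lambda)$ its Yoneda algebra. Let $m\in\mathbf{Z}$, $\mathcal{U}=n\mathbf{Z}\cup(n\mathbf{Z}+1)$ and $\mathcal{S}=m+\mathcal{U}$. Then there is an equivalence of categories between: (1) the full subcategory $\mathcal{G}(\mathcal{S},\mathcal{U})$ of $Gr_{\Lambda^!}$ consisting of those $M$ such that $M=M_{m+n\mathbf{Z}}\Lambda^!$ and, for every graded submodule $0\neq N\leq M$, one has $N_{\mathcal{S}}\neq0$; (2) the full subcategory $\mathcal{L}_E$ of $Gr_E$ consisting of those $V\in Gr_E$ which are generated in even degrees and satisfy $\mathrm{Ker}(\tilde{\mu}_{2k,1})\Lambda^!_{n-1}\subseteq\mathrm{Ker}(\tilde{\mu}_{2k,2})$ for all $k\in\mathbf{Z}$. Moreover, $\mathcal{L}_E$ contains all the graded $E$-modules presented in even degrees.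
   Context: Modules are right modules and $Gr$ denotes categories of $\mathbf{Z}$-graded right modules with degree-preserving morphisms. For a graded module $M$ and $\mathcal{X}\subseteq\mathbf{Z}$, $M_{\mathcal{X}}=\bigoplus_{x\in\mathcal{X}}M_x$. An $n$-Koszul algebra is a graded algebra $\Lambda=KQ/I$, with $K$ a field, $Q$ a finite quiver and $I$ an ideal generated by elements homogeneous of degree $n$ (path-length grading), such that the $i$-th term of the minimal graded projective resolution of $\Lambda_0$ is generated in degree $\delta(i)$ for all $i\geq0$, where $\delta(2k)=kn$ and $\delta(2k+1)=kn+1$. Its $n$-homogeneous dual is $\Lambda^!=KQ^{op}/\langle I_n^{\perp}\rangle$, where $I_n^\perp$ is the orthogonal of $I_n\subseteq KQ_n$ under the natural pairing between paths of length $n$ in $Q$ and in $Q^{op}$; it is a positively graded algebra generated in degrees $0,1$ with semisimple degree-$0$ part $\Lambda_0^!\cong\Lambda_0$. The Yoneda algebra is $E=\bigoplus_{i\geq0}\mathrm{Ext}^i_\Lambda(\Lambda_0,\Lambda_0)$. By a known theorem (Green–Marcos–Martínez-Villa–Zhang; Berger–Marconnet), taken as given, $E$ is identified as a graded algebra with the following: $E_{2k}=\Lambda^!_{kn}$, $E_{2k+1}=\Lambda^!_{kn+1}$, and the product of nonzero homogeneous elements $a,b$, of degrees $\deg(a),\deg(b)\in\mathcal{U}$ in $\Lambda^!$, is their product in $\Lambda^!$ if $\deg(a)+\deg(b)\in\mathcal{U}$ and is $0$ otherwise. $\otimes$ means $\otimes_{\Lambda^!_0}$ (with $E_0=\Lambda_0^!$).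 For $V\in Gr_E$, $\tilde{\mu}_{2k,1}:V_{2k}\otimes E_1=V_{2k}\otimes\Lambda^!_1\to V_{2k+1}$ and $\tilde{\mu}_{2k,2}:V_{2k}\otimes E_2=V_{2k}\otimes\Lambda^!_n\to V_{2k+2}$ are the multiplication maps, and $\mathrm{Ker}(\tilde{\mu}_{2k,1})\Lambda^!_{n-1}$ is computed in the right $\Lambda^!$-module $V_{2k}\otimes\Lambda^!$, hence lies in $V_{2k}\otimes\Lambda^!_n$. A graded module is generated in even degrees if it is generated by its homogeneous elements of even degree; presented in even degrees if it is the cokernel of a morphism $P\to Q$ of graded modules with $P,Q$ gr-projective and generated in even degrees. *)

theory Defs
  imports
    "Graph_Theory.Arc_Walk"
    "HOL-Algebra.Free_Abelian_Groups"
    "HOL-Algebra.QuotRing"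
begin

section \<open>Categories\<close>

record ('o, 'm) category =
  Ob :: "'o set"
  Hom :: "'o \<Rightarrow> 'o \<Rightarrow> 'm set"
  Id :: "'o \<Rightarrow> 'm"
  Comp :: "'o \<Rightarrow> 'o \<Rightarrow> 'o \<Rightarrow> 'm \<Rightarrow> 'm \<Rightarrow> 'm"
    \<comment> \<open>\<open>Comp X Y Z g f\<close> is the composite of \<open>f : X \<rightarrow> Y\<close> and \<open>g : Y \<rightarrow> Z\<close>\<close>

locale category =
  fixes C :: "('o, 'm) category"
  assumes Id_in: "X \<in> Ob C \<Longrightarrow> Id C X \<in> Hom C X X"
    and Comp_in: "\<lbrakk>X \<in> Ob C; Y \<in> Ob C; Z \<in> Ob C; f \<in> Hom C X Y; g \<in> Hom C Y Z\<rbrakk>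
      \<Longrightarrow> Comp C X Y Z g f \<in> Hom C X Z"
    and Id_left: "\<lbrakk>X \<in> Ob C; Y \<in> Ob C; f \<in> Hom C X Y\<rbrakk> \<Longrightarrow> Comp C X Y Y (Id C Y) f = f"
    and Id_right: "\<lbrakk>X \<in> Ob C; Y \<in> Ob C; f \<in> Hom C X Y\<rbrakk> \<Longrightarrow> Comp C X X Y f (Id C X) = f"
    and Comp_assoc: "\<lbrakk>W \<in> Ob C; X \<in> Ob C; Y \<in> Ob C; Z \<in> Ob C;
        f \<in> Hom C W X; g \<in> Hom C X Y; h \<in> Hom C Y Z\<rbrakk>
      \<Longrightarrow> Comp C W Y Z h (Comp C W X Y g f) = Comp C W X Z (Comp C X Y Z h g) f"

definition full_subcategory :: "('o, 'm) category \<Rightarrow> ('o \<Rightarrow> bool) \<Rightarrow> ('o, 'm) category" where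
  "full_subcategory C \<Phi> = C\<lparr>Ob := {X \<in> Ob C. \<Phi> X}\<rparr>"

text \<open>A functor is given by its object map \<open>Fo\<close> and its maps \<open>Fm X Y\<close> on hom sets.\<close>

locale cat_functor = C: category C + D: category D
  for C :: "('o, 'm) category" and D :: "('p, 'q) category" +
  fixes Fo :: "'o \<Rightarrow> 'p" and Fm :: "'o \<Rightarrow> 'o \<Rightarrow> 'm \<Rightarrow> 'q"
  assumes obj: "X \<in> Ob C \<Longrightarrow> Fo X \<in> Ob D"
    and mor: "\<lbrakk>X \<in> Ob C; Y \<in> Ob C; f \<in> Hom C X Y\<rbrakk> \<Longrightarrow> Fm X Y f \<in> Hom D (Fo X) (Fo Y)"
    and mor_Id: "X \<in> Ob C \<Longrightarrow> Fm X X (Id C X) = Id D (Fo X)"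
    and mor_Comp: "\<lbrakk>X \<in> Ob C; Y \<in> Ob C; Z \<in> Ob C; f \<in> Hom C X Y; g \<in> Hom C Y Z\<rbrakk>
      \<Longrightarrow> Fm X Z (Comp C X Y Z g f) = Comp D (Fo X) (Fo Y) (Fo Z) (Fm Y Z g) (Fm X Y f)"

definition iso_in :: "('o, 'm) category \<Rightarrow> 'o \<Rightarrow> 'o \<Rightarrow> 'm set" where
  "iso_in C X Y = {f \<in> Hom C X Y. \<exists>g \<in> Hom C Y X.
     Comp C X Y X g f = Id C X \<and> Comp C Y X Y f g = Id C Y}"

definition naturally_isomorphic ::
  "('o, 'm) category \<Rightarrow> ('p, 'q) category \<Rightarrow> ('o \<Rightarrow> 'p) \<Rightarrow> ('o \<Rightarrow> 'o \<Rightarrow> 'm \<Rightarrow> 'q)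
    \<Rightarrow> ('o \<Rightarrow> 'p) \<Rightarrow> ('o \<Rightarrow> 'o \<Rightarrow> 'm \<Rightarrow> 'q) \<Rightarrow> bool" where
  "naturally_isomorphic C D Fo Fm Go Gm \<longleftrightarrow>
     (\<exists>\<eta>. (\<forall>X \<in> Ob C. \<eta> X \<in> iso_in D (Fo X) (Go X)) \<and>
       (\<forall>X \<in> Ob C. \<forall>Y \<in> Ob C. \<forall>f \<in> Hom C X Y.
          Comp D (Fo X) (Fo Y) (Go Y) (\<eta> Y) (Fm X Y f)
        = Comp D (Fo X) (Go X) (Go Y) (Gm X Y f) (\<eta> X)))"

definition equivalent_categories :: "('o, 'm) category \<Rightarrow> ('p, 'q) category \<Rightarrow> bool" where
  "equivalent_categories C D \<longleftrightarrow>
     (\<exists>Fo Fm Go Gm. cat_functor C D Fo Fm \<and> cat_functor D C Go Gm \<and>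
        naturally_isomorphic C C (\<lambda>X. Go (Fo X)) (\<lambda>X Y f. Gm (Fo X) (Fo Y) (Fm X Y f))
          (\<lambda>X. X) (\<lambda>X Y f. f) \<and>
        naturally_isomorphic D D (\<lambda>X. Fo (Go X)) (\<lambda>X Y f. Fm (Go X) (Go Y) (Gm X Y f))
          (\<lambda>X. X) (\<lambda>X Y f. f))"


section \<open>Graded groups, graded rings and graded right modules\<close>

record 'a graded = "'a ring" +
  component :: "int \<Rightarrow> 'a set"

text \<open>As in the library's record for modules, the fields for multiplication and unit, which
  are inherited from rings, carry no meaning in a module.\<close>

record ('r, 'a) graded_module = "'a graded" +
  act :: "'a \<Rightarrow> 'r \<Rightarrow> 'a"

definition is_decomp :: "('a, 'm) graded_scheme \<Rightarrow> 'a \<Rightarrow> (int \<Rightarrow> 'a) \<Rightarrow> bool" where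
  "is_decomp M x f \<longleftrightarrow> (\<forall>i. f i \<in> component M i) \<and> finite {i. f i \<noteq> \<zero>\<^bsub>M\<^esub>} \<and>
     x = (\<Oplus>\<^bsub>M\<^esub>i\<in>{i. f i \<noteq> \<zero>\<^bsub>M\<^esub>}. f i)"

locale graded_group = abelian_group M for M :: "('a, 'm) graded_scheme" (structure) +
  assumes component_subgroup: "additive_subgroup (component M i) M"
    and decomposition: "x \<in> carrier M \<Longrightarrow> \<exists>!f. is_decomp M x f"

locale graded_ring = ring R + graded_group R for R :: "('a, 'm) graded_scheme" (structure) +
  assumes one_degree: "\<one> \<in> component R 0"
    and mult_degree: "\<lbrakk>x \<in> component R i; y \<in> component R j\<rbrakk> \<Longrightarrow> x \<otimes> y \<in> component R (i + j)"

locale graded_right_module = R: graded_ring R + M: graded_group M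
  for R :: "('r, 'x) graded_scheme" and M :: "('r, 'a) graded_module" +
  assumes act_closed: "\<lbrakk>x \<in> carrier M; a \<in> carrier R\<rbrakk> \<Longrightarrow> act M x a \<in> carrier M"
    and act_add_left: "\<lbrakk>x \<in> carrier M; y \<in> carrier M; a \<in> carrier R\<rbrakk>
      \<Longrightarrow> act M (x \<oplus>\<^bsub>M\<^esub> y) a = act M x a \<oplus>\<^bsub>M\<^esub> act M y a"
    and act_add_right: "\<lbrakk>x \<in> carrier M; a \<in> carrier R; b \<in> carrier R\<rbrakk>
      \<Longrightarrow> act M x (a \<oplus>\<^bsub>R\<^esub> b) = act M x a \<oplus>\<^bsub>M\<^esub> act M x b"
    and act_assoc: "\<lbrakk>x \<in> carrier M; a \<in> carrier R; b \<in> carrier R\<rbrakk>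
      \<Longrightarrow> act M (act M x a) b = act M x (a \<otimes>\<^bsub>R\<^esub> b)"
    and act_one: "x \<in> carrier M \<Longrightarrow> act M x \<one>\<^bsub>R\<^esub> = x"
    and act_degree: "\<lbrakk>x \<in> component M i; a \<in> component R j\<rbrakk> \<Longrightarrow> act M x a \<in> component M (i + j)"

definition hpart :: "('a, 'm) graded_scheme \<Rightarrow> int \<Rightarrow> 'a \<Rightarrow> 'a" where
  "hpart M i x = (THE f. is_decomp M x f) i"

text \<open>\<open>homog_sum M X\<close> is $M_X = \bigoplus_{i \in X} M_i$, as an internal sum in $M$.\<close>

definition homog_sum :: "('a, 'm) graded_scheme \<Rightarrow> int set \<Rightarrow> 'a set" where
  "homog_sum M X = generate (add_monoid M) (\<Union>i\<in>X. component M i)"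

definition act_prod :: "('r, 'a) graded_module \<Rightarrow> 'a set \<Rightarrow> 'r set \<Rightarrow> 'a set" where
  "act_prod M X Y = generate (add_monoid M) {act M x a | x a. x \<in> X \<and> a \<in> Y}"

definition generated_in_degrees ::
  "('r, 'x) graded_scheme \<Rightarrow> ('r, 'a) graded_module \<Rightarrow> int set \<Rightarrow> bool" where
  "generated_in_degrees R M X \<longleftrightarrow> act_prod M (homog_sum M X) (carrier R) = carrier M"

definition submod :: "('r, 'a) graded_module \<Rightarrow> 'a set \<Rightarrow> ('r, 'a) graded_module" where
  "submod M N = M\<lparr>carrier := N, component := (\<lambda>i. N \<inter> component M i)\<rparr>"

definition graded_submodule ::
  "('r, 'x) graded_scheme \<Rightarrow> 'a set \<Rightarrow> ('r, 'a) graded_module \<Rightarrow> bool" where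
  "graded_submodule R N M \<longleftrightarrow> N \<subseteq> carrier M \<and> graded_right_module R (submod M N)"

text \<open>Morphisms are extensional functions, so that equality of morphisms is equality on the
  carrier of the source.\<close>

definition mod_hom ::
  "('r, 'x) graded_scheme \<Rightarrow> ('r, 'a) graded_module \<Rightarrow> ('r, 'b) graded_module \<Rightarrow> ('a \<Rightarrow> 'b) set" where
  "mod_hom R M N = {f \<in> carrier M \<rightarrow>\<^sub>E carrier N.
     (\<forall>x \<in> carrier M. \<forall>y \<in> carrier M. f (x \<oplus>\<^bsub>M\<^esub> y) = f x \<oplus>\<^bsub>N\<^esub> f y) \<and>
     (\<forall>x \<in> carrier M. \<forall>a \<in> carrier R. f (act M x a) = act N (f x) a)}"

definition gr_hom ::
  "('r, 'x) graded_scheme \<Rightarrow> ('r, 'a) graded_module \<Rightarrow> ('r, 'b) graded_module \<Rightarrow> ('a \<Rightarrow> 'b) set" where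
  "gr_hom R M N = {f \<in> mod_hom R M N. \<forall>i. f ` component M i \<subseteq> component N i}"

text \<open>The category of graded right \<open>R\<close>-modules whose underlying set is contained in the
  type \<open>'u\<close>, which plays the role of a universe.\<close>

definition Gr :: "('r, 'x) graded_scheme \<Rightarrow> (('r, 'u) graded_module, 'u \<Rightarrow> 'u) category" where
  "Gr R = \<lparr>Ob = {M. graded_right_module R M}, Hom = gr_hom R,
     Id = (\<lambda>M. \<lambda>x\<in>carrier M. x), Comp = (\<lambda>L M N g f. compose (carrier L) g f)\<rparr>"

definition gr_projective :: "('r, 'x) graded_scheme \<Rightarrow> ('r, 'u) graded_module \<Rightarrow> bool" where
  "gr_projective R P \<longleftrightarrow> graded_right_module R P \<and>
     (\<forall>(M :: ('r, 'u) graded_module) (N :: ('r, 'u) graded_module) g f.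
        graded_right_module R M \<and> graded_right_module R N \<and>
        g \<in> gr_hom R M N \<and> g ` carrier M = carrier N \<and> f \<in> gr_hom R P N \<longrightarrow>
        (\<exists>h \<in> gr_hom R P M. compose (carrier P) g h = f))"

definition graded_ring_iso ::
  "('a, 'x) graded_scheme \<Rightarrow> ('b, 'y) graded_scheme \<Rightarrow> ('a \<Rightarrow> 'b) set" where
  "graded_ring_iso R S = {\<phi> \<in> ring_iso R S. \<forall>i. \<phi> ` component R i = component S i}"

definition graded_quotient :: "('a, 'x) graded_scheme \<Rightarrow> 'a set \<Rightarrow> 'a set graded" where
  "graded_quotient R I = \<lparr>carrier = carrier (R Quot I), mult = mult (R Quot I),
     one = one (R Quot I), zero = zero (R Quot I), add = add (R Quot I),
     component = (\<lambda>i. (\<lambda>x. I +>\<^bsub>R\<^esub> x) ` component R i)\<rparr>"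


section \<open>Quiver algebras and the homogeneous dual\<close>

text \<open>A path is a pair of its starting vertex and its list of arcs. The product of paths
  is concatenation read from left to right: \<open>p q\<close> first follows \<open>p\<close>.\<close>

definition paths :: "('v, 'b) pre_digraph \<Rightarrow> ('v \<times> 'b list) set" where
  "paths Q = {(u, p). \<exists>v. pre_digraph.awalk Q u p v}"

definition path_alg :: "('v, 'b) pre_digraph \<Rightarrow> (('v \<times> 'b list) \<Rightarrow>\<^sub>0 'k::field) graded" where
  "path_alg Q = \<lparr>carrier = {f. Poly_Mapping.keys f \<subseteq> paths Q},
     mult = (\<lambda>f g. \<Sum>p\<in>Poly_Mapping.keys f. \<Sum>q\<in>Poly_Mapping.keys g.
       if pre_digraph.awalk Q (fst p) (snd p) (fst q)
       then Poly_Mapping.single (fst p, snd p @ snd q)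
              (Poly_Mapping.lookup f p * Poly_Mapping.lookup g q)
       else 0),
     one = (\<Sum>v\<in>verts Q. Poly_Mapping.single (v, []) 1),
     zero = 0, add = (+),
     component = (\<lambda>i. {f. Poly_Mapping.keys f \<subseteq> {p \<in> paths Q. int (length (snd p)) = i}})\<rparr>"

definition opposite :: "('v, 'b) pre_digraph \<Rightarrow> ('v, 'b) pre_digraph" where
  "opposite Q = \<lparr>verts = verts Q, arcs = arcs Q, tail = head Q, head = tail Q\<rparr>"

definition opposite_path :: "('v, 'b) pre_digraph \<Rightarrow> 'v \<times> 'b list \<Rightarrow> 'v \<times> 'b list" where
  "opposite_path Q p = (last (pre_digraph.awalk_verts Q (fst p) (snd p)), rev (snd p))"

text \<open>The natural pairing of $KQ_n$ and $KQ^{op}_n$ makes the basis of paths of length \<open>n\<close>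
  and the basis of their opposites dual to each other.\<close>

definition path_pairing ::
  "('v, 'b) pre_digraph \<Rightarrow> (('v \<times> 'b list) \<Rightarrow>\<^sub>0 'k::field) \<Rightarrow> (('v \<times> 'b list) \<Rightarrow>\<^sub>0 'k) \<Rightarrow> 'k" where
  "path_pairing Q f g = (\<Sum>p\<in>Poly_Mapping.keys f.
     Poly_Mapping.lookup f p * Poly_Mapping.lookup g (opposite_path Q p))"

definition orthogonal ::
  "nat \<Rightarrow> ('v, 'b) pre_digraph \<Rightarrow> (('v \<times> 'b list) \<Rightarrow>\<^sub>0 'k::field) set
    \<Rightarrow> (('v \<times> 'b list) \<Rightarrow>\<^sub>0 'k) set" where
  "orthogonal n Q I = {g \<in> component (path_alg (opposite Q)) (int n).
     \<forall>f \<in> I \<inter> component (path_alg Q) (int n). path_pairing Q f g = 0}"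

definition homogeneous_dual ::
  "nat \<Rightarrow> ('v, 'b) pre_digraph \<Rightarrow> (('v \<times> 'b list) \<Rightarrow>\<^sub>0 'k::field) set
    \<Rightarrow> (('v \<times> 'b list) \<Rightarrow>\<^sub>0 'k) set graded" where
  "homogeneous_dual n Q I =
     graded_quotient (path_alg (opposite Q))
       (genideal (path_alg (opposite Q)) (orthogonal n Q I))"


section \<open>Koszul algebras\<close>

text \<open>The right \<open>R\<close>-module $R_0$, for a graded ring \<open>R\<close> without components of negative
  degree, so that $R_{\geq 1}$ is an ideal, which annihilates $R_0$.\<close>

definition degree_zero_module :: "('r, 'x) graded_scheme \<Rightarrow> ('r, 'r) graded_module" where
  "degree_zero_module R = \<lparr>carrier = component R 0, mult = mult R, one = one R, zero = zero R,
     add = add R, component = (\<lambda>i. if i = 0 then component R 0 else {\<zero>\<^bsub>R\<^esub>}),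
     act = (\<lambda>x a. x \<otimes>\<^bsub>R\<^esub> hpart R 0 a)\<rparr>"

definition superfluous ::
  "('r, 'x) graded_scheme \<Rightarrow> 'a set \<Rightarrow> ('r, 'a) graded_module \<Rightarrow> bool" where
  "superfluous R K M \<longleftrightarrow>
     (\<forall>N. graded_submodule R N M \<and> N <+>\<^bsub>M\<^esub> K = carrier M \<longrightarrow> N = carrier M)"

text \<open>\<open>\<dots> \<rightarrow> P 2 \<rightarrow> P 1 \<rightarrow> P 0 \<rightarrow> X \<rightarrow> 0\<close> with differentials
  \<open>d i : P (i + 1) \<rightarrow> P i\<close> and augmentation \<open>e\<close>. It is minimal if each term is a projective
  cover of its image.\<close>

definition graded_projective_resolution ::
  "('r, 'x) graded_scheme \<Rightarrow> ('r, 'b) graded_module \<Rightarrow> (nat \<Rightarrow> ('r, 'u) graded_module)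
    \<Rightarrow> (nat \<Rightarrow> 'u \<Rightarrow> 'u) \<Rightarrow> ('u \<Rightarrow> 'b) \<Rightarrow> bool" where
  "graded_projective_resolution R X P d e \<longleftrightarrow>
     (\<forall>i. gr_projective R (P i)) \<and>
     (\<forall>i. d i \<in> gr_hom R (P (Suc i)) (P i)) \<and> e \<in> gr_hom R (P 0) X \<and>
     e ` carrier (P 0) = carrier X \<and>
     a_kernel (P 0) X e = d 0 ` carrier (P 1) \<and>
     (\<forall>i. a_kernel (P (Suc i)) (P i) (d i) = d (Suc i) ` carrier (P (Suc (Suc i))))"

definition minimal_resolution ::
  "('r, 'x) graded_scheme \<Rightarrow> ('r, 'b) graded_module \<Rightarrow> (nat \<Rightarrow> ('r, 'u) graded_module)
    \<Rightarrow> (nat \<Rightarrow> 'u \<Rightarrow> 'u) \<Rightarrow> ('u \<Rightarrow> 'b) \<Rightarrow> bool" where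
  "minimal_resolution R X P d e \<longleftrightarrow>
     graded_projective_resolution R X P d e \<and>
     superfluous R (a_kernel (P 0) X e) (P 0) \<and>
     (\<forall>i. superfluous R (a_kernel (P (Suc i)) (P i) (d i)) (P (Suc i)))"

definition koszul_degree :: "nat \<Rightarrow> int \<Rightarrow> int" where
  "koszul_degree n i = (if even i then (i div 2) * int n else (i div 2) * int n + 1)"

text \<open>\<open>KQ / I\<close> is an \<open>n\<close>-Koszul algebra, with \<open>(P, d, e)\<close> the minimal graded projective
  resolution of its degree zero part.\<close>

definition n_Koszul ::
  "nat \<Rightarrow> ('v, 'b) pre_digraph \<Rightarrow> (('v \<times> 'b list) \<Rightarrow>\<^sub>0 'k::field) set
    \<Rightarrow> (nat \<Rightarrow> ((('v \<times> 'b list) \<Rightarrow>\<^sub>0 'k) set, 'u) graded_module)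
    \<Rightarrow> (nat \<Rightarrow> 'u \<Rightarrow> 'u) \<Rightarrow> ('u \<Rightarrow> (('v \<times> 'b list) \<Rightarrow>\<^sub>0 'k) set) \<Rightarrow> bool" where
  "n_Koszul n Q I P d e \<longleftrightarrow>
     fin_digraph Q \<and>
     (\<exists>S \<subseteq> component (path_alg Q) (int n). I = genideal (path_alg Q) S) \<and>
     (let \<Lambda> = graded_quotient (path_alg Q) I in
        minimal_resolution \<Lambda> (degree_zero_module \<Lambda>) P d e \<and>
        (\<forall>i. generated_in_degrees \<Lambda> (P i) {koszul_degree n (int i)}))"


section \<open>The Yoneda algebra\<close>

text \<open>For a projective resolution \<open>P\<close> of \<open>X\<close>, the group $\mathrm{Ext}^i(X, X)$ consists of the
  homotopy classes of chain maps of homological degree \<open>-i\<close> from \<open>P\<close> to itself, and the Yoneda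
  product is induced by composition. A chain map has components \<open>f i p : P (p + i) \<rightarrow> P p\<close>, which
  are linear but need not preserve the internal degree, and commute with the differentials
  without sign. A cochain is a family indexed by \<open>i\<close> with finite support.\<close>

definition chain_endo_ring ::
  "('r, 'x) graded_scheme \<Rightarrow> (nat \<Rightarrow> ('r, 'u) graded_module) \<Rightarrow> (nat \<Rightarrow> 'u \<Rightarrow> 'u)
    \<Rightarrow> (nat \<Rightarrow> nat \<Rightarrow> 'u \<Rightarrow> 'u) graded" where
  "chain_endo_ring R P d =
    (let Z = (\<lambda>i p. \<lambda>x\<in>carrier (P (p + i)). \<zero>\<^bsub>P p\<^esub>);
         C = {f. (\<forall>i p. f i p \<in> mod_hom R (P (p + i)) (P p)) \<and>
                 (\<forall>i p. \<forall>x\<in>carrier (P (Suc (p + i))).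
                    f i p (d (p + i) x) = d p (f i (Suc p) x)) \<and>
                 finite {i. f i \<noteq> Z i}}
     in \<lparr>carrier = C,
         mult = (\<lambda>f g k p. \<lambda>x\<in>carrier (P (p + k)).
           \<Oplus>\<^bsub>P p\<^esub>i\<in>{..k}. f i p (g (k - i) (p + i) x)),
         one = (\<lambda>i p. \<lambda>x\<in>carrier (P (p + i)). if i = 0 then x else \<zero>\<^bsub>P p\<^esub>),
         zero = Z,
         add = (\<lambda>f g i p. \<lambda>x\<in>carrier (P (p + i)). f i p x \<oplus>\<^bsub>P p\<^esub> g i p x),
         component = (\<lambda>j. {f \<in> C. \<forall>i. int i \<noteq> j \<longrightarrow> f i = Z i})\<rparr>)"

text \<open>A homotopy of degree \<open>i\<close> has components \<open>h i p : P (p + i - 1) \<rightarrow> P p\<close>, where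
  \<open>P (-1) = 0\<close>.\<close>

definition null_homotopic ::
  "('r, 'x) graded_scheme \<Rightarrow> (nat \<Rightarrow> ('r, 'u) graded_module) \<Rightarrow> (nat \<Rightarrow> 'u \<Rightarrow> 'u)
    \<Rightarrow> (nat \<Rightarrow> nat \<Rightarrow> 'u \<Rightarrow> 'u) set" where
  "null_homotopic R P d = {f \<in> carrier (chain_endo_ring R P d).
     \<exists>h. (\<forall>i p. p + i > 0 \<longrightarrow> h i p \<in> mod_hom R (P (p + i - 1)) (P p)) \<and>
       (\<forall>i p. \<forall>x\<in>carrier (P (p + i)).
          f i p x = d p (h i (Suc p) x) \<oplus>\<^bsub>P p\<^esub>
            (if p + i = 0 then \<zero>\<^bsub>P p\<^esub> else h i p (d (p + i - 1) x)))}"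

definition yoneda_algebra ::
  "('r, 'x) graded_scheme \<Rightarrow> (nat \<Rightarrow> ('r, 'u) graded_module) \<Rightarrow> (nat \<Rightarrow> 'u \<Rightarrow> 'u)
    \<Rightarrow> (nat \<Rightarrow> nat \<Rightarrow> 'u \<Rightarrow> 'u) set graded" where
  "yoneda_algebra R P d = graded_quotient (chain_endo_ring R P d) (null_homotopic R P d)"

definition degrees_U :: "nat \<Rightarrow> int set" where
  "degrees_U n = {int n * k | k. True} \<union> {int n * k + 1 | k. True}"

text \<open>The algebra with which the theorem of Green, Marcos, Martinez-Villa and Zhang and of
  Berger and Marconnet identifies the Yoneda algebra: the products of homogeneous elements
  of \<open>D\<close> with degrees in \<open>\<U>\<close> are kept if their degree is in \<open>\<U>\<close> and replaced by 0 otherwise.\<close>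

definition truncated_ring :: "nat \<Rightarrow> 'a graded \<Rightarrow> 'a graded" where
  "truncated_ring n D = \<lparr>carrier = homog_sum D (degrees_U n),
     mult = (\<lambda>x y. \<Oplus>\<^bsub>D\<^esub>i\<in>{i. hpart D i x \<noteq> \<zero>\<^bsub>D\<^esub>}. \<Oplus>\<^bsub>D\<^esub>j\<in>{j. hpart D j y \<noteq> \<zero>\<^bsub>D\<^esub>}.
       if i + j \<in> degrees_U n then hpart D i x \<otimes>\<^bsub>D\<^esub> hpart D j y else \<zero>\<^bsub>D\<^esub>),
     one = one D, zero = zero D, add = add D,
     component = (\<lambda>i. component D (koszul_degree n i))\<rparr>"


section \<open>Tensor products\<close>

text \<open>The tensor product of abelian groups \<open>M\<close> and \<open>N\<close> with a right action \<open>ra\<close> on \<open>M\<close> and a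
  left action \<open>la\<close> on \<open>N\<close> of a ring with underlying set \<open>A\<close>. The library's free abelian groups
  and quotient groups are written multiplicatively, and hence so is the tensor product.\<close>

definition tensor_relations ::
  "'r set \<Rightarrow> ('m, 'x) ring_scheme \<Rightarrow> ('m \<Rightarrow> 'r \<Rightarrow> 'm) \<Rightarrow> ('n, 'y) ring_scheme
    \<Rightarrow> ('r \<Rightarrow> 'n \<Rightarrow> 'n) \<Rightarrow> (('m \<times> 'n) \<Rightarrow>\<^sub>0 int) set" where
  "tensor_relations A M ra N la =
     {frag_of (x \<oplus>\<^bsub>M\<^esub> x', y) - frag_of (x, y) - frag_of (x', y) | x x' y.
        x \<in> carrier M \<and> x' \<in> carrier M \<and> y \<in> carrier N} \<union>
     {frag_of (x, y \<oplus>\<^bsub>N\<^esub> y') - frag_of (x, y) - frag_of (x, y') | x y y'.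
        x \<in> carrier M \<and> y \<in> carrier N \<and> y' \<in> carrier N} \<union>
     {frag_of (ra x a, y) - frag_of (x, la a y) | x a y.
        x \<in> carrier M \<and> a \<in> A \<and> y \<in> carrier N}"

definition tensor_subgroup ::
  "'r set \<Rightarrow> ('m, 'x) ring_scheme \<Rightarrow> ('m \<Rightarrow> 'r \<Rightarrow> 'm) \<Rightarrow> ('n, 'y) ring_scheme
    \<Rightarrow> ('r \<Rightarrow> 'n \<Rightarrow> 'n) \<Rightarrow> (('m \<times> 'n) \<Rightarrow>\<^sub>0 int) set" where
  "tensor_subgroup A M ra N la =
     generate (free_Abelian_group (carrier M \<times> carrier N)) (tensor_relations A M ra N la)"

definition tensor ::
  "'r set \<Rightarrow> ('m, 'x) ring_scheme \<Rightarrow> ('m \<Rightarrow> 'r \<Rightarrow> 'm) \<Rightarrow> ('n, 'y) ring_scheme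
    \<Rightarrow> ('r \<Rightarrow> 'n \<Rightarrow> 'n) \<Rightarrow> (('m \<times> 'n) \<Rightarrow>\<^sub>0 int) set monoid" where
  "tensor A M ra N la =
     free_Abelian_group (carrier M \<times> carrier N) Mod tensor_subgroup A M ra N la"

definition pure_tensor ::
  "'r set \<Rightarrow> ('m, 'x) ring_scheme \<Rightarrow> ('m \<Rightarrow> 'r \<Rightarrow> 'm) \<Rightarrow> ('n, 'y) ring_scheme
    \<Rightarrow> ('r \<Rightarrow> 'n \<Rightarrow> 'n) \<Rightarrow> 'm \<Rightarrow> 'n \<Rightarrow> (('m \<times> 'n) \<Rightarrow>\<^sub>0 int) set" where
  "pure_tensor A M ra N la x y =
     tensor_subgroup A M ra N la #>\<^bsub>free_Abelian_group (carrier M \<times> carrier N)\<^esub> frag_of (x, y)"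

text \<open>The homomorphism from a tensor product to the (multiplicative) abelian group \<open>G\<close> induced
  by a balanced map \<open>h\<close>, evaluated at a coset \<open>t\<close> of formal sums.\<close>

definition tensor_lift :: "('g, 'x) monoid_scheme \<Rightarrow> ('m \<Rightarrow> 'n \<Rightarrow> 'g) \<Rightarrow> (('m \<times> 'n) \<Rightarrow>\<^sub>0 int) set \<Rightarrow> 'g" where
  "tensor_lift G h t = (THE g. \<exists>s\<in>t.
     g = (\<Otimes>\<^bsub>G\<^esub>p\<in>Poly_Mapping.keys s. h (fst p) (snd p) [^]\<^bsub>G\<^esub> Poly_Mapping.lookup s p))"


section \<open>The two categories\<close>

definition in_G :: "nat \<Rightarrow> int \<Rightarrow> ('r, 'x) graded_scheme \<Rightarrow> ('r, 'u) graded_module \<Rightarrow> bool" where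
  "in_G n m D M \<longleftrightarrow>
     generated_in_degrees D M {m + int n * k | k. True} \<and>
     (\<forall>N. graded_submodule D N M \<and> N \<noteq> {\<zero>\<^bsub>M\<^esub>} \<longrightarrow>
        homog_sum (submod M N) ((+) m ` degrees_U n) \<noteq> {\<zero>\<^bsub>M\<^esub>})"

text \<open>In the following, \<open>D\<close> is the homogeneous dual, \<open>V\<close> is a graded module over the Yoneda
  algebra, and \<open>\<phi>\<close> identifies \<open>truncated_ring n D\<close> with the Yoneda algebra, so that
  elements of \<open>D\<close> with degree in \<open>\<U>\<close> act on \<open>V\<close>. The group \<open>V_tensor D \<phi> V k j\<close> is
  $V_{2k} \otimes_{D_0} D_j$, the component of degree \<open>j\<close> of the \<open>D\<close>-module $V_{2k} \otimes_{D_0} D$.\<close>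

definition V_even :: "('e, 'u) graded_module \<Rightarrow> int \<Rightarrow> ('e, 'u) graded_module" where
  "V_even V k = V\<lparr>carrier := component V (2 * k)\<rparr>"

definition V_tensor ::
  "'a graded \<Rightarrow> ('a \<Rightarrow> 'e) \<Rightarrow> ('e, 'u) graded_module \<Rightarrow> int \<Rightarrow> int
    \<Rightarrow> (('u \<times> 'a) \<Rightarrow>\<^sub>0 int) set monoid" where
  "V_tensor D \<phi> V k j = tensor (component D 0) (V_even V k) (\<lambda>v a. act V v (\<phi> a))
     (D\<lparr>carrier := component D j\<rparr>) (mult D)"

text \<open>Right multiplication by $b \in D_{j-i}$, from $V_{2k} \otimes D_i$ to
  $V_{2k} \otimes D_j$.\<close>

definition V_tensor_mult ::
  "'a graded \<Rightarrow> ('a \<Rightarrow> 'e) \<Rightarrow> ('e, 'u) graded_module \<Rightarrow> int \<Rightarrow> int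
    \<Rightarrow> (('u \<times> 'a) \<Rightarrow>\<^sub>0 int) set \<Rightarrow> 'a \<Rightarrow> (('u \<times> 'a) \<Rightarrow>\<^sub>0 int) set" where
  "V_tensor_mult D \<phi> V k j t b = tensor_lift (V_tensor D \<phi> V k j)
     (\<lambda>v a. pure_tensor (component D 0) (V_even V k) (\<lambda>v a. act V v (\<phi> a))
        (D\<lparr>carrier := component D j\<rparr>) (mult D) v (a \<otimes>\<^bsub>D\<^esub> b)) t"

definition mult_map :: "('a \<Rightarrow> 'e) \<Rightarrow> ('e, 'u) graded_module \<Rightarrow> (('u \<times> 'a) \<Rightarrow>\<^sub>0 int) set \<Rightarrow> 'u" where
  "mult_map \<phi> V = tensor_lift (add_monoid V) (\<lambda>v a. act V v (\<phi> a))"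

text \<open>The kernels of the multiplication maps from $V_{2k} \otimes D_1$ to $V_{2k+1}$ and from
  $V_{2k} \otimes D_n$ to $V_{2k+2}$.\<close>

definition Ker_mu1 ::
  "'a graded \<Rightarrow> ('a \<Rightarrow> 'e) \<Rightarrow> ('e, 'u) graded_module \<Rightarrow> int \<Rightarrow> (('u \<times> 'a) \<Rightarrow>\<^sub>0 int) set set" where
  "Ker_mu1 D \<phi> V k = kernel (V_tensor D \<phi> V k 1) (add_monoid V) (mult_map \<phi> V)"

definition Ker_mu2 ::
  "nat \<Rightarrow> 'a graded \<Rightarrow> ('a \<Rightarrow> 'e) \<Rightarrow> ('e, 'u) graded_module \<Rightarrow> int
    \<Rightarrow> (('u \<times> 'a) \<Rightarrow>\<^sub>0 int) set set" where
  "Ker_mu2 n D \<phi> V k = kernel (V_tensor D \<phi> V k (int n)) (add_monoid V) (mult_map \<phi> V)"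

definition in_L ::
  "nat \<Rightarrow> 'a graded \<Rightarrow> 'e graded \<Rightarrow> ('a \<Rightarrow> 'e) \<Rightarrow> ('e, 'u) graded_module \<Rightarrow> bool" where
  "in_L n D E \<phi> V \<longleftrightarrow>
     generated_in_degrees E V {i. even i} \<and>
     (\<forall>k. generate (V_tensor D \<phi> V k (int n))
            {V_tensor_mult D \<phi> V k (int n) t b | t b.
               t \<in> Ker_mu1 D \<phi> V k \<and> b \<in> component D (int n - 1)}
          \<subseteq> Ker_mu2 n D \<phi> V k)"

definition presented_in_even_degrees ::
  "('e, 'x) graded_scheme \<Rightarrow> ('e, 'u) graded_module \<Rightarrow> bool" where
  "presented_in_even_degrees E V \<longleftrightarrow>
     (\<exists>(P0 :: ('e, 'u) graded_module) (P1 :: ('e, 'u) graded_module) f g.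
        gr_projective E P0 \<and> generated_in_degrees E P0 {i. even i} \<and>
        gr_projective E P1 \<and> generated_in_degrees E P1 {i. even i} \<and>
        f \<in> gr_hom E P1 P0 \<and> g \<in> gr_hom E P0 V \<and>
        g ` carrier P0 = carrier V \<and> a_kernel P0 V g = f ` carrier P1)"

end

theory Submission
  imports Defs
begin

text \<open>
  A module \<open>M\<close> in \<open>G(S, U)\<close> embeds into the functions \<open>D \<rightarrow> M_S\<close> by sending \<open>x\<close> to
  \<open>b \<mapsto> \<pi>_S (x b)\<close>: the elements sent to \<open>0\<close> form a graded submodule whose part in degrees \<open>S\<close>
  vanishes.  Hence restriction to the degrees in \<open>S\<close>, which turns \<open>M\<close> into a module over the
  truncation of \<open>D\<close> and so over \<open>E\<close>, is fully faithful.  Its image satisfies the condition on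
  kernels because \<open>D_n = D_1 D_(n-1)\<close>.  Conversely, a module \<open>V\<close> in \<open>L_E\<close> is recovered from the
  submodule of the functions \<open>D \<rightarrow> V\<close> generated by the \<open>b \<mapsto> v \<phi>(\<pi>_U (a b))\<close>, with \<open>v\<close> of
  even degree: the condition on kernels says exactly that such functions of degree in \<open>S\<close> are
  determined by their value at \<open>1\<close>.

  A gr-projective \<open>E\<close>-module generated in even degrees is a direct summand of the restriction of some
  \<open>D\<close>-module, hence satisfies the condition on kernels; the condition passes to quotients by
  submodules generated in even degrees.
\<close>

section \<open>Graded groups\<close>

text \<open>The obstacle is that \<U> is not closed under sums or differences: D_1 D_(n-1) lands in
  D_n although n - 1 is not in \<U>. So E sees D_1 and D_n, but not the multiplication by D_(n-1)
  that leads from one to the other. If s and s + j are both in \<U>, then j is in \<U> too, except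
  when s is 1 and j is -1 modulo n; this exceptional pair of residues is exactly what the condition
  on kernels controls.

  Functions on D replace a quotient of a tensor product because equality of functions is tested by
  evaluation, and a nonzero function of any degree is moved by some homogeneous b to one whose value
  at 1 is nonzero, so the condition on submodules comes for free. The price is a carrier in a
  function type. The module must be copied into \<open>'u\<close>, so its size has to be bounded: it
  is generated by as many functions as there are pairs in V \<times> D, and D is bounded by the
  countably many paths and the field.

  The Yoneda algebra is handled as a record isomorphic to the truncation of D, from which its ring
  axioms are transported; that its zero corresponds to the zero of D takes a separate argument with
  homotopies.\<close>

definition additive_map :: "('a, 'x) ring_scheme \<Rightarrow> ('b, 'y) ring_scheme \<Rightarrow> ('a \<Rightarrow> 'b) \<Rightarrow> bool" where
  "additive_map M N h \<longleftrightarrow> h \<in> carrier M \<rightarrow> carrier N \<and>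
     (\<forall>x\<in>carrier M. \<forall>y\<in>carrier M. h (x \<oplus>\<^bsub>M\<^esub> y) = h x \<oplus>\<^bsub>N\<^esub> h y)"

lemma additive_mapI:
  assumes "\<And>x. x \<in> carrier M \<Longrightarrow> h x \<in> carrier N"
    and "\<And>x y. \<lbrakk>x \<in> carrier M; y \<in> carrier M\<rbrakk> \<Longrightarrow> h (x \<oplus>\<^bsub>M\<^esub> y) = h x \<oplus>\<^bsub>N\<^esub> h y"
  shows "additive_map M N h"
  using assms by (auto simp: additive_map_def)

lemma additive_map_closed: "\<lbrakk>additive_map M N h; x \<in> carrier M\<rbrakk> \<Longrightarrow> h x \<in> carrier N"
  by (auto simp: additive_map_def)

lemma additive_map_add:
  "\<lbrakk>additive_map M N h; x \<in> carrier M; y \<in> carrier M\<rbrakk> \<Longrightarrow> h (x \<oplus>\<^bsub>M\<^esub> y) = h x \<oplus>\<^bsub>N\<^esub> h y"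
  by (auto simp: additive_map_def)

lemma additive_map_hom:
  assumes "abelian_group M" "abelian_group N" "additive_map M N h"
  shows "abelian_group_hom M N h"
proof -
  interpret M: abelian_group M by fact
  interpret N: abelian_group N by fact
  show ?thesis
    by (rule abelian_group_homI[OF assms(1,2)], unfold group_hom_def group_hom_axioms_def)
      (use assms(3) M.a_group N.a_group in \<open>auto simp: hom_def additive_map_def\<close>)
qed

lemma additive_map_zero:
  "\<lbrakk>abelian_group M; abelian_group N; additive_map M N h\<rbrakk> \<Longrightarrow> h \<zero>\<^bsub>M\<^esub> = \<zero>\<^bsub>N\<^esub>"
  by (rule abelian_group_hom.hom_zero[OF additive_map_hom])

lemma additive_map_minus:
  "\<lbrakk>abelian_group M; abelian_group N; additive_map M N h; x \<in> carrier M\<rbrakk>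
    \<Longrightarrow> h (\<ominus>\<^bsub>M\<^esub> x) = \<ominus>\<^bsub>N\<^esub> h x"
  by (rule abelian_group_hom.hom_a_inv[OF additive_map_hom])

lemma additive_map_finsum:
  assumes "abelian_group M" "abelian_group N" "additive_map M N h"
    and "finite F" "f \<in> F \<rightarrow> carrier M"
  shows "h (finsum M f F) = finsum N (\<lambda>i. h (f i)) F"
  using assms(4,5)
proof (induction F)
  case empty
  then show ?case
    using assms(1-3) by (simp add: additive_map_zero abelian_monoid.finsum_empty abelian_group.axioms)
next
  case (insert i F)
  interpret M: abelian_group M by fact
  interpret N: abelian_group N by fact
  have "(\<lambda>i. h (f i)) \<in> F \<rightarrow> carrier N" "h (f i) \<in> carrier N"
    using insert.prems assms(3) by (auto simp: additive_map_def)
  then show ?case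
    using insert assms(3) by (simp add: additive_map_add[OF assms(3)] M.finsum_closed)
qed

section \<open>Additive subgroups generated by a set\<close>

lemma (in abelian_group) add_generate_induct [consumes 1, case_names subset zero incl add minus]:
  assumes "x \<in> generate (add_monoid G) H" "H \<subseteq> carrier G"
    and "P \<zero>" "\<And>h. h \<in> H \<Longrightarrow> P h"
    and "\<And>x y. \<lbrakk>x \<in> carrier G; y \<in> carrier G; P x; P y\<rbrakk> \<Longrightarrow> P (x \<oplus> y)"
    and "\<And>x. \<lbrakk>x \<in> carrier G; P x\<rbrakk> \<Longrightarrow> P (\<ominus> x)"
  shows "P x"
proof -
  have car: "y \<in> carrier G" if "y \<in> generate (add_monoid G) H" for y
    using group.generate_in_carrier[OF a_group, of H y] assms(2) that by auto
  show ?thesis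
    using assms(1)
  proof (induction rule: generate.induct)
    case one
    then show ?case using assms(3) by simp
  next
    case (incl h)
    then show ?case using assms(4) by simp
  next
    case (inv h)
    then show ?case using assms(4)[of h] assms(6)[of h] assms(2) by (auto simp: a_inv_def)
  next
    case (eng h1 h2)
    then show ?case using assms(5)[of h1 h2] car by auto
  qed
qed

context abelian_group
begin

lemma add_generate_carrier: "H \<subseteq> carrier G \<Longrightarrow> generate (add_monoid G) H \<subseteq> carrier G"
  using group.generate_incl[OF a_group, of H] by simp

lemma add_generate_zero [simp]: "\<zero> \<in> generate (add_monoid G) H"
  using generate.one[of "add_monoid G" H] by simp

lemma add_generate_incl: "h \<in> H \<Longrightarrow> h \<in> generate (add_monoid G) H"
  by (rule generate.incl)

lemma add_generate_add:
  "\<lbrakk>x \<in> generate (add_monoid G) H; y \<in> generate (add_monoid G) H\<rbrakk>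
    \<Longrightarrow> x \<oplus> y \<in> generate (add_monoid G) H"
  using generate.eng[of x "add_monoid G" H y] by simp

lemma add_generate_minus:
  "\<lbrakk>H \<subseteq> carrier G; x \<in> generate (add_monoid G) H\<rbrakk> \<Longrightarrow> \<ominus> x \<in> generate (add_monoid G) H"
  using group.generate_m_inv_closed[OF a_group, of H x] by (simp add: a_inv_def)

lemma add_generate_subgroup:
  "H \<subseteq> carrier G \<Longrightarrow> additive_subgroup (generate (add_monoid G) H) G"
  using group.generate_is_subgroup[OF a_group, of H] by (simp add: additive_subgroup_def)

lemma add_generate_mono:
  "H \<subseteq> K \<Longrightarrow> generate (add_monoid G) H \<subseteq> generate (add_monoid G) K"
  using group.mono_generate[OF a_group] by blast

lemma add_subgroup_of_predicate:
  assumes "P \<zero>" "\<And>x y. \<lbrakk>x \<in> carrier G; y \<in> carrier G; P x; P y\<rbrakk> \<Longrightarrow> P (x \<oplus> y)"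
    and "\<And>x. \<lbrakk>x \<in> carrier G; P x\<rbrakk> \<Longrightarrow> P (\<ominus> x)"
  shows "additive_subgroup {x \<in> carrier G. P x} G"
  unfolding additive_subgroup_def
  by (rule subgroup.intro)
    (use assms a_inv_def[of G, symmetric] in \<open>auto simp: a_inv_def[symmetric]\<close>)

end

text \<open>\<open>is_decomp\<close> sums over the exact support, which is awkward for a family
  built from other families. Any finite index set containing the support gives the same sum.\<close>

lemma is_decompI:
  assumes "abelian_group M" "\<And>i. f i \<in> component M i" "\<And>i. component M i \<subseteq> carrier M"
    and "finite F" "\<And>i. i \<notin> F \<Longrightarrow> f i = \<zero>\<^bsub>M\<^esub>" "x = finsum M f F"
  shows "is_decomp M x f"
proof -
  interpret abelian_group M by fact
  have sub: "{i. f i \<noteq> \<zero>\<^bsub>M\<^esub>} \<subseteq> F" using assms(5) by auto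
  have "finsum M f {i. f i \<noteq> \<zero>\<^bsub>M\<^esub>} = finsum M f F"
    by (rule add.finprod_mono_neutral_cong_left) (use assms sub in auto)
  then show ?thesis
    using assms sub by (auto simp: is_decomp_def intro: finite_subset)
qed

context graded_group
begin

lemma component_subset: "component M i \<subseteq> carrier M"
  using additive_subgroup.a_subset[OF component_subgroup] .

lemma component_carrier: "x \<in> component M i \<Longrightarrow> x \<in> carrier M"
  using component_subset by blast

lemma component_zero [simp]: "\<zero> \<in> component M i"
  using additive_subgroup.zero_closed[OF component_subgroup] .

lemma component_add: "\<lbrakk>x \<in> component M i; y \<in> component M i\<rbrakk> \<Longrightarrow> x \<oplus> y \<in> component M i"
  using additive_subgroup.a_closed[OF component_subgroup] .

lemma component_minus: "x \<in> component M i \<Longrightarrow> \<ominus> x \<in> component M i"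
  using additive_subgroup.a_inv_closed[OF component_subgroup] component_carrier abelian_group_axioms
  by blast

lemma is_decomp_hpart:
  assumes "x \<in> carrier M"
  shows "is_decomp M x (\<lambda>i. hpart M i x)"
  using theI'[OF decomposition[OF assms]] by (simp add: hpart_def)

lemma hpart_eqI: "\<lbrakk>x \<in> carrier M; is_decomp M x f\<rbrakk> \<Longrightarrow> hpart M i x = f i"
  using decomposition is_decomp_hpart by blast

lemma hpart_component [simp]: "x \<in> carrier M \<Longrightarrow> hpart M i x \<in> component M i"
  using is_decomp_hpart by (auto simp: is_decomp_def)

lemma hpart_closed [simp]: "x \<in> carrier M \<Longrightarrow> hpart M i x \<in> carrier M"
  using component_carrier hpart_component by blast

lemma hpart_finite: "x \<in> carrier M \<Longrightarrow> finite {i. hpart M i x \<noteq> \<zero>}"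
  using is_decomp_hpart by (auto simp: is_decomp_def)

lemma hpart_sum: "x \<in> carrier M \<Longrightarrow> finsum M (\<lambda>i. hpart M i x) {i. hpart M i x \<noteq> \<zero>} = x"
  using is_decomp_hpart by (auto simp: is_decomp_def)

lemma hpart_sum_superset:
  assumes "x \<in> carrier M" "finite F" "{i. hpart M i x \<noteq> \<zero>} \<subseteq> F"
  shows "finsum M (\<lambda>i. hpart M i x) F = x"
proof -
  have "finsum M (\<lambda>i. hpart M i x) {i. hpart M i x \<noteq> \<zero>} = finsum M (\<lambda>i. hpart M i x) F"
    by (rule add.finprod_mono_neutral_cong_left) (use assms in auto)
  then show ?thesis using hpart_sum[OF assms(1)] by simp
qed

lemma hpart_of_component:
  assumes "x \<in> component M i"
  shows "hpart M j x = (if j = i then x else \<zero>)"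
proof (rule hpart_eqI)
  show "is_decomp M x (\<lambda>j. if j = i then x else \<zero>)"
    by (rule is_decompI[where F = "{i}"])
      (use assms component_carrier component_subset in \<open>auto simp: abelian_group_axioms\<close>)
qed (use assms component_carrier in auto)

lemma hpart_additive: "additive_map M M (hpart M i)"
proof (rule additive_mapI)
  fix x y assume x: "x \<in> carrier M" and y: "y \<in> carrier M"
  let ?F = "{i. hpart M i x \<noteq> \<zero>} \<union> {i. hpart M i y \<noteq> \<zero>}"
  have F: "finite ?F" using x y by (simp add: hpart_finite)
  show "hpart M i (x \<oplus> y) = hpart M i x \<oplus> hpart M i y"
  proof (rule hpart_eqI)
    show "is_decomp M (x \<oplus> y) (\<lambda>i. hpart M i x \<oplus> hpart M i y)"
    proof (rule is_decompI[where F = ?F])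
      have "finsum M (\<lambda>i. hpart M i x \<oplus> hpart M i y) ?F
        = finsum M (\<lambda>i. hpart M i x) ?F \<oplus> finsum M (\<lambda>i. hpart M i y) ?F"
        by (rule finsum_addf) (use x y F in auto)
      also have "\<dots> = x \<oplus> y"
        by (subst (1 2) hpart_sum_superset) (use x y F in auto)
      finally show "x \<oplus> y = finsum M (\<lambda>i. hpart M i x \<oplus> hpart M i y) ?F" by simp
    qed (use x y F component_subset in \<open>auto intro: component_add simp: abelian_group_axioms\<close>)
  qed (use x y in auto)
qed simp

lemmas hpart_add = additive_map_add[OF hpart_additive]

lemma hpart_zero [simp]: "hpart M i \<zero> = \<zero>"
  using additive_map_zero[OF _ _ hpart_additive] abelian_group_axioms by blast

lemma hpart_minus: "x \<in> carrier M \<Longrightarrow> hpart M i (\<ominus> x) = \<ominus> hpart M i x"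
  using additive_map_minus[OF _ _ hpart_additive] abelian_group_axioms by blast

lemma finsum_closure_induct:
  assumes "finite F" "f \<in> F \<rightarrow> carrier M" "P \<zero>" "\<And>i. i \<in> F \<Longrightarrow> P (f i)"
    and "\<And>x y. \<lbrakk>x \<in> carrier M; y \<in> carrier M; P x; P y\<rbrakk> \<Longrightarrow> P (x \<oplus> y)"
  shows "P (finsum M f F)"
  using assms(1,2,4)
proof (induction F)
  case empty
  then show ?case using assms(3) by simp
next
  case (insert i F)
  then have "finsum M f (insert i F) = f i \<oplus> finsum M f F"
    by (intro finsum_insert) auto
  then show ?case using insert assms(5)[of "f i" "finsum M f F"] by (auto intro: finsum_closed)
qed

lemma graded_induct [consumes 1, case_names zero component add]:
  assumes "x \<in> carrier M" "P \<zero>" "\<And>i x. x \<in> component M i \<Longrightarrow> P x"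
    and "\<And>x y. \<lbrakk>x \<in> carrier M; y \<in> carrier M; P x; P y\<rbrakk> \<Longrightarrow> P (x \<oplus> y)"
  shows "P x"
proof -
  have "P (finsum M (\<lambda>i. hpart M i x) {i. hpart M i x \<noteq> \<zero>})"
    by (rule finsum_closure_induct) (use assms(1,2,4) hpart_finite assms(3)[OF hpart_component] in auto)
  then show ?thesis using hpart_sum assms(1) by simp
qed

text \<open>Both maps respect the finite sum of homogeneous parts. Most identities between graded
  objects below are stated as equalities of additive maps so that they need checking only on
  components.\<close>

lemma additive_map_eqI:
  assumes "additive_map M N h" "additive_map M N h'" "abelian_group N"
    and "\<And>i x. x \<in> component M i \<Longrightarrow> h x = h' x" "x \<in> carrier M"
  shows "h x = h' x"
  using assms(5)
proof (induction rule: graded_induct)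
  case zero
  then show ?case using assms additive_map_zero abelian_group_axioms by metis
next
  case (component i x)
  then show ?case using assms by blast
next
  case (add x y)
  then show ?case using assms by (simp add: additive_map_add)
qed

lemma zero_if_hparts_zero:
  assumes "x \<in> carrier M" "\<And>i. hpart M i x = \<zero>"
  shows "x = \<zero>"
  using hpart_sum[OF assms(1)] assms(2) by simp

lemma component_if_hparts_zero:
  assumes "x \<in> carrier M" "\<And>j. j \<noteq> i \<Longrightarrow> hpart M j x = \<zero>"
  shows "x \<in> component M i"
proof -
  have "finsum M (\<lambda>i. hpart M i x) {i} = x"
    by (rule hpart_sum_superset) (use assms in auto)
  then have "hpart M i x = x" using assms(1) by simp
  then show ?thesis using hpart_component[OF assms(1), of i] by simp
qed

lemma components_independent:
  assumes "finite F" "\<And>i. i \<in> F \<Longrightarrow> f i \<in> component M i" "finsum M f F = \<zero>" "i \<in> F"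
  shows "f i = \<zero>"
proof -
  let ?f = "\<lambda>i. if i \<in> F then f i else \<zero>"
  have "finsum M ?f F = finsum M f F"
    by (rule finsum_cong') (use assms component_carrier in auto)
  then have "is_decomp M \<zero> ?f"
    by (intro is_decompI[where F = F]) (use assms component_subset in \<open>auto simp: abelian_group_axioms\<close>)
  then have "hpart M i \<zero> = ?f i" by (intro hpart_eqI) auto
  then show ?thesis using assms by simp
qed

end

text \<open>Existence of a decomposition is stable under sums and negatives, hence follows from
  generation by the components; uniqueness is independence applied to the difference of two
  decompositions. The groups constructed later come with generators, so this form suits them better
  than \<open>decomposition\<close>.\<close>

lemma graded_groupI:
  assumes ab: "abelian_group M" and sub: "\<And>i. additive_subgroup (component M i) M"
    and gen: "carrier M \<subseteq> generate (add_monoid M) (\<Union>i. component M i)"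
    and ind: "\<And>F f i. \<lbrakk>finite F; \<And>i. i \<in> F \<Longrightarrow> f i \<in> component M i; finsum M f F = \<zero>\<^bsub>M\<^esub>; i \<in> F\<rbrakk>
      \<Longrightarrow> f i = \<zero>\<^bsub>M\<^esub>"
  shows "graded_group M"
proof -
  interpret abelian_group M by fact
  have car: "component M i \<subseteq> carrier M" for i using additive_subgroup.a_subset[OF sub] .
  have C0: "\<zero>\<^bsub>M\<^esub> \<in> component M i" for i using additive_subgroup.zero_closed[OF sub] .
  have Cadd: "x \<oplus>\<^bsub>M\<^esub> y \<in> component M i" if "x \<in> component M i" "y \<in> component M i" for x y i
    using additive_subgroup.a_closed[OF sub that] .
  have Cneg: "\<ominus>\<^bsub>M\<^esub> x \<in> component M i" if "x \<in> component M i" for x i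
    using additive_subgroup.a_inv_closed[OF sub] car that ab by blast
  have ex: "\<exists>f. is_decomp M x f" if "x \<in> carrier M" for x
    using subsetD[OF gen that]
  proof (induction rule: add_generate_induct)
    case subset
    then show ?case using car by blast
  next
    case zero
    have "is_decomp M \<zero>\<^bsub>M\<^esub> (\<lambda>i. \<zero>\<^bsub>M\<^esub>)"
      by (rule is_decompI[where F = "{}"]) (use car C0 ab in auto)
    then show ?case by blast
  next
    case (incl h)
    then obtain i where h: "h \<in> component M i" by blast
    have "is_decomp M h (\<lambda>j. if j = i then h else \<zero>\<^bsub>M\<^esub>)"
      by (rule is_decompI[where F = "{i}"]) (use h subsetD[OF car h] car C0 ab in auto)
    then show ?case by blast
  next
    case (add x y)
    then obtain f g where f: "is_decomp M x f" and g: "is_decomp M y g" by blast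
    let ?F = "{i. f i \<noteq> \<zero>\<^bsub>M\<^esub>} \<union> {i. g i \<noteq> \<zero>\<^bsub>M\<^esub>}"
    have F: "finite ?F" using f g by (auto simp: is_decomp_def)
    have fc: "f i \<in> component M i" "g i \<in> component M i" for i using f g by (auto simp: is_decomp_def)
    have "finsum M f {i. f i \<noteq> \<zero>\<^bsub>M\<^esub>} = finsum M f ?F"
      by (rule add.finprod_mono_neutral_cong_left) (use F fc car in auto)
    moreover have "finsum M g {i. g i \<noteq> \<zero>\<^bsub>M\<^esub>} = finsum M g ?F"
      by (rule add.finprod_mono_neutral_cong_left) (use F fc car in auto)
    moreover have "finsum M (\<lambda>i. f i \<oplus>\<^bsub>M\<^esub> g i) ?F = finsum M f ?F \<oplus>\<^bsub>M\<^esub> finsum M g ?F"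
      by (rule finsum_addf) (use F fc car in blast)+
    ultimately have "x \<oplus>\<^bsub>M\<^esub> y = finsum M (\<lambda>i. f i \<oplus>\<^bsub>M\<^esub> g i) ?F"
      using f g by (simp add: is_decomp_def)
    then have "is_decomp M (x \<oplus>\<^bsub>M\<^esub> y) (\<lambda>i. f i \<oplus>\<^bsub>M\<^esub> g i)"
      by (intro is_decompI[where F = ?F]) (use fc Cadd car ab F in auto)
    then show ?case by blast
  next
    case (minus x)
    then obtain f where f: "is_decomp M x f" by blast
    let ?F = "{i. f i \<noteq> \<zero>\<^bsub>M\<^esub>}"
    have F: "finite ?F" using f by (auto simp: is_decomp_def)
    have fc: "f i \<in> component M i" for i using f by (auto simp: is_decomp_def)
    have "additive_map M M (\<lambda>x. \<ominus>\<^bsub>M\<^esub> x)"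
      by (rule additive_mapI) (auto simp: minus_add a_comm)
    then have "\<ominus>\<^bsub>M\<^esub> (finsum M f ?F) = finsum M (\<lambda>i. \<ominus>\<^bsub>M\<^esub> f i) ?F"
      by (intro additive_map_finsum) (use F fc car ab in auto)
    then have "is_decomp M (\<ominus>\<^bsub>M\<^esub> x) (\<lambda>i. \<ominus>\<^bsub>M\<^esub> f i)"
      by (intro is_decompI[where F = ?F]) (use f fc Cneg car ab F in \<open>auto simp: is_decomp_def\<close>)
    then show ?case by blast
  qed
  have uniq: "f = g" if f: "is_decomp M x f" and g: "is_decomp M x g" for x f g
  proof
    fix i
    \<comment> \<open>The index \<open>i\<close> is added because independence speaks of members of
      the index set, and \<open>i\<close> may lie outside both supports.\<close>
    let ?F = "{i. f i \<noteq> \<zero>\<^bsub>M\<^esub>} \<union> {i. g i \<noteq> \<zero>\<^bsub>M\<^esub>} \<union> {i}"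
    have F: "finite ?F" using f g by (auto simp: is_decomp_def)
    have fc: "f i \<in> component M i" "g i \<in> component M i" for i using f g by (auto simp: is_decomp_def)
    have fc': "f i \<in> carrier M" "g i \<in> carrier M" for i using fc car by blast+
    have 1: "finsum M f {i. f i \<noteq> \<zero>\<^bsub>M\<^esub>} = finsum M f ?F"
      by (rule add.finprod_mono_neutral_cong_left) (use F fc' in auto)
    have 2: "finsum M g {i. g i \<noteq> \<zero>\<^bsub>M\<^esub>} = finsum M g ?F"
      by (rule add.finprod_mono_neutral_cong_left) (use F fc' in auto)
    have "additive_map M M (\<lambda>x. \<ominus>\<^bsub>M\<^esub> x)"
      by (rule additive_mapI) (auto simp: minus_add a_comm)
    then have 3: "\<ominus>\<^bsub>M\<^esub> (finsum M g ?F) = finsum M (\<lambda>i. \<ominus>\<^bsub>M\<^esub> g i) ?F"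
      by (intro additive_map_finsum) (use F fc' ab in auto)
    have "finsum M (\<lambda>i. f i \<oplus>\<^bsub>M\<^esub> \<ominus>\<^bsub>M\<^esub> g i) ?F = finsum M f ?F \<oplus>\<^bsub>M\<^esub> finsum M (\<lambda>i. \<ominus>\<^bsub>M\<^esub> g i) ?F"
      by (rule finsum_addf) (use F fc' in auto)
    also have "\<dots> = x \<oplus>\<^bsub>M\<^esub> \<ominus>\<^bsub>M\<^esub> x" using f g 1 2 3 by (simp add: is_decomp_def)
    also have "\<dots> = \<zero>\<^bsub>M\<^esub>"
    proof -
      have "finsum M f ?F \<in> carrier M" by (rule finsum_closed) (use fc' in auto)
      then show ?thesis using f 1 by (simp add: is_decomp_def r_neg)
    qed
    finally have "f i \<oplus>\<^bsub>M\<^esub> \<ominus>\<^bsub>M\<^esub> g i = \<zero>\<^bsub>M\<^esub>"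
      using ind[of ?F "\<lambda>i. f i \<oplus>\<^bsub>M\<^esub> \<ominus>\<^bsub>M\<^esub> g i" i] F fc Cneg Cadd by blast
    then show "f i = g i"
      using fc' by (metis add.inv_equality minus_minus a_inv_closed)
  qed
  show ?thesis
    by (intro graded_group.intro graded_group_axioms.intro ab sub) (use ex uniq in blast)
qed

text \<open>The idempotent projection onto \<open>homog_sum M X\<close> that kills the other
  components. Summing over the support of \<open>x\<close> keeps the sum finite when
  \<open>X\<close> is infinite.\<close>

definition hproj :: "('a, 'm) graded_scheme \<Rightarrow> int set \<Rightarrow> 'a \<Rightarrow> 'a" where
  "hproj M X x = finsum M (\<lambda>i. if i \<in> X then hpart M i x else \<zero>\<^bsub>M\<^esub>) {i. hpart M i x \<noteq> \<zero>\<^bsub>M\<^esub>}"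

context graded_group
begin

lemma hproj_superset:
  assumes "x \<in> carrier M" "finite F" "{i. hpart M i x \<noteq> \<zero>} \<subseteq> F"
  shows "hproj M X x = finsum M (\<lambda>i. if i \<in> X then hpart M i x else \<zero>) F"
  unfolding hproj_def
  by (rule add.finprod_mono_neutral_cong_left) (use assms in auto)

lemma hproj_additive: "additive_map M M (hproj M X)"
proof (rule additive_mapI)
  fix x assume "x \<in> carrier M"
  then show "hproj M X x \<in> carrier M" by (auto simp: hproj_def intro!: finsum_closed)
next
  fix x y assume x: "x \<in> carrier M" and y: "y \<in> carrier M"
  let ?F = "{i. hpart M i x \<noteq> \<zero>} \<union> {i. hpart M i y \<noteq> \<zero>}"
  have F: "finite ?F" using x y by (simp add: hpart_finite)
  have "{i. hpart M i (x \<oplus> y) \<noteq> \<zero>} \<subseteq> ?F" using x y by (auto simp: hpart_add)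
  then have "hproj M X (x \<oplus> y) = finsum M (\<lambda>i. if i \<in> X then hpart M i (x \<oplus> y) else \<zero>) ?F"
    using x y F by (intro hproj_superset) auto
  also have "\<dots> = finsum M (\<lambda>i. (if i \<in> X then hpart M i x else \<zero>) \<oplus> (if i \<in> X then hpart M i y else \<zero>)) ?F"
    by (rule finsum_cong') (use x y in \<open>auto simp: hpart_add\<close>)
  also have "\<dots> = finsum M (\<lambda>i. if i \<in> X then hpart M i x else \<zero>) ?F
      \<oplus> finsum M (\<lambda>i. if i \<in> X then hpart M i y else \<zero>) ?F"
    by (rule finsum_addf) (use x y F in auto)
  also have "\<dots> = hproj M X x \<oplus> hproj M X y"
    by (subst (1 2) hproj_superset[where F = ?F]) (use x y F in auto)
  finally show "hproj M X (x \<oplus> y) = hproj M X x \<oplus> hproj M X y" .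
qed

lemmas hproj_add = additive_map_add[OF hproj_additive]
lemmas hproj_closed [simp] = additive_map_closed[OF hproj_additive]

lemma hproj_zero [simp]: "hproj M X \<zero> = \<zero>"
  using additive_map_zero[OF _ _ hproj_additive] abelian_group_axioms by blast

lemma hproj_of_component:
  assumes "x \<in> component M i"
  shows "hproj M X x = (if i \<in> X then x else \<zero>)"
proof -
  have "hproj M X x = finsum M (\<lambda>j. if j \<in> X then hpart M j x else \<zero>) {i}"
    by (rule hproj_superset) (use assms component_carrier in \<open>auto simp: hpart_of_component\<close>)
  then show ?thesis
    using assms component_carrier by (auto simp: hpart_of_component)
qed

lemma additive_map_compose:
  "\<lbrakk>additive_map A B f; additive_map B C g\<rbrakk> \<Longrightarrow> additive_map A C (\<lambda>x. g (f x))"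
  by (auto simp: additive_map_def Pi_iff)

lemma hpart_hproj:
  assumes "x \<in> carrier M"
  shows "hpart M i (hproj M X x) = (if i \<in> X then hpart M i x else \<zero>)"
proof (rule additive_map_eqI[OF _ _ _ _ assms])
  show "additive_map M M (\<lambda>x. hpart M i (hproj M X x))"
    by (rule additive_map_compose[OF hproj_additive hpart_additive])
  show "additive_map M M (\<lambda>x. if i \<in> X then hpart M i x else \<zero>)"
    by (rule additive_mapI) (auto simp: hpart_add)
qed (auto simp: hproj_of_component hpart_of_component abelian_group_axioms)

lemma homog_sum_subset: "(\<Union>i\<in>X. component M i) \<subseteq> carrier M"
  using component_subset by blast

lemma homog_sum_carrier: "x \<in> homog_sum M X \<Longrightarrow> x \<in> carrier M"
  unfolding homog_sum_def using add_generate_carrier[OF homog_sum_subset] by blast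

lemma homog_sum_component: "\<lbrakk>x \<in> component M i; i \<in> X\<rbrakk> \<Longrightarrow> x \<in> homog_sum M X"
  unfolding homog_sum_def by (rule add_generate_incl) blast

lemma homog_sum_subgroup: "additive_subgroup (homog_sum M X) M"
  unfolding homog_sum_def by (rule add_generate_subgroup[OF homog_sum_subset])

lemma homog_sum_zero [simp]: "\<zero> \<in> homog_sum M X"
  unfolding homog_sum_def by simp

lemma homog_sum_add: "\<lbrakk>x \<in> homog_sum M X; y \<in> homog_sum M X\<rbrakk> \<Longrightarrow> x \<oplus> y \<in> homog_sum M X"
  unfolding homog_sum_def by (rule add_generate_add)

lemma homog_sum_minus: "x \<in> homog_sum M X \<Longrightarrow> \<ominus> x \<in> homog_sum M X"
  unfolding homog_sum_def by (rule add_generate_minus[OF homog_sum_subset])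

text \<open>The parts of such an element outside \<open>X\<close> vanish, so it is a sum of
  homogeneous elements with degrees in \<open>X\<close>; negatives of generators are again
  homogeneous and get no case of their own.\<close>

lemma homog_sum_induct [consumes 1, case_names zero component add]:
  assumes "x \<in> homog_sum M X" "P \<zero>" "\<And>i x. \<lbrakk>i \<in> X; x \<in> component M i\<rbrakk> \<Longrightarrow> P x"
    and "\<And>x y. \<lbrakk>x \<in> homog_sum M X; y \<in> homog_sum M X; P x; P y\<rbrakk> \<Longrightarrow> P (x \<oplus> y)"
  shows "P x"
proof -
  have *: "hpart M i x = \<zero>" if "i \<notin> X" for i
    using assms(1) unfolding homog_sum_def
  proof (induction rule: add_generate_induct)
    case (incl h)
    then show ?case using that by (auto simp: hpart_of_component)
  qed (use homog_sum_subset that in \<open>auto simp: hpart_add hpart_minus\<close>)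
  have x: "x \<in> carrier M" using assms(1) by (rule homog_sum_carrier)
  have "(\<lambda>x. x \<in> homog_sum M X \<and> P x) (finsum M (\<lambda>i. hpart M i x) {i. hpart M i x \<noteq> \<zero>})"
  proof (rule finsum_closure_induct)
    fix i assume "i \<in> {i. hpart M i x \<noteq> \<zero>}"
    then have "i \<in> X" using * by blast
    then show "hpart M i x \<in> homog_sum M X \<and> P (hpart M i x)"
      using assms(3)[of i] homog_sum_component[of _ i X] x hpart_component by blast
  qed (use assms x hpart_finite in \<open>auto intro: homog_sum_add\<close>)
  then show ?thesis using hpart_sum x by simp
qed

lemma hproj_homog_sum: "x \<in> homog_sum M X \<Longrightarrow> hproj M X x = x"
  by (induction rule: homog_sum_induct) (auto simp: hproj_of_component hproj_add homog_sum_carrier)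

lemma hproj_in_homog_sum: "x \<in> carrier M \<Longrightarrow> hproj M X x \<in> homog_sum M X"
  by (induction rule: graded_induct)
    (auto simp: hproj_of_component hproj_add homog_sum_add homog_sum_component)

lemma homog_sum_hpart_zero:
  "\<lbrakk>x \<in> homog_sum M X; i \<notin> X\<rbrakk> \<Longrightarrow> hpart M i x = \<zero>"
  using hpart_hproj[of x i X] homog_sum_carrier hproj_homog_sum by metis

lemma homog_sum_eq_zeroI:
  assumes "\<And>i. i \<in> X \<Longrightarrow> component M i \<subseteq> {\<zero>}"
  shows "homog_sum M X = {\<zero>}"
proof -
  have "x = \<zero>" if "x \<in> homog_sum M X" for x
    using that by (induction rule: homog_sum_induct) (use assms in auto)
  then show ?thesis by auto
qed

end

section \<open>Graded modules\<close>

text \<open>These sets cut the products in \<open>generated_in_degrees\<close>, whose factors need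
  not be homogeneous, into one generating set for each component.\<close>

definition homog_products ::
  "('r, 'x) graded_scheme \<Rightarrow> ('r, 'a) graded_module \<Rightarrow> int set \<Rightarrow> int \<Rightarrow> 'a set" where
  "homog_products R M X d =
     {act M x a | i x a. i \<in> X \<and> x \<in> component M i \<and> a \<in> component R (d - i)}"

context graded_right_module
begin

lemma act_additive_left: "a \<in> carrier R \<Longrightarrow> additive_map M M (\<lambda>x. act M x a)"
  by (rule additive_mapI) (auto simp: act_closed act_add_left)

lemma act_additive_right: "x \<in> carrier M \<Longrightarrow> additive_map R M (act M x)"
  by (rule additive_mapI) (auto simp: act_closed act_add_right)

lemma act_zero_left [simp]: "a \<in> carrier R \<Longrightarrow> act M \<zero>\<^bsub>M\<^esub> a = \<zero>\<^bsub>M\<^esub>"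
  using additive_map_zero[OF _ _ act_additive_left] M.abelian_group_axioms by blast

lemma act_zero_right [simp]: "x \<in> carrier M \<Longrightarrow> act M x \<zero>\<^bsub>R\<^esub> = \<zero>\<^bsub>M\<^esub>"
  using additive_map_zero[OF _ _ act_additive_right] M.abelian_group_axioms R.abelian_group_axioms by blast

lemma act_minus_left: "\<lbrakk>x \<in> carrier M; a \<in> carrier R\<rbrakk> \<Longrightarrow> act M (\<ominus>\<^bsub>M\<^esub> x) a = \<ominus>\<^bsub>M\<^esub> act M x a"
  using additive_map_minus[OF _ _ act_additive_left] M.abelian_group_axioms by blast

lemma act_minus_right: "\<lbrakk>x \<in> carrier M; a \<in> carrier R\<rbrakk> \<Longrightarrow> act M x (\<ominus>\<^bsub>R\<^esub> a) = \<ominus>\<^bsub>M\<^esub> act M x a"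
  using additive_map_minus[OF _ _ act_additive_right] M.abelian_group_axioms R.abelian_group_axioms by blast

lemma hpart_act:
  assumes "x \<in> component M i" "a \<in> carrier R"
  shows "hpart M j (act M x a) = act M x (hpart R (j - i) a)"
proof (rule R.additive_map_eqI[OF _ _ _ _ assms(2), where N = M])
  have x: "x \<in> carrier M" using assms M.component_carrier by blast
  show "additive_map R M (\<lambda>a. hpart M j (act M x a))"
    by (rule M.additive_map_compose[OF act_additive_right M.hpart_additive]) (rule x)
  show "additive_map R M (\<lambda>a. act M x (hpart R (j - i) a))"
    by (rule M.additive_map_compose[OF R.hpart_additive act_additive_right]) (rule x)
  show "hpart M j (act M x a) = act M x (hpart R (j - i) a)" if "a \<in> component R k" for k a
    using that act_degree[OF assms(1) that] x
    by (auto simp: M.hpart_of_component R.hpart_of_component R.component_carrier)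
qed (rule M.abelian_group_axioms)

lemma homog_products_component: "homog_products R M X d \<subseteq> component M d"
proof
  fix y assume "y \<in> homog_products R M X d"
  then obtain i x a where y: "y = act M x a" "x \<in> component M i" "a \<in> component R (d - i)"
    by (auto simp: homog_products_def)
  then show "y \<in> component M d" using act_degree[OF y(2,3)] by simp
qed

lemma homog_products_carrier: "homog_products R M X d \<subseteq> carrier M"
  using homog_products_component M.component_subset by blast

lemma hpart_product_generated:
  assumes "x \<in> homog_sum M X" "a \<in> carrier R"
  shows "hpart M d (act M x a) \<in> generate (add_monoid M) (homog_products R M X d)"
  using assms(1)
proof (induction rule: M.homog_sum_induct)
  case zero
  then show ?case using assms(2) by simp
next
  case (component i x)
  then have "hpart M d (act M x a) \<in> homog_products R M X d"
    unfolding homog_products_def hpart_act[OF component(2) assms(2)]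
    using R.hpart_component[OF assms(2)] by blast
  then show ?case by (rule M.add_generate_incl)
next
  case (add x y)
  then show ?case
    using assms(2) by (simp add: act_add_left M.homog_sum_carrier M.hpart_add act_closed M.add_generate_add)
qed

text \<open>Each homogeneous part of a product is a sum of products of homogeneous elements, so
  generation can be tested degree by degree. All later arguments use this form.\<close>

lemma generated_in_degrees_iff:
  "generated_in_degrees R M X \<longleftrightarrow>
    (\<forall>d. component M d \<subseteq> generate (add_monoid M) (homog_products R M X d))"
proof
  let ?Z = "{act M x a | x a. x \<in> homog_sum M X \<and> a \<in> carrier R}"
  have Z: "?Z \<subseteq> carrier M" using act_closed M.homog_sum_carrier by blast
  assume gen: "generated_in_degrees R M X"
  have *: "hpart M d z \<in> generate (add_monoid M) (homog_products R M X d)"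
    if "z \<in> generate (add_monoid M) ?Z" for z d
    using that
  proof (induction rule: M.add_generate_induct)
    case (incl h)
    then show ?case using hpart_product_generated by auto
  qed (use Z homog_products_carrier in
      \<open>auto simp: M.hpart_add M.hpart_minus M.add_generate_add M.add_generate_minus\<close>)
  show "\<forall>d. component M d \<subseteq> generate (add_monoid M) (homog_products R M X d)"
  proof (intro allI subsetI)
    fix d z assume z: "z \<in> component M d"
    then have "z \<in> generate (add_monoid M) ?Z"
      using gen M.component_carrier by (auto simp: generated_in_degrees_def act_prod_def)
    from *[OF this, of d] show "z \<in> generate (add_monoid M) (homog_products R M X d)"
      using z by (simp add: M.hpart_of_component)
  qed
next
  let ?Z = "{act M x a | x a. x \<in> homog_sum M X \<and> a \<in> carrier R}"
  have Z: "?Z \<subseteq> carrier M" using act_closed M.homog_sum_carrier by blast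
  assume gen: "\<forall>d. component M d \<subseteq> generate (add_monoid M) (homog_products R M X d)"
  have sub: "homog_products R M X d \<subseteq> ?Z" for d
    unfolding homog_products_def using M.homog_sum_component R.component_carrier by blast
  have "z \<in> generate (add_monoid M) ?Z" if "z \<in> carrier M" for z
    using that
  proof (induction rule: M.graded_induct)
    case (component d z)
    then show ?case using gen M.add_generate_mono[OF sub] by blast
  qed (auto intro: M.add_generate_add)
  then show "generated_in_degrees R M X"
    using M.add_generate_carrier[OF Z] by (auto simp: generated_in_degrees_def act_prod_def)
qed

text \<open>The sign of a product can be absorbed into its left factor, which is why closure under
  negation is not asked of \<open>P\<close>.\<close>

lemma generated_component_induct [consumes 2, case_names zero product add]:
  assumes "generated_in_degrees R M X" "z \<in> component M d" "P \<zero>\<^bsub>M\<^esub>"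
    and "\<And>i x a. \<lbrakk>i \<in> X; x \<in> component M i; a \<in> component R (d - i)\<rbrakk> \<Longrightarrow> P (act M x a)"
    and "\<And>x y. \<lbrakk>x \<in> component M d; y \<in> component M d; P x; P y\<rbrakk> \<Longrightarrow> P (x \<oplus>\<^bsub>M\<^esub> y)"
  shows "P z"
proof -
  have "z \<in> generate (add_monoid M) (homog_products R M X d)"
    using assms(1,2) generated_in_degrees_iff by blast
  then have "P z \<and> z \<in> component M d"
  proof (induction rule: generate.induct)
    case one
    then show ?case using assms(3) by simp
  next
    case (incl h)
    then have "h \<in> component M d" using homog_products_component by blast
    moreover have "P h" using incl assms(4) by (auto simp: homog_products_def)
    ultimately show ?case by simp
  next
    case (inv h)
    then obtain i x a where h: "h = act M x a" "i \<in> X" "x \<in> component M i" "a \<in> component R (d - i)"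
      by (auto simp: homog_products_def)
    then have "inv\<^bsub>add_monoid M\<^esub> h = act M (\<ominus>\<^bsub>M\<^esub> x) a"
      using act_minus_left M.component_carrier R.component_carrier by (metis a_inv_def)
    moreover have "\<ominus>\<^bsub>M\<^esub> x \<in> component M i" using h M.component_minus by blast
    ultimately show ?case using assms(4) h act_degree[of "\<ominus>\<^bsub>M\<^esub> x" i a "d - i"] by auto
  next
    case (eng h1 h2)
    then show ?case using assms(5) M.component_add by auto
  qed
  then show ?thesis by simp
qed

end

text \<open>Submodules, the truncated ring, restricted modules and \<open>MV\<close> all carry the
  operations of an ambient group on a smaller carrier. This lemma and the next ones compare the two
  records.\<close>

lemma abelian_group_restrict:
  assumes "abelian_group G" "additive_subgroup (carrier H) G" "add H = add G" "zero H = zero G"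
  shows "abelian_group H"
proof -
  interpret G: abelian_group G by fact
  interpret S: additive_subgroup "carrier H" G by fact
  show ?thesis
  proof (rule abelian_groupI)
    show "\<exists>y\<in>carrier H. y \<oplus>\<^bsub>H\<^esub> x = \<zero>\<^bsub>H\<^esub>" if "x \<in> carrier H" for x
      using that S.a_inv_closed[OF that] G.l_neg[of x] assms(3,4) by auto
  qed (use assms(3,4) G.a_assoc G.a_comm in auto)
qed

lemma minus_restrict:
  assumes "abelian_group G" "additive_subgroup (carrier H) G" "add H = add G" "zero H = zero G"
    and "x \<in> carrier H"
  shows "\<ominus>\<^bsub>H\<^esub> x = \<ominus>\<^bsub>G\<^esub> x"
proof -
  interpret G: abelian_group G by fact
  interpret S: additive_subgroup "carrier H" G by fact
  interpret H: abelian_group H by (rule abelian_group_restrict[OF assms(1-4)])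
  show ?thesis
    by (rule H.minus_equality)
      (use assms S.a_inv_closed G.l_neg in auto)
qed

lemma finsum_restrict:
  assumes "abelian_group G" "additive_subgroup (carrier H) G" "add H = add G" "zero H = zero G"
    and "finite F" "f \<in> F \<rightarrow> carrier H"
  shows "finsum H f F = finsum G f F"
proof -
  have "additive_map H G (\<lambda>x. x)"
    by (rule additive_mapI) (use additive_subgroup.a_subset[OF assms(2)] assms(3) in auto)
  from additive_map_finsum[OF abelian_group_restrict[OF assms(1-4)] assms(1) this assms(5,6)]
  show ?thesis by simp
qed

text \<open>\<open>generate\<close> refers to inverses, which are definite descriptions over the
  carrier of the record. By \<open>minus_restrict\<close> both records have the same inverses, so
  they generate by the same words.\<close>

lemma generate_restrict:
  assumes "abelian_group G" "additive_subgroup (carrier H) G" "add H = add G" "zero H = zero G"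
    and "X \<subseteq> carrier H"
  shows "generate (add_monoid H) X = generate (add_monoid G) X"
proof -
  interpret G: abelian_group G by fact
  interpret H: abelian_group H by (rule abelian_group_restrict[OF assms(1-4)])
  have X: "X \<subseteq> carrier G" using assms(5) additive_subgroup.a_subset[OF assms(2)] by blast
  have neg: "\<ominus>\<^bsub>H\<^esub> x = \<ominus>\<^bsub>G\<^esub> x" if "x \<in> carrier H" for x
    using minus_restrict[OF assms(1-4) that] .
  have "x \<in> generate (add_monoid G) X" if "x \<in> generate (add_monoid H) X" for x
    using that
  proof (induction rule: H.add_generate_induct)
    case (add x y)
    then show ?case using G.add_generate_add[of x X y] assms(3) by simp
  next
    case (minus x)
    then show ?case using G.add_generate_minus[OF X, of x] neg by simp
  qed (use assms in \<open>auto intro: G.add_generate_incl\<close>)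
  moreover have "x \<in> generate (add_monoid H) X" if "x \<in> generate (add_monoid G) X" for x
    using that
  proof (induction rule: G.add_generate_induct)
    case zero
    then show ?case using H.add_generate_zero assms(4) by metis
  next
    case (add x y)
    then show ?case using H.add_generate_add[of x X y] assms(3) by simp
  next
    case (minus x)
    then have "x \<in> carrier H" using H.add_generate_carrier[OF assms(5)] by blast
    then show ?case using minus H.add_generate_minus[OF assms(5), of x] neg by simp
  qed (use X in \<open>auto intro: H.add_generate_incl\<close>)
  ultimately show ?thesis by blast
qed

lemma additive_subgroup_restrict:
  assumes "abelian_group G" "additive_subgroup (carrier H) G" "add H = add G" "zero H = zero G"
    and "A \<subseteq> carrier H" "additive_subgroup A G"
  shows "additive_subgroup A H"
  unfolding additive_subgroup_def
proof (rule subgroup.intro)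
  fix x assume x: "x \<in> A"
  then have "\<ominus>\<^bsub>H\<^esub> x \<in> A"
    using minus_restrict[OF assms(1-4), of x] additive_subgroup.a_inv_closed[OF assms(6) x] assms(5)
    by auto
  then show "inv\<^bsub>add_monoid H\<^esub> x \<in> A" by (simp add: a_inv_def)
qed (use additive_subgroup.a_closed[OF assms(6)] additive_subgroup.zero_closed[OF assms(6)] assms in auto)

lemma graded_group_restrict:
  assumes G: "abelian_group G" "additive_subgroup (carrier H) G" "add H = add G" "zero H = zero G"
    and sub: "\<And>i. additive_subgroup (component H i) G" "\<And>i. component H i \<subseteq> carrier H"
    and gen: "carrier H \<subseteq> generate (add_monoid G) (\<Union>i. component H i)"
    and ind: "\<And>F f i. \<lbrakk>finite F; \<And>i. i \<in> F \<Longrightarrow> f i \<in> component H i; finsum G f F = \<zero>\<^bsub>G\<^esub>; i \<in> F\<rbrakk>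
      \<Longrightarrow> f i = \<zero>\<^bsub>G\<^esub>"
  shows "graded_group H"
proof (rule graded_groupI)
  show "abelian_group H" by (rule abelian_group_restrict[OF G])
  show "additive_subgroup (component H i) H" for i
    by (rule additive_subgroup_restrict[OF G sub(2) sub(1)])
  show "carrier H \<subseteq> generate (add_monoid H) (\<Union>i. component H i)"
    using gen by (subst generate_restrict[OF G]) (use sub in auto)
  show "f i = \<zero>\<^bsub>H\<^esub>" if "finite F" "\<And>i. i \<in> F \<Longrightarrow> f i \<in> component H i" "finsum H f F = \<zero>\<^bsub>H\<^esub>" "i \<in> F" for F f i
  proof -
    have "finsum H f F = finsum G f F"
      by (rule finsum_restrict[OF G]) (use that sub in auto)
    then show ?thesis using ind[of F f i] that G by simp
  qed
qed

lemma (in graded_right_module) graded_submoduleI: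
  assumes sub: "additive_subgroup N M" and hp: "\<And>x i. x \<in> N \<Longrightarrow> hpart M i x \<in> N"
    and act: "\<And>x a. \<lbrakk>x \<in> N; a \<in> carrier R\<rbrakk> \<Longrightarrow> act M x a \<in> N"
  shows "graded_submodule R N M"
proof -
  let ?N = "submod M N"
  have car: "N \<subseteq> carrier M" using additive_subgroup.a_subset[OF sub] .
  have simps: "carrier ?N = N" "zero ?N = zero M" "add ?N = add M" "act ?N = act M"
    "component ?N i = N \<inter> component M i" for i
    by (simp_all add: submod_def)
  have gg: "graded_group ?N"
  proof (rule graded_group_restrict[OF M.abelian_group_axioms])
    show "additive_subgroup (component ?N i) M" for i
      using sub M.component_subgroup[of i] group.subgroups_Inter_pair[OF M.a_group]
      unfolding simps additive_subgroup_def by blast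
    show "carrier ?N \<subseteq> generate (add_monoid M) (\<Union>i. component ?N i)"
    proof
      fix x assume "x \<in> carrier ?N"
      then have x: "x \<in> N" "x \<in> carrier M" using car by (auto simp: simps)
      have "finsum M (\<lambda>i. hpart M i x) {i. hpart M i x \<noteq> \<zero>\<^bsub>M\<^esub>} \<in> generate (add_monoid M) (\<Union>i. component ?N i)"
      proof (rule M.finsum_closure_induct)
        show "hpart M i x \<in> generate (add_monoid M) (\<Union>i. component ?N i)" for i
          by (rule M.add_generate_incl) (use x hp M.hpart_component[OF x(2), of i] in \<open>unfold simps, blast\<close>)
      qed (use x M.hpart_finite M.add_generate_add in auto)
      then show "x \<in> generate (add_monoid M) (\<Union>i. component ?N i)"
        using M.hpart_sum x by simp
    qed
  qed (use simps sub M.components_independent in auto)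
  have "graded_right_module R ?N"
    unfolding graded_right_module_def
    by (intro conjI R.graded_ring_axioms gg graded_right_module_axioms.intro)
      (use car act act_closed act_add_left act_add_right act_assoc act_one act_degree in
        \<open>auto simp: simps subset_iff R.component_carrier\<close>)
  then show ?thesis using car by (simp add: graded_submodule_def)
qed

section \<open>Equivalences of categories\<close>

lemma naturally_isomorphicI:
  assumes "\<And>X. X \<in> Ob C \<Longrightarrow> \<eta> X \<in> iso_in D (Fo X) (Go X)"
    and "\<And>X Y f. \<lbrakk>X \<in> Ob C; Y \<in> Ob C; f \<in> Hom C X Y\<rbrakk> \<Longrightarrow>
      Comp D (Fo X) (Fo Y) (Go Y) (\<eta> Y) (Fm X Y f) = Comp D (Fo X) (Go X) (Go Y) (Gm X Y f) (\<eta> X)"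
  shows "naturally_isomorphic C D Fo Fm Go Gm"
  using assms unfolding naturally_isomorphic_def by blast

text \<open>The inverse functor chooses for each object of \<open>D\<close> an isomorphic object in
  the image, and lifts conjugates of morphisms along the bijections \<open>Fm\<close>. Equations in
  \<open>C\<close> are verified after applying \<open>Fm\<close>, which is injective on hom
  sets.\<close>

lemma equivalent_categoriesI:
  assumes F: "cat_functor C D Fo Fm"
    and ff: "\<And>X Y. \<lbrakk>X \<in> Ob C; Y \<in> Ob C\<rbrakk> \<Longrightarrow> bij_betw (Fm X Y) (Hom C X Y) (Hom D (Fo X) (Fo Y))"
    and ess: "\<And>Y. Y \<in> Ob D \<Longrightarrow> \<exists>X \<in> Ob C. iso_in D (Fo X) Y \<noteq> {}"
  shows "equivalent_categories C D"
proof -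
  interpret F: cat_functor C D Fo Fm by fact
  obtain Go where Go: "\<And>Y. Y \<in> Ob D \<Longrightarrow> Go Y \<in> Ob C \<and> iso_in D (Fo (Go Y)) Y \<noteq> {}"
    using ess by metis
  \<comment> \<open>A chosen isomorphism for each object; these form the second of the two natural
    isomorphisms.\<close>
  define \<epsilon> where "\<epsilon> Y = (SOME e. e \<in> iso_in D (Fo (Go Y)) Y)" for Y
  have \<epsilon>: "\<And>Y. Y \<in> Ob D \<Longrightarrow> \<epsilon> Y \<in> iso_in D (Fo (Go Y)) Y"
    using Go by (simp add: \<epsilon>_def some_in_eq)
  then obtain \<delta> where \<epsilon>H: "\<And>Y. Y \<in> Ob D \<Longrightarrow> \<epsilon> Y \<in> Hom D (Fo (Go Y)) Y"
    and \<delta>H: "\<And>Y. Y \<in> Ob D \<Longrightarrow> \<delta> Y \<in> Hom D Y (Fo (Go Y))"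
    and \<delta>\<epsilon>: "\<And>Y. Y \<in> Ob D \<Longrightarrow> Comp D (Fo (Go Y)) Y (Fo (Go Y)) (\<delta> Y) (\<epsilon> Y) = Id D (Fo (Go Y))"
    and \<epsilon>\<delta>: "\<And>Y. Y \<in> Ob D \<Longrightarrow> Comp D Y (Fo (Go Y)) Y (\<epsilon> Y) (\<delta> Y) = Id D Y"
    unfolding iso_in_def by (simp add: Bex_def) metis
  have GoC: "Go Y \<in> Ob C" and FGo: "Fo (Go Y) \<in> Ob D" if "Y \<in> Ob D" for Y
    using Go[OF that] F.obj by auto
  define L where "L X Y h = inv_into (Hom C X Y) (Fm X Y) h" for X Y h
  have L_in: "L X Y h \<in> Hom C X Y" and FL: "Fm X Y (L X Y h) = h"
    if "X \<in> Ob C" "Y \<in> Ob C" "h \<in> Hom D (Fo X) (Fo Y)" for X Y h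
    using ff[OF that(1,2)] that(3) unfolding L_def bij_betw_def
    by (auto intro: inv_into_into f_inv_into_f)
  have inj: "f = g" if "X \<in> Ob C" "Y \<in> Ob C" "f \<in> Hom C X Y" "g \<in> Hom C X Y" "Fm X Y f = Fm X Y g"
    for X Y f g
    using ff[OF that(1,2)] that(3-5) by (auto simp: bij_betw_def inj_on_def)
  \<comment> \<open>The conjugate of \<open>f\<close> by the chosen isomorphisms. Its preimage under
    \<open>Fm\<close> will be the image of \<open>f\<close> under the inverse functor.\<close>
  define K where "K X Y f = Comp D (Fo (Go X)) Y (Fo (Go Y)) (\<delta> Y) (Comp D (Fo (Go X)) X Y f (\<epsilon> X))" for X Y f
  have K_in: "K X Y f \<in> Hom D (Fo (Go X)) (Fo (Go Y))"
    if "X \<in> Ob D" "Y \<in> Ob D" "f \<in> Hom D X Y" for X Y f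
    unfolding K_def using that by (intro F.D.Comp_in[where Y = Y] F.D.Comp_in[where Y = X] FGo \<epsilon>H \<delta>H) auto
  have \<epsilon>K: "Comp D (Fo (Go X)) (Fo (Go Y)) Y (\<epsilon> Y) (K X Y f) = Comp D (Fo (Go X)) X Y f (\<epsilon> X)"
    if that: "X \<in> Ob D" "Y \<in> Ob D" "f \<in> Hom D X Y" for X Y f
  proof -
    have fe: "Comp D (Fo (Go X)) X Y f (\<epsilon> X) \<in> Hom D (Fo (Go X)) Y"
      using that by (intro F.D.Comp_in[where Y = X] FGo \<epsilon>H) auto
    then show ?thesis
      unfolding K_def using that
      by (subst F.D.Comp_assoc[where X = Y and Y = "Fo (Go Y)" and Z = Y])
        (auto simp: \<epsilon>\<delta> F.D.Id_left FGo \<epsilon>H \<delta>H)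
  qed
  \<comment> \<open>Left cancellation of \<epsilon> turns the compatibility of \<open>K\<close> with
    composition into a chain of reassociations using \<open>\<epsilon>K\<close>.\<close>
  have \<epsilon>_cancel: "f = g" if "X \<in> Ob D" "Y \<in> Ob D" "f \<in> Hom D X (Fo (Go Y))" "g \<in> Hom D X (Fo (Go Y))"
    "Comp D X (Fo (Go Y)) Y (\<epsilon> Y) f = Comp D X (Fo (Go Y)) Y (\<epsilon> Y) g" for X Y f g
  proof -
    have "h = Comp D X Y (Fo (Go Y)) (\<delta> Y) (Comp D X (Fo (Go Y)) Y (\<epsilon> Y) h)"
      if h: "h \<in> Hom D X (Fo (Go Y))" for h
      using \<open>X \<in> Ob D\<close> \<open>Y \<in> Ob D\<close> h
      by (subst F.D.Comp_assoc[where X = "Fo (Go Y)" and Y = Y and Z = "Fo (Go Y)"])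
        (auto simp: \<delta>\<epsilon> F.D.Id_left FGo \<epsilon>H \<delta>H)
    then show ?thesis using that by metis
  qed
  define Gm where "Gm X Y f = L (Go X) (Go Y) (K X Y f)" for X Y f
  have FG: "Fm (Go X) (Go Y) (Gm X Y f) = K X Y f" and Gm_in: "Gm X Y f \<in> Hom C (Go X) (Go Y)"
    if "X \<in> Ob D" "Y \<in> Ob D" "f \<in> Hom D X Y" for X Y f
    unfolding Gm_def using that by (auto intro!: L_in FL GoC K_in)
  have G: "cat_functor D C Go Gm"
  proof (intro cat_functor.intro cat_functor_axioms.intro F.C.category_axioms F.D.category_axioms)
    show "Go X \<in> Ob C" if "X \<in> Ob D" for X using GoC that .
    show "Gm X Y f \<in> Hom C (Go X) (Go Y)" if "X \<in> Ob D" "Y \<in> Ob D" "f \<in> Hom D X Y" for X Y f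
      using Gm_in that .
    show "Gm X X (Id D X) = Id C (Go X)" if X: "X \<in> Ob D" for X
    proof (rule inj)
      show "Fm (Go X) (Go X) (Gm X X (Id D X)) = Fm (Go X) (Go X) (Id C (Go X))"
        using X by (simp add: FG F.D.Id_in F.mor_Id GoC K_def F.D.Id_left \<epsilon>H FGo \<delta>\<epsilon>)
    qed (use X GoC Gm_in F.D.Id_in F.C.Id_in in auto)
    show "Gm X Z (Comp D X Y Z g f) = Comp C (Go X) (Go Y) (Go Z) (Gm Y Z g) (Gm X Y f)"
      if X: "X \<in> Ob D" and Y: "Y \<in> Ob D" and Z: "Z \<in> Ob D" and f: "f \<in> Hom D X Y" and g: "g \<in> Hom D Y Z"
      for X Y Z f g
    proof (rule inj)
      have gf: "Comp D X Y Z g f \<in> Hom D X Z" using F.D.Comp_in X Y Z f g by blast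
      let ?A = "Fo (Go X)" and ?B = "Fo (Go Y)" and ?Z = "Fo (Go Z)"
      have "K X Z (Comp D X Y Z g f) = Comp D ?A ?B ?Z (K Y Z g) (K X Y f)"
      proof (rule \<epsilon>_cancel[of ?A Z])
        have "Comp D ?A ?Z Z (\<epsilon> Z) (Comp D ?A ?B ?Z (K Y Z g) (K X Y f))
          = Comp D ?A ?B Z (Comp D ?B ?Z Z (\<epsilon> Z) (K Y Z g)) (K X Y f)"
          by (rule F.D.Comp_assoc) (use X Y Z f g FGo K_in \<epsilon>H in auto)
        also have "\<dots> = Comp D ?A ?B Z (Comp D ?B Y Z g (\<epsilon> Y)) (K X Y f)"
          using \<epsilon>K Y Z g by simp
        also have "\<dots> = Comp D ?A Y Z g (Comp D ?A ?B Y (\<epsilon> Y) (K X Y f))"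
          by (rule F.D.Comp_assoc[symmetric]) (use X Y Z f g FGo K_in \<epsilon>H in auto)
        also have "\<dots> = Comp D ?A Y Z g (Comp D ?A X Y f (\<epsilon> X))"
          using \<epsilon>K X Y f by simp
        also have "\<dots> = Comp D ?A X Z (Comp D X Y Z g f) (\<epsilon> X)"
          by (rule F.D.Comp_assoc) (use X Y Z f g FGo K_in \<epsilon>H in auto)
        finally show "Comp D ?A ?Z Z (\<epsilon> Z) (K X Z (Comp D X Y Z g f))
          = Comp D ?A ?Z Z (\<epsilon> Z) (Comp D ?A ?B ?Z (K Y Z g) (K X Y f))"
          using \<epsilon>K X Z gf by simp
      qed (use X Y Z f g gf FGo K_in F.D.Comp_in[where Y = ?B] in auto)
      then show "Fm (Go X) (Go Z) (Gm X Z (Comp D X Y Z g f))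
        = Fm (Go X) (Go Z) (Comp C (Go X) (Go Y) (Go Z) (Gm Y Z g) (Gm X Y f))"
        using X Y Z f g gf by (subst F.mor_Comp) (auto simp: FG GoC Gm_in)
    qed (use X Y Z f g GoC Gm_in F.D.Comp_in F.C.Comp_in in auto)
  qed
  have N2: "naturally_isomorphic D D (\<lambda>X. Fo (Go X)) (\<lambda>X Y f. Fm (Go X) (Go Y) (Gm X Y f)) (\<lambda>X. X) (\<lambda>X Y f. f)"
    by (rule naturally_isomorphicI[where \<eta> = \<epsilon>]) (auto simp: \<epsilon> FG \<epsilon>K)
  \<comment> \<open>The other natural isomorphism is forced: it is the lift of \<epsilon> at
    \<open>Fo X\<close>, so its naturality and invertibility follow from those of \<epsilon> by
    faithfulness.\<close>
  define \<eta> where "\<eta> X = L (Go (Fo X)) X (\<epsilon> (Fo X))" for X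
  have \<eta>_in: "\<eta> X \<in> Hom C (Go (Fo X)) X" and F\<eta>: "Fm (Go (Fo X)) X (\<eta> X) = \<epsilon> (Fo X)" if "X \<in> Ob C" for X
    unfolding \<eta>_def using that by (auto intro!: L_in FL GoC \<epsilon>H F.obj)
  have \<eta>_iso: "\<eta> X \<in> iso_in C (Go (Fo X)) X" if X: "X \<in> Ob C" for X
  proof -
    let ?G = "Go (Fo X)"
    have o: "?G \<in> Ob C" "Fo X \<in> Ob D" using X F.obj GoC by auto
    define \<theta> where "\<theta> = L X ?G (\<delta> (Fo X))"
    have \<theta>: "\<theta> \<in> Hom C X ?G" "Fm X ?G \<theta> = \<delta> (Fo X)"
      unfolding \<theta>_def using X o by (auto intro!: L_in FL \<delta>H)
    note \<eta> = \<eta>_in[OF X] F\<eta>[OF X]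
    have "Comp C ?G X ?G \<theta> (\<eta> X) = Id C ?G"
    proof (rule inj[of ?G ?G])
      show "Fm ?G ?G (Comp C ?G X ?G \<theta> (\<eta> X)) = Fm ?G ?G (Id C ?G)"
        using F.mor_Comp[OF o(1) X o(1) \<eta>(1) \<theta>(1)] F.mor_Id[OF o(1)] \<eta> \<theta> \<delta>\<epsilon>[OF o(2)] by simp
      show "Comp C ?G X ?G \<theta> (\<eta> X) \<in> Hom C ?G ?G"
        by (rule F.C.Comp_in[OF o(1) X o(1) \<eta>(1) \<theta>(1)])
    qed (use o F.C.Id_in in auto)
    moreover have "Comp C X ?G X (\<eta> X) \<theta> = Id C X"
    proof (rule inj[of X X])
      show "Fm X X (Comp C X ?G X (\<eta> X) \<theta>) = Fm X X (Id C X)"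
        using F.mor_Comp[OF X o(1) X \<theta>(1) \<eta>(1)] F.mor_Id[OF X] \<eta> \<theta> \<epsilon>\<delta>[OF o(2)] by simp
      show "Comp C X ?G X (\<eta> X) \<theta> \<in> Hom C X X"
        by (rule F.C.Comp_in[OF X o(1) X \<theta>(1) \<eta>(1)])
    qed (use X F.C.Id_in in auto)
    ultimately show ?thesis using \<theta> \<eta>_in X unfolding iso_in_def by blast
  qed
  have N1: "naturally_isomorphic C C (\<lambda>X. Go (Fo X)) (\<lambda>X Y f. Gm (Fo X) (Fo Y) (Fm X Y f)) (\<lambda>X. X) (\<lambda>X Y f. f)"
  proof (rule naturally_isomorphicI[where \<eta> = \<eta>])
    fix X Y f assume X: "X \<in> Ob C" and Y: "Y \<in> Ob C" and f: "f \<in> Hom C X Y"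
    have o: "Fo X \<in> Ob D" "Fo Y \<in> Ob D" "Go (Fo X) \<in> Ob C" "Go (Fo Y) \<in> Ob C"
      using X Y F.obj GoC by auto
    have Ff: "Fm X Y f \<in> Hom D (Fo X) (Fo Y)" using F.mor X Y f by blast
    note G_in = Gm_in[OF o(1,2) Ff]
    show "Comp C (Go (Fo X)) (Go (Fo Y)) Y (\<eta> Y) (Gm (Fo X) (Fo Y) (Fm X Y f))
      = Comp C (Go (Fo X)) X Y f (\<eta> X)"
    proof (rule inj)
      show "Fm (Go (Fo X)) Y (Comp C (Go (Fo X)) (Go (Fo Y)) Y (\<eta> Y) (Gm (Fo X) (Fo Y) (Fm X Y f)))
        = Fm (Go (Fo X)) Y (Comp C (Go (Fo X)) X Y f (\<eta> X))"
        using X Y f o G_in \<eta>_in Ff by (simp add: F.mor_Comp F\<eta> FG \<epsilon>K)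
    qed (use X Y f o G_in \<eta>_in F.C.Comp_in[of "Go (Fo X)" _ Y] in auto)
  qed (rule \<eta>_iso)
  show ?thesis unfolding equivalent_categories_def using F G N1 N2 by blast
qed

section \<open>Graded morphisms and their category\<close>

lemma gr_homD:
  assumes "f \<in> gr_hom R M N"
  shows "f \<in> extensional (carrier M)" "x \<in> carrier M \<Longrightarrow> f x \<in> carrier N"
    "\<lbrakk>x \<in> carrier M; y \<in> carrier M\<rbrakk> \<Longrightarrow> f (x \<oplus>\<^bsub>M\<^esub> y) = f x \<oplus>\<^bsub>N\<^esub> f y"
    "\<lbrakk>x \<in> carrier M; a \<in> carrier R\<rbrakk> \<Longrightarrow> f (act M x a) = act N (f x) a"
    "z \<in> component M i \<Longrightarrow> f z \<in> component N i"
    "additive_map M N f"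
  using assms by (auto simp: gr_hom_def mod_hom_def additive_map_def PiE_def image_subset_iff)

lemma gr_homI:
  assumes "f \<in> extensional (carrier M)" "\<And>x. x \<in> carrier M \<Longrightarrow> f x \<in> carrier N"
    "\<And>x y. \<lbrakk>x \<in> carrier M; y \<in> carrier M\<rbrakk> \<Longrightarrow> f (x \<oplus>\<^bsub>M\<^esub> y) = f x \<oplus>\<^bsub>N\<^esub> f y"
    "\<And>x a. \<lbrakk>x \<in> carrier M; a \<in> carrier R\<rbrakk> \<Longrightarrow> f (act M x a) = act N (f x) a"
    "\<And>i z. z \<in> component M i \<Longrightarrow> f z \<in> component N i"
  shows "f \<in> gr_hom R M N"
  using assms by (auto simp: gr_hom_def mod_hom_def PiE_def)

lemma gr_hom_compose:
  assumes L: "graded_right_module R L" and f: "f \<in> gr_hom R L M" and g: "g \<in> gr_hom R M N"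
  shows "compose (carrier L) g f \<in> gr_hom R L N"
proof -
  interpret L: graded_right_module R L by fact
  show ?thesis
    by (rule gr_homI)
      (use gr_homD[OF f] gr_homD[OF g] L.act_closed L.M.component_carrier in \<open>auto simp: compose_def\<close>)
qed

lemma gr_hom_id: "graded_right_module R M \<Longrightarrow> (\<lambda>x\<in>carrier M. x) \<in> gr_hom R M M"
  by (rule gr_homI)
    (auto simp: graded_right_module.act_closed graded_group.component_carrier graded_right_module_def
      abelian_monoid.a_closed abelian_group_def graded_group_def)

lemma category_Gr: "category (full_subcategory (Gr R) \<Phi>)"
proof (rule category.intro)
  let ?C = "full_subcategory (Gr R) \<Phi>"
  fix W X Y Z f g h
  show "Id ?C X \<in> Hom ?C X X" if "X \<in> Ob ?C"
    using that by (auto simp: full_subcategory_def Gr_def gr_hom_id)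
  show "Comp ?C X Y Z g f \<in> Hom ?C X Z"
    if "X \<in> Ob ?C" "Y \<in> Ob ?C" "Z \<in> Ob ?C" "f \<in> Hom ?C X Y" "g \<in> Hom ?C Y Z"
    using that by (auto simp: full_subcategory_def Gr_def intro: gr_hom_compose)
  show "Comp ?C X Y Y (Id ?C Y) f = f" if "X \<in> Ob ?C" "Y \<in> Ob ?C" "f \<in> Hom ?C X Y"
    using that gr_homD(1,2)[of f R X Y]
    by (auto simp: full_subcategory_def Gr_def compose_def extensional_def fun_eq_iff)
  show "Comp ?C X X Y f (Id ?C X) = f" if "X \<in> Ob ?C" "Y \<in> Ob ?C" "f \<in> Hom ?C X Y"
    using that gr_homD(1,2)[of f R X Y]
    by (auto simp: full_subcategory_def Gr_def compose_def extensional_def fun_eq_iff)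
  show "Comp ?C W Y Z h (Comp ?C W X Y g f) = Comp ?C W X Z (Comp ?C X Y Z h g) f"
    if "W \<in> Ob ?C" "X \<in> Ob ?C" "Y \<in> Ob ?C" "Z \<in> Ob ?C" "f \<in> Hom ?C W X" "g \<in> Hom ?C X Y" "h \<in> Hom ?C Y Z"
    using that gr_homD(2)[of f R W X]
    by (auto simp: full_subcategory_def Gr_def compose_def fun_eq_iff)
qed

section \<open>The subcategory G(S, U)\<close>

definition gen_degrees :: "nat \<Rightarrow> int \<Rightarrow> int set" where
  "gen_degrees n m = {m + int n * k | k. True}"

definition degrees_S :: "nat \<Rightarrow> int \<Rightarrow> int set" where
  "degrees_S n m = (+) m ` degrees_U n"

text \<open>A homogeneous element y spans the graded submodule y R, and a nonzero graded submodule
  contains a nonzero homogeneous y. So the condition on all submodules says that each such y can be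
  multiplied to something nonzero in a degree of S.\<close>

lemma (in graded_right_module) in_G_iff:
  "in_G n m R M \<longleftrightarrow> generated_in_degrees R M (gen_degrees n m) \<and>
     (\<forall>d. \<forall>y \<in> component M d. y \<noteq> \<zero>\<^bsub>M\<^esub> \<longrightarrow>
        (\<exists>j. \<exists>b \<in> component R j. d + j \<in> degrees_S n m \<and> act M y b \<noteq> \<zero>\<^bsub>M\<^esub>))"
proof -
  have "(\<forall>N. graded_submodule R N M \<and> N \<noteq> {\<zero>\<^bsub>M\<^esub>} \<longrightarrow>
        homog_sum (submod M N) (degrees_S n m) \<noteq> {\<zero>\<^bsub>M\<^esub>}) \<longleftrightarrow>
     (\<forall>d. \<forall>y \<in> component M d. y \<noteq> \<zero>\<^bsub>M\<^esub> \<longrightarrow>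
        (\<exists>j. \<exists>b \<in> component R j. d + j \<in> degrees_S n m \<and> act M y b \<noteq> \<zero>\<^bsub>M\<^esub>))" (is "?L \<longleftrightarrow> ?R")
  proof (intro iffI allI ballI impI)
    fix d y assume L: ?L and y: "y \<in> component M d" "y \<noteq> \<zero>\<^bsub>M\<^esub>"
    have yc: "y \<in> carrier M" using y M.component_carrier by blast
    let ?N = "act M y ` carrier R"
    have sub: "graded_submodule R ?N M"
    proof (rule graded_submoduleI)
      have "group_hom (add_monoid R) (add_monoid M) (act M y)"
        by (rule abelian_group_hom.a_group_hom)
          (rule additive_map_hom[OF R.abelian_group_axioms M.abelian_group_axioms act_additive_right[OF yc]])
      from group_hom.img_is_subgroup[OF this]
      have "subgroup (act M y ` carrier R) (add_monoid M)" by simp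
      then show "additive_subgroup ?N M" by (simp add: additive_subgroup_def)
      show "hpart M i x \<in> ?N" if x: "x \<in> ?N" for x i
      proof -
        obtain a where a: "a \<in> carrier R" "x = act M y a" using x by blast
        show ?thesis
          unfolding a(2) hpart_act[OF y(1) a(1)] using R.hpart_closed[OF a(1)] by blast
      qed
      show "act M x a \<in> ?N" if x: "x \<in> ?N" and a: "a \<in> carrier R" for x a
      proof -
        obtain c where c: "c \<in> carrier R" "x = act M y c" using x by blast
        show ?thesis
          unfolding c(2) act_assoc[OF yc c(1) a] using R.m_closed[OF c(1) a] by blast
      qed
    qed
    have "y \<in> ?N" by (rule image_eqI[of _ _ "\<one>\<^bsub>R\<^esub>"]) (use act_one[OF yc] in simp_all)
    then have "?N \<noteq> {\<zero>\<^bsub>M\<^esub>}" using y(2) by blast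
    then have ne: "homog_sum (submod M ?N) (degrees_S n m) \<noteq> {\<zero>\<^bsub>M\<^esub>}" 
      using L[rule_format, OF conjI[OF sub]] by simp
    have zero: "zero (submod M ?N) = zero M" and comp: "\<And>s. component (submod M ?N) s = ?N \<inter> component M s"
      by (simp_all add: submod_def)
    interpret N: graded_right_module R "submod M ?N"
      using sub unfolding graded_submodule_def by (rule conjunct2)
    have "\<exists>s \<in> degrees_S n m. \<not> component (submod M ?N) s \<subseteq> {\<zero>\<^bsub>M\<^esub>}"
    proof (rule ccontr)
      assume "\<not> ?thesis"
      then have "homog_sum (submod M ?N) (degrees_S n m) = {\<zero>\<^bsub>submod M ?N\<^esub>}"
        by (intro N.M.homog_sum_eq_zeroI) (unfold zero, blast)
      then show False using ne unfolding zero by blast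
    qed
    then obtain s where s: "s \<in> degrees_S n m" "\<not> component (submod M ?N) s \<subseteq> {\<zero>\<^bsub>M\<^esub>}" by blast
    from s(2)[unfolded comp] obtain a where a: "a \<in> carrier R" "act M y a \<in> component M s" "act M y a \<noteq> \<zero>\<^bsub>M\<^esub>"
      by blast
    \<comment> \<open>The product already lies in degree s, so only the part of \<open>a\<close> in
      degree s - d contributes; this part is the homogeneous multiplier that is sought.\<close>
    have eq: "act M y a = act M y (hpart R (s - d) a)"
      unfolding hpart_act[OF y(1) a(1), symmetric] M.hpart_of_component[OF a(2)] by simp
    have "d + (s - d) \<in> degrees_S n m" using s(1) by simp
    moreover have "act M y (hpart R (s - d) a) \<noteq> \<zero>\<^bsub>M\<^esub>" using a(3) unfolding eq .
    ultimately show "\<exists>j. \<exists>b \<in> component R j. d + j \<in> degrees_S n m \<and> act M y b \<noteq> \<zero>\<^bsub>M\<^esub>"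
      using R.hpart_component[OF a(1), of "s - d"] by blast
  next
    fix N assume R: ?R and N: "graded_submodule R N M \<and> N \<noteq> {\<zero>\<^bsub>M\<^esub>}"
    have simps: "carrier (submod M N) = N" "zero (submod M N) = zero M" "act (submod M N) = act M"
      "\<And>i. component (submod M N) i = N \<inter> component M i"
      by (simp_all add: submod_def)
    interpret N: graded_right_module R "submod M N"
      using conjunct1[OF N] unfolding graded_submodule_def by (rule conjunct2)
    have "\<exists>d. \<not> component (submod M N) d \<subseteq> {\<zero>\<^bsub>M\<^esub>}"
    proof (rule ccontr)
      assume "\<not> ?thesis"
      then have c0: "z = \<zero>\<^bsub>M\<^esub>" if "z \<in> component (submod M N) d" for z d using that by blast
      have "x = \<zero>\<^bsub>M\<^esub>" if "x \<in> N" for x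
      proof -
        have x: "x \<in> carrier (submod M N)" using that simps(1) by simp
        have "x = \<zero>\<^bsub>submod M N\<^esub>"
          by (rule N.M.zero_if_hparts_zero[OF x]) (unfold simps(2), rule c0[OF N.M.hpart_component[OF x]])
        then show ?thesis unfolding simps .
      qed
      moreover have "\<zero>\<^bsub>M\<^esub> \<in> N" using N.M.zero_closed unfolding simps .
      ultimately show False using N by blast
    qed
    then obtain d y where y: "y \<in> N" "y \<in> component M d" "y \<noteq> \<zero>\<^bsub>M\<^esub>"
      unfolding simps by blast
    then obtain j b where b: "b \<in> component R j" "d + j \<in> degrees_S n m" "act M y b \<noteq> \<zero>\<^bsub>M\<^esub>" using R[rule_format, OF y(2,3)] by blast
    have "act M y b \<in> component (submod M N) (d + j)"
      using N.act_degree[of y d b j] y(1,2) b(1) unfolding simps by blast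
    then have "act M y b \<in> homog_sum (submod M N) (degrees_S n m)"
      using b(2) by (rule N.M.homog_sum_component)
    then show "homog_sum (submod M N) (degrees_S n m) \<noteq> {\<zero>\<^bsub>M\<^esub>}"
      using b(3) by (metis singletonD)
  qed
  then show ?thesis
    unfolding in_G_def gen_degrees_def[symmetric] degrees_S_def[symmetric] by (rule conj_cong[OF refl])
qed

section \<open>Degrees\<close>

lemma koszul_degree_eq: "koszul_degree n i = int n * (i div 2) + i mod 2"
proof (cases "even i")
  case False
  then show ?thesis by (simp add: koszul_degree_def odd_iff_mod_2_eq_one)
qed (simp add: koszul_degree_def)

context
  fixes n :: nat
  assumes n2: "n > 2"
begin

text \<open>Since i mod 2 < n, the numbers i div 2 and i mod 2 are quotient and remainder of the
  Koszul degree by n, so that i can be recovered from it.\<close>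

lemma koszul_degree_div: "koszul_degree n i div int n = i div 2"
  and koszul_degree_mod: "koszul_degree n i mod int n = i mod 2"
proof -
  have "0 \<le> i mod 2" "i mod 2 < int n" using n2 by (simp_all add: pos_mod_bound order_less_trans[of "i mod 2" 2])
  then show "koszul_degree n i div int n = i div 2" "koszul_degree n i mod int n = i mod 2"
    by (simp_all add: koszul_degree_eq)
qed

lemma koszul_degree_inj: "koszul_degree n i = koszul_degree n j \<longleftrightarrow> i = j"
  using koszul_degree_div koszul_degree_mod by (metis div_mult_mod_eq)

lemma degrees_U_iff_mod: "u \<in> degrees_U n \<longleftrightarrow> u mod int n \<in> {0, 1}"
proof
  assume "u \<in> degrees_U n"
  then obtain k where "u = int n * k \<or> u = int n * k + 1" by (auto simp: degrees_U_def)
  then show "u mod int n \<in> {0, 1}" using n2 by auto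
next
  have u: "u = int n * (u div int n) + u mod int n" by simp
  assume "u mod int n \<in> {0, 1}"
  then consider "u mod int n = 0" | "u mod int n = 1" by blast
  then have "u = int n * (u div int n) \<or> u = int n * (u div int n) + 1"
    using u by cases linarith+
  then show "u \<in> degrees_U n" unfolding degrees_U_def by blast
qed

lemma degrees_U_iff: "u \<in> degrees_U n \<longleftrightarrow> (\<exists>i. u = koszul_degree n i)"
proof
  assume "u \<in> degrees_U n"
  then obtain k where "u = int n * k \<or> u = int n * k + 1" by (auto simp: degrees_U_def)
  then have "u = koszul_degree n (2 * k) \<or> u = koszul_degree n (2 * k + 1)"
    by (auto simp: koszul_degree_def)
  then show "\<exists>i. u = koszul_degree n i" by blast
next
  assume "\<exists>i. u = koszul_degree n i"
  then show "u \<in> degrees_U n" by (auto simp: degrees_U_iff_mod koszul_degree_mod)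
qed

lemma koszul_degree_in_U [simp]: "koszul_degree n i \<in> degrees_U n"
  using degrees_U_iff by blast

text \<open>The remainders modulo n add up to at most 2 < n, so there is no carry. The only sum
  outside {0, 1} is 2, which comes from two odd indices.\<close>

lemma koszul_degree_add_in_U:
  "koszul_degree n i + koszul_degree n j \<in> degrees_U n \<longleftrightarrow> \<not> (odd i \<and> odd j)"
proof -
  have "(koszul_degree n i + koszul_degree n j) mod int n = (i mod 2 + j mod 2) mod int n"
    using koszul_degree_mod by (metis mod_add_eq)
  also have "\<dots> = i mod 2 + j mod 2"
    using n2 pos_mod_bound[of 2 i] pos_mod_bound[of 2 j] by (intro mod_pos_pos_trivial) auto
  finally have *: "(koszul_degree n i + koszul_degree n j) mod int n = i mod 2 + j mod 2" .
  show ?thesis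
    unfolding degrees_U_iff_mod * by (cases "even i"; cases "even j") (simp_all add: odd_iff_mod_2_eq_one)
qed

lemma koszul_degree_add:
  "\<not> (odd i \<and> odd j) \<Longrightarrow> koszul_degree n i + koszul_degree n j = koszul_degree n (i + j)"
proof -
  assume "\<not> (odd i \<and> odd j)"
  then have "(i + j) div 2 = i div 2 + j div 2" "(i + j) mod 2 = i mod 2 + j mod 2" by presburger+
  then show ?thesis by (simp add: koszul_degree_eq distrib_left)
qed

text \<open>A product of three homogeneous elements with degrees in \<open>\<U>\<close> whose degree is again in
  \<open>\<U>\<close> has either at most one factor of odd degree, or else \<open>n = 3\<close> and three of them; in the
  second case neither partial product has its degree in \<open>\<U>\<close>.\<close>

lemma degrees_U_assoc:
  assumes "s \<in> degrees_U n" "u \<in> degrees_U n" "w \<in> degrees_U n" "s + u + w \<in> degrees_U n"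
  shows "s + u \<in> degrees_U n \<longleftrightarrow> u + w \<in> degrees_U n"
proof -
  obtain i j k where ijk: "s = koszul_degree n i" "u = koszul_degree n j" "w = koszul_degree n k"
    using assms degrees_U_iff by metis
  have "s + u + w = (i mod 2 + j mod 2 + k mod 2) + int n * (i div 2 + j div 2 + k div 2)"
    unfolding ijk koszul_degree_eq by (simp add: distrib_left)
  then have "(s + u + w) mod int n = (i mod 2 + j mod 2 + k mod 2) mod int n"
    by (simp only: mod_mult_self2)
  then have *: "(i mod 2 + j mod 2 + k mod 2) mod int n \<in> {0, 1}"
    using assms(4) degrees_U_iff_mod by simp
  have 2: "(2 :: int) mod int n = 2" using n2 by (intro mod_pos_pos_trivial) auto
  have "\<not> (odd i \<and> odd j \<and> even k)"
  proof
    assume "odd i \<and> odd j \<and> even k"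
    then have "i mod 2 + j mod 2 + k mod 2 = 2" by presburger
    then show False using * 2 by simp
  qed
  moreover have "\<not> (even i \<and> odd j \<and> odd k)"
  proof
    assume "even i \<and> odd j \<and> odd k"
    then have "i mod 2 + j mod 2 + k mod 2 = 2" by presburger
    then show False using * 2 by simp
  qed
  ultimately show ?thesis unfolding ijk koszul_degree_add_in_U by blast
qed

lemma degrees_S_iff: "s \<in> degrees_S n m \<longleftrightarrow> s - m \<in> degrees_U n"
proof
  assume "s - m \<in> degrees_U n"
  then show "s \<in> degrees_S n m" unfolding degrees_S_def by (rule image_eqI[rotated]) simp
qed (auto simp: degrees_S_def)

end

section \<open>Transport of structure along a bijection\<close>

lemma additive_map_inv:
  assumes ab: "abelian_group T" and h: "additive_map T E h" and bij: "bij_betw h (carrier T) (carrier E)"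
  shows "additive_map E T (inv_into (carrier T) h)"
proof (rule additive_mapI)
  interpret abelian_group T by fact
  fix x y assume "x \<in> carrier E" "y \<in> carrier E"
  then have "x \<in> h ` carrier T" "y \<in> h ` carrier T" using bij by (simp_all add: bij_betw_def)
  then obtain s t where "s \<in> carrier T" "t \<in> carrier T" "x = h s" "y = h t" by blast
  then show "inv_into (carrier T) h (x \<oplus>\<^bsub>E\<^esub> y)
      = inv_into (carrier T) h x \<oplus>\<^bsub>T\<^esub> inv_into (carrier T) h y"
    using bij additive_map_add[OF h, of s t, symmetric] by (simp add: bij_betw_def inv_into_f_f)
qed (use bij in \<open>auto simp: bij_betw_def intro: inv_into_into\<close>)

lemma graded_group_transport:
  assumes T: "graded_group T" and E: "abelian_group E" and h: "additive_map T E h"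
    and bij: "bij_betw h (carrier T) (carrier E)" and comp: "\<And>i. component E i = h ` component T i"
  shows "graded_group E"
proof -
  interpret T: graded_group T by fact
  interpret E: abelian_group E by fact
  interpret h: abelian_group_hom T E h by (rule additive_map_hom[OF T.abelian_group_axioms E h])
  let ?g = "inv_into (carrier T) h"
  have g: "additive_map E T ?g" by (rule additive_map_inv[OF T.abelian_group_axioms h bij])
  have gh: "?g (h x) = x" if "x \<in> carrier T" for x
    using bij that by (simp add: bij_betw_def inv_into_f_f)
  have hg: "h (?g y) = y" if "y \<in> carrier E" for y
    using bij that by (auto simp: bij_betw_def intro: f_inv_into_f)
  show ?thesis
  proof (rule graded_groupI[OF E])
    show "additive_subgroup (component E i) E" for i
      unfolding comp additive_subgroup_def
      using group_hom.subgroup_img_is_subgroup[OF h.a_group_hom, of "component T i"] T.component_subgroup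
      by (simp add: additive_subgroup_def)
    show "carrier E \<subseteq> generate (add_monoid E) (\<Union>i. component E i)"
    proof
      fix y assume "y \<in> carrier E"
      then obtain x where x: "x \<in> carrier T" "y = h x" using bij by (auto simp: bij_betw_def)
      have "h x \<in> generate (add_monoid E) (\<Union>i. component E i)"
        using x(1)
      proof (induction rule: T.graded_induct)
        case (component i x)
        then show ?case by (intro E.add_generate_incl) (auto simp: comp)
      qed (auto intro: E.add_generate_add)
      then show "y \<in> generate (add_monoid E) (\<Union>i. component E i)" using x by simp
    qed
    show "f i = \<zero>\<^bsub>E\<^esub>" if F: "finite F" "\<And>i. i \<in> F \<Longrightarrow> f i \<in> component E i" "finsum E f F = \<zero>\<^bsub>E\<^esub>" "i \<in> F" for F f i
    proof -
      have fE: "f i \<in> carrier E" if "i \<in> F" for i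
        using F(2)[OF that] T.component_carrier bij by (auto simp: comp bij_betw_def)
      have "finsum T (\<lambda>i. ?g (f i)) F = ?g (finsum E f F)"
        by (rule additive_map_finsum[symmetric]) (use F fE g E T.abelian_group_axioms in auto)
      also have "\<dots> = \<zero>\<^bsub>T\<^esub>"
        using F(3) additive_map_zero[OF E T.abelian_group_axioms g] by simp
      finally have "finsum T (\<lambda>i. ?g (f i)) F = \<zero>\<^bsub>T\<^esub>" .
      moreover have "?g (f i) \<in> component T i" if "i \<in> F" for i
        using F(2)[OF that] gh T.component_carrier by (auto simp: comp)
      ultimately have "?g (f i) = \<zero>\<^bsub>T\<^esub>"
        using T.components_independent[of F "\<lambda>i. ?g (f i)" i] F by blast
      then show ?thesis using hg[OF fE[OF F(4)]] h.hom_zero by simp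
    qed
  qed
qed

text \<open>The target is a bare record. Membership in \<open>graded_ring_iso\<close> speaks of a
  bijection compatible with sums, products, units and components, but says nothing about zero; hence
  the separate hypothesis.\<close>

lemma graded_ring_transport:
  assumes T: "graded_ring T" and iso: "h \<in> graded_ring_iso T E" and zero: "h \<zero>\<^bsub>T\<^esub> = \<zero>\<^bsub>E\<^esub>"
  shows "graded_ring (E :: 'e graded)"
proof -
  interpret T: graded_ring T by fact
  have h: "h \<in> ring_iso T E" and comp: "component E i = h ` component T i" for i
    using iso by (auto simp: graded_ring_iso_def)
  note hE = ring_iso_memE[OF h]
  have ring: "ring E" using T.ring_iso_imp_img_ring[OF h] zero by simp
  then interpret E: ring E .
  have gg: "graded_group E"
    by (rule graded_group_transport[OF T.graded_group_axioms E.abelian_group_axioms _ hE(5) comp])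
      (use hE in \<open>auto intro: additive_mapI\<close>)
  show ?thesis
  proof (intro graded_ring.intro ring gg graded_ring_axioms.intro)
    show "\<one>\<^bsub>E\<^esub> \<in> component E 0" using hE(4) T.one_degree comp by (metis image_eqI)
    show "x \<otimes>\<^bsub>E\<^esub> y \<in> component E (i + j)" if xy: "x \<in> component E i" "y \<in> component E j" for x y i j
    proof -
      obtain a b where ab: "a \<in> component T i" "b \<in> component T j" "x = h a" "y = h b"
        using xy by (auto simp: comp)
      then have "x \<otimes>\<^bsub>E\<^esub> y = h (a \<otimes>\<^bsub>T\<^esub> b)" using hE(2) T.component_carrier by metis
      then show ?thesis using T.mult_degree[OF ab(1,2)] comp by auto
    qed
  qed
qed

section \<open>The truncated ring\<close>

context graded_ring
begin

text \<open>The right-hand side is the double sum by which \<open>truncated_ring\<close> defines its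
  product. Recognizing it as a projection of the product makes the ring axioms accessible.\<close>

lemma hproj_mult_eq:
  assumes x: "x \<in> carrier R" and y: "y \<in> carrier R"
  shows "hproj R X (x \<otimes> y) = (\<Oplus>i\<in>{i. hpart R i x \<noteq> \<zero>}. \<Oplus>j\<in>{j. hpart R j y \<noteq> \<zero>}.
       if i + j \<in> X then hpart R i x \<otimes> hpart R j y else \<zero>)"
proof -
  let ?I = "{i. hpart R i x \<noteq> \<zero>}" and ?J = "{j. hpart R j y \<noteq> \<zero>}"
  have fin: "finite ?I" "finite ?J" using x y hpart_finite by auto
  have ab: "abelian_group R" by (rule abelian_group_axioms)
  have "additive_map R R (\<lambda>x. hproj R X (x \<otimes> y))"
    by (rule additive_mapI) (use y in \<open>auto simp: l_distr hproj_add\<close>)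
  from additive_map_finsum[OF ab ab this fin(1), of "\<lambda>i. hpart R i x"]
  have 1: "hproj R X (x \<otimes> y) = (\<Oplus>i\<in>?I. hproj R X (hpart R i x \<otimes> y))"
    using x by (simp add: hpart_sum)
  have 2: "hproj R X (hpart R i x \<otimes> y)
      = (\<Oplus>j\<in>?J. if i + j \<in> X then hpart R i x \<otimes> hpart R j y else \<zero>)" for i
  proof -
    have "additive_map R R (\<lambda>y. hproj R X (hpart R i x \<otimes> y))"
      by (rule additive_mapI) (use x in \<open>auto simp: r_distr hproj_add\<close>)
    from additive_map_finsum[OF ab ab this fin(2), of "\<lambda>j. hpart R j y"]
    have "hproj R X (hpart R i x \<otimes> y) = (\<Oplus>j\<in>?J. hproj R X (hpart R i x \<otimes> hpart R j y))"
      using y by (simp add: hpart_sum)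
    also have "\<dots> = (\<Oplus>j\<in>?J. if i + j \<in> X then hpart R i x \<otimes> hpart R j y else \<zero>)"
    proof (rule finsum_cong')
      fix j
      have "hpart R i x \<otimes> hpart R j y \<in> component R (i + j)" using x y mult_degree by simp
      then show "hproj R X (hpart R i x \<otimes> hpart R j y)
          = (if i + j \<in> X then hpart R i x \<otimes> hpart R j y else \<zero>)"
        by (rule hproj_of_component)
    qed (use x y in auto)
    finally show ?thesis .
  qed
  show ?thesis unfolding 1 2 ..
qed

end

lemma truncated_ring_simps:
  "carrier (truncated_ring n D) = homog_sum D (degrees_U n)"
  "one (truncated_ring n D) = one D" "zero (truncated_ring n D) = zero D" "add (truncated_ring n D) = add D"
  "component (truncated_ring n D) i = component D (koszul_degree n i)"
  by (simp_all add: truncated_ring_def)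

lemma truncated_ring_mult:
  assumes "graded_ring D" "x \<in> carrier D" "y \<in> carrier D"
  shows "x \<otimes>\<^bsub>truncated_ring n D\<^esub> y = hproj D (degrees_U n) (x \<otimes>\<^bsub>D\<^esub> y)"
  using graded_ring.hproj_mult_eq[OF assms] by (simp add: truncated_ring_def)

text \<open>Regrading along \<delta>: injectivity keeps a family of components independent after its
  indices are renamed. It is applied to the truncated ring with the Koszul degrees and to restricted
  modules with the Koszul degrees shifted by m.\<close>

lemma (in graded_group) graded_group_of_degrees:
  assumes H: "carrier H = homog_sum M X" "add H = add M" "zero H = zero M"
    and inj: "inj \<delta>" and X: "X = range \<delta>" and comp: "\<And>i. component H i = component M (\<delta> i)"
  shows "graded_group H"
proof (rule graded_group_restrict[where G = M])
  show "carrier H \<subseteq> generate (add_monoid M) (\<Union>i. component H i)"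
    by (simp add: H comp homog_sum_def X)
  show "component H i \<subseteq> carrier H" for i
    using homog_sum_component[of _ "\<delta> i" X] by (auto simp: H comp X)
  show "f i = \<zero>" if F: "finite F" "\<And>i. i \<in> F \<Longrightarrow> f i \<in> component H i" "finsum M f F = \<zero>" "i \<in> F" for F f i
  proof -
    let ?g = "\<lambda>j. f (inv_into UNIV \<delta> j)"
    have "finsum M ?g (\<delta> ` F) = finsum M (\<lambda>i. ?g (\<delta> i)) F"
      by (rule finsum_reindex)
        (use component_carrier[OF F(2)[unfolded comp]] inj in \<open>auto simp: inv_f_f intro: inj_on_subset\<close>)
    then have "finsum M ?g (\<delta> ` F) = \<zero>" using F(3) inj by (simp add: inv_f_f)
    then have "?g (\<delta> i) = \<zero>"
      by (rule components_independent[rotated 2]) (use F inj in \<open>auto simp: comp inv_f_f\<close>)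
    then show ?thesis using inj by (simp add: inv_f_f)
  qed
qed (use H homog_sum_subgroup component_subgroup abelian_group_axioms in \<open>auto simp: comp\<close>)

lemma graded_ring_truncated:
  fixes D :: "'a graded"
  assumes D: "graded_ring D" and n: "n > 2"
  shows "graded_ring (truncated_ring n D)"
proof -
  interpret D: graded_ring D by fact
  let ?T = "truncated_ring n D" and ?U = "degrees_U n"
  note s = truncated_ring_simps
  have U: "?U = range (koszul_degree n)" using degrees_U_iff[OF n] by auto
  interpret T: graded_group ?T
    by (rule D.graded_group_of_degrees[where \<delta> = "koszul_degree n" and X = ?U])
      (use U koszul_degree_inj[OF n] in \<open>auto simp: s inj_def\<close>)
  have c: "x \<in> carrier D" if "x \<in> homog_sum D ?U" for x
    using that by (rule D.homog_sum_carrier)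
  have mult: "x \<otimes>\<^bsub>?T\<^esub> y = hproj D ?U (x \<otimes>\<^bsub>D\<^esub> y)" if "x \<in> homog_sum D ?U" "y \<in> homog_sum D ?U" for x y
    using truncated_ring_mult[OF D] c that by blast
  have 0: "0 \<in> ?U" using koszul_degree_in_U[OF n, of 0] by (simp add: koszul_degree_def)
  have one: "\<one>\<^bsub>D\<^esub> \<in> homog_sum D ?U" using D.homog_sum_component[OF D.one_degree 0] .
  \<comment> \<open>By additivity in each factor, only homogeneous elements matter. If the total
    degree is outside \<U>, both sides vanish; otherwise \<open>degrees_U_assoc\<close> says that
    the two inner products are kept or dropped together.\<close>
  have assoc: "hproj D ?U (hproj D ?U (x \<otimes>\<^bsub>D\<^esub> y) \<otimes>\<^bsub>D\<^esub> z) = hproj D ?U (x \<otimes>\<^bsub>D\<^esub> hproj D ?U (y \<otimes>\<^bsub>D\<^esub> z))"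
    if x: "x \<in> homog_sum D ?U" and y: "y \<in> homog_sum D ?U" and z: "z \<in> homog_sum D ?U" for x y z
    using x
  proof (induction rule: D.homog_sum_induct)
    case zero
    then show ?case using y z c by simp
  next
    case (component i x)
    note x = component
    show ?case using y
    proof (induction rule: D.homog_sum_induct)
      case zero
      then show ?case using x z c D.component_carrier by simp
    next
      case (component j y)
      note y = component
      show ?case using z
      proof (induction rule: D.homog_sum_induct)
        case zero
        then show ?case using x y D.component_carrier by simp
      next
        case (component k z)
        note z = component
        have xy: "x \<otimes>\<^bsub>D\<^esub> y \<in> component D (i + j)" and yz: "y \<otimes>\<^bsub>D\<^esub> z \<in> component D (j + k)"
          using x y z D.mult_degree by auto
        have xyz: "x \<otimes>\<^bsub>D\<^esub> y \<otimes>\<^bsub>D\<^esub> z \<in> component D (i + j + k)" using xy z D.mult_degree by auto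
        have as: "x \<otimes>\<^bsub>D\<^esub> y \<otimes>\<^bsub>D\<^esub> z = x \<otimes>\<^bsub>D\<^esub> (y \<otimes>\<^bsub>D\<^esub> z)"
          using x y z D.component_carrier by (intro D.m_assoc) auto
        have carrs: "x \<in> carrier D" "z \<in> carrier D" using x z D.component_carrier by auto
        show ?case
          using D.hproj_of_component[OF xy, of ?U] D.hproj_of_component[OF yz, of ?U]
            D.hproj_of_component[OF xyz, of ?U] degrees_U_assoc[OF n, of i j k] x(1) y(1) z(1) as carrs
          by (auto split: if_splits)
      next
        case (add z z')
        then show ?case using x y c D.component_carrier by (simp add: D.r_distr D.hproj_add)
      qed
    next
      case (add y y')
      then show ?case using x z c D.component_carrier by (simp add: D.r_distr D.l_distr D.hproj_add)
    qed
  next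
    case (add x x')
    then show ?case using y z c by (simp add: D.l_distr D.hproj_add)
  qed
  have "ring ?T"
  proof (rule ringI)
    show "abelian_group ?T" by (rule T.abelian_group_axioms)
    show "monoid ?T"
      by (rule monoidI)
        (use c one D.hproj_in_homog_sum D.hproj_homog_sum in \<open>auto simp: s mult assoc\<close>)
  qed (use c in \<open>auto simp: s mult D.l_distr D.r_distr D.hproj_add D.homog_sum_add\<close>)
  then show ?thesis
  proof (intro graded_ring.intro T.graded_group_axioms graded_ring_axioms.intro)
    show "\<one>\<^bsub>?T\<^esub> \<in> component ?T 0" using D.one_degree by (simp add: s koszul_degree_def)
    show "x \<otimes>\<^bsub>?T\<^esub> y \<in> component ?T (i + j)" if "x \<in> component ?T i" "y \<in> component ?T j" for x y i j
    proof -
      have xy: "x \<in> component D (koszul_degree n i)" "y \<in> component D (koszul_degree n j)"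
        using that by (auto simp: s)
      then have "x \<in> homog_sum D ?U" "y \<in> homog_sum D ?U"
        using D.homog_sum_component koszul_degree_in_U[OF n] by blast+
      then show ?thesis
        using D.hproj_of_component[OF D.mult_degree[OF xy], of ?U] D.mult_degree[OF xy]
          koszul_degree_add_in_U[OF n, of i j] koszul_degree_add[OF n, of i j]
        by (auto simp: s mult)
    qed
  qed
qed

section \<open>Graded quotient rings\<close>

text \<open>\<open>graded_quotient\<close> copies the fields of \<open>R Quot I\<close> into a
  different record type, so the axioms have to be carried over field by field.\<close>

lemma ring_cong:
  assumes "ring A" "carrier B = carrier A" "mult B = mult A" "one B = one A" "zero B = zero A" "add B = add A"
  shows "ring B"
proof -
  interpret A: ring A by fact
  show ?thesis
  proof (rule ringI)
    show "abelian_group B"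
    proof (rule abelian_groupI)
      show "\<exists>y\<in>carrier B. y \<oplus>\<^bsub>B\<^esub> x = \<zero>\<^bsub>B\<^esub>" if "x \<in> carrier B" for x
        using that assms A.l_neg[of x] by (intro bexI[of _ "\<ominus>\<^bsub>A\<^esub> x"]) auto
    qed (use assms in \<open>auto simp: A.a_ac\<close>)
    show "monoid B" by (rule monoidI) (use assms in \<open>auto simp: A.m_assoc\<close>)
  qed (use assms in \<open>auto simp: A.l_distr A.r_distr\<close>)
qed

context graded_ring
begin

lemma hpart_mult_left:
  assumes "a \<in> component R j" "x \<in> carrier R"
  shows "hpart R i (a \<otimes> x) = a \<otimes> hpart R (i - j) x"
proof (rule additive_map_eqI[OF _ _ abelian_group_axioms _ assms(2)])
  have a: "a \<in> carrier R" using assms component_carrier by blast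
  have m: "additive_map R R (\<lambda>x. a \<otimes> x)" by (rule additive_mapI) (auto simp: a r_distr)
  show "additive_map R R (\<lambda>x. hpart R i (a \<otimes> x))"
    using m hpart_additive by (auto simp: additive_map_def Pi_iff)
  show "additive_map R R (\<lambda>x. a \<otimes> hpart R (i - j) x)"
    using m hpart_additive by (auto simp: additive_map_def Pi_iff)
  show "hpart R i (a \<otimes> x) = a \<otimes> hpart R (i - j) x" if "x \<in> component R k" for k x
    using hpart_of_component[OF that, of "i - j"] hpart_of_component[OF mult_degree[OF assms(1) that], of i] a
    by (auto simp: algebra_simps)
qed

lemma hpart_mult_right:
  assumes "x \<in> carrier R" "a \<in> component R j"
  shows "hpart R i (x \<otimes> a) = hpart R (i - j) x \<otimes> a"
proof (rule additive_map_eqI[OF _ _ abelian_group_axioms _ assms(1)])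
  have a: "a \<in> carrier R" using assms component_carrier by blast
  have m: "additive_map R R (\<lambda>x. x \<otimes> a)" by (rule additive_mapI) (auto simp: a l_distr)
  show "additive_map R R (\<lambda>x. hpart R i (x \<otimes> a))"
    using m hpart_additive by (auto simp: additive_map_def Pi_iff)
  show "additive_map R R (\<lambda>x. hpart R (i - j) x \<otimes> a)"
    using m hpart_additive by (auto simp: additive_map_def Pi_iff)
  show "hpart R i (x \<otimes> a) = hpart R (i - j) x \<otimes> a" if "x \<in> component R k" for k x
    using hpart_of_component[OF that, of "i - j"] hpart_of_component[OF mult_degree[OF that assms(2)], of i] a
    by (auto simp: algebra_simps)
qed

text \<open>The elements all of whose parts lie in the generated ideal form an ideal themselves. It
  contains the homogeneous generators, so by minimality it contains the generated ideal.\<close>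

lemma homogeneous_genideal:
  assumes S: "S \<subseteq> (\<Union>i. component R i)" and x: "x \<in> genideal R S"
  shows "hpart R i x \<in> genideal R S"
proof -
  let ?J = "genideal R S"
  let ?H = "{x \<in> carrier R. \<forall>i. hpart R i x \<in> ?J}"
  have Sc: "S \<subseteq> carrier R" using S component_carrier by blast
  interpret J: ideal ?J R by (rule genideal_ideal[OF Sc])
  have "ideal ?H R"
  proof (rule idealI)
    show "ring R" by (rule ring_axioms)
    have "additive_subgroup ?H R"
      by (rule add_subgroup_of_predicate) (auto simp: hpart_add hpart_minus)
    then show "subgroup ?H (add_monoid R)" by (simp add: additive_subgroup_def)
    show "x \<otimes> a \<in> ?H" if a: "a \<in> ?H" and x: "x \<in> carrier R" for a x
      using x
    proof (induction rule: graded_induct)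
      case zero
      then show ?case using a by simp
    next
      case (component j x)
      then show ?case
        using a component_carrier by (auto simp: hpart_mult_left J.I_l_closed)
    next
      case (add x y)
      then show ?case using a by (auto simp: l_distr hpart_add)
    qed
    show "a \<otimes> x \<in> ?H" if a: "a \<in> ?H" and x: "x \<in> carrier R" for a x
      using x
    proof (induction rule: graded_induct)
      case zero
      then show ?case using a by simp
    next
      case (component j x)
      then show ?case
        using a component_carrier by (auto simp: hpart_mult_right J.I_r_closed)
    next
      case (add x y)
      then show ?case using a by (auto simp: r_distr hpart_add)
    qed
  qed
  moreover have "S \<subseteq> ?H"
  proof
    fix s assume s: "s \<in> S"
    then obtain k where "s \<in> component R k" using S by blast
    then show "s \<in> ?H" using genideal_self[OF Sc] s by (auto simp: hpart_of_component component_carrier)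
  qed
  ultimately have "?J \<subseteq> ?H" by (rule genideal_minimal)
  then show ?thesis using x by blast
qed

text \<open>Directness of the sum is where homogeneity of the ideal enters: if cosets of homogeneous
  elements of distinct degrees add up to zero, the sum of representatives lies in the ideal, hence
  so does each of them, being one of its parts.\<close>

lemma graded_quotient_graded_ring:
  assumes S: "S \<subseteq> (\<Union>i. component R i)"
  shows "graded_ring (graded_quotient R (genideal R S))"
    and "ring_hom_ring R (graded_quotient R (genideal R S)) (\<lambda>x. genideal R S +> x)"
proof -
  let ?J = "genideal R S" and ?Q = "graded_quotient R (genideal R S)"
  let ?p = "\<lambda>x. genideal R S +> x"
  have Sc: "S \<subseteq> carrier R" using S component_carrier by blast
  interpret J: ideal ?J R by (rule genideal_ideal[OF Sc])
  have Qs: "carrier ?Q = carrier (R Quot ?J)" "mult ?Q = mult (R Quot ?J)" "one ?Q = one (R Quot ?J)"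
    "zero ?Q = zero (R Quot ?J)" "add ?Q = add (R Quot ?J)" "component ?Q i = ?p ` component R i" for i
    by (simp_all add: graded_quotient_def)
  interpret Q: ring ?Q by (rule ring_cong[OF J.quotient_is_ring]) (simp_all add: Qs)
  have hom: "?p \<in> ring_hom R ?Q"
    using J.rcos_ring_hom by (auto simp: ring_hom_def Qs)
  then show "ring_hom_ring R ?Q ?p" by (intro ring_hom_ringI2 ring_axioms Q.ring_axioms)
  have p_add: "additive_map R ?Q ?p"
    by (rule additive_mapI) (use ring_hom_closed[OF hom] ring_hom_add[OF hom] in auto)
  have p_zero: "x \<in> ?J" if "x \<in> carrier R" "?p x = \<zero>\<^bsub>?Q\<^esub>" for x
    using that a_coset_join1[of ?J x] J.is_additive_subgroup
    by (simp add: Qs FactRing_def additive_subgroup_def)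
  have zero_p: "?p x = \<zero>\<^bsub>?Q\<^esub>" if "x \<in> ?J" for x
    using that J.a_rcos_const by (simp add: Qs FactRing_def)
  have surj: "carrier ?Q = ?p ` carrier R" by (auto simp: Qs FactRing_def A_RCOSETS_def')
  have gg: "graded_group ?Q"
  proof (rule graded_groupI[OF Q.abelian_group_axioms])
    show "additive_subgroup (component ?Q i) ?Q" for i
      unfolding Qs(6) additive_subgroup_def
      by (rule group_hom.subgroup_img_is_subgroup[OF abelian_group_hom.a_group_hom[OF
            additive_map_hom[OF abelian_group_axioms Q.abelian_group_axioms p_add]]])
        (use component_subgroup in \<open>simp add: additive_subgroup_def\<close>)
    show "carrier ?Q \<subseteq> generate (add_monoid ?Q) (\<Union>i. component ?Q i)"
    proof
      fix y assume "y \<in> carrier ?Q"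
      then obtain x where x: "x \<in> carrier R" "y = ?p x" using surj by blast
      have "?p x \<in> generate (add_monoid ?Q) (\<Union>i. component ?Q i)"
        using x(1)
      proof (induction rule: graded_induct)
        case zero
        then show ?case
          using additive_map_zero[OF abelian_group_axioms Q.abelian_group_axioms p_add] by simp
      next
        case (component i x)
        then show ?case by (intro Q.add_generate_incl) (auto simp: Qs(6))
      next
        case (add x y)
        then show ?case using Q.add_generate_add additive_map_add[OF p_add] by simp
      qed
      then show "y \<in> generate (add_monoid ?Q) (\<Union>i. component ?Q i)" using x by simp
    qed
    show "f i = \<zero>\<^bsub>?Q\<^esub>" if F: "finite F" "\<And>i. i \<in> F \<Longrightarrow> f i \<in> component ?Q i" "finsum ?Q f F = \<zero>\<^bsub>?Q\<^esub>" "i \<in> F" for F f i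
    proof -
      have "\<exists>x. x \<in> component R i \<and> f i = ?p x" if "i \<in> F" for i using F(2)[OF that] by (auto simp: Qs(6))
      then obtain x where x: "\<And>i. i \<in> F \<Longrightarrow> x i \<in> component R i" "\<And>i. i \<in> F \<Longrightarrow> f i = ?p (x i)" by metis
      let ?x = "\<lambda>i. if i \<in> F then x i else \<zero>"
      let ?s = "finsum R ?x F"
      have xi: "x i \<in> carrier R" if "i \<in> F" for i using component_carrier[OF x(1)[OF that]] .
      then have xc: "?x \<in> F \<rightarrow> carrier R" by auto
      have "?p ?s = finsum ?Q (\<lambda>i. ?p (?x i)) F"
        by (rule additive_map_finsum[OF abelian_group_axioms Q.abelian_group_axioms p_add F(1) xc])
      also have "\<dots> = finsum ?Q f F"
      proof (rule Q.finsum_cong'[OF refl])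
        show "f \<in> F \<rightarrow> carrier ?Q" using x(2) additive_map_closed[OF p_add xi] by auto
      qed (use x(2) in simp)
      finally have "?p ?s = \<zero>\<^bsub>?Q\<^esub>" using F(3) by simp
      then have sJ: "?s \<in> ?J" using xc by (intro p_zero finsum_closed) auto
      have "is_decomp R ?s ?x"
        by (rule is_decompI[where F = F]) (use x F(1) component_subset in \<open>auto simp: abelian_group_axioms\<close>)
      then have "hpart R i ?s = ?x i" using xc by (intro hpart_eqI finsum_closed) auto
      then have "x i \<in> ?J" using homogeneous_genideal[OF S sJ, of i] F(4) by simp
      then show ?thesis using x(2)[OF F(4)] zero_p by simp
    qed
  qed
  show "graded_ring ?Q"
  proof (intro graded_ring.intro Q.ring_axioms gg graded_ring_axioms.intro)
    show "\<one>\<^bsub>?Q\<^esub> \<in> component ?Q 0" unfolding Qs(6) using ring_hom_one[OF hom] one_degree by (metis image_eqI)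
    fix x y i j assume "x \<in> component ?Q i" "y \<in> component ?Q j"
    then obtain a b where ab: "a \<in> component R i" "b \<in> component R j" "x = ?p a" "y = ?p b" by (auto simp: Qs(6))
    then have "x \<otimes>\<^bsub>?Q\<^esub> y = ?p (a \<otimes> b)" using ring_hom_mult[OF hom] component_carrier by simp
    then show "x \<otimes>\<^bsub>?Q\<^esub> y \<in> component ?Q (i + j)" unfolding Qs(6) using mult_degree[OF ab(1,2)] by blast
  qed
qed

end

section \<open>Path algebras\<close>

text \<open>A finitely supported function is a sum of its single terms, so bilinear identities in
  the path algebra reduce to paths with coefficients.\<close>

lemma keys_induct [consumes 1, case_names zero single add]:
  fixes f :: "'p \<Rightarrow>\<^sub>0 'k::comm_monoid_add"
  assumes "Poly_Mapping.keys f \<subseteq> X" "P 0" "\<And>p c. p \<in> X \<Longrightarrow> P (Poly_Mapping.single p c)"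
    and "\<And>f g. \<lbrakk>Poly_Mapping.keys f \<subseteq> X; Poly_Mapping.keys g \<subseteq> X; P f; P g\<rbrakk> \<Longrightarrow> P (f + g)"
  shows "P f"
proof -
  have eq: "f = (\<Sum>p\<in>Poly_Mapping.keys f. Poly_Mapping.single p (Poly_Mapping.lookup f p))"
    by (rule poly_mapping_eqI) (simp add: lookup_sum lookup_single when_def in_keys_iff)
  have "Poly_Mapping.keys (\<Sum>p\<in>A. Poly_Mapping.single p (Poly_Mapping.lookup f p)) \<subseteq> X \<and>
      P (\<Sum>p\<in>A. Poly_Mapping.single p (Poly_Mapping.lookup f p))" if "finite A" "A \<subseteq> X" for A
    using that
  proof (induction A)
    case empty
    then show ?case using assms(2) by simp
  next
    case (insert p A)
    let ?s = "Poly_Mapping.single p (Poly_Mapping.lookup f p)" and ?t = "\<Sum>p\<in>A. Poly_Mapping.single p (Poly_Mapping.lookup f p)"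
    have k: "Poly_Mapping.keys ?s \<subseteq> X" "Poly_Mapping.keys ?t \<subseteq> X" using insert by (auto split: if_splits)
    have "Poly_Mapping.keys (?s + ?t) \<subseteq> X" using keys_add[of ?s ?t] k by blast
    moreover have "P (?s + ?t)" using assms(3,4) k insert by simp
    ultimately show ?case using insert by simp
  qed
  from this[OF finite_keys assms(1)] show ?thesis using eq by simp
qed

context
  fixes G :: "('v, 'b) pre_digraph"
  assumes G: "fin_digraph G"
begin

interpretation G: fin_digraph G by (rule G)

text \<open>One summand of the product in \<open>path_alg\<close>. Isolating it exhibits the
  additivity in the coefficient from which bilinearity follows.\<close>

definition path_term :: "'v \<times> 'b list \<Rightarrow> 'v \<times> 'b list \<Rightarrow> 'k::field \<Rightarrow> ('v \<times> 'b list) \<Rightarrow>\<^sub>0 'k" where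
  "path_term p q c = (if pre_digraph.awalk G (fst p) (snd p) (fst q)
     then Poly_Mapping.single (fst p, snd p @ snd q) c else 0)"

abbreviation (input) "PA \<equiv> (path_alg G :: (('v \<times> 'b list) \<Rightarrow>\<^sub>0 'k::field) graded)"

lemma path_alg_simps:
  "carrier PA = {f. Poly_Mapping.keys f \<subseteq> paths G}"
  "f \<otimes>\<^bsub>PA\<^esub> g = (\<Sum>p\<in>Poly_Mapping.keys f. \<Sum>q\<in>Poly_Mapping.keys g.
     path_term p q (Poly_Mapping.lookup f p * Poly_Mapping.lookup g q))"
  "\<one>\<^bsub>PA\<^esub> = (\<Sum>v\<in>verts G. Poly_Mapping.single (v, []) 1)" "\<zero>\<^bsub>PA\<^esub> = 0" "f \<oplus>\<^bsub>PA\<^esub> g = f + g"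
  "component PA i = {f. Poly_Mapping.keys f \<subseteq> {p \<in> paths G. int (length (snd p)) = i}}"
  by (simp_all add: path_alg_def path_term_def)

lemma awlast_eq: "pre_digraph.awalk G u es w \<Longrightarrow> last (pre_digraph.awalk_verts G u es) = w"
  using G.awlast_if_cas[of u es w] unfolding G.awalk_def by blast

lemma path_term_zero [simp]: "path_term p q 0 = 0"
  by (simp add: path_term_def)

lemma path_term_add: "path_term p q (c + d) = path_term p q c + path_term p q d"
  by (simp add: path_term_def single_add)

text \<open>The supports in the definition of the product change under addition; over fixed finite
  supersets the double sum is additive term by term.\<close>

lemma mult_superset:
  assumes "finite A" "Poly_Mapping.keys f \<subseteq> A" "finite B" "Poly_Mapping.keys g \<subseteq> B"
  shows "f \<otimes>\<^bsub>PA\<^esub> g = (\<Sum>p\<in>A. \<Sum>q\<in>B. path_term p q (Poly_Mapping.lookup f p * Poly_Mapping.lookup g q))"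
proof -
  have "(\<Sum>q\<in>Poly_Mapping.keys g. path_term p q (Poly_Mapping.lookup f p * Poly_Mapping.lookup g q))
      = (\<Sum>q\<in>B. path_term p q (Poly_Mapping.lookup f p * Poly_Mapping.lookup g q))" for p
    by (rule sum.mono_neutral_left) (use assms in \<open>auto simp: in_keys_iff\<close>)
  then have "f \<otimes>\<^bsub>PA\<^esub> g = (\<Sum>p\<in>Poly_Mapping.keys f. \<Sum>q\<in>B. path_term p q (Poly_Mapping.lookup f p * Poly_Mapping.lookup g q))"
    by (simp add: path_alg_simps(2))
  also have "\<dots> = (\<Sum>p\<in>A. \<Sum>q\<in>B. path_term p q (Poly_Mapping.lookup f p * Poly_Mapping.lookup g q))"
    by (rule sum.mono_neutral_left) (use assms in \<open>auto simp: in_keys_iff\<close>)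
  finally show ?thesis .
qed

lemma mult_add_left: "(f + f') \<otimes>\<^bsub>PA\<^esub> g = f \<otimes>\<^bsub>PA\<^esub> g + f' \<otimes>\<^bsub>PA\<^esub> g"
proof -
  let ?A = "Poly_Mapping.keys f \<union> Poly_Mapping.keys f'" and ?B = "Poly_Mapping.keys g"
  have A: "finite ?A" "Poly_Mapping.keys (f + f') \<subseteq> ?A" by (simp_all add: keys_add)
  show ?thesis
    by (subst (1 2 3) mult_superset[where A = ?A and B = ?B])
      (use A in \<open>simp_all add: lookup_add distrib_right path_term_add sum.distrib\<close>)
qed

lemma mult_add_right: "f \<otimes>\<^bsub>PA\<^esub> (g + g') = f \<otimes>\<^bsub>PA\<^esub> g + f \<otimes>\<^bsub>PA\<^esub> g'"
proof -
  let ?A = "Poly_Mapping.keys f" and ?B = "Poly_Mapping.keys g \<union> Poly_Mapping.keys g'"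
  have B: "finite ?B" "Poly_Mapping.keys (g + g') \<subseteq> ?B" by (simp_all add: keys_add)
  show ?thesis
    by (subst (1 2 3) mult_superset[where A = ?A and B = ?B])
      (use B in \<open>simp_all add: lookup_add distrib_left path_term_add sum.distrib\<close>)
qed

lemma mult_zero [simp]: "0 \<otimes>\<^bsub>PA\<^esub> g = 0" "f \<otimes>\<^bsub>PA\<^esub> 0 = 0"
  by (simp_all add: path_alg_simps(2))

lemma mult_single: "Poly_Mapping.single p c \<otimes>\<^bsub>PA\<^esub> Poly_Mapping.single q d = path_term p q (c * d)"
  by (subst mult_superset[where A = "{p}" and B = "{q}"]) auto

lemma mult_sum_left: "(\<Sum>i\<in>A. h i) \<otimes>\<^bsub>PA\<^esub> g = (\<Sum>i\<in>A. h i \<otimes>\<^bsub>PA\<^esub> g)"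
  by (induction A rule: infinite_finite_induct) (simp_all add: mult_add_left)

lemma mult_sum_right: "g \<otimes>\<^bsub>PA\<^esub> (\<Sum>i\<in>A. h i) = (\<Sum>i\<in>A. g \<otimes>\<^bsub>PA\<^esub> h i)"
  by (induction A rule: infinite_finite_induct) (simp_all add: mult_add_right)

text \<open>Once p meets q, their concatenation ends where q ends and so composes with r exactly if
  q does. Both sides are then the concatenation of all three; if a junction fails, both are
  0.\<close>

lemma path_term_assoc:
  "path_term p q c \<otimes>\<^bsub>PA\<^esub> Poly_Mapping.single r d = Poly_Mapping.single p c \<otimes>\<^bsub>PA\<^esub> path_term q r d"
proof -
  consider (both) "pre_digraph.awalk G (fst p) (snd p) (fst q)" "pre_digraph.awalk G (fst q) (snd q) (fst r)"
    | (left) "\<not> pre_digraph.awalk G (fst p) (snd p) (fst q)"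
    | (right) "pre_digraph.awalk G (fst p) (snd p) (fst q)" "\<not> pre_digraph.awalk G (fst q) (snd q) (fst r)"
    by blast
  then show ?thesis
  proof cases
    case both
    have "pre_digraph.awalk G (fst p) (snd p @ snd q) (fst r)"
      unfolding G.awalk_append_iff awlast_eq[OF both(1)] using both by blast
    then show ?thesis using both by (simp only: path_term_def mult_single if_True fst_conv snd_conv append_assoc)
  next
    case left
    then show ?thesis
      by (cases "pre_digraph.awalk G (fst q) (snd q) (fst r)")
        (simp_all only: path_term_def mult_single if_False if_True mult_zero fst_conv)
  next
    case right
    have "\<not> pre_digraph.awalk G (fst p) (snd p @ snd q) (fst r)"
      unfolding G.awalk_append_iff awlast_eq[OF right(1)] using right by blast
    then show ?thesis
      using right by (simp only: path_term_def mult_single if_False if_True mult_zero fst_conv snd_conv)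
  qed
qed

lemma mult_assoc_PA: "f \<otimes>\<^bsub>PA\<^esub> g \<otimes>\<^bsub>PA\<^esub> h = f \<otimes>\<^bsub>PA\<^esub> (g \<otimes>\<^bsub>PA\<^esub> h)"
proof (induction f rule: keys_induct[OF subset_UNIV])
  case (2 p c)
  show ?case
  proof (induction g rule: keys_induct[OF subset_UNIV])
    case (2 q d)
    show ?case
    proof (induction h rule: keys_induct[OF subset_UNIV])
      case (2 r e)
      have "path_term p q (c * d) \<otimes>\<^bsub>PA\<^esub> Poly_Mapping.single r e = path_term p q (c * d * e) \<otimes>\<^bsub>PA\<^esub> Poly_Mapping.single r 1"
        by (simp add: path_term_def mult_single)
      moreover have "Poly_Mapping.single p c \<otimes>\<^bsub>PA\<^esub> path_term q r (d * e) = Poly_Mapping.single p (c * d * e) \<otimes>\<^bsub>PA\<^esub> path_term q r 1"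
        by (simp add: path_term_def mult_single mult.assoc)
      ultimately show ?case by (simp add: mult_single path_term_assoc)
    qed (simp_all add: mult_add_right)
  qed (simp_all add: mult_add_left mult_add_right)
qed (simp_all add: mult_add_left)

lemma keys_sum_subset: "(\<And>i. i \<in> A \<Longrightarrow> Poly_Mapping.keys (h i) \<subseteq> X) \<Longrightarrow> Poly_Mapping.keys (\<Sum>i\<in>A. h i) \<subseteq> X"
proof (induction A rule: infinite_finite_induct)
  case (insert x A)
  then show ?case using keys_add[of "h x" "\<Sum>i\<in>A. h i"] by auto
qed simp_all

lemma path_term_keys:
  assumes "q \<in> paths G"
  shows "Poly_Mapping.keys (path_term p q c) \<subseteq> {r \<in> paths G. length (snd r) = length (snd p) + length (snd q)}"
proof -
  obtain w where w: "pre_digraph.awalk G (fst q) (snd q) w" using assms by (auto simp: paths_def)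
  have "(fst p, snd p @ snd q) \<in> paths G" if a: "pre_digraph.awalk G (fst p) (snd p) (fst q)"
  proof -
    have "pre_digraph.awalk G (fst p) (snd p @ snd q) w"
      unfolding G.awalk_append_iff awlast_eq[OF a] using a w by blast
    then show ?thesis by (auto simp: paths_def)
  qed
  then show ?thesis by (auto simp: path_term_def)
qed

lemma mult_component_PA:
  assumes "f \<in> component PA i" "g \<in> component PA j"
  shows "f \<otimes>\<^bsub>PA\<^esub> g \<in> component PA (i + j)"
  unfolding path_alg_simps(2,6)
proof (intro CollectI keys_sum_subset)
  fix p q assume "p \<in> Poly_Mapping.keys f" "q \<in> Poly_Mapping.keys g"
  then have "q \<in> paths G" "int (length (snd p)) = i" "int (length (snd q)) = j"
    using assms by (auto simp: path_alg_simps)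
  then show "Poly_Mapping.keys (path_term p q (Poly_Mapping.lookup f p * Poly_Mapping.lookup g q))
      \<subseteq> {p \<in> paths G. int (length (snd p)) = i + j}"
    using path_term_keys[of q p "Poly_Mapping.lookup f p * Poly_Mapping.lookup g q"] by auto
qed

lemma mult_closed_PA:
  assumes "f \<in> carrier PA" "g \<in> carrier PA"
  shows "f \<otimes>\<^bsub>PA\<^esub> g \<in> carrier PA"
  unfolding path_alg_simps(1,2)
proof (intro CollectI keys_sum_subset)
  fix p q assume "q \<in> Poly_Mapping.keys g"
  then show "Poly_Mapping.keys (path_term p q (Poly_Mapping.lookup f p * Poly_Mapping.lookup g q)) \<subseteq> paths G"
    using assms(2) path_term_keys[of q p "Poly_Mapping.lookup f p * Poly_Mapping.lookup g q"]
    by (auto simp: path_alg_simps)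
qed

lemma one_mult_PA:
  assumes "Poly_Mapping.keys f \<subseteq> paths G"
  shows "\<one>\<^bsub>PA\<^esub> \<otimes>\<^bsub>PA\<^esub> f = f"
  using assms
proof (induction rule: keys_induct)
  case (single p c)
  then have v: "fst p \<in> verts G" by (auto simp: paths_def G.awalk_def)
  have "\<one>\<^bsub>PA\<^esub> \<otimes>\<^bsub>PA\<^esub> Poly_Mapping.single p c = (\<Sum>v\<in>verts G. path_term (v, []) p c)"
    by (simp add: path_alg_simps(3) mult_sum_left mult_single)
  also have "\<dots> = (\<Sum>v\<in>verts G. if v = fst p then Poly_Mapping.single p c else 0)"
    by (rule sum.cong) (auto simp: path_term_def G.awalk_Nil_iff)
  also have "\<dots> = Poly_Mapping.single p c" using v by (simp add: sum.delta)
  finally show ?case .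
qed (simp_all add: mult_add_right)

lemma mult_one_PA:
  assumes "Poly_Mapping.keys f \<subseteq> paths G"
  shows "f \<otimes>\<^bsub>PA\<^esub> \<one>\<^bsub>PA\<^esub> = f"
  using assms
proof (induction rule: keys_induct)
  case (single p c)
  then obtain w where w: "pre_digraph.awalk G (fst p) (snd p) w" by (auto simp: paths_def)
  \<comment> \<open>A path has only one end vertex, so exactly one trivial path in the unit
    contributes.\<close>
  have u: "pre_digraph.awalk G (fst p) (snd p) v \<longleftrightarrow> v = w" for v
    using w awlast_eq[OF w] awlast_eq[of "fst p" "snd p" v] by blast
  have wv: "w \<in> verts G" using w by (rule G.awalk_last_in_verts)
  have "Poly_Mapping.single p c \<otimes>\<^bsub>PA\<^esub> \<one>\<^bsub>PA\<^esub> = (\<Sum>v\<in>verts G. path_term p (v, []) c)"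
    by (simp add: path_alg_simps(3) mult_sum_right mult_single)
  also have "\<dots> = (\<Sum>v\<in>verts G. if v = w then Poly_Mapping.single p c else 0)"
    by (rule sum.cong) (auto simp: path_term_def u)
  also have "\<dots> = Poly_Mapping.single p c" using wv by (simp add: sum.delta)
  finally show ?case .
qed (simp_all add: mult_add_left)

lemma abelian_group_PA: "abelian_group PA"
proof (rule abelian_groupI)
  show "\<exists>g\<in>carrier PA. g \<oplus>\<^bsub>PA\<^esub> f = \<zero>\<^bsub>PA\<^esub>" if "f \<in> carrier PA" for f
    using that by (intro bexI[of _ "- f"]) (simp_all add: path_alg_simps)
  show "f \<oplus>\<^bsub>PA\<^esub> g \<in> carrier PA" if "f \<in> carrier PA" "g \<in> carrier PA" for f g
    using that keys_add[of f g] by (auto simp: path_alg_simps)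
qed (simp_all add: path_alg_simps add_ac)

lemma one_component_PA: "\<one>\<^bsub>PA\<^esub> \<in> component PA 0"
  unfolding path_alg_simps(3,6)
  by (intro CollectI keys_sum_subset) (auto simp: paths_def G.awalk_Nil_iff)

lemma finsum_PA: "f \<in> F \<rightarrow> carrier PA \<Longrightarrow> finsum PA f F = (\<Sum>i\<in>F. f i)" for f :: "int \<Rightarrow> _"
proof (induction F rule: infinite_finite_induct)
  case (infinite F)
  then show ?case
    using abelian_monoid.finsum_infinite[OF abelian_group.axioms(1)[OF abelian_group_PA]]
    by (simp add: path_alg_simps(4))
next
  case empty
  then show ?case
    using abelian_monoid.finsum_empty[OF abelian_group.axioms(1)[OF abelian_group_PA]]
    by (simp add: path_alg_simps(4))
next
  case (insert x F)
  then show ?case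
    using abelian_monoid.finsum_insert[OF abelian_group.axioms(1)[OF abelian_group_PA] insert(1,2), of f]
    by (simp add: path_alg_simps(5))
qed

lemma component_subset_PA: "component PA i \<subseteq> carrier PA"
  by (auto simp: path_alg_simps)

lemma a_inv_PA: "f \<in> carrier PA \<Longrightarrow> \<ominus>\<^bsub>PA\<^esub> f = - f"
  by (rule abelian_group.minus_equality[OF abelian_group_PA]) (simp_all add: path_alg_simps)

lemma graded_ring_PA: "graded_ring (path_alg G :: (('v \<times> 'b list) \<Rightarrow>\<^sub>0 'k::field) graded)" (is "graded_ring ?A")
proof -
  interpret A: abelian_group ?A by (rule abelian_group_PA)
  have "ring ?A"
  proof (rule ringI)
    show "monoid ?A"
    proof (rule monoidI)
      show "\<one>\<^bsub>?A\<^esub> \<in> carrier ?A" using one_component_PA component_subset_PA by blast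
    qed (simp_all add: mult_closed_PA mult_assoc_PA, simp_all add: path_alg_simps(1) one_mult_PA mult_one_PA)
  qed (simp_all add: abelian_group_PA path_alg_simps(5) mult_add_left mult_add_right)
  moreover have "graded_group ?A"
  proof (rule graded_groupI[OF abelian_group_PA])
    show "additive_subgroup (component ?A i) ?A" for i
      unfolding additive_subgroup_def
    proof (rule subgroup.intro)
      fix f assume f: "f \<in> component ?A i"
      then have "\<ominus>\<^bsub>?A\<^esub> f \<in> component ?A i"
        using a_inv_PA[OF subsetD[OF component_subset_PA f]] by (simp add: path_alg_simps(6))
      then show "inv\<^bsub>add_monoid ?A\<^esub> f \<in> component ?A i" by (simp add: a_inv_def)
    next
      fix f g assume "f \<in> component ?A i" "g \<in> component ?A i"
      then show "f \<otimes>\<^bsub>add_monoid ?A\<^esub> g \<in> component ?A i"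
        using keys_add[of f g] by (auto simp: path_alg_simps(5,6))
    qed (use component_subset_PA in \<open>auto simp: path_alg_simps(4,6)\<close>)
    show "carrier ?A \<subseteq> generate (add_monoid ?A) (\<Union>i. component ?A i)"
    proof
      fix f assume "f \<in> carrier ?A"
      then have "Poly_Mapping.keys f \<subseteq> paths G" by (simp add: path_alg_simps)
      then show "f \<in> generate (add_monoid ?A) (\<Union>i. component ?A i)"
      proof (induction rule: keys_induct)
        case zero
        then show ?case using A.add_generate_zero by (simp add: path_alg_simps(4))
      next
        case (single p c)
        then have "Poly_Mapping.single p c \<in> component ?A (int (length (snd p)))" by (auto simp: path_alg_simps(6))
        then show ?case by (intro A.add_generate_incl) blast
      next
        case (add f g)
        then show ?case using A.add_generate_add[OF add(3,4)] by (simp only: path_alg_simps(5)[of f g])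
      qed
    qed
    show "f i = \<zero>\<^bsub>?A\<^esub>" if F: "finite F" "\<And>i. i \<in> F \<Longrightarrow> f i \<in> component ?A i" "finsum ?A f F = \<zero>\<^bsub>?A\<^esub>" "i \<in> F" for F f i
    proof (rule ccontr)
      assume "f i \<noteq> \<zero>\<^bsub>?A\<^esub>"
      then have "Poly_Mapping.keys (f i) \<noteq> {}" by (simp add: path_alg_simps(4))
      then obtain p where p: "p \<in> Poly_Mapping.keys (f i)" by blast
      have z: "Poly_Mapping.lookup (f j) p = 0" if "j \<in> F - {i}" for j
      proof (rule ccontr)
        assume "Poly_Mapping.lookup (f j) p \<noteq> 0"
        then have "p \<in> Poly_Mapping.keys (f j)" by (simp add: in_keys_iff)
        then have "int (length (snd p)) = j" using F(2)[of j] that by (auto simp: path_alg_simps(6))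
        moreover have "int (length (snd p)) = i" using p F(2)[OF F(4)] by (auto simp: path_alg_simps(6))
        ultimately show False using that by simp
      qed
      have "(\<Sum>j\<in>F. f j) = 0"
        using F(2,3) component_subset_PA finsum_PA[of f F] by (auto simp: path_alg_simps(4))
      then have "(\<Sum>j\<in>F. Poly_Mapping.lookup (f j) p) = 0" by (simp add: lookup_sum[symmetric])
      then have "Poly_Mapping.lookup (f i) p = 0"
        using z F(1,4) by (simp add: sum.remove[of F i])
      then show False using p by (simp add: in_keys_iff)
    qed
  qed
  ultimately show ?thesis
    by (intro graded_ring.intro graded_ring_axioms.intro one_component_PA mult_component_PA)
qed

text \<open>Cut the path after its first i arcs and leave the coefficient with the first piece. In
  the dual algebra this yields the factorization of degrees assumed in the locale
  \<open>truncation\<close>.\<close>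

lemma path_split:
  assumes "p \<in> paths G" "int (length (snd p)) = i + j" "0 \<le> i" "0 \<le> j"
  shows "\<exists>f \<in> component PA i. \<exists>g \<in> component PA j. f \<otimes>\<^bsub>PA\<^esub> g = Poly_Mapping.single p (c :: 'k::field)"
proof -
  obtain w where w: "pre_digraph.awalk G (fst p) (snd p) w" using assms(1) by (auto simp: paths_def)
  let ?a = "take (nat i) (snd p)" and ?b = "drop (nat i) (snd p)"
  let ?u = "last (pre_digraph.awalk_verts G (fst p) ?a)"
  have "pre_digraph.awalk G (fst p) (?a @ ?b) w" using w by simp
  then have ab: "pre_digraph.awalk G (fst p) ?a ?u" "pre_digraph.awalk G ?u ?b w"
    unfolding G.awalk_append_iff by auto
  have "Poly_Mapping.single (fst p, ?a) c \<in> component PA i"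
    using ab assms by (auto simp: path_alg_simps(6) paths_def)
  moreover have "Poly_Mapping.single (?u, ?b) (1::'k) \<in> component PA j"
    using ab assms by (auto simp: path_alg_simps(6) paths_def)
  moreover have "Poly_Mapping.single (fst p, ?a) c \<otimes>\<^bsub>PA\<^esub> Poly_Mapping.single (?u, ?b) (1::'k) = Poly_Mapping.single p c"
    using ab by (simp add: mult_single path_term_def)
  ultimately show ?thesis by blast
qed

text \<open>There are finitely many vertices and arcs. With an injection of the field into
  \<open>'u\<close>, this bounds the size of the dual algebra.\<close>

lemma countable_paths: "countable (paths G)"
proof -
  have "paths G \<subseteq> verts G \<times> lists (arcs G)" by (auto simp: paths_def G.awalk_def)
  moreover have "countable (verts G \<times> lists (arcs G))"
    by (intro countable_SIGMA countable_lists countable_finite) auto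
  ultimately show ?thesis by (rule countable_subset)
qed

lemma component_negative_PA: "i < 0 \<Longrightarrow> component PA i = {0}"
  by (auto simp: path_alg_simps(6))

end

section \<open>The restriction functor\<close>

text \<open>The part of M in degrees S, regraded so that even indices correspond to the degrees m +
  nZ. An element of E acts as its counterpart in D, and the projection discards what leaves S, in
  the same way as the truncated product discards degrees outside \<U>.\<close>

definition restrict_module ::
  "nat \<Rightarrow> int \<Rightarrow> 'a graded \<Rightarrow> ('a \<Rightarrow> 'e) \<Rightarrow> ('a, 'u) graded_module \<Rightarrow> ('e, 'u) graded_module" where
  "restrict_module n m D \<phi> M =
     \<lparr>carrier = homog_sum M (degrees_S n m), mult = mult M, one = one M, zero = zero M, add = add M,
      component = (\<lambda>i. component M (m + koszul_degree n i)),
      act = (\<lambda>x e. hproj M (degrees_S n m) (act M x (inv_into (homog_sum D (degrees_U n)) \<phi> e)))\<rparr>"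

text \<open>What the construction takes from the two algebras. The last assumption serves twice: to
  write D_(nk+1) as D_(nk) D_1, and D_(nl-1) as D_(n-1) D_(n(l-1)).\<close>

locale truncation =
  fixes D :: "'a graded" and E :: "'e graded" and \<phi> :: "'a \<Rightarrow> 'e" and n :: nat and m :: int
  assumes graded_D: "graded_ring D"
    and n2: "n > 2"
    and iso: "\<phi> \<in> graded_ring_iso (truncated_ring n D) E"
    and \<phi>_zero: "\<phi> \<zero>\<^bsub>D\<^esub> = \<zero>\<^bsub>E\<^esub>"
    and negative: "i < 0 \<Longrightarrow> component D i = {\<zero>\<^bsub>D\<^esub>}"
    and generated: "\<lbrakk>0 \<le> i; 0 \<le> j\<rbrakk> \<Longrightarrow> component D (i + j) \<subseteq>
      generate (add_monoid D) {a \<otimes>\<^bsub>D\<^esub> b | a b. a \<in> component D i \<and> b \<in> component D j}"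

sublocale truncation \<subseteq> D: graded_ring D by (rule graded_D)

sublocale truncation \<subseteq> E: graded_ring E
  by (rule graded_ring_transport[OF graded_ring_truncated[OF graded_D n2] iso])
    (simp add: truncated_ring_simps \<phi>_zero)

context truncation
begin

abbreviation "U \<equiv> degrees_U n"
abbreviation "S \<equiv> degrees_S n m"
abbreviation "\<delta> \<equiv> koszul_degree n"
abbreviation "DU \<equiv> homog_sum D (degrees_U n)"
abbreviation "\<psi> \<equiv> inv_into (homog_sum D (degrees_U n)) \<phi>"
abbreviation "F \<equiv> restrict_module n m D \<phi>"

lemma S_range: "S = range (\<lambda>i. m + \<delta> i)"
  unfolding degrees_S_def using degrees_U_iff[OF n2] by auto

lemma S_add_iff: "m + s \<in> S \<longleftrightarrow> s \<in> U"
  by (simp add: degrees_S_iff[OF n2])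

lemma S_even [simp]: "m + int n * k \<in> S"
  unfolding S_add_iff by (auto simp: degrees_U_def)

lemma \<delta>_even [simp]: "\<delta> (2 * k) = int n * k"
  by (simp add: koszul_degree_def)

lemma \<delta>_odd [simp]: "\<delta> (2 * k + 1) = int n * k + 1"
  by (simp add: koszul_degree_def)

lemma U_0 [simp]: "0 \<in> U"
  using koszul_degree_in_U[OF n2, of 0] by (simp add: koszul_degree_def)

lemma DU_carrier: "a \<in> DU \<Longrightarrow> a \<in> carrier D"
  by (rule D.homog_sum_carrier)

lemma DU_component: "\<lbrakk>a \<in> component D u; u \<in> U\<rbrakk> \<Longrightarrow> a \<in> DU"
  by (rule D.homog_sum_component)

lemma DU_one: "\<one>\<^bsub>D\<^esub> \<in> DU"
  by (rule DU_component[OF D.one_degree U_0])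

lemma \<phi>_bij: "bij_betw \<phi> DU (carrier E)"
  and \<phi>_closed: "a \<in> DU \<Longrightarrow> \<phi> a \<in> carrier E"
  and \<phi>_add: "\<lbrakk>a \<in> DU; b \<in> DU\<rbrakk> \<Longrightarrow> \<phi> (a \<oplus>\<^bsub>D\<^esub> b) = \<phi> a \<oplus>\<^bsub>E\<^esub> \<phi> b"
  and \<phi>_mult: "\<lbrakk>a \<in> DU; b \<in> DU\<rbrakk> \<Longrightarrow> \<phi> a \<otimes>\<^bsub>E\<^esub> \<phi> b = \<phi> (hproj D U (a \<otimes>\<^bsub>D\<^esub> b))"
  and \<phi>_one: "\<phi> \<one>\<^bsub>D\<^esub> = \<one>\<^bsub>E\<^esub>"
  and \<phi>_image: "\<phi> ` component D (\<delta> i) = component E i"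
proof -
  have h: "\<phi> \<in> ring_iso (truncated_ring n D) E"
    and "\<forall>i. \<phi> ` component (truncated_ring n D) i = component E i"
    using iso by (auto simp: graded_ring_iso_def)
  then show "\<phi> ` component D (\<delta> i) = component E i" by (simp add: truncated_ring_simps)
  note hE = ring_iso_memE[OF h, unfolded truncated_ring_simps]
  show "bij_betw \<phi> DU (carrier E)" "a \<in> DU \<Longrightarrow> \<phi> a \<in> carrier E"
    "\<lbrakk>a \<in> DU; b \<in> DU\<rbrakk> \<Longrightarrow> \<phi> (a \<oplus>\<^bsub>D\<^esub> b) = \<phi> a \<oplus>\<^bsub>E\<^esub> \<phi> b" "\<phi> \<one>\<^bsub>D\<^esub> = \<one>\<^bsub>E\<^esub>"
    using hE by auto
  show "\<phi> a \<otimes>\<^bsub>E\<^esub> \<phi> b = \<phi> (hproj D U (a \<otimes>\<^bsub>D\<^esub> b))" if "a \<in> DU" "b \<in> DU"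
    using hE(2)[OF that] truncated_ring_mult[OF graded_D, of a b n] that DU_carrier by simp
qed

lemma \<phi>_component: "a \<in> component D (\<delta> i) \<Longrightarrow> \<phi> a \<in> component E i"
  using \<phi>_image by blast

lemma \<psi>_in [simp]: "e \<in> carrier E \<Longrightarrow> \<psi> e \<in> DU"
  using \<phi>_bij by (auto simp: bij_betw_def intro: inv_into_into)

lemma \<psi>_closed [simp]: "e \<in> carrier E \<Longrightarrow> \<psi> e \<in> carrier D"
  using DU_carrier \<psi>_in by blast

lemma \<phi>_\<psi> [simp]: "e \<in> carrier E \<Longrightarrow> \<phi> (\<psi> e) = e"
  using \<phi>_bij by (auto simp: bij_betw_def intro: f_inv_into_f)

lemma \<psi>_\<phi> [simp]: "a \<in> DU \<Longrightarrow> \<psi> (\<phi> a) = a"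
  using \<phi>_bij by (auto simp: bij_betw_def intro: inv_into_f_f)

lemma \<psi>_add: "\<lbrakk>e \<in> carrier E; f \<in> carrier E\<rbrakk> \<Longrightarrow> \<psi> (e \<oplus>\<^bsub>E\<^esub> f) = \<psi> e \<oplus>\<^bsub>D\<^esub> \<psi> f"
  using \<phi>_add[of "\<psi> e" "\<psi> f"] \<psi>_\<phi>[of "\<psi> e \<oplus>\<^bsub>D\<^esub> \<psi> f"] D.homog_sum_add by simp

lemma \<psi>_one: "\<psi> \<one>\<^bsub>E\<^esub> = \<one>\<^bsub>D\<^esub>"
  using \<psi>_\<phi>[OF DU_one] \<phi>_one by simp

lemma \<psi>_mult: "\<lbrakk>e \<in> carrier E; f \<in> carrier E\<rbrakk> \<Longrightarrow> \<psi> (e \<otimes>\<^bsub>E\<^esub> f) = hproj D U (\<psi> e \<otimes>\<^bsub>D\<^esub> \<psi> f)"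
  using \<phi>_mult[of "\<psi> e" "\<psi> f"] \<psi>_\<phi>[of "hproj D U (\<psi> e \<otimes>\<^bsub>D\<^esub> \<psi> f)"] D.hproj_in_homog_sum by simp

lemma \<psi>_component: "e \<in> component E i \<Longrightarrow> \<psi> e \<in> component D (\<delta> i)"
proof -
  assume "e \<in> component E i"
  then obtain a where a: "a \<in> component D (\<delta> i)" "e = \<phi> a" using \<phi>_image by blast
  then show ?thesis using DU_component[OF a(1)] koszul_degree_in_U[OF n2] by simp
qed

lemma F_simps:
  "carrier (F M) = homog_sum M S" "zero (F M) = zero M" "add (F M) = add M"
  "component (F M) i = component M (m + \<delta> i)"
  "act (F M) x e = hproj M S (act M x (\<psi> e))"
  by (simp_all add: restrict_module_def)

end

locale truncation_module = truncation D E \<phi> n m + M: graded_right_module D M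
  for D :: "'a graded" and E :: "'e graded" and \<phi> :: "'a \<Rightarrow> 'e" and n :: nat and m :: int
    and M :: "('a, 'u) graded_module"
begin

lemma FM_carrier: "x \<in> homog_sum M S \<Longrightarrow> x \<in> carrier M"
  by (rule M.M.homog_sum_carrier)

lemma component_homog_sum: "x \<in> component M (m + \<delta> i) \<Longrightarrow> x \<in> homog_sum M S"
  by (rule M.M.homog_sum_component) (auto simp: S_range)

lemma graded_group_F: "graded_group (F M)"
  by (rule M.M.graded_group_of_degrees[where \<delta> = "\<lambda>i. m + \<delta> i" and X = S])
    (auto simp: F_simps S_range inj_def koszul_degree_inj[OF n2])

text \<open>The same comparison of degrees as for associativity of the truncated ring, with the
  degree of x lowered by m so that it lies in \<U>.\<close>

lemma act_hproj_assoc: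
  assumes x: "x \<in> homog_sum M S" and a: "a \<in> DU" and b: "b \<in> DU"
  shows "hproj M S (act M (hproj M S (act M x a)) b) = hproj M S (act M x (hproj D U (a \<otimes>\<^bsub>D\<^esub> b)))"
  using x
proof (induction rule: M.M.homog_sum_induct)
  case zero
  then show ?case using a b DU_carrier by simp
next
  case (component i x)
  note x = component
  show ?case using a
  proof (induction rule: D.homog_sum_induct)
    case zero
    then show ?case using x b DU_carrier M.M.component_carrier by simp
  next
    case (component j a)
    note a = component
    show ?case using b
    proof (induction rule: D.homog_sum_induct)
      case zero
      then show ?case using x a D.component_carrier M.M.component_carrier M.act_closed by simp
    next
      case (component k b)
      note b = component
      have xa: "act M x a \<in> component M (i + j)" using M.act_degree x a by auto
      have ab: "a \<otimes>\<^bsub>D\<^esub> b \<in> component D (j + k)" using a b D.mult_degree by auto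
      have xab: "act M (act M x a) b \<in> component M (i + j + k)" using M.act_degree xa b by auto
      have c: "x \<in> carrier M" "a \<in> carrier D" "b \<in> carrier D"
        using x a b D.component_carrier M.M.component_carrier by auto
      have as: "act M x (a \<otimes>\<^bsub>D\<^esub> b) = act M (act M x a) b" using c by (simp add: M.act_assoc)
      have d: "i + j \<in> S \<longleftrightarrow> j + k \<in> U" if "i + j + k \<in> S"
        using degrees_U_assoc[OF n2, of "i - m" j k] x(1) a(1) b(1) that
        by (simp add: degrees_S_iff[OF n2] algebra_simps)
      show ?case
        unfolding M.M.hproj_of_component[OF xa, of S] D.hproj_of_component[OF ab, of U]
        using M.M.hproj_of_component[OF xab, of S] d as c
        by (auto split: if_splits)
    next
      case (add b b')
      then show ?case using x a DU_carrier D.component_carrier M.M.component_carrier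
        by (simp add: D.r_distr D.hproj_add M.M.hproj_add M.act_add_right M.act_closed)
    qed
  next
    case (add a a')
    then show ?case using x b DU_carrier M.M.component_carrier
      by (simp add: D.l_distr D.hproj_add M.M.hproj_add M.act_add_right M.act_add_left M.act_closed)
  qed
next
  case (add x x')
  then show ?case using a b DU_carrier FM_carrier
    by (simp add: M.M.hproj_add M.act_add_left M.act_closed)
qed

text \<open>Koszul degrees add correctly unless both indices are odd; in that case the product
  leaves S, and its projection 0 lies in every component.\<close>

lemma F_degree:
  assumes "x \<in> component M (m + \<delta> i)" "a \<in> component D (\<delta> j)"
  shows "hproj M S (act M x a) \<in> component M (m + \<delta> (i + j))"
proof -
  have xa: "act M x a \<in> component M (m + (\<delta> i + \<delta> j))" using M.act_degree[OF assms] by (simp add: add.assoc)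
  show ?thesis
    using M.M.hproj_of_component[OF xa, of S] xa koszul_degree_add_in_U[OF n2, of i j]
      koszul_degree_add[OF n2, of i j] S_add_iff by auto
qed

lemma graded_right_module_F: "graded_right_module E (F M)"
  unfolding graded_right_module_def
proof (intro conjI graded_right_module_axioms.intro E.graded_ring_axioms graded_group_F)
  fix x y a b i j
  show "x \<in> carrier (F M) \<Longrightarrow> a \<in> carrier E \<Longrightarrow> act (F M) x a \<in> carrier (F M)"
    by (simp add: F_simps M.M.hproj_in_homog_sum M.act_closed FM_carrier)
  show "x \<in> carrier (F M) \<Longrightarrow> y \<in> carrier (F M) \<Longrightarrow> a \<in> carrier E \<Longrightarrow>
      act (F M) (x \<oplus>\<^bsub>F M\<^esub> y) a = act (F M) x a \<oplus>\<^bsub>F M\<^esub> act (F M) y a"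
    by (simp add: F_simps M.M.hproj_add M.act_add_left M.act_closed FM_carrier)
  show "x \<in> carrier (F M) \<Longrightarrow> a \<in> carrier E \<Longrightarrow> b \<in> carrier E \<Longrightarrow>
      act (F M) x (a \<oplus>\<^bsub>E\<^esub> b) = act (F M) x a \<oplus>\<^bsub>F M\<^esub> act (F M) x b"
    by (simp add: F_simps M.M.hproj_add M.act_add_right M.act_closed FM_carrier \<psi>_add)
  show "x \<in> carrier (F M) \<Longrightarrow> a \<in> carrier E \<Longrightarrow> b \<in> carrier E \<Longrightarrow>
      act (F M) (act (F M) x a) b = act (F M) x (a \<otimes>\<^bsub>E\<^esub> b)"
    by (simp add: F_simps act_hproj_assoc \<psi>_mult)
  show "x \<in> carrier (F M) \<Longrightarrow> act (F M) x \<one>\<^bsub>E\<^esub> = x"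
    by (simp add: F_simps \<psi>_one M.act_one FM_carrier M.M.hproj_homog_sum)
  show "x \<in> component (F M) i \<Longrightarrow> a \<in> component E j \<Longrightarrow> act (F M) x a \<in> component (F M) (i + j)"
    using F_degree[of x i "\<psi> a" j] \<psi>_component[of a j] by (simp add: F_simps)
qed

text \<open>Unless both indices are odd, the product stays in S and the projection does
  nothing.\<close>

lemma F_act:
  assumes "x \<in> component M (m + \<delta> i)" "a \<in> component D (\<delta> j)" "\<not> (odd i \<and> odd j)"
  shows "act (F M) x (\<phi> a) = act M x a"
proof -
  have xa: "act M x a \<in> component M (m + (\<delta> i + \<delta> j))" using M.act_degree[OF assms(1,2)] by (simp add: add.assoc)
  moreover have "m + (\<delta> i + \<delta> j) \<in> S" using koszul_degree_add_in_U[OF n2, of i j] assms(3) S_add_iff by blast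
  moreover have "a \<in> DU" using assms(2) DU_component koszul_degree_in_U[OF n2] by blast
  ultimately show ?thesis using M.M.hproj_of_component[OF xa, of S] by (simp add: F_simps)
qed

text \<open>If a product x a has degree in S and x has degree in m + nZ, then a has degree in \<U>,
  so the product is already one with an element of E.\<close>

lemma generated_F:
  assumes "generated_in_degrees D M (gen_degrees n m)"
  shows "generated_in_degrees E (F M) {i. even i}"
proof -
  interpret FM: graded_right_module E "F M" by (rule graded_right_module_F)
  show ?thesis
    unfolding FM.generated_in_degrees_iff
  proof (intro allI subsetI)
    fix d z assume "z \<in> component (F M) d"
    then have "z \<in> component M (m + \<delta> d)" by (simp add: F_simps)
    then show "z \<in> generate (add_monoid (F M)) (homog_products E (F M) {i. even i} d)"
    proof (induction rule: M.generated_component_induct[OF assms, consumes 1, case_names zero product add])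
      case zero
      then show ?case using FM.M.add_generate_zero[of "homog_products E (F M) {i. even i} d"] by (simp add: F_simps)
    next
      case (product i x a)
      then obtain k where k: "i = m + int n * k" by (auto simp: gen_degrees_def)
      \<comment> \<open>Subtracting a multiple of n corresponds to subtracting an even index, where
        Koszul degrees are additive.\<close>
      have e: "\<delta> (d - 2 * k) = m + \<delta> d - i"
        using koszul_degree_add[OF n2, of "d - 2 * k" "2 * k"] k by simp
      have x: "x \<in> component M (m + \<delta> (2 * k))" and a: "a \<in> component D (\<delta> (d - 2 * k))"
        using product k e by auto
      have "act M x a = act (F M) x (\<phi> a)" by (rule F_act[OF x a, symmetric]) simp
      then have "act M x a \<in> homog_products E (F M) {i. even i} d"
        unfolding homog_products_def F_simps(4) using x \<phi>_component[OF a]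
        by (intro CollectI exI[of _ "2 * k"] exI[of _ x] exI[of _ "\<phi> a"]) auto
      then show ?case by (rule FM.M.add_generate_incl)
    next
      case (add x y)
      then show ?case using FM.M.add_generate_add by (simp add: F_simps)
    qed
  qed
qed

end

lemma gr_hom_hproj:
  assumes "graded_group M" "graded_group N" and f: "f \<in> gr_hom R M N" and x: "x \<in> carrier M"
  shows "f (hproj M X x) = hproj N X (f x)"
proof -
  interpret M: graded_group M by fact
  interpret N: graded_group N by fact
  note fD = gr_homD[OF f]
  show ?thesis
  proof (rule M.additive_map_eqI[OF _ _ N.abelian_group_axioms _ x])
    show "additive_map M N (\<lambda>x. f (hproj M X x))"
      by (rule M.additive_map_compose[OF M.hproj_additive fD(6)])
    show "additive_map M N (\<lambda>x. hproj N X (f x))"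
      by (rule M.additive_map_compose[OF fD(6) N.hproj_additive])
    show "f (hproj M X z) = hproj N X (f z)" if "z \<in> component M i" for i z
      using that N.hproj_of_component[OF fD(5)[OF that], of X] M.hproj_of_component[OF that, of X]
        additive_map_zero[OF M.abelian_group_axioms N.abelian_group_axioms fD(6)] by simp
  qed
qed

context truncation
begin

lemma restrict_gr_hom:
  assumes M: "graded_right_module D M" and N: "graded_right_module D N" and f: "f \<in> gr_hom D M N"
  shows "restrict f (homog_sum M S) \<in> gr_hom E (F M) (F N)"
proof -
  interpret M: truncation_module D E \<phi> n m M by (intro truncation_module.intro truncation_axioms M)
  interpret N: truncation_module D E \<phi> n m N by (intro truncation_module.intro truncation_axioms N)
  note fD = gr_homD[OF f]
  have S: "f x \<in> homog_sum N S" if x: "x \<in> homog_sum M S" for x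
    using gr_hom_hproj[OF M.M.M.graded_group_axioms N.M.M.graded_group_axioms f, of x S]
      M.M.M.hproj_homog_sum[OF x] M.FM_carrier[OF x] fD(2) N.M.M.hproj_in_homog_sum by metis
  show ?thesis
  proof (rule gr_homI)
    fix x e assume x: "x \<in> carrier (F M)" and e: "e \<in> carrier E"
    have "act M x (\<psi> e) \<in> carrier M" using x e M.M.act_closed M.FM_carrier by (simp add: F_simps)
    then show "restrict f (homog_sum M S) (act (F M) x e) = act (F N) (restrict f (homog_sum M S) x) e"
      using gr_hom_hproj[OF M.M.M.graded_group_axioms N.M.M.graded_group_axioms f, of "act M x (\<psi> e)" S]
        x e fD(4)[of x "\<psi> e"] M.FM_carrier by (simp add: F_simps M.M.M.hproj_in_homog_sum)
  qed (use S fD M.FM_carrier M.component_homog_sum M.M.M.homog_sum_add in \<open>auto simp: F_simps\<close>)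
qed

end

lemma (in graded_right_module) hpart_act_right:
  assumes "x \<in> carrier M" "a \<in> component R j"
  shows "hpart M i (act M x a) = act M (hpart M (i - j) x) a"
proof (rule M.additive_map_eqI[OF _ _ M.abelian_group_axioms _ assms(1)])
  have a: "a \<in> carrier R" using assms R.component_carrier by blast
  show "additive_map M M (\<lambda>x. hpart M i (act M x a))"
    by (rule M.additive_map_compose[OF act_additive_left[OF a] M.hpart_additive])
  show "additive_map M M (\<lambda>x. act M (hpart M (i - j) x) a)"
    by (rule M.additive_map_compose[OF M.hpart_additive act_additive_left[OF a]])
  show "hpart M i (act M x a) = act M (hpart M (i - j) x) a" if "x \<in> component M k" for k x
    using M.hpart_of_component[OF that, of "i - j"] M.hpart_of_component[OF act_degree[OF that assms(2)], of i] a
    by (auto simp: algebra_simps)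
qed

section \<open>The restriction functor is fully faithful\<close>

context truncation
begin

lemma U_shift [simp]: "int n * k + j \<in> U \<longleftrightarrow> j \<in> U"
  by (simp add: degrees_U_iff_mod[OF n2] mod_add_left_eq[symmetric])

lemma gen_degrees_S: "i \<in> gen_degrees n m \<Longrightarrow> i \<in> S"
  by (auto simp: gen_degrees_def)

text \<open>The generators of M have degrees in m + nZ, which is contained in S, so the restriction
  determines the morphism.\<close>

lemma restrict_gr_hom_inj:
  assumes M: "graded_right_module D M" and N: "graded_right_module D N"
    and gen: "generated_in_degrees D M (gen_degrees n m)"
    and f: "f \<in> gr_hom D M N" and f': "f' \<in> gr_hom D M N"
    and eq: "restrict f (homog_sum M S) = restrict f' (homog_sum M S)"
  shows "f = f'"
proof -
  interpret M: graded_right_module D M by fact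
  interpret N: graded_right_module D N by fact
  note fD = gr_homD[OF f] and fD' = gr_homD[OF f']
  have agree: "f x = f' x" if "x \<in> homog_sum M S" for x
    using fun_cong[OF eq, of x] that by simp
  have "f x = f' x" if "x \<in> carrier M" for x
  proof (rule M.M.additive_map_eqI[OF fD(6) fD'(6) N.M.abelian_group_axioms _ that])
    show "f z = f' z" if "z \<in> component M i" for i z
      using gen that
    proof (induction rule: M.generated_component_induct)
      case zero
      then show ?case
        using additive_map_zero[OF M.M.abelian_group_axioms N.M.abelian_group_axioms] fD(6) fD'(6) by metis
    next
      case (product i x a)
      then have "x \<in> homog_sum M S" using M.M.homog_sum_component gen_degrees_S by blast
      then show ?case
        using agree fD(4)[of x a] fD'(4)[of x a] product M.M.component_carrier D.component_carrier by auto
    next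
      case (add x y)
      then show ?case using fD(3) fD'(3) M.M.component_carrier by metis
    qed
  qed
  then show ?thesis by (rule extensionalityI[OF fD(1) fD'(1)])
qed

text \<open>A module in \<open>G(S, U)\<close> embeds into the functions \<open>D \<rightarrow> M_S\<close> by sending \<open>x\<close> to
  \<open>b \<mapsto> \<pi>_S (x b)\<close>; thus \<open>x\<close> determines at most one element \<open>y\<close> of the target whose
  function is the composite of that of \<open>x\<close> and \<open>g\<close>.\<close>

definition lift_rel :: "('a, 'u) graded_module \<Rightarrow> ('a, 'w) graded_module \<Rightarrow> ('u \<Rightarrow> 'w) \<Rightarrow> 'u \<Rightarrow> 'w \<Rightarrow> bool" where
  "lift_rel M N g x y \<longleftrightarrow> x \<in> carrier M \<and> y \<in> carrier N \<and>
     (\<forall>b \<in> carrier D. g (hproj M S (act M x b)) = hproj N S (act N y b))"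

text \<open>\<open>lift_rel\<close> is compatible with sums and with the action of D. It relates
  each generator x to g x, hence is total because M is generated, and it is single-valued because
  homogeneous elements of N are detected in degrees S. It is thus the graph of the wanted
  extension.\<close>

lemma restrict_gr_hom_surj:
  assumes M: "graded_right_module D M" and N: "graded_right_module D N"
    and MG: "in_G n m D M" and NG: "in_G n m D N" and g: "g \<in> gr_hom E (F M) (F N)"
  shows "\<exists>f \<in> gr_hom D M N. restrict f (homog_sum M S) = g"
proof -
  interpret M: graded_right_module D M by fact
  interpret N: graded_right_module D N by fact
  interpret TM: truncation_module D E \<phi> n m M by (intro truncation_module.intro truncation_axioms M)
  interpret TN: truncation_module D E \<phi> n m N by (intro truncation_module.intro truncation_axioms N)
  have gen: "generated_in_degrees D M (gen_degrees n m)" using MG M.in_G_iff by blast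
  have tf: "\<exists>j. \<exists>b \<in> component D j. d + j \<in> S \<and> act N y b \<noteq> \<zero>\<^bsub>N\<^esub>"
    if "y \<in> component N d" "y \<noteq> \<zero>\<^bsub>N\<^esub>" for y d
    using NG that unfolding N.in_G_iff by blast
  note gD = gr_homD[OF g, unfolded F_simps]
  have g0: "g \<zero>\<^bsub>M\<^esub> = \<zero>\<^bsub>N\<^esub>"
  proof -
    have "g (\<zero>\<^bsub>M\<^esub> \<oplus>\<^bsub>M\<^esub> \<zero>\<^bsub>M\<^esub>) = g \<zero>\<^bsub>M\<^esub> \<oplus>\<^bsub>N\<^esub> g \<zero>\<^bsub>M\<^esub>" by (rule gD(3)) simp_all
    moreover have "g \<zero>\<^bsub>M\<^esub> \<in> carrier N" using gD(2)[OF M.M.homog_sum_zero] TN.FM_carrier by blast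
    ultimately show ?thesis using N.M.add.l_cancel_one by simp
  qed
  let ?R = "lift_rel M N g"
  have Rc: "x \<in> carrier M" "y \<in> carrier N" if "?R x y" for x y using that by (auto simp: lift_rel_def)
  have R_add: "?R (x \<oplus>\<^bsub>M\<^esub> x') (y \<oplus>\<^bsub>N\<^esub> y')" if "?R x y" "?R x' y'" for x x' y y'
    using that by (auto simp: lift_rel_def M.act_add_left N.act_add_left M.M.hproj_add N.M.hproj_add
        M.act_closed N.act_closed gD(3) M.M.hproj_in_homog_sum)
  have R_act: "?R (act M x a) (act N y a)" if "?R x y" "a \<in> carrier D" for x y a
    using that by (auto simp: lift_rel_def M.act_assoc N.act_assoc M.act_closed N.act_closed)
  have R_zero: "?R \<zero>\<^bsub>M\<^esub> \<zero>\<^bsub>N\<^esub>" by (simp add: lift_rel_def g0)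
  \<comment> \<open>Negation is the action of -1, so compatibility with the action covers
    it.\<close>
  have R_minus: "?R (\<ominus>\<^bsub>M\<^esub> x) (\<ominus>\<^bsub>N\<^esub> y)" if R: "?R x y" for x y
  proof -
    have "?R (act M x (\<ominus>\<^bsub>D\<^esub> \<one>\<^bsub>D\<^esub>)) (act N y (\<ominus>\<^bsub>D\<^esub> \<one>\<^bsub>D\<^esub>))" by (rule R_act[OF R]) simp
    then show ?thesis using Rc[OF R] by (simp add: M.act_minus_right N.act_minus_right M.act_one N.act_one)
  qed
  \<comment> \<open>If a part of y were nonzero, some homogeneous b would move it to a nonzero
    element in a degree of S. That element is a part of the projection of y b, which equals g 0 =
    0.\<close>
  have R_zero_unique: "y = \<zero>\<^bsub>N\<^esub>" if R: "?R \<zero>\<^bsub>M\<^esub> y" for y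
  proof (rule N.M.zero_if_hparts_zero)
    show y: "y \<in> carrier N" using Rc(2)[OF R] .
    show "hpart N d y = \<zero>\<^bsub>N\<^esub>" for d
    proof (rule ccontr)
      assume "hpart N d y \<noteq> \<zero>\<^bsub>N\<^esub>"
      then obtain j b where b: "b \<in> component D j" "d + j \<in> S" "act N (hpart N d y) b \<noteq> \<zero>\<^bsub>N\<^esub>"
        using tf[OF N.M.hpart_component[OF y]] by blast
      have bc: "b \<in> carrier D" using b D.component_carrier by blast
      have "hproj N S (act N y b) = \<zero>\<^bsub>N\<^esub>"
        using R bc g0 by (auto simp: lift_rel_def)
      then have "hpart N (d + j) (act N y b) = \<zero>\<^bsub>N\<^esub>"
        using N.M.hpart_hproj[of "act N y b" "d + j" S] b(2) y bc by (simp add: N.act_closed)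
      then show False using N.hpart_act_right[OF y b(1), of "d + j"] b(3) by simp
    qed
  qed
  have R_unique: "y = y'" if R: "?R x y" "?R x y'" for x y y'
  proof -
    have "?R (x \<oplus>\<^bsub>M\<^esub> \<ominus>\<^bsub>M\<^esub> x) (y \<oplus>\<^bsub>N\<^esub> \<ominus>\<^bsub>N\<^esub> y')" by (rule R_add[OF R(1) R_minus[OF R(2)]])
    then have "y \<oplus>\<^bsub>N\<^esub> \<ominus>\<^bsub>N\<^esub> y' = \<zero>\<^bsub>N\<^esub>"
      using Rc[OF R(1)] by (intro R_zero_unique) (simp add: M.M.r_neg)
    then show ?thesis
      using Rc[OF R(1)] Rc[OF R(2)] by (metis N.M.add.inv_equality N.M.minus_minus N.M.a_inv_closed)
  qed
  \<comment> \<open>For b of degree in \<U> the equation is linearity of g over E; for other degrees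
    the products on both sides leave S and project to 0.\<close>
  have R_base: "?R x (g x)" if x: "x \<in> component M i" and i: "i \<in> gen_degrees n m" for x i
  proof -
    obtain k where k: "i = m + int n * k" using i by (auto simp: gen_degrees_def)
    have xM: "x \<in> component M (m + \<delta> (2 * k))" using x k by simp
    have xS: "x \<in> homog_sum M S" by (rule TM.component_homog_sum[OF xM])
    have gx: "g x \<in> component N (m + \<delta> (2 * k))" by (rule gD(5)[OF xM])
    have xc: "x \<in> carrier M" and gxc: "g x \<in> carrier N"
      using TM.FM_carrier[OF xS] TN.FM_carrier[OF gD(2)[OF xS]] by auto
    have "g (hproj M S (act M x b)) = hproj N S (act N (g x) b)" if b: "b \<in> carrier D" for b
      using b
    proof (induction rule: D.graded_induct)
      case zero
      then show ?case using xc gxc by (simp add: g0)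
    next
      case (component j b)
      show ?case
      proof (cases "j \<in> U")
        case True
        then have bU: "b \<in> DU" using component DU_component by blast
        then show ?thesis using gD(4)[OF xS \<phi>_closed[OF bU]] by simp
      next
        case False
        then have "m + \<delta> (2 * k) + j \<notin> S" using S_add_iff[of "int n * k + j"] by (simp add: add.assoc)
        then show ?thesis
          using M.M.hproj_of_component[OF M.act_degree[OF xM component], of S]
            N.M.hproj_of_component[OF N.act_degree[OF gx component], of S] g0 by simp
      qed
    next
      case (add b b')
      then show ?case using xc gxc
        by (simp add: M.act_add_right N.act_add_right M.M.hproj_add N.M.hproj_add
            M.act_closed N.act_closed gD(3) M.M.hproj_in_homog_sum)
    qed
    then show ?thesis using xc gxc by (simp add: lift_rel_def)
  qed
  have R_total: "\<exists>y \<in> component N d. ?R x y" if "x \<in> component M d" for x d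
    using gen that
  proof (induction rule: M.generated_component_induct)
    case zero
    then show ?case using R_zero N.M.component_zero by blast
  next
    case (product i x a)
    then obtain k where k: "i = m + int n * k" by (auto simp: gen_degrees_def)
    then have "g x \<in> component N i" using gD(5)[of x "2 * k"] product by simp
    then have "act N (g x) a \<in> component N d" using N.act_degree[of "g x" i a "d - i"] product by simp
    moreover have "?R (act M x a) (act N (g x) a)"
      using R_act[OF R_base] product D.component_carrier by blast
    ultimately show ?case by blast
  next
    case (add x y)
    then show ?case using R_add N.M.component_add by blast
  qed
  \<comment> \<open>The extension must agree with g on all of M_S and not just on generators. An
    element x a with degree in S has a of degree in \<U>, so the value of g there is known from
    linearity over E.\<close>
  have R_S: "?R x (g x)" if "x \<in> homog_sum M S" for x
    using that
  proof (induction rule: M.M.homog_sum_induct)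
    case zero
    then show ?case using R_zero g0 by simp
  next
    case (component s z)
    obtain d where d: "s = m + \<delta> d" using component(1) S_range by blast
    show ?case using gen component(2)
    proof (induction rule: M.generated_component_induct)
      case zero
      then show ?case using R_zero g0 by simp
    next
      case (product i x a)
      then obtain k where k: "i = m + int n * k" by (auto simp: gen_degrees_def)
      have e: "\<delta> (d - 2 * k) = s - i"
        using koszul_degree_add[OF n2, of "d - 2 * k" "2 * k"] k d by simp
      have x: "x \<in> component M (m + \<delta> (2 * k))" and a: "a \<in> component D (\<delta> (d - 2 * k))"
        using product k e by auto
      have aU: "a \<in> DU" using a DU_component koszul_degree_in_U[OF n2] by blast
      have "g (act M x a) = g (act (F M) x (\<phi> a))" using TM.F_act[OF x a] by simp
      also have "\<dots> = act (F N) (g x) (\<phi> a)"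
        unfolding F_simps using gD(4)[OF TM.component_homog_sum[OF x] \<phi>_closed[OF aU]] .
      also have "\<dots> = act N (g x) a" using TN.F_act[OF gD(5)[OF x] a] by simp
      finally have "g (act M x a) = act N (g x) a" .
      then show ?case using R_act[OF R_base] product D.component_carrier by metis
    next
      case (add x y)
      then have "x \<in> homog_sum M S" "y \<in> homog_sum M S"
        using component(1) M.M.homog_sum_component by blast+
      then show ?case using R_add[OF add(3,4)] gD(3) by simp
    qed
  next
    case (add x y)
    then show ?case using R_add[OF add(3,4)] gD(3) by simp
  qed
  define f where "f = (\<lambda>x\<in>carrier M. THE y. ?R x y)"
  have Rf: "?R x (f x)" if x: "x \<in> carrier M" for x
  proof -
    have "\<exists>y. ?R x y" using x
    proof (induction rule: M.M.graded_induct)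
      case zero
      then show ?case using R_zero by blast
    next
      case (component i x)
      then show ?case using R_total by blast
    next
      case (add x y)
      then show ?case using R_add by blast
    qed
    then have "\<exists>!y. ?R x y" using R_unique by blast
    then show ?thesis using theI'[of "?R x"] x by (simp add: f_def)
  qed
  have f_eq: "f x = y" if "?R x y" for x y
    using R_unique[OF Rf that] Rc[OF that] by blast
  have "f \<in> gr_hom D M N"
  proof (rule gr_homI)
    show "f \<in> extensional (carrier M)" by (simp add: f_def)
    show "f x \<in> carrier N" if "x \<in> carrier M" for x using Rc(2)[OF Rf[OF that]] .
    show "f (x \<oplus>\<^bsub>M\<^esub> y) = f x \<oplus>\<^bsub>N\<^esub> f y" if "x \<in> carrier M" "y \<in> carrier M" for x y
      by (rule f_eq) (rule R_add[OF Rf[OF that(1)] Rf[OF that(2)]])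
    show "f (act M x a) = act N (f x) a" if "x \<in> carrier M" "a \<in> carrier D" for x a
      by (rule f_eq) (rule R_act[OF Rf[OF that(1)] that(2)])
    show "f z \<in> component N i" if "z \<in> component M i" for i z
      using R_total[OF that] f_eq by blast
  qed
  moreover have "restrict f (homog_sum M S) = g"
    using f_eq[OF R_S] gD(1) by (auto simp: fun_eq_iff extensional_def)
  ultimately show ?thesis by blast
qed

end

section \<open>Homomorphisms on tensor products\<close>

text \<open>The homomorphism from the free abelian group on pairs that h induces.
  \<open>tensor_lift\<close> is its value at a representative of a coset, and working with
  representatives keeps later arguments free of cosets.\<close>

definition frag_lift :: "('g, 'x) monoid_scheme \<Rightarrow> ('m \<Rightarrow> 'n \<Rightarrow> 'g) \<Rightarrow> (('m \<times> 'n) \<Rightarrow>\<^sub>0 int) \<Rightarrow> 'g" where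
  "frag_lift G h s =
     (\<Otimes>\<^bsub>G\<^esub>p\<in>Poly_Mapping.keys s. h (fst p) (snd p) [^]\<^bsub>G\<^esub> Poly_Mapping.lookup s p)"

context comm_group
begin

lemma frag_lift_superset:
  assumes "finite A" "Poly_Mapping.keys s \<subseteq> A" "\<And>x y. (x, y) \<in> A \<Longrightarrow> h x y \<in> carrier G"
  shows "frag_lift G h s = (\<Otimes>p\<in>A. h (fst p) (snd p) [^] Poly_Mapping.lookup s p)"
  unfolding frag_lift_def
  by (rule finprod_mono_neutral_cong_left)
    (use assms in \<open>auto simp: in_keys_iff split_paired_all\<close>)

lemma frag_lift_closed:
  assumes "Poly_Mapping.keys s \<subseteq> X" "\<And>x y. (x, y) \<in> X \<Longrightarrow> h x y \<in> carrier G"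
  shows "frag_lift G h s \<in> carrier G"
  unfolding frag_lift_def by (rule finprod_closed) (use assms in \<open>auto simp: split_paired_all\<close>)

lemma frag_lift_zero [simp]: "frag_lift G h 0 = \<one>"
  by (simp add: frag_lift_def)

lemma frag_lift_of: "h x y \<in> carrier G \<Longrightarrow> frag_lift G h (frag_of (x, y)) = h x y"
  by (simp add: frag_lift_def keys_frag_of)

lemma frag_lift_add:
  assumes "Poly_Mapping.keys s \<subseteq> X" "Poly_Mapping.keys t \<subseteq> X" "\<And>x y. (x, y) \<in> X \<Longrightarrow> h x y \<in> carrier G"
  shows "frag_lift G h (s + t) = frag_lift G h s \<otimes> frag_lift G h t"
proof -
  let ?A = "Poly_Mapping.keys s \<union> Poly_Mapping.keys t"
  have A: "finite ?A" and h: "h x y \<in> carrier G" if "(x, y) \<in> ?A" for x y using assms that by auto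
  have hp: "h (fst p) (snd p) \<in> carrier G" if "p \<in> ?A" for p using h[of "fst p" "snd p"] that by simp
  have "frag_lift G h (s + t) = (\<Otimes>p\<in>?A. h (fst p) (snd p) [^] Poly_Mapping.lookup (s + t) p)"
    by (rule frag_lift_superset) (use keys_add[of s t] h A in auto)
  also have "\<dots> = (\<Otimes>p\<in>?A. (h (fst p) (snd p) [^] Poly_Mapping.lookup s p) \<otimes> (h (fst p) (snd p) [^] Poly_Mapping.lookup t p))"
    by (rule finprod_cong') (use hp in \<open>auto simp: lookup_add int_pow_mult\<close>)
  also have "\<dots> = (\<Otimes>p\<in>?A. h (fst p) (snd p) [^] Poly_Mapping.lookup s p) \<otimes> (\<Otimes>p\<in>?A. h (fst p) (snd p) [^] Poly_Mapping.lookup t p)"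
    by (rule finprod_multf) (use hp in auto)
  also have "\<dots> = frag_lift G h s \<otimes> frag_lift G h t"
    by (subst (1 2) frag_lift_superset[where A = ?A]) (use h in auto)
  finally show ?thesis .
qed

lemma frag_lift_minus:
  assumes "Poly_Mapping.keys s \<subseteq> X" "\<And>x y. (x, y) \<in> X \<Longrightarrow> h x y \<in> carrier G"
  shows "frag_lift G h (- s) = inv (frag_lift G h s)"
proof -
  have "frag_lift G h (- s) \<otimes> frag_lift G h s = frag_lift G h (- s + s)"
    by (rule frag_lift_add[symmetric, where X = X]) (use assms in auto)
  then show ?thesis
    using frag_lift_closed[of s X h] frag_lift_closed[of "- s" X h] assms by (simp add: inv_equality[symmetric])
qed

lemma frag_lift_diff:
  assumes "Poly_Mapping.keys s \<subseteq> X" "Poly_Mapping.keys t \<subseteq> X" "\<And>x y. (x, y) \<in> X \<Longrightarrow> h x y \<in> carrier G"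
  shows "frag_lift G h (s - t) = frag_lift G h s \<otimes> inv (frag_lift G h t)"
  using frag_lift_add[of s X "- t" h] frag_lift_minus[of t X h] assms by simp

lemma frag_lift_induct [consumes 1, case_names zero of diff]:
  assumes "Poly_Mapping.keys s \<subseteq> X" "P 0" "\<And>x y. (x, y) \<in> X \<Longrightarrow> P (frag_of (x, y))"
    and "\<And>s t. \<lbrakk>Poly_Mapping.keys s \<subseteq> X; Poly_Mapping.keys t \<subseteq> X; P s; P t\<rbrakk> \<Longrightarrow> P (s - t)"
  shows "P s"
  using assms(1) by (rule free_Abelian_group_induct) (use assms in auto)

lemma frag_lift_hom:
  assumes H: "group H" and f: "f \<in> hom G H" "comm_group H"
    and s: "Poly_Mapping.keys s \<subseteq> X" and h: "\<And>x y. (x, y) \<in> X \<Longrightarrow> h x y \<in> carrier G"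
  shows "f (frag_lift G h s) = frag_lift H (\<lambda>x y. f (h x y)) s"
proof -
  interpret H: comm_group H by fact
  interpret f: group_hom G H f by unfold_locales (rule f)
  have fh: "f (h x y) \<in> carrier H" if "(x, y) \<in> X" for x y using h[OF that] by simp
  show ?thesis
    using s
  proof (induction rule: frag_lift_induct)
    case (of x y)
    then show ?case using h fh by (simp add: frag_lift_of H.frag_lift_of)
  next
    case (diff s t)
    then show ?case
      using frag_lift_closed[of s X h] frag_lift_closed[of t X h] h fh
      by (simp add: frag_lift_diff[where X = X] H.frag_lift_diff[where X = X])
  qed simp
qed

end

text \<open>Closure of the operations and actions places the relations in the free abelian group,
  which suffices for the quotient and its pure tensors.\<close>

locale tensor_data =
  fixes A :: "'r set" and M :: "('m, 'x) ring_scheme" and ra :: "'m \<Rightarrow> 'r \<Rightarrow> 'm"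
    and N :: "('n, 'y) ring_scheme" and la :: "'r \<Rightarrow> 'n \<Rightarrow> 'n"
  assumes M_add: "\<lbrakk>x \<in> carrier M; x' \<in> carrier M\<rbrakk> \<Longrightarrow> x \<oplus>\<^bsub>M\<^esub> x' \<in> carrier M"
    and N_add: "\<lbrakk>y \<in> carrier N; y' \<in> carrier N\<rbrakk> \<Longrightarrow> y \<oplus>\<^bsub>N\<^esub> y' \<in> carrier N"
    and ra_closed: "\<lbrakk>x \<in> carrier M; a \<in> A\<rbrakk> \<Longrightarrow> ra x a \<in> carrier M"
    and la_closed: "\<lbrakk>a \<in> A; y \<in> carrier N\<rbrakk> \<Longrightarrow> la a y \<in> carrier N"
begin

abbreviation "Fr \<equiv> free_Abelian_group (carrier M \<times> carrier N)"
abbreviation "K \<equiv> tensor_subgroup A M ra N la"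
abbreviation "T \<equiv> tensor A M ra N la"

lemma relations_carrier: "tensor_relations A M ra N la \<subseteq> carrier Fr"
proof
  fix r assume r: "r \<in> tensor_relations A M ra N la"
  let ?X = "carrier M \<times> carrier N"
  have kd: "Poly_Mapping.keys (s - t) \<subseteq> ?X" if "Poly_Mapping.keys s \<subseteq> ?X" "Poly_Mapping.keys t \<subseteq> ?X" for s t :: "('m \<times> 'n) \<Rightarrow>\<^sub>0 int"
    using keys_diff[of s t] that by blast
  have kf: "Poly_Mapping.keys (frag_of (x, y)) \<subseteq> ?X" if "x \<in> carrier M" "y \<in> carrier N" for x y
    using that by (simp add: keys_frag_of)
  show "r \<in> carrier Fr"
    using r unfolding tensor_relations_def carrier_free_Abelian_group_iff
    by (elim UnE CollectE exE conjE) (simp_all add: kd kf M_add N_add ra_closed la_closed)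
qed

lemma K_subgroup: "subgroup K Fr"
  unfolding tensor_subgroup_def
  by (rule group.generate_is_subgroup[OF _ relations_carrier]) simp

lemma K_normal: "normal K Fr"
  using comm_group.normal_iff_subgroup[OF abelian_free_Abelian_group] K_subgroup by blast

lemma T_group: "group T"
  unfolding tensor_def by (rule normal.factorgroup_is_group[OF K_normal])

lemma coset_mult:
  assumes "Poly_Mapping.keys s \<subseteq> carrier M \<times> carrier N" "Poly_Mapping.keys t \<subseteq> carrier M \<times> carrier N"
  shows "(K #>\<^bsub>Fr\<^esub> s) \<otimes>\<^bsub>T\<^esub> (K #>\<^bsub>Fr\<^esub> t) = K #>\<^bsub>Fr\<^esub> (s + t)"
  using normal.rcos_sum[OF K_normal, of s t] assms by (simp add: tensor_def FactGroup_def)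

lemma T_carrier: "carrier T = {K #>\<^bsub>Fr\<^esub> s | s. Poly_Mapping.keys s \<subseteq> carrier M \<times> carrier N}"
  by (auto simp: tensor_def FactGroup_def RCOSETS_def)

lemma T_comm_group: "comm_group T"
proof (rule group.group_comm_groupI[OF T_group])
  fix x y assume "x \<in> carrier T" "y \<in> carrier T"
  then show "x \<otimes>\<^bsub>T\<^esub> y = y \<otimes>\<^bsub>T\<^esub> x" by (auto simp: T_carrier coset_mult add.commute)
qed

lemma K_zero: "K #>\<^bsub>Fr\<^esub> r = \<one>\<^bsub>T\<^esub>" if "r \<in> K"
  using group.coset_join2[OF group_free_Abelian_group _ K_subgroup that]
    subgroup.subset[OF K_subgroup] that by (auto simp: tensor_def FactGroup_def)

lemma relation_in_K: "r \<in> tensor_relations A M ra N la \<Longrightarrow> r \<in> K"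
  unfolding tensor_subgroup_def by (rule generate.incl)

lemma pure_closed: "\<lbrakk>x \<in> carrier M; y \<in> carrier N\<rbrakk> \<Longrightarrow> pure_tensor A M ra N la x y \<in> carrier T"
  unfolding pure_tensor_def T_carrier
  by (intro CollectI exI[of _ "frag_of (x, y)"]) (simp add: keys_frag_of)

lemma coset_eqI:
  assumes "Poly_Mapping.keys s \<subseteq> carrier M \<times> carrier N" "Poly_Mapping.keys t \<subseteq> carrier M \<times> carrier N"
    and "s - t \<in> K"
  shows "K #>\<^bsub>Fr\<^esub> s = K #>\<^bsub>Fr\<^esub> t"
proof -
  interpret Tg: group T by (rule T_group)
  have "(K #>\<^bsub>Fr\<^esub> (s - t)) \<otimes>\<^bsub>T\<^esub> (K #>\<^bsub>Fr\<^esub> t) = K #>\<^bsub>Fr\<^esub> (s - t + t)"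
    by (rule coset_mult) (use assms(1,2) keys_diff[of s t] in auto)
  moreover have "K #>\<^bsub>Fr\<^esub> t \<in> carrier T" using assms(2) T_carrier by blast
  ultimately show ?thesis using K_zero[OF assms(3)] by simp
qed

lemma pure_add_left:
  assumes "x \<in> carrier M" "x' \<in> carrier M" "y \<in> carrier N"
  shows "pure_tensor A M ra N la (x \<oplus>\<^bsub>M\<^esub> x') y = pure_tensor A M ra N la x y \<otimes>\<^bsub>T\<^esub> pure_tensor A M ra N la x' y"
proof -
  have "frag_of (x \<oplus>\<^bsub>M\<^esub> x', y) - frag_of (x, y) - frag_of (x', y) \<in> K"
    by (rule relation_in_K) (use assms in \<open>unfold tensor_relations_def, blast\<close>)
  then have "frag_of (x \<oplus>\<^bsub>M\<^esub> x', y) - (frag_of (x, y) + frag_of (x', y)) \<in> K" by (simp add: diff_diff_eq)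
  then have "K #>\<^bsub>Fr\<^esub> frag_of (x \<oplus>\<^bsub>M\<^esub> x', y) = K #>\<^bsub>Fr\<^esub> (frag_of (x, y) + frag_of (x', y))"
    by (rule coset_eqI[rotated 2])
      (use assms M_add keys_add[of "frag_of (x, y)" "frag_of (x', y)"] in \<open>auto simp: keys_frag_of\<close>)
  then show ?thesis
    unfolding pure_tensor_def using assms by (simp add: coset_mult keys_frag_of)
qed

lemma pure_add_right:
  assumes "x \<in> carrier M" "y \<in> carrier N" "y' \<in> carrier N"
  shows "pure_tensor A M ra N la x (y \<oplus>\<^bsub>N\<^esub> y') = pure_tensor A M ra N la x y \<otimes>\<^bsub>T\<^esub> pure_tensor A M ra N la x y'"
proof -
  have "frag_of (x, y \<oplus>\<^bsub>N\<^esub> y') - frag_of (x, y) - frag_of (x, y') \<in> K"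
    by (rule relation_in_K) (use assms in \<open>unfold tensor_relations_def, blast\<close>)
  then have "frag_of (x, y \<oplus>\<^bsub>N\<^esub> y') - (frag_of (x, y) + frag_of (x, y')) \<in> K" by (simp add: diff_diff_eq)
  then have "K #>\<^bsub>Fr\<^esub> frag_of (x, y \<oplus>\<^bsub>N\<^esub> y') = K #>\<^bsub>Fr\<^esub> (frag_of (x, y) + frag_of (x, y'))"
    by (rule coset_eqI[rotated 2])
      (use assms N_add keys_add[of "frag_of (x, y)" "frag_of (x, y')"] in \<open>auto simp: keys_frag_of\<close>)
  then show ?thesis
    unfolding pure_tensor_def using assms by (simp add: coset_mult keys_frag_of)
qed

lemma pure_balanced:
  assumes "x \<in> carrier M" "a \<in> A" "y \<in> carrier N"
  shows "pure_tensor A M ra N la (ra x a) y = pure_tensor A M ra N la x (la a y)"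
  unfolding pure_tensor_def
proof (rule coset_eqI)
  show "frag_of (ra x a, y) - frag_of (x, la a y) \<in> K"
    by (rule relation_in_K) (use assms in \<open>unfold tensor_relations_def, blast\<close>)
qed (use assms ra_closed la_closed in \<open>auto simp: keys_frag_of\<close>)

context
  fixes G :: "('g, 'z) monoid_scheme" and h :: "'m \<Rightarrow> 'n \<Rightarrow> 'g"
  assumes G: "comm_group G"
    and h_closed: "\<And>x y. \<lbrakk>x \<in> carrier M; y \<in> carrier N\<rbrakk> \<Longrightarrow> h x y \<in> carrier G"
    and h_left: "\<And>x x' y. \<lbrakk>x \<in> carrier M; x' \<in> carrier M; y \<in> carrier N\<rbrakk>
      \<Longrightarrow> h (x \<oplus>\<^bsub>M\<^esub> x') y = h x y \<otimes>\<^bsub>G\<^esub> h x' y"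
    and h_right: "\<And>x y y'. \<lbrakk>x \<in> carrier M; y \<in> carrier N; y' \<in> carrier N\<rbrakk>
      \<Longrightarrow> h x (y \<oplus>\<^bsub>N\<^esub> y') = h x y \<otimes>\<^bsub>G\<^esub> h x y'"
    and h_balanced: "\<And>x a y. \<lbrakk>x \<in> carrier M; a \<in> A; y \<in> carrier N\<rbrakk> \<Longrightarrow> h (ra x a) y = h x (la a y)"
begin

text \<open>A biadditive balanced map sends each of the three kinds of relations to the unit, and
  the formal sums sent to the unit are closed under sums and negatives.\<close>

lemma frag_lift_K: "r \<in> K \<Longrightarrow> frag_lift G h r = \<one>\<^bsub>G\<^esub>"
proof -
  interpret G: comm_group G by (rule G)
  let ?X = "carrier M \<times> carrier N"
  have hX: "h x y \<in> carrier G" if "(x, y) \<in> ?X" for x y using that h_closed by blast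
  have k: "Poly_Mapping.keys (frag_of (x, y)) \<subseteq> ?X" if "x \<in> carrier M" "y \<in> carrier N" for x y
    using that by (simp add: keys_frag_of)
  have d: "frag_lift G h (s - t) = frag_lift G h s \<otimes>\<^bsub>G\<^esub> inv\<^bsub>G\<^esub> (frag_lift G h t)"
    if "Poly_Mapping.keys s \<subseteq> ?X" "Poly_Mapping.keys t \<subseteq> ?X" for s t
    using that hX by (rule G.frag_lift_diff)
  have kd: "Poly_Mapping.keys (s - t) \<subseteq> ?X" if "Poly_Mapping.keys s \<subseteq> ?X" "Poly_Mapping.keys t \<subseteq> ?X" for s t :: "('m \<times> 'n) \<Rightarrow>\<^sub>0 int"
    using keys_diff[of s t] that by blast
  have rel: "frag_lift G h r = \<one>\<^bsub>G\<^esub>" if r: "r \<in> tensor_relations A M ra N la" for r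
  proof -
    consider (1) x x' y where "x \<in> carrier M" "x' \<in> carrier M" "y \<in> carrier N"
        "r = frag_of (x \<oplus>\<^bsub>M\<^esub> x', y) - frag_of (x, y) - frag_of (x', y)"
      | (2) x y y' where "x \<in> carrier M" "y \<in> carrier N" "y' \<in> carrier N"
        "r = frag_of (x, y \<oplus>\<^bsub>N\<^esub> y') - frag_of (x, y) - frag_of (x, y')"
      | (3) x a y where "x \<in> carrier M" "a \<in> A" "y \<in> carrier N" "r = frag_of (ra x a, y) - frag_of (x, la a y)"
      using r[unfolded tensor_relations_def] by blast
    then show ?thesis
    proof cases
      case (1 x x' y)
      let ?a = "h x y" and ?b = "h x' y"
      have ab: "?a \<in> carrier G" "?b \<in> carrier G" using 1 h_closed by auto
      have k1: "Poly_Mapping.keys (frag_of (x \<oplus>\<^bsub>M\<^esub> x', y)) \<subseteq> ?X" "Poly_Mapping.keys (frag_of (x, y)) \<subseteq> ?X"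
        "Poly_Mapping.keys (frag_of (x', y)) \<subseteq> ?X"
        using 1 k M_add by blast+
      have "frag_lift G h r = frag_lift G h (frag_of (x \<oplus>\<^bsub>M\<^esub> x', y)) \<otimes>\<^bsub>G\<^esub> inv\<^bsub>G\<^esub> (frag_lift G h (frag_of (x, y)))
          \<otimes>\<^bsub>G\<^esub> inv\<^bsub>G\<^esub> (frag_lift G h (frag_of (x', y)))"
        unfolding 1(4) d[OF kd[OF k1(1,2)] k1(3)] d[OF k1(1,2)] ..
      also have "\<dots> = ?a \<otimes>\<^bsub>G\<^esub> ?b \<otimes>\<^bsub>G\<^esub> inv\<^bsub>G\<^esub> ?a \<otimes>\<^bsub>G\<^esub> inv\<^bsub>G\<^esub> ?b"
        using ab h_left[OF 1(1-3)] 1(1-3) by (simp add: G.frag_lift_of h_closed M_add)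
      also have "\<dots> = ?b \<otimes>\<^bsub>G\<^esub> (?a \<otimes>\<^bsub>G\<^esub> inv\<^bsub>G\<^esub> ?a) \<otimes>\<^bsub>G\<^esub> inv\<^bsub>G\<^esub> ?b"
        using ab by (simp only: G.m_comm[of ?a ?b] G.m_assoc G.inv_closed G.m_closed)
      also have "\<dots> = \<one>\<^bsub>G\<^esub>" using ab by simp
      finally show ?thesis .
    next
      case (2 x y y')
      let ?a = "h x y" and ?b = "h x y'"
      have ab: "?a \<in> carrier G" "?b \<in> carrier G" using 2 h_closed by auto
      have k1: "Poly_Mapping.keys (frag_of (x, y \<oplus>\<^bsub>N\<^esub> y')) \<subseteq> ?X" "Poly_Mapping.keys (frag_of (x, y)) \<subseteq> ?X"
        "Poly_Mapping.keys (frag_of (x, y')) \<subseteq> ?X"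
        using 2 k N_add by blast+
      have "frag_lift G h r = frag_lift G h (frag_of (x, y \<oplus>\<^bsub>N\<^esub> y')) \<otimes>\<^bsub>G\<^esub> inv\<^bsub>G\<^esub> (frag_lift G h (frag_of (x, y)))
          \<otimes>\<^bsub>G\<^esub> inv\<^bsub>G\<^esub> (frag_lift G h (frag_of (x, y')))"
        unfolding 2(4) d[OF kd[OF k1(1,2)] k1(3)] d[OF k1(1,2)] ..
      also have "\<dots> = ?a \<otimes>\<^bsub>G\<^esub> ?b \<otimes>\<^bsub>G\<^esub> inv\<^bsub>G\<^esub> ?a \<otimes>\<^bsub>G\<^esub> inv\<^bsub>G\<^esub> ?b"
        using ab h_right[OF 2(1-3)] 2(1-3) by (simp add: G.frag_lift_of h_closed N_add)
      also have "\<dots> = ?b \<otimes>\<^bsub>G\<^esub> (?a \<otimes>\<^bsub>G\<^esub> inv\<^bsub>G\<^esub> ?a) \<otimes>\<^bsub>G\<^esub> inv\<^bsub>G\<^esub> ?b"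
        using ab by (simp only: G.m_comm[of ?a ?b] G.m_assoc G.inv_closed G.m_closed)
      also have "\<dots> = \<one>\<^bsub>G\<^esub>" using ab by simp
      finally show ?thesis .
    next
      case 3
      then show ?thesis
        by (simp add: d k ra_closed la_closed G.frag_lift_of h_closed h_balanced G.r_inv)
    qed
  qed
  assume "r \<in> K"
  then have "r \<in> generate Fr (tensor_relations A M ra N la)" by (simp add: tensor_subgroup_def)
  then have "Poly_Mapping.keys r \<subseteq> ?X \<and> frag_lift G h r = \<one>\<^bsub>G\<^esub>"
  proof (induction rule: generate.induct)
    case (incl r)
    then show ?case using rel[OF incl] subsetD[OF relations_carrier incl] by simp
  next
    case (inv r)
    then have "Poly_Mapping.keys r \<subseteq> ?X" using subsetD[OF relations_carrier inv] by simp
    then show ?case using rel[OF inv] G.frag_lift_minus[of r ?X h] hX by simp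
  next
    case (eng r t)
    then show ?case using G.frag_lift_add[of r ?X t h] hX keys_add[of r t] by auto
  qed auto
  then show ?thesis by simp
qed

text \<open>Two representatives of a coset differ by an element of \<open>K\<close>, on which the
  induced map is trivial. The definite description in \<open>tensor_lift\<close> therefore denotes,
  and any representative may be used to evaluate it.\<close>

lemma tensor_lift_coset:
  assumes s: "Poly_Mapping.keys s \<subseteq> carrier M \<times> carrier N"
  shows "tensor_lift G h (K #>\<^bsub>Fr\<^esub> s) = frag_lift G h s"
proof -
  interpret G: comm_group G by (rule G)
  let ?X = "carrier M \<times> carrier N"
  have hX: "h x y \<in> carrier G" if "(x, y) \<in> ?X" for x y using that h_closed by blast
  have val: "frag_lift G h t = frag_lift G h s" if "t \<in> K #>\<^bsub>Fr\<^esub> s" for t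
  proof -
    from that obtain r where r: "r \<in> K" "t = r + s" unfolding r_coset_def mult_free_Abelian_group by blast
    have "Poly_Mapping.keys r \<subseteq> ?X"
      using subsetD[OF subgroup.subset[OF K_subgroup] r(1)] by simp
    then show ?thesis
      using G.frag_lift_add[of r ?X s h] hX s r frag_lift_K[OF r(1)] G.frag_lift_closed[of s ?X h] by simp
  qed
  have "s \<in> K #>\<^bsub>Fr\<^esub> s"
    using group.rcos_self[OF group_free_Abelian_group _ K_subgroup, of s] s by simp
  then show ?thesis
    unfolding tensor_lift_def frag_lift_def[symmetric] by (intro the_equality) (blast, metis val)
qed

lemma tensor_lift_hom: "tensor_lift G h \<in> hom T G"
proof -
  interpret G: comm_group G by (rule G)
  let ?X = "carrier M \<times> carrier N"
  have hX: "h x y \<in> carrier G" if "(x, y) \<in> ?X" for x y using that h_closed by blast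
  show ?thesis
  proof (rule homI)
    fix x assume "x \<in> carrier T"
    then show "tensor_lift G h x \<in> carrier G"
      using tensor_lift_coset G.frag_lift_closed[of _ ?X h] hX by (auto simp: T_carrier)
  next
    fix x y assume "x \<in> carrier T" "y \<in> carrier T"
    then obtain s t where st: "x = K #>\<^bsub>Fr\<^esub> s" "y = K #>\<^bsub>Fr\<^esub> t" "Poly_Mapping.keys s \<subseteq> ?X" "Poly_Mapping.keys t \<subseteq> ?X"
      unfolding T_carrier by blast
    then have "Poly_Mapping.keys (s + t) \<subseteq> ?X" using keys_add[of s t] by blast
    then show "tensor_lift G h (x \<otimes>\<^bsub>T\<^esub> y) = tensor_lift G h x \<otimes>\<^bsub>G\<^esub> tensor_lift G h y"
      using st G.frag_lift_add[of s ?X t h] hX by (simp add: coset_mult tensor_lift_coset)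
  qed
qed

lemma tensor_lift_pure: "\<lbrakk>x \<in> carrier M; y \<in> carrier N\<rbrakk> \<Longrightarrow> tensor_lift G h (pure_tensor A M ra N la x y) = h x y"
  unfolding pure_tensor_def
  using tensor_lift_coset[of "frag_of (x, y)"] comm_group.frag_lift_of[OF G, of h x y] h_closed[of x y]
  by (simp add: keys_frag_of)

end

end

lemma (in comm_group) frag_lift_cong:
  assumes "Poly_Mapping.keys s \<subseteq> X" "\<And>x y. (x, y) \<in> X \<Longrightarrow> h' x y \<in> carrier G"
    and "\<And>x y. (x, y) \<in> X \<Longrightarrow> h x y = h' x y"
  shows "frag_lift G h s = frag_lift G h' s"
  unfolding frag_lift_def
proof (rule finprod_cong')
  fix p assume "p \<in> Poly_Mapping.keys s"
  then have "(fst p, snd p) \<in> X" using assms(1) by auto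
  then show "h (fst p) (snd p) [^] Poly_Mapping.lookup s p = h' (fst p) (snd p) [^] Poly_Mapping.lookup s p"
    using assms(3) by simp
next
  show "(\<lambda>p. h' (fst p) (snd p) [^] Poly_Mapping.lookup s p) \<in> Poly_Mapping.keys s \<rightarrow> carrier G"
    using assms(1,2) by (auto simp: split_paired_all)
qed simp

section \<open>The subcategory of E-modules\<close>

text \<open>The condition on kernels, with the elements of the tensor products represented by formal
  sums of pairs.\<close>

definition kernel_condition :: "nat \<Rightarrow> 'a graded \<Rightarrow> ('a \<Rightarrow> 'e) \<Rightarrow> ('e, 'u) graded_module \<Rightarrow> bool" where
  "kernel_condition n D \<phi> V \<longleftrightarrow> (\<forall>k. \<forall>b \<in> component D (int n - 1). \<forall>s.
     Poly_Mapping.keys s \<subseteq> component V (2 * k) \<times> component D 1 \<longrightarrow>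
     frag_lift (add_monoid V) (\<lambda>v a. act V v (\<phi> a)) s = \<zero>\<^bsub>V\<^esub> \<longrightarrow>
     frag_lift (add_monoid V) (\<lambda>v a. act V v (\<phi> (a \<otimes>\<^bsub>D\<^esub> b))) s = \<zero>\<^bsub>V\<^esub>)"

locale truncation_vmodule = truncation D E \<phi> n m + V: graded_right_module E V
  for D :: "'a graded" and E :: "'e graded" and \<phi> :: "'a \<Rightarrow> 'e" and n :: nat and m :: int
    and V :: "('e, 'u) graded_module"
begin

definition star :: "'u \<Rightarrow> 'a \<Rightarrow> 'u" (infixl \<open>\<star>\<close> 75) where
  "v \<star> a = act V v (\<phi> a)"

lemma star_closed: "\<lbrakk>v \<in> carrier V; a \<in> DU\<rbrakk> \<Longrightarrow> v \<star> a \<in> carrier V"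
  by (simp add: star_def V.act_closed \<phi>_closed)

lemma star_component: "\<lbrakk>v \<in> component V i; a \<in> component D (\<delta> j)\<rbrakk> \<Longrightarrow> v \<star> a \<in> component V (i + j)"
  by (simp add: star_def V.act_degree \<phi>_component)

lemma star_add_left:
  "\<lbrakk>v \<in> carrier V; w \<in> carrier V; a \<in> DU\<rbrakk> \<Longrightarrow> (v \<oplus>\<^bsub>V\<^esub> w) \<star> a = v \<star> a \<oplus>\<^bsub>V\<^esub> w \<star> a"
  by (simp add: star_def V.act_add_left \<phi>_closed)

lemma star_add_right:
  "\<lbrakk>v \<in> carrier V; a \<in> DU; b \<in> DU\<rbrakk> \<Longrightarrow> v \<star> (a \<oplus>\<^bsub>D\<^esub> b) = v \<star> a \<oplus>\<^bsub>V\<^esub> v \<star> b"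
  by (simp add: star_def V.act_add_right \<phi>_closed \<phi>_add)

lemma star_assoc:
  "\<lbrakk>v \<in> carrier V; a \<in> DU; b \<in> DU\<rbrakk> \<Longrightarrow> v \<star> a \<star> b = v \<star> hproj D U (a \<otimes>\<^bsub>D\<^esub> b)"
  by (simp add: star_def V.act_assoc \<phi>_closed \<phi>_mult)

lemma star_zero_left: "a \<in> DU \<Longrightarrow> \<zero>\<^bsub>V\<^esub> \<star> a = \<zero>\<^bsub>V\<^esub>"
  by (simp add: star_def \<phi>_closed)

lemma star_zero_right: "v \<in> carrier V \<Longrightarrow> v \<star> \<zero>\<^bsub>D\<^esub> = \<zero>\<^bsub>V\<^esub>"
  by (simp add: star_def \<phi>_zero)

lemma one_in_U: "1 \<in> U" and n_in_U: "int n \<in> U"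
  using koszul_degree_in_U[OF n2, of 1] koszul_degree_in_U[OF n2, of 2] by (simp_all add: koszul_degree_def)

lemma star_assoc_component:
  assumes "v \<in> carrier V" "a \<in> component D i" "b \<in> component D j" "i \<in> U" "j \<in> U" "i + j \<in> U"
  shows "v \<star> a \<star> b = v \<star> (a \<otimes>\<^bsub>D\<^esub> b)"
proof -
  have "hproj D U (a \<otimes>\<^bsub>D\<^esub> b) = a \<otimes>\<^bsub>D\<^esub> b"
    using D.hproj_of_component[OF D.mult_degree[OF assms(2,3)], of U] assms(6) by simp
  then show ?thesis using star_assoc[OF assms(1)] assms DU_component by metis
qed

lemma tensor_data_V:
  "tensor_data (component D 0) (V_even V k) (\<lambda>v a. act V v (\<phi> a)) (D\<lparr>carrier := component D j\<rparr>) (mult D)"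
proof
  fix x a y
  show "x \<in> carrier (V_even V k) \<Longrightarrow> a \<in> component D 0 \<Longrightarrow> act V x (\<phi> a) \<in> carrier (V_even V k)"
    using star_component[of x "2 * k" a 0] by (simp add: V_even_def star_def koszul_degree_def)
  show "a \<in> component D 0 \<Longrightarrow> y \<in> carrier (D\<lparr>carrier := component D j\<rparr>) \<Longrightarrow>
      a \<otimes>\<^bsub>D\<^esub> y \<in> carrier (D\<lparr>carrier := component D j\<rparr>)"
    using D.mult_degree[of a 0 y j] by simp
qed (auto simp: V_even_def V.M.component_add D.component_add)

lemma V_comm_group: "comm_group (add_monoid V)"
  by (rule V.M.a_comm_group)

text \<open>The action is balanced over D_0 because multiplying by degree 0 keeps the degree j in
  \<U>, so no product is truncated.\<close>

lemma mult_map_facts: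
  assumes j: "j \<in> U"
  shows mult_map_coset: "Poly_Mapping.keys s \<subseteq> component V (2 * k) \<times> component D j \<Longrightarrow>
      mult_map \<phi> V (tensor_subgroup (component D 0) (V_even V k) (\<lambda>v a. act V v (\<phi> a)) (D\<lparr>carrier := component D j\<rparr>) (mult D)
        #>\<^bsub>free_Abelian_group (component V (2 * k) \<times> component D j)\<^esub> s)
      = frag_lift (add_monoid V) (\<star>) s"
    and mult_map_hom: "mult_map \<phi> V \<in> hom (V_tensor D \<phi> V k j) (add_monoid V)"
    and mult_map_pure: "\<lbrakk>v \<in> component V (2 * k); a \<in> component D j\<rbrakk> \<Longrightarrow>
      mult_map \<phi> V (pure_tensor (component D 0) (V_even V k) (\<lambda>v a. act V v (\<phi> a)) (D\<lparr>carrier := component D j\<rparr>) (mult D) v a)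
      = v \<star> a"
proof -
  interpret td: tensor_data "component D 0" "V_even V k" "\<lambda>v a. act V v (\<phi> a)" "D\<lparr>carrier := component D j\<rparr>" "mult D"
    by (rule tensor_data_V)
  have mm: "mult_map \<phi> V = tensor_lift (add_monoid V) (\<star>)"
    by (simp add: mult_map_def star_def[abs_def])
  have aU: "a \<in> DU" if "a \<in> component D j" for a using that j DU_component by blast
  have vc: "v \<in> carrier V" if "v \<in> component V (2 * k)" for v using that V.M.component_carrier by blast
  have 1: "v \<star> a \<in> carrier (add_monoid V)"
    if "v \<in> carrier (V_even V k)" "a \<in> carrier (D\<lparr>carrier := component D j\<rparr>)" for v a
    using that star_closed vc aU by (simp add: V_even_def)
  have 2: "(v \<oplus>\<^bsub>V_even V k\<^esub> w) \<star> a = (v \<star> a) \<otimes>\<^bsub>add_monoid V\<^esub> (w \<star> a)"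
    if "v \<in> carrier (V_even V k)" "w \<in> carrier (V_even V k)" "a \<in> carrier (D\<lparr>carrier := component D j\<rparr>)" for v w a
    using that star_add_left vc aU by (simp add: V_even_def)
  have 3: "v \<star> (a \<oplus>\<^bsub>D\<lparr>carrier := component D j\<rparr>\<^esub> b) = (v \<star> a) \<otimes>\<^bsub>add_monoid V\<^esub> (v \<star> b)"
    if "v \<in> carrier (V_even V k)" "a \<in> carrier (D\<lparr>carrier := component D j\<rparr>)" "b \<in> carrier (D\<lparr>carrier := component D j\<rparr>)" for v a b
    using that star_add_right vc aU by (simp add: V_even_def)
  have 4: "act V v (\<phi> c) \<star> a = v \<star> (c \<otimes>\<^bsub>D\<^esub> a)"
    if "v \<in> carrier (V_even V k)" "c \<in> component D 0" "a \<in> carrier (D\<lparr>carrier := component D j\<rparr>)" for v c a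
    using that star_assoc_component[of v c 0 a j] vc j by (simp add: V_even_def star_def)
  note facts = V_comm_group 1 2 3 4
  show "mult_map \<phi> V \<in> hom (V_tensor D \<phi> V k j) (add_monoid V)"
    unfolding mm V_tensor_def by (rule td.tensor_lift_hom[OF facts])
  show "mult_map \<phi> V (tensor_subgroup (component D 0) (V_even V k) (\<lambda>v a. act V v (\<phi> a)) (D\<lparr>carrier := component D j\<rparr>) (mult D)
        #>\<^bsub>free_Abelian_group (component V (2 * k) \<times> component D j)\<^esub> s)
      = frag_lift (add_monoid V) (\<star>) s" if "Poly_Mapping.keys s \<subseteq> component V (2 * k) \<times> component D j"
    using td.tensor_lift_coset[OF facts, of s] that unfolding mm by (simp add: V_even_def)
  show "mult_map \<phi> V (pure_tensor (component D 0) (V_even V k) (\<lambda>v a. act V v (\<phi> a)) (D\<lparr>carrier := component D j\<rparr>) (mult D) v a)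
      = v \<star> a" if "v \<in> component V (2 * k)" "a \<in> component D j"
    using td.tensor_lift_pure[OF facts, of v a] that unfolding mm by (simp add: V_even_def)
qed

text \<open>On representatives, multiplication by b followed by the multiplication map sends a sum
  of pairs (v, a) to the sum of the v (a b). This removes the tensor products from the condition on
  kernels.\<close>

lemma mult_map_V_tensor_mult:
  assumes b: "b \<in> component D (int n - 1)" and s: "Poly_Mapping.keys s \<subseteq> component V (2 * k) \<times> component D 1"
  defines "t \<equiv> tensor_subgroup (component D 0) (V_even V k) (\<lambda>v a. act V v (\<phi> a)) (D\<lparr>carrier := component D 1\<rparr>) (mult D)
        #>\<^bsub>free_Abelian_group (component V (2 * k) \<times> component D 1)\<^esub> s"
  shows "V_tensor_mult D \<phi> V k (int n) t b \<in> carrier (V_tensor D \<phi> V k (int n))"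
    and "mult_map \<phi> V (V_tensor_mult D \<phi> V k (int n) t b)
      = frag_lift (add_monoid V) (\<lambda>v a. v \<star> (a \<otimes>\<^bsub>D\<^esub> b)) s"
proof -
  interpret td: tensor_data "component D 0" "V_even V k" "\<lambda>v a. act V v (\<phi> a)" "D\<lparr>carrier := component D 1\<rparr>" "mult D"
    by (rule tensor_data_V)
  interpret tn: tensor_data "component D 0" "V_even V k" "\<lambda>v a. act V v (\<phi> a)" "D\<lparr>carrier := component D (int n)\<rparr>" "mult D"
    by (rule tensor_data_V)
  let ?T = "V_tensor D \<phi> V k (int n)" and ?X = "component V (2 * k) \<times> component D 1"
  let ?p = "pure_tensor (component D 0) (V_even V k) (\<lambda>v a. act V v (\<phi> a)) (D\<lparr>carrier := component D (int n)\<rparr>) (mult D)"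
  have bc: "b \<in> carrier D" using b D.component_carrier by blast
  have ab: "a \<otimes>\<^bsub>D\<^esub> b \<in> component D (int n)" if "a \<in> component D 1" for a
    using D.mult_degree[OF that b] by simp
  have T: "comm_group ?T" unfolding V_tensor_def by (rule tn.T_comm_group)
  interpret T: comm_group ?T by (rule T)
  have 1: "?p v (a \<otimes>\<^bsub>D\<^esub> b) \<in> carrier ?T"
    if "v \<in> carrier (V_even V k)" "a \<in> carrier (D\<lparr>carrier := component D 1\<rparr>)" for v a
    unfolding V_tensor_def by (rule tn.pure_closed) (use that ab in auto)
  have 2: "?p (v \<oplus>\<^bsub>V_even V k\<^esub> w) (a \<otimes>\<^bsub>D\<^esub> b) = ?p v (a \<otimes>\<^bsub>D\<^esub> b) \<otimes>\<^bsub>?T\<^esub> ?p w (a \<otimes>\<^bsub>D\<^esub> b)"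
    if "v \<in> carrier (V_even V k)" "w \<in> carrier (V_even V k)" "a \<in> carrier (D\<lparr>carrier := component D 1\<rparr>)" for v w a
    unfolding V_tensor_def by (rule tn.pure_add_left) (use that ab in auto)
  have 3: "?p v ((a \<oplus>\<^bsub>D\<lparr>carrier := component D 1\<rparr>\<^esub> a') \<otimes>\<^bsub>D\<^esub> b) = ?p v (a \<otimes>\<^bsub>D\<^esub> b) \<otimes>\<^bsub>?T\<^esub> ?p v (a' \<otimes>\<^bsub>D\<^esub> b)"
    if "v \<in> carrier (V_even V k)" "a \<in> carrier (D\<lparr>carrier := component D 1\<rparr>)" "a' \<in> carrier (D\<lparr>carrier := component D 1\<rparr>)" for v a a'
    using tn.pure_add_right[of v "a \<otimes>\<^bsub>D\<^esub> b" "a' \<otimes>\<^bsub>D\<^esub> b"] that ab bc D.component_carrier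
    unfolding V_tensor_def by (simp add: D.l_distr)
  have 4: "?p (act V v (\<phi> c)) (a \<otimes>\<^bsub>D\<^esub> b) = ?p v ((c \<otimes>\<^bsub>D\<^esub> a) \<otimes>\<^bsub>D\<^esub> b)"
    if "v \<in> carrier (V_even V k)" "c \<in> component D 0" "a \<in> carrier (D\<lparr>carrier := component D 1\<rparr>)" for v c a
    using tn.pure_balanced[of v c "a \<otimes>\<^bsub>D\<^esub> b"] that ab bc D.component_carrier by (simp add: D.m_assoc)
  have hX: "?p v (a \<otimes>\<^bsub>D\<^esub> b) \<in> carrier ?T" if "(v, a) \<in> ?X" for v a
    using 1[of v a] that by (simp add: V_even_def)
  have eq: "V_tensor_mult D \<phi> V k (int n) t b = frag_lift ?T (\<lambda>v a. ?p v (a \<otimes>\<^bsub>D\<^esub> b)) s"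
    using td.tensor_lift_coset[OF T, of "\<lambda>v a. ?p v (a \<otimes>\<^bsub>D\<^esub> b)" s] 1 2 3 4 s
    unfolding V_tensor_mult_def t_def by (simp add: V_even_def)
  show "V_tensor_mult D \<phi> V k (int n) t b \<in> carrier ?T"
    unfolding eq using s hX by (rule T.frag_lift_closed)
  have "mult_map \<phi> V (V_tensor_mult D \<phi> V k (int n) t b)
      = frag_lift (add_monoid V) (\<lambda>v a. mult_map \<phi> V (?p v (a \<otimes>\<^bsub>D\<^esub> b))) s"
    unfolding eq
    by (rule T.frag_lift_hom[where X = ?X])
      (use mult_map_hom[OF n_in_U] V_comm_group V.M.a_group s hX in auto)
  also have "\<dots> = frag_lift (add_monoid V) (\<lambda>v a. v \<star> (a \<otimes>\<^bsub>D\<^esub> b)) s"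
  proof (rule comm_group.frag_lift_cong[OF V_comm_group s])
    fix v a assume va: "(v, a) \<in> ?X"
    then show "mult_map \<phi> V (?p v (a \<otimes>\<^bsub>D\<^esub> b)) = v \<star> (a \<otimes>\<^bsub>D\<^esub> b)"
      using mult_map_pure[OF n_in_U] ab by simp
    show "v \<star> (a \<otimes>\<^bsub>D\<^esub> b) \<in> carrier (add_monoid V)"
      using va ab DU_component[OF _ n_in_U] star_closed V.M.component_carrier by auto
  qed
  finally show "mult_map \<phi> V (V_tensor_mult D \<phi> V k (int n) t b)
      = frag_lift (add_monoid V) (\<lambda>v a. v \<star> (a \<otimes>\<^bsub>D\<^esub> b)) s" .
qed

lemma kernel_condition_iff:
  "kernel_condition n D \<phi> V \<longleftrightarrow> (\<forall>k. \<forall>b \<in> component D (int n - 1). \<forall>s.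
     Poly_Mapping.keys s \<subseteq> component V (2 * k) \<times> component D 1 \<longrightarrow>
     frag_lift (add_monoid V) (\<star>) s = \<zero>\<^bsub>V\<^esub> \<longrightarrow>
     frag_lift (add_monoid V) (\<lambda>v a. v \<star> (a \<otimes>\<^bsub>D\<^esub> b)) s = \<zero>\<^bsub>V\<^esub>)"
  unfolding kernel_condition_def star_def[abs_def] ..

text \<open>\<open>Ker_mu2\<close> is a subgroup, so containing the generated subgroup means
  containing its generators; these are then computed on representatives of the elements of
  \<open>Ker_mu1\<close>.\<close>

lemma in_L_iff:
  "in_L n D E \<phi> V \<longleftrightarrow> generated_in_degrees E V {i. even i} \<and> kernel_condition n D \<phi> V"
proof -
  have "generate (V_tensor D \<phi> V k (int n))
            {V_tensor_mult D \<phi> V k (int n) t b | t b. t \<in> Ker_mu1 D \<phi> V k \<and> b \<in> component D (int n - 1)}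
          \<subseteq> Ker_mu2 n D \<phi> V k \<longleftrightarrow> (\<forall>b \<in> component D (int n - 1). \<forall>s.
     Poly_Mapping.keys s \<subseteq> component V (2 * k) \<times> component D 1 \<longrightarrow>
     frag_lift (add_monoid V) (\<star>) s = \<zero>\<^bsub>V\<^esub> \<longrightarrow>
     frag_lift (add_monoid V) (\<lambda>v a. v \<star> (a \<otimes>\<^bsub>D\<^esub> b)) s = \<zero>\<^bsub>V\<^esub>)" (is "?L \<longleftrightarrow> ?R") for k
  proof -
    let ?T = "V_tensor D \<phi> V k (int n)"
    let ?G = "{V_tensor_mult D \<phi> V k (int n) t b | t b. t \<in> Ker_mu1 D \<phi> V k \<and> b \<in> component D (int n - 1)}"
    let ?c = "\<lambda>s. tensor_subgroup (component D 0) (V_even V k) (\<lambda>v a. act V v (\<phi> a)) (D\<lparr>carrier := component D 1\<rparr>) (mult D)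
        #>\<^bsub>free_Abelian_group (component V (2 * k) \<times> component D 1)\<^esub> s"
    interpret td: tensor_data "component D 0" "V_even V k" "\<lambda>v a. act V v (\<phi> a)" "D\<lparr>carrier := component D 1\<rparr>" "mult D"
      by (rule tensor_data_V)
    interpret tn: tensor_data "component D 0" "V_even V k" "\<lambda>v a. act V v (\<phi> a)" "D\<lparr>carrier := component D (int n)\<rparr>" "mult D"
      by (rule tensor_data_V)
    have T: "group ?T" unfolding V_tensor_def by (rule tn.T_group)
    have hom: "group_hom ?T (add_monoid V) (mult_map \<phi> V)"
      using T V.M.a_group mult_map_hom[OF n_in_U, of k] by (simp add: group_hom_def group_hom_axioms_def)
    have K: "subgroup (Ker_mu2 n D \<phi> V k) ?T"
      unfolding Ker_mu2_def by (rule group_hom.subgroup_kernel[OF hom])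
    have T1: "carrier (V_tensor D \<phi> V k 1) = {?c s | s. Poly_Mapping.keys s \<subseteq> component V (2 * k) \<times> component D 1}"
      using td.T_carrier unfolding V_tensor_def by (simp add: V_even_def)
    have ker1: "Ker_mu1 D \<phi> V k = {?c s | s. Poly_Mapping.keys s \<subseteq> component V (2 * k) \<times> component D 1 \<and>
        frag_lift (add_monoid V) (\<star>) s = \<zero>\<^bsub>V\<^esub>}"
      using mult_map_coset[OF one_in_U, of _ k] unfolding Ker_mu1_def kernel_def T1 by auto
    have "?L \<longleftrightarrow> ?G \<subseteq> Ker_mu2 n D \<phi> V k"
      using group.generate_subgroup_incl[OF T _ K] generate.incl[of _ ?G ?T] by blast
    also have "\<dots> \<longleftrightarrow> ?R"
    proof
      assume sub: "?G \<subseteq> Ker_mu2 n D \<phi> V k"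
      show ?R
      proof (intro ballI allI impI)
        fix b s assume b: "b \<in> component D (int n - 1)"
          and s: "Poly_Mapping.keys s \<subseteq> component V (2 * k) \<times> component D 1" "frag_lift (add_monoid V) (\<star>) s = \<zero>\<^bsub>V\<^esub>"
        have "?c s \<in> Ker_mu1 D \<phi> V k" unfolding ker1 using s by blast
        then have "V_tensor_mult D \<phi> V k (int n) (?c s) b \<in> Ker_mu2 n D \<phi> V k" using sub b by blast
        then show "frag_lift (add_monoid V) (\<lambda>v a. v \<star> (a \<otimes>\<^bsub>D\<^esub> b)) s = \<zero>\<^bsub>V\<^esub>"
          using mult_map_V_tensor_mult(2)[OF b s(1)] by (simp add: Ker_mu2_def kernel_def)
      qed
    next
      assume R: ?R
      show "?G \<subseteq> Ker_mu2 n D \<phi> V k"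
      proof
        fix g assume "g \<in> ?G"
        then obtain s b where b: "b \<in> component D (int n - 1)"
          and s: "Poly_Mapping.keys s \<subseteq> component V (2 * k) \<times> component D 1" "frag_lift (add_monoid V) (\<star>) s = \<zero>\<^bsub>V\<^esub>"
          and g: "g = V_tensor_mult D \<phi> V k (int n) (?c s) b"
          unfolding ker1 by blast
        show "g \<in> Ker_mu2 n D \<phi> V k"
          unfolding g Ker_mu2_def kernel_def
          using mult_map_V_tensor_mult[OF b s(1)] R[rule_format, OF b s] by simp
      qed
    qed
    finally show ?thesis .
  qed
  then show ?thesis unfolding in_L_def kernel_condition_iff by blast
qed

end

section \<open>Restrictions satisfy the condition on kernels\<close>

context truncation_module
begin

text \<open>An element b of degree n - 1 does not act on the restriction, but it does act on M.
  There the sum of the v (a b) is (the sum of the v a) b, which vanishes together with the sum in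
  brackets.\<close>

lemma kernel_condition_F: "kernel_condition n D \<phi> (F M)"
proof -
  interpret G: comm_group "add_monoid (F M)"
    by (rule abelian_group.a_comm_group[OF graded_group.axioms(1)[OF graded_group_F]])
  interpret FM: graded_right_module E "F M" by (rule graded_right_module_F)
  have FM: "abelian_group M" "additive_subgroup (carrier (F M)) M" "add (F M) = add M" "zero (F M) = zero M"
    using M.M.abelian_group_axioms M.M.homog_sum_subgroup by (simp_all add: F_simps)
  show ?thesis
    unfolding kernel_condition_def
  proof (intro allI ballI impI)
    fix k b s
    let ?X = "component (F M) (2 * k) \<times> component D 1"
    let ?f = "frag_lift (add_monoid (F M)) (\<lambda>v a. act (F M) v (\<phi> a))"
    let ?g = "frag_lift (add_monoid (F M)) (\<lambda>v a. act (F M) v (\<phi> (a \<otimes>\<^bsub>D\<^esub> b)))"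
    assume b: "b \<in> component D (int n - 1)" and s: "Poly_Mapping.keys s \<subseteq> ?X"
      and z: "?f s = \<zero>\<^bsub>F M\<^esub>"
    have bc: "b \<in> carrier D" using b D.component_carrier by blast
    have d: "\<delta> 1 = 1" "\<delta> 2 = int n" by (simp_all add: koszul_degree_def)
    have f1: "act (F M) v (\<phi> a) = act M v a" and g1: "act (F M) v (\<phi> (a \<otimes>\<^bsub>D\<^esub> b)) = act M (act M v a) b"
      and cl: "act M v a \<in> carrier (F M)" "act M (act M v a) b \<in> carrier (F M)"
      if va: "(v, a) \<in> ?X" for v a
    proof -
      have v: "v \<in> component M (m + \<delta> (2 * k))" and a: "a \<in> component D (\<delta> 1)"
        using va by (auto simp: F_simps d)
      have ab: "a \<otimes>\<^bsub>D\<^esub> b \<in> component D (\<delta> 2)" using D.mult_degree[of a 1 b "int n - 1"] a b d by simp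
      have c: "v \<in> carrier M" "a \<in> carrier D" using v a M.M.component_carrier D.component_carrier by auto
      show 1: "act (F M) v (\<phi> a) = act M v a" by (rule F_act[OF v a]) simp
      have "act (F M) v (\<phi> (a \<otimes>\<^bsub>D\<^esub> b)) = act M v (a \<otimes>\<^bsub>D\<^esub> b)" by (rule F_act[OF v ab]) simp
      then show 2: "act (F M) v (\<phi> (a \<otimes>\<^bsub>D\<^esub> b)) = act M (act M v a) b" using c bc by (simp add: M.act_assoc)
      have "v \<in> carrier (F M)" "\<phi> a \<in> carrier E" "\<phi> (a \<otimes>\<^bsub>D\<^esub> b) \<in> carrier E"
        using component_homog_sum[OF v] \<phi>_component[OF a] \<phi>_component[OF ab] E.component_carrier
        by (auto simp: F_simps)
      then show "act M v a \<in> carrier (F M)" "act M (act M v a) b \<in> carrier (F M)"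
        using FM.act_closed 1 2 by metis+
    qed
    \<comment> \<open>The equation has to be proved for every formal sum, not only for those in the
      kernel, so that it can be built up from pairs. Closure is carried along to make the inverses
      of F M and M comparable.\<close>
    have "?f s \<in> carrier (F M) \<and> ?g s = act M (?f s) b"
      using s
    proof (induction rule: G.frag_lift_induct)
      case zero
      have z0: "frag_lift (add_monoid (F M)) h 0 = \<zero>\<^bsub>M\<^esub>" for h :: "'u \<Rightarrow> 'a \<Rightarrow> 'u"
        using G.frag_lift_zero[of h] FM(4) by simp
      show ?case unfolding z0 using bc by (simp add: F_simps)
    next
      case (of v a)
      have "?f (frag_of (v, a)) = act (F M) v (\<phi> a)"
        by (rule G.frag_lift_of) (use f1[OF of] cl[OF of] in simp)
      moreover have "?g (frag_of (v, a)) = act (F M) v (\<phi> (a \<otimes>\<^bsub>D\<^esub> b))"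
        by (rule G.frag_lift_of) (use g1[OF of] cl[OF of] in simp)
      ultimately show ?case using f1[OF of] g1[OF of] cl[OF of] by simp
    next
      case (diff s t)
      have inv: "inv\<^bsub>add_monoid (F M)\<^esub> x = \<ominus>\<^bsub>M\<^esub> x" if "x \<in> carrier (F M)" for x
        using minus_restrict[OF FM that] by (simp add: a_inv_def)
      have f: "?f (s - t) = ?f s \<otimes>\<^bsub>add_monoid (F M)\<^esub> inv\<^bsub>add_monoid (F M)\<^esub> (?f t)"
        using diff(1,2) by (rule G.frag_lift_diff) (use f1 cl in simp)
      have g: "?g (s - t) = ?g s \<otimes>\<^bsub>add_monoid (F M)\<^esub> inv\<^bsub>add_monoid (F M)\<^esub> (?g t)"
        using diff(1,2) by (rule G.frag_lift_diff) (use g1 cl in simp)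
      have gt: "?g t \<in> carrier (add_monoid (F M))"
        using diff(2) by (rule G.frag_lift_closed) (use g1 cl in simp)
      have fst: "?f s \<in> carrier (F M)" "?f t \<in> carrier (F M)" "?f s \<in> carrier M" "?f t \<in> carrier M"
        using diff(3,4) FM_carrier by (simp_all add: F_simps)
      have "?f (s - t) \<in> carrier (F M)"
        unfolding f using G.m_closed[of "?f s" "inv\<^bsub>add_monoid (F M)\<^esub> (?f t)"] G.inv_closed[of "?f t"] fst by simp
      moreover have "?g (s - t) = act M (?f (s - t)) b"
        unfolding f g using diff(3,4) inv[OF fst(2)] inv[of "?g t"] gt fst bc
        by (simp add: F_simps M.act_add_left M.act_minus_left)
      ultimately show ?case by simp
    qed
    then show "?g s = \<zero>\<^bsub>F M\<^esub>" using z bc by (simp add: F_simps)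
  qed
qed

lemma in_L_F:
  assumes "generated_in_degrees D M (gen_degrees n m)"
  shows "in_L n D E \<phi> (F M)"
proof -
  interpret truncation_vmodule D E \<phi> n m "F M"
    by (intro truncation_vmodule.intro truncation_axioms graded_right_module_F)
  show ?thesis using in_L_iff generated_F[OF assms] kernel_condition_F by blast
qed

end

section \<open>The module of functions generated by an E-module\<close>

text \<open>The group of all additive maps from D to V with the right action (f c)(b) = f (c b). It
  is not graded itself, hence \<open>component\<close> is left open; only the submodule
  \<open>MV\<close> receives a grading. Extensionality makes equality of maps equality on D.\<close>

definition coinduced :: "'a graded \<Rightarrow> ('e, 'u) graded_module \<Rightarrow> ('a, 'a \<Rightarrow> 'u) graded_module" where
  "coinduced D V = \<lparr>carrier = {f \<in> extensional (carrier D). additive_map D V f},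
     mult = undefined, one = undefined,
     zero = (\<lambda>b\<in>carrier D. \<zero>\<^bsub>V\<^esub>), add = (\<lambda>f g. \<lambda>b\<in>carrier D. f b \<oplus>\<^bsub>V\<^esub> g b),
     component = undefined, act = (\<lambda>f c. \<lambda>b\<in>carrier D. f (c \<otimes>\<^bsub>D\<^esub> b))\<rparr>"

context truncation_vmodule
begin

abbreviation "CV \<equiv> coinduced D V"

text \<open>It plays the role of v a in the D-module to be built: the action of c takes \<theta> v a
  to \<theta> v (a c), so these functions are the multiples of \<theta> v 1.\<close>

definition \<theta> :: "'u \<Rightarrow> 'a \<Rightarrow> 'a \<Rightarrow> 'u" where
  "\<theta> v a = (\<lambda>b\<in>carrier D. v \<star> hproj D U (a \<otimes>\<^bsub>D\<^esub> b))"

text \<open>An element v of degree 2k is placed in degree m + nk, as restriction demands, and a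
  makes up the rest of d.\<close>

definition gens :: "int \<Rightarrow> ('a \<Rightarrow> 'u) set" where
  "gens d = {\<theta> v a | v a k. v \<in> component V (2 * k) \<and> a \<in> component D (d - m - int n * k)}"

text \<open>Components are spans of generators rather than sets of functions with a degree property.
  Generation is thereby built in, and directness of the sum is what has to be shown, by
  evaluation.\<close>

definition MV :: "('a, 'a \<Rightarrow> 'u) graded_module" where
  "MV = CV\<lparr>carrier := generate (add_monoid CV) (\<Union>d. gens d),
     component := (\<lambda>d. generate (add_monoid CV) (gens d))\<rparr>"

lemma CV_simps:
  "carrier CV = {f \<in> extensional (carrier D). additive_map D V f}"
  "zero CV = (\<lambda>b\<in>carrier D. \<zero>\<^bsub>V\<^esub>)" "add CV f g = (\<lambda>b\<in>carrier D. f b \<oplus>\<^bsub>V\<^esub> g b)"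
  "act CV f c = (\<lambda>b\<in>carrier D. f (c \<otimes>\<^bsub>D\<^esub> b))"
  by (simp_all add: coinduced_def)

lemma CVD: "f \<in> carrier CV \<Longrightarrow> f \<in> extensional (carrier D)" "f \<in> carrier CV \<Longrightarrow> additive_map D V f"
  "\<lbrakk>f \<in> carrier CV; b \<in> carrier D\<rbrakk> \<Longrightarrow> f b \<in> carrier V"
  "\<lbrakk>f \<in> carrier CV; b \<in> carrier D; c \<in> carrier D\<rbrakk> \<Longrightarrow> f (b \<oplus>\<^bsub>D\<^esub> c) = f b \<oplus>\<^bsub>V\<^esub> f c"
  by (auto simp: CV_simps additive_map_def)

lemma CV_add_closed: "\<lbrakk>f \<in> carrier CV; g \<in> carrier CV\<rbrakk> \<Longrightarrow> f \<oplus>\<^bsub>CV\<^esub> g \<in> carrier CV"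
  unfolding CV_simps(1) by (auto simp: CV_simps additive_map_def Pi_iff V.M.a_ac)

lemma CV_abelian_group: "abelian_group CV"
proof (rule abelian_groupI)
  show "\<exists>g\<in>carrier CV. g \<oplus>\<^bsub>CV\<^esub> f = \<zero>\<^bsub>CV\<^esub>" if f: "f \<in> carrier CV" for f
  proof
    let ?g = "\<lambda>b\<in>carrier D. \<ominus>\<^bsub>V\<^esub> f b"
    show "?g \<in> carrier CV"
      using CVD[OF f] unfolding CV_simps(1) by (auto simp: additive_map_def V.M.minus_add V.M.a_comm)
    show "?g \<oplus>\<^bsub>CV\<^esub> f = \<zero>\<^bsub>CV\<^esub>"
      using CVD(3)[OF f] by (auto simp: CV_simps fun_eq_iff V.M.l_neg)
  qed
  show "\<zero>\<^bsub>CV\<^esub> \<in> carrier CV" unfolding CV_simps(1) by (auto simp: CV_simps additive_map_def)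
  show "f \<oplus>\<^bsub>CV\<^esub> g \<oplus>\<^bsub>CV\<^esub> h = f \<oplus>\<^bsub>CV\<^esub> (g \<oplus>\<^bsub>CV\<^esub> h)" if "f \<in> carrier CV" "g \<in> carrier CV" "h \<in> carrier CV" for f g h
    using CVD(3)[OF that(1)] CVD(3)[OF that(2)] CVD(3)[OF that(3)] by (auto simp: CV_simps fun_eq_iff V.M.a_assoc)
  show "f \<oplus>\<^bsub>CV\<^esub> g = g \<oplus>\<^bsub>CV\<^esub> f" if "f \<in> carrier CV" "g \<in> carrier CV" for f g
    using CVD(3)[OF that(1)] CVD(3)[OF that(2)] by (auto simp: CV_simps fun_eq_iff V.M.a_comm)
  show "\<zero>\<^bsub>CV\<^esub> \<oplus>\<^bsub>CV\<^esub> f = f" if "f \<in> carrier CV" for f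
    using CVD(1,3)[OF that] by (auto simp: CV_simps fun_eq_iff extensional_def)
qed (rule CV_add_closed)

end

sublocale truncation_vmodule \<subseteq> CV: abelian_group CV by (rule CV_abelian_group)

context truncation_vmodule
begin

lemma CV_eval_additive: "b \<in> carrier D \<Longrightarrow> additive_map CV V (\<lambda>f. f b)"
  by (rule additive_mapI) (auto simp: CVD(3), simp add: CV_simps)

lemma CV_eval_minus: "\<lbrakk>f \<in> carrier CV; b \<in> carrier D\<rbrakk> \<Longrightarrow> (\<ominus>\<^bsub>CV\<^esub> f) b = \<ominus>\<^bsub>V\<^esub> f b"
  by (rule additive_map_minus[OF CV.abelian_group_axioms V.M.abelian_group_axioms CV_eval_additive])

lemma CV_eqI: "\<lbrakk>f \<in> carrier CV; g \<in> carrier CV; \<And>i b. b \<in> component D i \<Longrightarrow> f b = g b\<rbrakk> \<Longrightarrow> f = g"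
  by (rule extensionalityI[OF CVD(1) CVD(1)])
    (auto intro: D.additive_map_eqI[OF CVD(2) CVD(2) V.M.abelian_group_axioms])

lemma \<theta>_apply: "b \<in> carrier D \<Longrightarrow> \<theta> v a b = v \<star> hproj D U (a \<otimes>\<^bsub>D\<^esub> b)"
  by (simp add: \<theta>_def)

lemma \<theta>_CV: "\<lbrakk>v \<in> carrier V; a \<in> carrier D\<rbrakk> \<Longrightarrow> \<theta> v a \<in> carrier CV"
  unfolding CV_simps(1) \<theta>_def
  by (auto simp: additive_map_def D.r_distr D.hproj_add star_add_right star_closed D.hproj_in_homog_sum)

lemma gens_CV: "gens d \<subseteq> carrier CV"
  using \<theta>_CV V.M.component_carrier D.component_carrier by (auto simp: gens_def)

lemma Gens_CV: "(\<Union>d. gens d) \<subseteq> carrier CV"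
  using gens_CV by blast

lemma MV_simps:
  "carrier MV = generate (add_monoid CV) (\<Union>d. gens d)" "zero MV = zero CV" "add MV = add CV"
  "component MV d = generate (add_monoid CV) (gens d)" "act MV = act CV"
  by (simp_all add: MV_def)

lemma MV_CV: "carrier MV \<subseteq> carrier CV"
  unfolding MV_simps by (rule CV.add_generate_carrier[OF Gens_CV])

lemma MV_component_CV: "component MV d \<subseteq> carrier CV"
  unfolding MV_simps by (rule CV.add_generate_carrier[OF gens_CV])

lemma MV_component_carrier: "component MV d \<subseteq> carrier MV"
  unfolding MV_simps by (rule CV.add_generate_mono) blast

text \<open>The value of f at b is the value at 1 of the function f b, whose degree is d + j. On a
  generator \<theta> v a it is v acted on by the projection of a b, so it vanishes when d + j is
  outside S and otherwise has the degree predicted by the regrading.\<close>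

lemma MV_component_eval:
  assumes "f \<in> component MV d" "b \<in> component D j"
  shows "d + j = m + \<delta> i \<Longrightarrow> f b \<in> component V i" and "d + j \<notin> S \<Longrightarrow> f b = \<zero>\<^bsub>V\<^esub>"
proof -
  have b: "b \<in> carrier D" using assms(2) D.component_carrier by blast
  have "(d + j = m + \<delta> i \<longrightarrow> f b \<in> component V i) \<and> (d + j \<notin> S \<longrightarrow> f b = \<zero>\<^bsub>V\<^esub>)"
    using assms(1)[unfolded MV_simps]
  proof (induction rule: CV.add_generate_induct)
    case subset
    then show ?case by (rule gens_CV)
  next
    case (incl h)
    then obtain v a k where h: "h = \<theta> v a" "v \<in> component V (2 * k)" "a \<in> component D (d - m - int n * k)"
      by (auto simp: gens_def)
    have ab: "a \<otimes>\<^bsub>D\<^esub> b \<in> component D (d + j - m - int n * k)"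
      using D.mult_degree[OF h(3) assms(2)] by (simp add: algebra_simps)
    have v: "v \<in> carrier V" using h(2) V.M.component_carrier by blast
    show ?case
    proof (intro conjI impI)
      assume dj: "d + j = m + \<delta> i"
      have e: "d + j - m - int n * k = \<delta> (i - 2 * k)"
        using koszul_degree_add[OF n2, of "i - 2 * k" "2 * k"] dj by simp
      have "h b = v \<star> (a \<otimes>\<^bsub>D\<^esub> b)"
        using D.hproj_of_component[OF ab, of U] koszul_degree_in_U[OF n2] b by (simp add: h(1) \<theta>_apply e)
      then show "h b \<in> component V i" using star_component[OF h(2) ab[unfolded e]] by simp
    next
      assume dj: "d + j \<notin> S"
      have "d + j - m \<notin> U" using dj degrees_S_iff[OF n2, of "d + j" m] by simp
      moreover have e: "int n * k + (d + j - m - int n * k) = d + j - m" by simp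
      ultimately have "d + j - m - int n * k \<notin> U"
        using U_shift[of k "d + j - m - int n * k"] unfolding e by blast
      then have "hproj D U (a \<otimes>\<^bsub>D\<^esub> b) = \<zero>\<^bsub>D\<^esub>" using D.hproj_of_component[OF ab, of U] by simp
      then show "h b = \<zero>\<^bsub>V\<^esub>" using b v by (simp add: h(1) \<theta>_apply star_zero_right)
    qed
  qed (use b in \<open>auto simp: CV_simps(2,3) CV_eval_minus V.M.component_add V.M.component_minus\<close>)
  then show "d + j = m + \<delta> i \<Longrightarrow> f b \<in> component V i" "d + j \<notin> S \<Longrightarrow> f b = \<zero>\<^bsub>V\<^esub>" by auto
qed

lemma graded_group_MV: "graded_group MV"
proof (rule graded_group_restrict[OF CV.abelian_group_axioms])
  show "additive_subgroup (carrier MV) CV"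
    unfolding MV_simps by (rule CV.add_generate_subgroup[OF Gens_CV])
  show "additive_subgroup (component MV i) CV" for i
    unfolding MV_simps by (rule CV.add_generate_subgroup[OF gens_CV])
  show "carrier MV \<subseteq> generate (add_monoid CV) (\<Union>i. component MV i)"
    unfolding MV_simps by (rule CV.add_generate_mono) (auto intro: CV.add_generate_incl)
  show "f d = \<zero>\<^bsub>CV\<^esub>"
    if F: "finite F" "\<And>d. d \<in> F \<Longrightarrow> f d \<in> component MV d" "finsum CV f F = \<zero>\<^bsub>CV\<^esub>" "d \<in> F" for F f d
  proof (rule CV_eqI)
    have fc: "f e \<in> carrier CV" if "e \<in> F" for e using F(2)[OF that] MV_component_CV by blast
    show "f d \<in> carrier CV" using fc F(4) .
    fix j b assume b: "b \<in> component D j"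
    then have bc: "b \<in> carrier D" by (rule D.component_carrier)
    have "f d b = \<zero>\<^bsub>V\<^esub>"
    proof (cases "d + j \<in> S")
      case False
      then show ?thesis using MV_component_eval(2)[OF F(2)[OF F(4)] b] by simp
    next
      case True
      then obtain i where i: "d + j = m + \<delta> i" using S_range by blast
      have "additive_map CV V (\<lambda>f. hpart V i (f b))"
        by (rule V.M.additive_map_compose[OF CV_eval_additive[OF bc] V.M.hpart_additive])
      from additive_map_finsum[OF CV.abelian_group_axioms V.M.abelian_group_axioms this F(1), of f]
      have "hpart V i (\<zero>\<^bsub>CV\<^esub> b) = finsum V (\<lambda>e. hpart V i (f e b)) F" using fc F(3) by simp
      also have "\<dots> = finsum V (\<lambda>e. if d = e then f e b else \<zero>\<^bsub>V\<^esub>) F"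
      proof (rule V.M.finsum_cong')
        fix e assume e: "e \<in> F"
        show "hpart V i (f e b) = (if d = e then f e b else \<zero>\<^bsub>V\<^esub>)"
        proof (cases "e + j \<in> S")
          case False
          then have "d \<noteq> e" using True by auto
          then show ?thesis using MV_component_eval(2)[OF F(2)[OF e] b False] by simp
        next
          case True
          then obtain i' where i': "e + j = m + \<delta> i'" using S_range by blast
          \<comment> \<open>Functions of distinct degrees take their values at b in distinct
            components of V, as Koszul degrees are injective. The part of degree i of the sum at b
            is therefore the value of \<open>f d\<close> alone.\<close>
          have "i = i' \<longleftrightarrow> d = e" using i i' koszul_degree_inj[OF n2, of i i'] by auto
          then show ?thesis
            using V.M.hpart_of_component[OF MV_component_eval(1)[OF F(2)[OF e] b i'], of i] by auto
        qed
      qed (use CVD(3)[OF fc bc] in auto)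
      also have "\<dots> = f d b"
        by (rule V.M.finsum_singleton) (use F CVD(3)[OF fc bc] in auto)
      finally show ?thesis using bc by (simp add: CV_simps(2))
    qed
    then show "f d b = \<zero>\<^bsub>CV\<^esub> b" using bc by (simp add: CV_simps(2))
  qed simp
qed (simp_all add: MV_component_carrier, simp_all add: MV_simps)

lemma \<theta>_act: "\<lbrakk>a \<in> carrier D; c \<in> carrier D\<rbrakk> \<Longrightarrow> act CV (\<theta> v a) c = \<theta> v (a \<otimes>\<^bsub>D\<^esub> c)"
  by (auto simp: CV_simps \<theta>_def fun_eq_iff D.m_assoc)

lemma act_CV_minus:
  "\<lbrakk>f \<in> carrier CV; c \<in> carrier D\<rbrakk> \<Longrightarrow> act CV (\<ominus>\<^bsub>CV\<^esub> f) c = \<ominus>\<^bsub>CV\<^esub> act CV f c"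
proof -
  assume f: "f \<in> carrier CV" and c: "c \<in> carrier D"
  have ac: "act CV f c \<in> carrier CV"
    using CVD[OF f] c unfolding CV_simps(1) by (auto simp: CV_simps additive_map_def D.r_distr)
  show ?thesis
  proof (rule extensionalityI)
    show "act CV (\<ominus>\<^bsub>CV\<^esub> f) c \<in> extensional (carrier D)" by (simp add: CV_simps)
    show "\<ominus>\<^bsub>CV\<^esub> act CV f c \<in> extensional (carrier D)" by (rule CVD(1)) (use ac in simp)
    show "act CV (\<ominus>\<^bsub>CV\<^esub> f) c b = (\<ominus>\<^bsub>CV\<^esub> act CV f c) b" if "b \<in> carrier D" for b
      using that c by (simp add: CV_eval_minus[OF ac that]) (simp add: CV_simps CV_eval_minus[OF f])
  qed
qed

lemma MV_degree:
  assumes "f \<in> component MV d" "c \<in> component D j"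
  shows "act CV f c \<in> component MV (d + j)"
proof -
  have c: "c \<in> carrier D" using assms(2) D.component_carrier by blast
  show ?thesis
    using assms(1)[unfolded MV_simps]
  proof (induction rule: CV.add_generate_induct)
    case subset
    then show ?case by (rule gens_CV)
  next
    case zero
    have "act CV \<zero>\<^bsub>CV\<^esub> c = \<zero>\<^bsub>CV\<^esub>" using c by (auto simp: CV_simps fun_eq_iff)
    then show ?case by (simp add: MV_simps)
  next
    case (incl h)
    then obtain v a k where h: "h = \<theta> v a" "v \<in> component V (2 * k)" "a \<in> component D (d - m - int n * k)"
      by (auto simp: gens_def)
    have "a \<otimes>\<^bsub>D\<^esub> c \<in> component D (d + j - m - int n * k)"
      using D.mult_degree[OF h(3) assms(2)] by (simp add: algebra_simps)
    moreover have "act CV h c = \<theta> v (a \<otimes>\<^bsub>D\<^esub> c)"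
      unfolding h(1) by (rule \<theta>_act[OF D.component_carrier[OF h(3)] c])
    ultimately have "act CV h c \<in> gens (d + j)" using h(2) unfolding gens_def by blast
    then show ?case unfolding MV_simps by (rule CV.add_generate_incl)
  next
    case (add f g)
    have "act CV (f \<oplus>\<^bsub>CV\<^esub> g) c = act CV f c \<oplus>\<^bsub>CV\<^esub> act CV g c" using c by (auto simp: CV_simps fun_eq_iff)
    then show ?case using add(3,4) CV.add_generate_add by (simp add: MV_simps)
  next
    case (minus f)
    then show ?case
      using CV.add_generate_minus[OF gens_CV, of "act CV f c" "d + j"]
      by (simp add: act_CV_minus[OF _ c] MV_simps)
  qed
qed

lemma graded_right_module_MV: "graded_right_module D MV"
proof -
  interpret MV: graded_group MV by (rule graded_group_MV)
  have c: "f \<in> carrier CV" if "f \<in> carrier MV" for f using that MV_CV by blast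
  show ?thesis
    unfolding graded_right_module_def
  proof (intro conjI graded_right_module_axioms.intro D.graded_ring_axioms graded_group_MV)
    fix f g a b i j
    show "act MV f a \<in> component MV (i + j)" if "f \<in> component MV i" "a \<in> component D j"
      using MV_degree[OF that] by (simp add: MV_simps)
    show addr: "act MV f (a \<oplus>\<^bsub>D\<^esub> b) = act MV f a \<oplus>\<^bsub>MV\<^esub> act MV f b"
      if "f \<in> carrier MV" "a \<in> carrier D" "b \<in> carrier D" for f a b
      using that CVD(4)[OF c[OF that(1)]] by (auto simp: MV_simps CV_simps fun_eq_iff D.l_distr)
    show addl: "act MV (f \<oplus>\<^bsub>MV\<^esub> g) a = act MV f a \<oplus>\<^bsub>MV\<^esub> act MV g a"
      if "f \<in> carrier MV" "g \<in> carrier MV" "a \<in> carrier D" for f g a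
      using that by (auto simp: MV_simps CV_simps fun_eq_iff)
    have z: "act MV f \<zero>\<^bsub>D\<^esub> = \<zero>\<^bsub>MV\<^esub>" if "f \<in> carrier MV" for f
      using additive_map_zero[OF D.abelian_group_axioms V.M.abelian_group_axioms CVD(2)[OF c[OF that]]]
      by (auto simp: MV_simps CV_simps fun_eq_iff)
    have z': "act MV \<zero>\<^bsub>MV\<^esub> a = \<zero>\<^bsub>MV\<^esub>" if "a \<in> carrier D" for a
      using that by (auto simp: MV_simps CV_simps fun_eq_iff)
    show "act MV f a \<in> carrier MV" if f: "f \<in> carrier MV" and a: "a \<in> carrier D"
      using f
    proof (induction rule: MV.graded_induct)
      case zero
      then show ?case using z'[OF a] by simp
    next
      case (component i f)
      note f = component
      show ?case using a
      proof (induction rule: D.graded_induct)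
        case zero
        then show ?case using z f MV.component_carrier by simp
      next
        case (component j a)
        then show ?case using MV_degree[OF f component] MV_component_carrier by (auto simp: MV_simps(5))
      next
        case (add a b)
        then show ?case using addr f MV.component_carrier by simp
      qed
    next
      case (add f g)
      then show ?case using addl a by simp
    qed
    show "act MV (act MV f a) b = act MV f (a \<otimes>\<^bsub>D\<^esub> b)" if "f \<in> carrier MV" "a \<in> carrier D" "b \<in> carrier D"
      using that by (auto simp: MV_simps CV_simps fun_eq_iff D.m_assoc)
    show "act MV f \<one>\<^bsub>D\<^esub> = f" if "f \<in> carrier MV"
      using CVD(1)[OF c[OF that]] by (auto simp: MV_simps CV_simps fun_eq_iff extensional_def)
  qed
qed

end

sublocale truncation_vmodule \<subseteq> MV: graded_right_module D MV by (rule graded_right_module_MV)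

context truncation_vmodule
begin

lemma \<theta>_in_component:
  assumes "v \<in> component V (2 * k)" "a \<in> component D j" "d = m + int n * k + j"
  shows "\<theta> v a \<in> component MV d"
  unfolding MV_simps
proof (rule CV.add_generate_incl)
  have "a \<in> component D (d - m - int n * k)" using assms(2,3) by simp
  then show "\<theta> v a \<in> gens d" using assms(1) unfolding gens_def by blast
qed

text \<open>Generation holds since \<theta> v a is \<theta> v 1 times a. A nonzero function has a
  nonzero value at some homogeneous b; then d + j lies in S by \<open>MV_component_eval\<close>, and
  the function f b is nonzero because its value at 1 is that value.\<close>

lemma in_G_MV: "in_G n m D MV"
  unfolding MV.in_G_iff
proof (intro conjI allI ballI impI)
  show "generated_in_degrees D MV (gen_degrees n m)"
    unfolding MV.generated_in_degrees_iff
  proof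
    fix d
    let ?H = "homog_products D MV (gen_degrees n m) d"
    have "gens d \<subseteq> ?H"
    proof
      fix h assume "h \<in> gens d"
      then obtain v a k where h: "h = \<theta> v a" "v \<in> component V (2 * k)" "a \<in> component D (d - m - int n * k)"
        by (auto simp: gens_def)
      have a: "a \<in> component D (d - (m + int n * k))" using h(3) by (simp add: algebra_simps)
      have "\<theta> v \<one>\<^bsub>D\<^esub> \<in> component MV (m + int n * k)"
        by (rule \<theta>_in_component[OF h(2) D.one_degree]) simp
      moreover have "act MV (\<theta> v \<one>\<^bsub>D\<^esub>) a = h"
        using \<theta>_act[of "\<one>\<^bsub>D\<^esub>" a v] D.component_carrier[OF a] by (simp add: MV_simps h(1))
      moreover have "m + int n * k \<in> gen_degrees n m" by (auto simp: gen_degrees_def)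
      ultimately show "h \<in> ?H" unfolding homog_products_def using a by blast
    qed
    then have "generate (add_monoid CV) (gens d) \<subseteq> generate (add_monoid CV) ?H"
      by (rule CV.add_generate_mono)
    also have "\<dots> = generate (add_monoid MV) ?H"
      by (rule generate_restrict[symmetric, OF CV.abelian_group_axioms])
        (use CV.add_generate_subgroup[OF Gens_CV] MV.homog_products_carrier in \<open>auto simp: MV_simps(1-3)\<close>)
    finally show "component MV d \<subseteq> generate (add_monoid MV) ?H" by (simp only: MV_simps(4))
  qed
next
  fix d f assume f: "f \<in> component MV d" and f0: "f \<noteq> \<zero>\<^bsub>MV\<^esub>"
  have fC: "f \<in> carrier CV" using f MV_component_CV by blast
  have "\<exists>j. \<exists>b \<in> component D j. f b \<noteq> \<zero>\<^bsub>V\<^esub>"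
  proof (rule ccontr)
    assume *: "\<not> ?thesis"
    have "f = \<zero>\<^bsub>CV\<^esub>"
    proof (rule CV_eqI[OF fC])
      show "f b = \<zero>\<^bsub>CV\<^esub> b" if "b \<in> component D j" for j b
        using * that D.component_carrier[OF that] by (auto simp: CV_simps(2))
    qed simp
    then show False using f0 by (simp add: MV_simps)
  qed
  then obtain j b where b: "b \<in> component D j" "f b \<noteq> \<zero>\<^bsub>V\<^esub>" by blast
  have bc: "b \<in> carrier D" using b(1) by (rule D.component_carrier)
  have "d + j \<in> S" using MV_component_eval(2)[OF f b(1)] b(2) by blast
  moreover have "act MV f b \<noteq> \<zero>\<^bsub>MV\<^esub>"
  proof
    assume "act MV f b = \<zero>\<^bsub>MV\<^esub>"
    then have "act CV f b \<one>\<^bsub>D\<^esub> = \<zero>\<^bsub>CV\<^esub> \<one>\<^bsub>D\<^esub>" by (simp add: MV_simps)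
    then show False using b(2) bc by (simp add: CV_simps)
  qed
  ultimately show "\<exists>j. \<exists>b \<in> component D j. d + j \<in> degrees_S n m \<and> act MV f b \<noteq> \<zero>\<^bsub>MV\<^esub>"
    using b(1) by blast
qed

section \<open>Evaluation at 1 compares the restriction of \<open>MV\<close> with V\<close>

lemma MV_eval_additive: "b \<in> carrier D \<Longrightarrow> additive_map MV V (\<lambda>f. f b)"
  using CV_eval_additive[of b] MV_CV by (auto simp: additive_map_def MV_simps(3))

lemma MV_zero_apply: "b \<in> carrier D \<Longrightarrow> \<zero>\<^bsub>MV\<^esub> b = \<zero>\<^bsub>V\<^esub>"
  by (simp add: MV_simps CV_simps)

text \<open>The unit has degree 0, so functions of degree outside S vanish at it and dropping them
  changes nothing.\<close>

lemma hproj_eval_one: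
  assumes "f \<in> carrier MV"
  shows "(hproj MV S f) \<one>\<^bsub>D\<^esub> = f \<one>\<^bsub>D\<^esub>"
proof (rule MV.M.additive_map_eqI[OF _ _ V.M.abelian_group_axioms _ assms])
  show "additive_map MV V (\<lambda>f. (hproj MV S f) \<one>\<^bsub>D\<^esub>)"
    by (rule MV.M.additive_map_compose[OF MV.M.hproj_additive MV_eval_additive]) simp
  show "additive_map MV V (\<lambda>f. f \<one>\<^bsub>D\<^esub>)" by (rule MV_eval_additive) simp
  show "(hproj MV S f) \<one>\<^bsub>D\<^esub> = f \<one>\<^bsub>D\<^esub>" if "f \<in> component MV d" for d f
    using MV.M.hproj_of_component[OF that, of S] MV_component_eval(2)[OF that D.one_degree] MV_zero_apply
    by auto
qed

text \<open>A generator \<theta> v a' of degree in S has a' of degree in \<U>. Hence a' acts on V by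
  itself, and the claim becomes associativity of the action of E. For a' of other degrees this would
  fail.\<close>

lemma MV_eval_star:
  assumes f: "f \<in> homog_sum MV S" and a: "a \<in> DU"
  shows "f a = f \<one>\<^bsub>D\<^esub> \<star> a"
  using f
proof (induction rule: MV.M.homog_sum_induct)
  case zero
  then show ?case using a DU_carrier MV_zero_apply star_zero_left by simp
next
  case (component s f)
  have ac: "a \<in> carrier D" using a by (rule DU_carrier)
  show ?case
    using component(2)[unfolded MV_simps]
  proof (induction rule: CV.add_generate_induct)
    case subset
    then show ?case by (rule gens_CV)
  next
    case zero
    then show ?case using a ac star_zero_left by (simp add: CV_simps)
  next
    case (incl h)
    then obtain v a' k where h: "h = \<theta> v a'" "v \<in> component V (2 * k)" "a' \<in> component D (s - m - int n * k)"
      by (auto simp: gens_def)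
    have e: "int n * k + (s - m - int n * k) = s - m" by simp
    have "s - m - int n * k \<in> U"
      using component(1) degrees_S_iff[OF n2, of s m] U_shift[of k "s - m - int n * k"] unfolding e by blast
    then have a': "a' \<in> DU" using h(3) DU_component by blast
    have v: "v \<in> carrier V" using h(2) V.M.component_carrier by blast
    have "h \<one>\<^bsub>D\<^esub> = v \<star> a'" using a' DU_carrier D.hproj_homog_sum by (simp add: h(1) \<theta>_apply)
    then show ?case using star_assoc[OF v a' a] ac by (simp add: h(1) \<theta>_apply)
  next
    case (add f g)
    then show ?case using a ac CVD(3) star_add_left by (simp add: CV_simps)
  next
    case (minus f)
    have "\<ominus>\<^bsub>V\<^esub> (f \<one>\<^bsub>D\<^esub>) \<star> a = \<ominus>\<^bsub>V\<^esub> (f \<one>\<^bsub>D\<^esub> \<star> a)"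
      using V.act_minus_left[of "f \<one>\<^bsub>D\<^esub>" "\<phi> a"] CVD(3)[OF minus(1)] \<phi>_closed[OF a] by (simp add: star_def)
    then show ?case using minus ac by (simp add: CV_eval_minus)
  qed
next
  case (add f g)
  then have "f \<in> carrier CV" "g \<in> carrier CV" using MV.M.homog_sum_carrier MV_CV by blast+
  then show ?case using add a DU_carrier CVD(3) star_add_left by (simp add: MV_simps(3) CV_simps)
qed

text \<open>The comparison map to V: onto when V is generated in even degrees, and injective under
  the condition on kernels.\<close>

definition ev :: "('a \<Rightarrow> 'u) \<Rightarrow> 'u" where
  "ev = (\<lambda>f\<in>homog_sum MV S. f \<one>\<^bsub>D\<^esub>)"

lemma ev_gr_hom: "ev \<in> gr_hom E (F MV) V"
proof (rule gr_homI)
  have c: "f \<in> carrier MV" if "f \<in> homog_sum MV S" for f using that by (rule MV.M.homog_sum_carrier)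
  have cv: "f \<one>\<^bsub>D\<^esub> \<in> carrier V" if "f \<in> homog_sum MV S" for f
    using CVD(3)[of f "\<one>\<^bsub>D\<^esub>"] c[OF that] MV_CV by auto
  show "ev \<in> extensional (carrier (F MV))" by (simp add: ev_def F_simps)
  show "ev f \<in> carrier V" if "f \<in> carrier (F MV)" for f using that cv by (simp add: ev_def F_simps)
  show "ev (f \<oplus>\<^bsub>F MV\<^esub> g) = ev f \<oplus>\<^bsub>V\<^esub> ev g" if "f \<in> carrier (F MV)" "g \<in> carrier (F MV)" for f g
    using that MV.M.homog_sum_add[of f S g] additive_map_add[OF MV_eval_additive, of "\<one>\<^bsub>D\<^esub>" f g] c
    by (simp add: ev_def F_simps)
  show "ev (act (F MV) f e) = act V (ev f) e" if f: "f \<in> carrier (F MV)" and e: "e \<in> carrier E" for f e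
  proof -
    have fS: "f \<in> homog_sum MV S" using f by (simp add: F_simps)
    have ac: "act MV f (\<psi> e) \<in> carrier MV" using c[OF fS] e by (simp add: MV.act_closed)
    \<comment> \<open>The projection does not affect the value at 1, and acting by \<psi> e moves
      the evaluation from 1 to \<psi> e, where \<open>MV_eval_star\<close> applies.\<close>
    have "ev (act (F MV) f e) = act MV f (\<psi> e) \<one>\<^bsub>D\<^esub>"
      using MV.M.hproj_in_homog_sum[OF ac, of S] hproj_eval_one[OF ac] by (simp add: ev_def F_simps)
    also have "\<dots> = f (\<psi> e)" using e by (simp add: MV_simps CV_simps)
    also have "\<dots> = f \<one>\<^bsub>D\<^esub> \<star> \<psi> e" by (rule MV_eval_star[OF fS]) (use e in simp)
    also have "\<dots> = act V (ev f) e" using fS e by (simp add: ev_def star_def)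
    finally show ?thesis .
  qed
  show "ev f \<in> component V i" if "f \<in> component (F MV) i" for i f
  proof -
    have f: "f \<in> component MV (m + \<delta> i)" using that by (simp add: F_simps)
    then have "f \<in> homog_sum MV S" by (rule MV.M.homog_sum_component) (simp add: S_add_iff koszul_degree_in_U[OF n2])
    then show ?thesis using MV_component_eval(1)[OF f D.one_degree, of i] by (simp add: ev_def)
  qed
qed

text \<open>A product x e with x of even degree is the value at 1 of \<theta> x (\<psi> e), and such
  products span V.\<close>

lemma ev_component_surj:
  assumes gen: "generated_in_degrees E V {i. even i}" and z: "z \<in> component V d"
  shows "\<exists>f \<in> component MV (m + \<delta> d). f \<one>\<^bsub>D\<^esub> = z"
  using gen z
proof (induction rule: V.generated_component_induct)
  case zero
  then show ?case using MV.M.component_zero MV_zero_apply D.one_closed by blast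
next
  case (product i x e)
  then obtain k where k: "i = 2 * k" by blast
  have a: "\<psi> e \<in> component D (\<delta> (d - 2 * k))" using \<psi>_component[OF product(3)] k by simp
  have e: "e \<in> carrier E" using product(3) E.component_carrier by blast
  have "\<delta> d = int n * k + \<delta> (d - 2 * k)"
    using koszul_degree_add[OF n2, of "2 * k" "d - 2 * k"] by simp
  then have "\<theta> x (\<psi> e) \<in> component MV (m + \<delta> d)"
    using product(2) a unfolding k by (intro \<theta>_in_component[of x k "\<psi> e" "\<delta> (d - 2 * k)"]) simp_all
  moreover have "\<theta> x (\<psi> e) \<one>\<^bsub>D\<^esub> = act V x e"
    using e D.hproj_homog_sum by (simp add: \<theta>_apply star_def)
  ultimately show ?case by blast
next
  case (add x y)
  then obtain f g where "f \<in> component MV (m + \<delta> d)" "f \<one>\<^bsub>D\<^esub> = x" "g \<in> component MV (m + \<delta> d)" "g \<one>\<^bsub>D\<^esub> = y"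
    by blast
  then show ?case
    using MV.M.component_add additive_map_add[OF MV_eval_additive[OF D.one_closed], of f g] MV.M.component_carrier
    by blast
qed

lemma ev_surj:
  assumes gen: "generated_in_degrees E V {i. even i}"
  shows "ev ` carrier (F MV) = carrier V"
proof
  show "ev ` carrier (F MV) \<subseteq> carrier V" using gr_homD(2)[OF ev_gr_hom] by blast
  show "carrier V \<subseteq> ev ` carrier (F MV)"
  proof
    fix z assume "z \<in> carrier V"
    then have "\<exists>f \<in> homog_sum MV S. f \<one>\<^bsub>D\<^esub> = z"
    proof (induction rule: V.M.graded_induct)
      case zero
      then show ?case using MV.M.homog_sum_zero MV_zero_apply D.one_closed by blast
    next
      case (component d z)
      then obtain f where f: "f \<in> component MV (m + \<delta> d)" "f \<one>\<^bsub>D\<^esub> = z" using ev_component_surj[OF gen] by blast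
      have "f \<in> homog_sum MV S"
        by (rule MV.M.homog_sum_component[OF f(1)]) (simp add: S_add_iff koszul_degree_in_U[OF n2])
      then show ?case using f by blast
    next
      case (add x y)
      then obtain f g where "f \<in> homog_sum MV S" "f \<one>\<^bsub>D\<^esub> = x" "g \<in> homog_sum MV S" "g \<one>\<^bsub>D\<^esub> = y" by blast
      then show ?case
        using MV.M.homog_sum_add additive_map_add[OF MV_eval_additive[OF D.one_closed], of f g] MV.M.homog_sum_carrier
        by blast
    qed
    then show "z \<in> ev ` carrier (F MV)" by (auto simp: ev_def F_simps)
  qed
qed

text \<open>In degree m + nk + 1 every generator can be rewritten with v in degree 2k and a in D_1,
  by moving the rest of a over to v. So a function of this degree comes from a formal sum in V_(2k)
  \<times> D_1, and its values at 1 and at b are the two sums that the condition on kernels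
  compares.\<close>

lemma MV_odd_representation:
  assumes f: "f \<in> component MV (m + int n * k + 1)" and b: "b \<in> component D (int n - 1)"
  shows "\<exists>s. Poly_Mapping.keys s \<subseteq> component V (2 * k) \<times> component D 1 \<and>
    f \<one>\<^bsub>D\<^esub> = frag_lift (add_monoid V) (\<star>) s \<and>
    f b = frag_lift (add_monoid V) (\<lambda>v a. v \<star> (a \<otimes>\<^bsub>D\<^esub> b)) s" (is "?P f")
proof -
  let ?X = "component V (2 * k) \<times> component D 1"
  let ?G = "add_monoid V"
  have G: "comm_group ?G" by (rule V_comm_group)
  have bc: "b \<in> carrier D" using b by (rule D.component_carrier)
  have X1: "v \<star> a \<in> carrier ?G" if "(v, a) \<in> ?X" for v a
    using that star_closed V.M.component_carrier DU_component[OF _ one_in_U] by auto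
  have ab: "a \<otimes>\<^bsub>D\<^esub> b \<in> component D (int n)" if "a \<in> component D 1" for a
    using D.mult_degree[OF that b] by simp
  have X2: "v \<star> (a \<otimes>\<^bsub>D\<^esub> b) \<in> carrier ?G" if "(v, a) \<in> ?X" for v a
    using that star_closed V.M.component_carrier DU_component[OF ab n_in_U] by auto
  have P_zero: "?P f" if "f \<one>\<^bsub>D\<^esub> = \<zero>\<^bsub>V\<^esub>" "f b = \<zero>\<^bsub>V\<^esub>" for f
    using that comm_group.frag_lift_zero[OF G] by (intro exI[of _ 0]) simp
  have P_add: "?P (f \<oplus>\<^bsub>CV\<^esub> g)" if P: "?P f" "?P g" for f g
  proof -
    obtain s t where s: "Poly_Mapping.keys s \<subseteq> ?X" "f \<one>\<^bsub>D\<^esub> = frag_lift ?G (\<star>) s"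
        "f b = frag_lift ?G (\<lambda>v a. v \<star> (a \<otimes>\<^bsub>D\<^esub> b)) s"
      and t: "Poly_Mapping.keys t \<subseteq> ?X" "g \<one>\<^bsub>D\<^esub> = frag_lift ?G (\<star>) t"
        "g b = frag_lift ?G (\<lambda>v a. v \<star> (a \<otimes>\<^bsub>D\<^esub> b)) t"
      using P by blast
    have "Poly_Mapping.keys (s + t) \<subseteq> ?X" using keys_add[of s t] s(1) t(1) by blast
    moreover have "frag_lift ?G (\<star>) (s + t) = f \<one>\<^bsub>D\<^esub> \<oplus>\<^bsub>V\<^esub> g \<one>\<^bsub>D\<^esub>"
      using comm_group.frag_lift_add[OF G s(1) t(1), of "(\<star>)"] X1 s t by simp
    moreover have "frag_lift ?G (\<lambda>v a. v \<star> (a \<otimes>\<^bsub>D\<^esub> b)) (s + t) = f b \<oplus>\<^bsub>V\<^esub> g b"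
      using comm_group.frag_lift_add[OF G s(1) t(1), of "\<lambda>v a. v \<star> (a \<otimes>\<^bsub>D\<^esub> b)"] X2 s t by simp
    ultimately show ?thesis using bc by (intro exI[of _ "s + t"]) (simp add: CV_simps(3))
  qed
  have P_minus: "?P (\<ominus>\<^bsub>CV\<^esub> f)" if fc: "f \<in> carrier CV" and P: "?P f" for f
  proof -
    obtain s where s: "Poly_Mapping.keys s \<subseteq> ?X" "f \<one>\<^bsub>D\<^esub> = frag_lift ?G (\<star>) s"
        "f b = frag_lift ?G (\<lambda>v a. v \<star> (a \<otimes>\<^bsub>D\<^esub> b)) s"
      using P by blast
    have "frag_lift ?G (\<star>) (- s) = \<ominus>\<^bsub>V\<^esub> f \<one>\<^bsub>D\<^esub>"
      using comm_group.frag_lift_minus[OF G s(1), of "(\<star>)"] X1 s by (simp add: a_inv_def)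
    moreover have "frag_lift ?G (\<lambda>v a. v \<star> (a \<otimes>\<^bsub>D\<^esub> b)) (- s) = \<ominus>\<^bsub>V\<^esub> f b"
      using comm_group.frag_lift_minus[OF G s(1), of "\<lambda>v a. v \<star> (a \<otimes>\<^bsub>D\<^esub> b)"] X2 s by (simp add: a_inv_def)
    ultimately show ?thesis
      using s(1) bc CV_eval_minus[OF fc] by (intro exI[of _ "- s"]) simp
  qed
  show ?thesis
    using f[unfolded MV_simps]
  proof (induction rule: CV.add_generate_induct)
    case subset
    then show ?case by (rule gens_CV)
  next
    case zero
    show ?case by (rule P_zero) (simp_all add: CV_simps(2) bc)
  next
    case (add f g)
    then show ?case using P_add by blast
  next
    case (minus f)
    then show ?case using P_minus by blast
  next
    case (incl h)
    then obtain v a k' where h: "h = \<theta> v a" "v \<in> component V (2 * k')"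
      and a0: "a \<in> component D (m + int n * k + 1 - m - int n * k')"
      by (auto simp: gens_def)
    have a: "a \<in> component D (int n * (k - k') + 1)" using a0 by (simp add: algebra_simps)
    have v: "v \<in> carrier V" using h(2) V.M.component_carrier by blast
    show ?case
    proof (cases "k' \<le> k")
      case False
      \<comment> \<open>For k < k' the degree of a is at most 1 - n, hence negative, and a is
        zero.\<close>
      then have "int n * (k - k') \<le> int n * (- 1)" by (intro mult_left_mono) auto
      then have "int n * (k - k') + 1 < 0" using n2 by linarith
      then have "a = \<zero>\<^bsub>D\<^esub>" using a negative by blast
      then show ?thesis using bc v by (intro P_zero) (simp_all add: h(1) \<theta>_apply star_zero_right)
    next
      case True
      then have "0 \<le> int n * (k - k')" by simp
      \<comment> \<open>Splitting off a right factor a'' of degree 1 leaves a' of degree n (k - k'),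
        which carries v from degree 2k' to degree 2k; then \<theta> v (a' a'') is represented by the
        pair of v a' and a''.\<close>
      then have "a \<in> generate (add_monoid D) {a' \<otimes>\<^bsub>D\<^esub> a'' | a' a''. a' \<in> component D (int n * (k - k')) \<and> a'' \<in> component D 1}"
        using generated[of "int n * (k - k')" 1] a by auto
      then have "?P (\<theta> v a)"
      proof (induction rule: D.add_generate_induct)
        case subset
        then show ?case using D.component_carrier by auto
      next
        case zero
        show ?case using bc v by (intro P_zero) (simp_all add: \<theta>_apply star_zero_right)
      next
        case (incl c)
        then obtain a' a'' where c: "c = a' \<otimes>\<^bsub>D\<^esub> a''" "a' \<in> component D (int n * (k - k'))" "a'' \<in> component D 1"
          by blast
        have U1: "int n * (k - k') \<in> U" "int n * (k - k') + 1 \<in> U" "int n * (k - k') + int n \<in> U"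
          using one_in_U n_in_U U_shift[of "k - k'" 0] by auto
        have cc: "a' \<in> carrier D" "a'' \<in> carrier D" using c D.component_carrier by auto
        have va: "v \<star> a' \<in> component V (2 * k)"
        proof -
          have "v \<star> a' \<in> component V (2 * k' + 2 * (k - k'))"
            by (rule star_component[OF h(2)]) (unfold \<delta>_even, rule c(2))
          moreover have "2 * k' + 2 * (k - k') = 2 * k" by simp
          ultimately show ?thesis by (simp only:)
        qed
        have "\<theta> v c \<one>\<^bsub>D\<^esub> = v \<star> (a' \<otimes>\<^bsub>D\<^esub> a'')"
          using D.hproj_of_component[OF D.mult_degree[OF c(2,3)], of U] U1 cc by (simp add: \<theta>_apply c(1))
        then have 1: "\<theta> v c \<one>\<^bsub>D\<^esub> = v \<star> a' \<star> a''"
          using star_assoc_component[OF v c(2,3) U1(1) one_in_U U1(2)] by simp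
        have "\<theta> v c b = v \<star> (a' \<otimes>\<^bsub>D\<^esub> (a'' \<otimes>\<^bsub>D\<^esub> b))"
          using D.hproj_of_component[OF D.mult_degree[OF c(2) ab[OF c(3)]], of U] U1 cc bc
          by (simp add: \<theta>_apply c(1) D.m_assoc)
        then have 2: "\<theta> v c b = v \<star> a' \<star> (a'' \<otimes>\<^bsub>D\<^esub> b)"
          using star_assoc_component[OF v c(2) ab[OF c(3)] U1(1) n_in_U U1(3)] by simp
        have X: "(v \<star> a', a'') \<in> ?X" using va c(3) by simp
        show ?case
          using X 1 2 comm_group.frag_lift_of[OF G, of "(\<star>)" "v \<star> a'" a''] X1[OF X]
            comm_group.frag_lift_of[OF G, of "\<lambda>v a. v \<star> (a \<otimes>\<^bsub>D\<^esub> b)" "v \<star> a'" a''] X2[OF X]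
          by (intro exI[of _ "frag_of (v \<star> a', a'')"]) (simp add: keys_frag_of)
      next
        case (add x y)
        have "\<theta> v (x \<oplus>\<^bsub>D\<^esub> y) = \<theta> v x \<oplus>\<^bsub>CV\<^esub> \<theta> v y"
          using add(1,2) v by (auto simp: \<theta>_def CV_simps(3) fun_eq_iff D.l_distr D.hproj_add
              star_add_right D.hproj_in_homog_sum)
        then show ?case using P_add[OF add(3,4)] by simp
      next
        case (minus x)
        have "\<theta> v (\<ominus>\<^bsub>D\<^esub> x) \<oplus>\<^bsub>CV\<^esub> \<theta> v x = \<zero>\<^bsub>CV\<^esub>"
        proof -
          have "\<theta> v (\<ominus>\<^bsub>D\<^esub> x) \<oplus>\<^bsub>CV\<^esub> \<theta> v x = \<theta> v (\<ominus>\<^bsub>D\<^esub> x \<oplus>\<^bsub>D\<^esub> x)"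
            using minus(1) v by (auto simp: \<theta>_def CV_simps(3) fun_eq_iff D.l_distr D.hproj_add
                star_add_right D.hproj_in_homog_sum simp del: D.l_neg)
          also have "\<dots> = \<zero>\<^bsub>CV\<^esub>"
            using minus(1) v by (auto simp: \<theta>_def CV_simps(2) fun_eq_iff D.l_neg star_zero_right)
          finally show ?thesis .
        qed
        then have "\<ominus>\<^bsub>CV\<^esub> \<theta> v x = \<theta> v (\<ominus>\<^bsub>D\<^esub> x)"
          using \<theta>_CV[OF v minus(1)] \<theta>_CV[OF v, of "\<ominus>\<^bsub>D\<^esub> x"] minus(1) by (intro CV.minus_equality) auto
        then show ?case using P_minus[OF \<theta>_CV[OF v minus(1)] minus(2)] by simp
      qed
      then show ?thesis by (simp only: h(1))
    qed
  qed
qed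

text \<open>The value at 1 determines f at all b of degree in \<U>, and f vanishes at b when the
  total degree misses S. What remains is f of odd index and b of degree -1 modulo n; there the
  condition on kernels handles the factor in D_(n-1), and the remaining factor acts through
  E.\<close>

lemma MV_component_zero:
  assumes ker: "kernel_condition n D \<phi> V" and f: "f \<in> component MV (m + \<delta> i)" and f1: "f \<one>\<^bsub>D\<^esub> = \<zero>\<^bsub>V\<^esub>"
  shows "f = \<zero>\<^bsub>MV\<^esub>"
proof -
  have fS: "f \<in> homog_sum MV S"
    by (rule MV.M.homog_sum_component[OF f]) (simp add: S_add_iff koszul_degree_in_U[OF n2])
  have fC: "f \<in> carrier CV" using f MV_component_CV by blast
  have "f b = \<zero>\<^bsub>V\<^esub>" if b: "b \<in> component D j" for b j
  proof -
    have bc: "b \<in> carrier D" using b by (rule D.component_carrier)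
    consider (out) "m + \<delta> i + j \<notin> S" | (mult) "j \<in> U" | (neg) "j < 0"
      | (gap) "m + \<delta> i + j \<in> S" "j \<notin> U" "0 \<le> j" by linarith
    then show ?thesis
    proof cases
      case out
      then show ?thesis using MV_component_eval(2)[OF f b] by simp
    next
      case mult
      then have bU: "b \<in> DU" using b DU_component by blast
      show ?thesis using MV_eval_star[OF fS bU] f1 star_zero_left[OF bU] by simp
    next
      case neg
      then have "b = \<zero>\<^bsub>D\<^esub>" using b negative by blast
      then show ?thesis
        using additive_map_zero[OF D.abelian_group_axioms V.M.abelian_group_axioms CVD(2)[OF fC]] by simp
    next
      case gap
      have iU: "\<delta> i + j \<in> U" using gap(1) S_add_iff[of "\<delta> i + j"] by (simp add: add.assoc)
      have "odd i"
      proof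
        assume "even i"
        then obtain k where "i = 2 * k" by blast
        then show False using iU gap(2) by simp
      qed
      then obtain k where k: "i = 2 * k + 1" by (blast elim: oddE)
      have \<delta>i: "\<delta> i = int n * k + 1" by (simp only: k \<delta>_odd)
      \<comment> \<open>Here j misses \<U> while 1 + j meets it, which forces 1 + j to be a multiple
        of n.\<close>
      have "1 + j \<in> U" using iU U_shift[of k "1 + j"] by (simp add: \<delta>i add.assoc)
      then obtain l where "1 + j = int n * l \<or> 1 + j = int n * l + 1" by (auto simp: degrees_U_def)
      moreover have "j \<noteq> int n * l" using gap(2) by (auto simp: degrees_U_def)
      ultimately have l: "1 + j = int n * l" by linarith
      have "0 < int n * l" using l gap(3) by linarith
      then have "0 < l" using n2 by (simp add: zero_less_mult_iff)
      then have l1: "0 \<le> int n * (l - 1)" by simp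
      \<comment> \<open>The first factor, of degree n - 1, brings f from degree m + nk + 1 to the
        degree m + n (k + 1) of S; the second has degree in \<U>, so that
        \<open>MV_eval_star\<close> applies to it.\<close>
      have j: "j = (int n - 1) + int n * (l - 1)" using l by (simp add: algebra_simps)
      have "b \<in> generate (add_monoid D) {b' \<otimes>\<^bsub>D\<^esub> b'' | b' b''. b' \<in> component D (int n - 1) \<and> b'' \<in> component D (int n * (l - 1))}"
        using generated[of "int n - 1" "int n * (l - 1)"] n2 l1 b unfolding j by auto
      then show ?thesis
      proof (induction rule: D.add_generate_induct)
        case subset
        then show ?case using D.component_carrier by auto
      next
        case zero
        then show ?case
          using additive_map_zero[OF D.abelian_group_axioms V.M.abelian_group_axioms CVD(2)[OF fC]] by simp
      next
        case (add x y)
        then show ?case using CVD(4)[OF fC] by simp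
      next
        case (minus x)
        then show ?case
          using additive_map_minus[OF D.abelian_group_axioms V.M.abelian_group_axioms CVD(2)[OF fC]] by simp
      next
        case (incl c)
        then obtain b' b'' where c: "c = b' \<otimes>\<^bsub>D\<^esub> b''" "b' \<in> component D (int n - 1)" "b'' \<in> component D (int n * (l - 1))"
          by blast
        have cc: "b' \<in> carrier D" "b'' \<in> carrier D" using c D.component_carrier by auto
        have f': "f \<in> component MV (m + int n * k + 1)" using f by (simp add: \<delta>i add.assoc)
        obtain s where s: "Poly_Mapping.keys s \<subseteq> component V (2 * k) \<times> component D 1"
          "f \<one>\<^bsub>D\<^esub> = frag_lift (add_monoid V) (\<star>) s"
          "f b' = frag_lift (add_monoid V) (\<lambda>v a. v \<star> (a \<otimes>\<^bsub>D\<^esub> b')) s"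
          using MV_odd_representation[OF f' c(2)] by blast
        have fb': "f b' = \<zero>\<^bsub>V\<^esub>"
          using ker[unfolded kernel_condition_iff, rule_format, OF c(2) s(1)] s(2,3) f1 by simp
        have "act CV f b' \<in> component MV (m + int n * (k + 1))"
          using MV_degree[OF f' c(2)] by (simp add: algebra_simps)
        then have "act CV f b' \<in> homog_sum MV S" by (rule MV.M.homog_sum_component) simp
        moreover have "b'' \<in> DU"
          using DU_component[OF c(3)] U_shift[of "l - 1" 0] by simp
        ultimately have "act CV f b' b'' = act CV f b' \<one>\<^bsub>D\<^esub> \<star> b''" by (rule MV_eval_star)
        then show ?case
          using cc fb' star_zero_left[OF \<open>b'' \<in> DU\<close>] by (simp add: CV_simps(4) c(1))
      qed
    qed
  qed
  then have "f = \<zero>\<^bsub>CV\<^esub>"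
    by (intro CV_eqI[OF fC CV.zero_closed]) (simp add: CV_simps(2) D.component_carrier)
  then show ?thesis by (simp add: MV_simps)
qed

lemma ev_inj:
  assumes ker: "kernel_condition n D \<phi> V"
  shows "inj_on ev (carrier (F MV))"
proof -
  have zero: "f = \<zero>\<^bsub>MV\<^esub>" if f: "f \<in> homog_sum MV S" and f1: "f \<one>\<^bsub>D\<^esub> = \<zero>\<^bsub>V\<^esub>" for f
  proof (rule MV.M.zero_if_hparts_zero)
    show fc: "f \<in> carrier MV" using f by (rule MV.M.homog_sum_carrier)
    show "hpart MV s f = \<zero>\<^bsub>MV\<^esub>" for s
    proof (cases "s \<in> S")
      case False
      then show ?thesis using MV.M.homog_sum_hpart_zero[OF f] by simp
    next
      case True
      then obtain i where i: "s = m + \<delta> i" using S_range by blast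
      \<comment> \<open>Evaluation at 1 matches parts of degree m + \<delta> i with parts of degree
        i. This reduces injectivity to homogeneous functions.\<close>
      have "hpart V i (g \<one>\<^bsub>D\<^esub>) = (hpart MV s g) \<one>\<^bsub>D\<^esub>" if "g \<in> homog_sum MV S" for g
        using that
      proof (induction rule: MV.M.homog_sum_induct)
        case zero
        then show ?case by (simp add: MV_zero_apply)
      next
        case (component s' g)
        obtain i' where i': "s' = m + \<delta> i'" using component(1) S_range by blast
        have "g \<one>\<^bsub>D\<^esub> \<in> component V i'"
          by (rule MV_component_eval(1)[OF component(2) D.one_degree]) (simp add: i')
        then show ?case
          using MV.M.hpart_of_component[OF component(2), of s] V.M.hpart_of_component[of "g \<one>\<^bsub>D\<^esub>" i' i]
            koszul_degree_inj[OF n2, of i i'] by (auto simp: i i' MV_zero_apply)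
      next
        case (add g g')
        then have "g \<in> carrier MV" "g' \<in> carrier MV" using MV.M.homog_sum_carrier by blast+
        then show ?case
          using add additive_map_add[OF MV_eval_additive[OF D.one_closed]]
            additive_map_closed[OF MV_eval_additive[OF D.one_closed]]
          by (simp add: V.M.hpart_add MV.M.hpart_add)
      qed
      then have "(hpart MV s f) \<one>\<^bsub>D\<^esub> = \<zero>\<^bsub>V\<^esub>" using f f1 V.M.hpart_zero by metis
      then show ?thesis using MV_component_zero[OF ker, of "hpart MV s f" i] fc i by simp
    qed
  qed
  show ?thesis
  proof (rule inj_onI)
    fix f g assume f: "f \<in> carrier (F MV)" and g: "g \<in> carrier (F MV)" and eq: "ev f = ev g"
    have fg: "f \<in> homog_sum MV S" "g \<in> homog_sum MV S" using f g by (auto simp: F_simps)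
    have c: "f \<in> carrier MV" "g \<in> carrier MV" using fg MV.M.homog_sum_carrier by auto
    have "f \<one>\<^bsub>D\<^esub> = g \<one>\<^bsub>D\<^esub>" using eq fg by (simp add: ev_def)
    moreover have "g \<one>\<^bsub>D\<^esub> \<in> carrier V" using additive_map_closed[OF MV_eval_additive[OF D.one_closed] c(2)] .
    ultimately have "(f \<oplus>\<^bsub>MV\<^esub> \<ominus>\<^bsub>MV\<^esub> g) \<one>\<^bsub>D\<^esub> = \<zero>\<^bsub>V\<^esub>"
      using c additive_map_add[OF MV_eval_additive[OF D.one_closed], of f "\<ominus>\<^bsub>MV\<^esub> g"]
        additive_map_minus[OF MV.M.abelian_group_axioms V.M.abelian_group_axioms MV_eval_additive[OF D.one_closed], of g]
      by (simp add: V.M.r_neg)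
    then have "f \<oplus>\<^bsub>MV\<^esub> \<ominus>\<^bsub>MV\<^esub> g = \<zero>\<^bsub>MV\<^esub>"
      using zero[OF MV.M.homog_sum_add[OF fg(1) MV.M.homog_sum_minus[OF fg(2)]]] by blast
    then show "f = g" using c by (metis MV.M.add.inv_equality MV.M.minus_minus MV.M.a_inv_closed)
  qed
qed

end

section \<open>The universe\<close>

lemma infinite_pair_injection:
  assumes "infinite (UNIV :: 'u set)"
  shows "\<exists>p :: 'u \<times> 'u \<Rightarrow> 'u. inj p"
proof -
  have "|UNIV \<times> UNIV :: ('u \<times> 'u) set| =o |UNIV :: 'u set|"
    using card_of_Times_same_infinite[OF assms] by simp
  then obtain p :: "'u \<times> 'u \<Rightarrow> 'u" where "bij_betw p (UNIV \<times> UNIV) UNIV"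
    unfolding card_of_ordIso[symmetric] by blast
  then show ?thesis by (auto simp: bij_betw_def)
qed

text \<open>Iterated pairing is injective on lists of equal length only; pairing the result with the
  length separates the rest.\<close>

lemma infinite_list_injection:
  assumes "infinite (UNIV :: 'u set)"
  shows "\<exists>e :: (bool \<times> 'u) list \<Rightarrow> 'u. inj e"
proof -
  obtain p :: "'u \<times> 'u \<Rightarrow> 'u" where p: "inj p" using infinite_pair_injection[OF assms] by blast
  obtain \<nu> :: "nat \<Rightarrow> 'u" where \<nu>: "inj \<nu>" using assms infinite_countable_subset by blast
  define c where "c l = foldr (\<lambda>(b, u) w. p (p (\<nu> (if b then 1 else 0), u), w)) l (\<nu> 0)" for l :: "(bool \<times> 'u) list"
  have c: "l = l'" if "length l = length l'" "c l = c l'" for l l'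
    using that
  proof (induction l l' rule: list_induct2)
    case (Cons x xs y ys)
    obtain b u b' u' where xy: "x = (b, u)" "y = (b', u')" by fastforce
    have "p (p (\<nu> (if b then 1 else 0), u), c xs) = p (p (\<nu> (if b' then 1 else 0), u'), c ys)"
      using Cons.prems by (simp add: c_def xy)
    then have eq: "\<nu> (if b then 1 else 0) = \<nu> (if b' then 1 else 0)" "u = u'" "c xs = c ys"
      using p by (auto simp: inj_eq)
    then have "(if b then 1 else 0 :: nat) = (if b' then 1 else 0)" using \<nu> by (simp add: inj_eq)
    then show ?case using eq Cons.IH by (auto simp: xy split: if_splits)
  qed simp
  have "inj (\<lambda>l. p (\<nu> (length l), c l))"
    by (rule injI) (use p \<nu> c in \<open>auto simp: inj_eq\<close>)
  then show ?thesis by blast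
qed

text \<open>Every element of the generated subgroup is the value of a word in generators and their
  inverses, the boolean telling which. Choosing a word for each element embeds the subgroup into
  lists over \<open>'u\<close>.\<close>

lemma (in group) generate_injection:
  assumes inf: "infinite (UNIV :: 'u set)" and X: "X \<subseteq> carrier G" and \<iota>: "inj_on (\<iota> :: 'a \<Rightarrow> 'u) X"
  shows "\<exists>\<kappa> :: 'a \<Rightarrow> 'u. inj_on \<kappa> (generate G X)"
proof -
  define x where "x = (\<lambda>(b, u). if b then inv_into X \<iota> u else inv (inv_into X \<iota> u))"
  define val where "val l = foldr (\<lambda>q g. x q \<otimes> g) l \<one>" for l
  let ?Y = "UNIV \<times> \<iota> ` X"
  have xc: "x q \<in> carrier G" if "q \<in> ?Y" for q
    using that X \<iota> by (auto simp: x_def)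
  have vc: "val l \<in> carrier G" if "set l \<subseteq> ?Y" for l
    using that by (induction l) (use xc in \<open>auto simp: val_def\<close>)
  have va: "val (l @ l') = val l \<otimes> val l'" if "set l \<subseteq> ?Y" "set l' \<subseteq> ?Y" for l l'
    using that(1)
  proof (induction l)
    case Nil
    then show ?case using vc[OF that(2)] by (simp add: val_def)
  next
    case (Cons q l)
    then have "val (q # l @ l') = x q \<otimes> (val l \<otimes> val l')" by (simp add: val_def)
    also have "\<dots> = x q \<otimes> val l \<otimes> val l'" using Cons.prems xc vc[of l] vc[OF that(2)] by (simp add: m_assoc)
    finally show ?case by (simp add: val_def)
  qed
  have "\<exists>l. set l \<subseteq> ?Y \<and> val l = g" if "g \<in> generate G X" for g
    using that
  proof (induction rule: generate.induct)
    case one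
    show ?case by (rule exI[of _ "[]"]) (simp add: val_def)
  next
    case (incl h)
    then show ?case using X \<iota> by (intro exI[of _ "[(True, \<iota> h)]"]) (auto simp: val_def x_def)
  next
    case (inv h)
    then show ?case using X \<iota> by (intro exI[of _ "[(False, \<iota> h)]"]) (auto simp: val_def x_def)
  next
    case (eng h1 h2)
    then obtain l1 l2 where "set l1 \<subseteq> ?Y" "val l1 = h1" "set l2 \<subseteq> ?Y" "val l2 = h2" by blast
    then show ?case using va by (intro exI[of _ "l1 @ l2"]) auto
  qed
  then obtain l where l: "\<And>g. g \<in> generate G X \<Longrightarrow> val (l g) = g" by metis
  obtain e :: "(bool \<times> 'u) list \<Rightarrow> 'u" where e: "inj e" using infinite_list_injection[OF inf] by blast
  have "inj_on (\<lambda>g. e (l g)) (generate G X)"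
    by (rule inj_onI) (use e l in \<open>metis injD\<close>)
  then show ?thesis by blast
qed

text \<open>\<open>MV\<close> has its carrier in a type of functions, while the objects of the
  category have carriers in \<open>'u\<close>. This is the copy of a module along a map that is
  injective on the carrier.\<close>

definition transport_module :: "('a \<Rightarrow> 'u) \<Rightarrow> ('r, 'a) graded_module \<Rightarrow> ('r, 'u) graded_module" where
  "transport_module \<iota> M = \<lparr>carrier = \<iota> ` carrier M, mult = undefined, one = undefined, zero = \<iota> \<zero>\<^bsub>M\<^esub>,
     add = (\<lambda>x y. \<iota> (inv_into (carrier M) \<iota> x \<oplus>\<^bsub>M\<^esub> inv_into (carrier M) \<iota> y)),
     component = (\<lambda>i. \<iota> ` component M i),
     act = (\<lambda>x a. \<iota> (act M (inv_into (carrier M) \<iota> x) a))\<rparr>"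

context graded_right_module
begin

context
  fixes \<iota> :: "'a \<Rightarrow> 'u"
  assumes \<iota>: "inj_on \<iota> (carrier M)"
begin

abbreviation "TM \<equiv> transport_module \<iota> M"
abbreviation "\<kappa> \<equiv> inv_into (carrier M) \<iota>"

lemma transport_inverse: "x \<in> carrier M \<Longrightarrow> \<kappa> (\<iota> x) = x"
  using \<iota> by simp

lemma transport_simps:
  "carrier TM = \<iota> ` carrier M" "\<zero>\<^bsub>TM\<^esub> = \<iota> \<zero>\<^bsub>M\<^esub>" "component TM i = \<iota> ` component M i"
  "\<lbrakk>x \<in> carrier M; y \<in> carrier M\<rbrakk> \<Longrightarrow> \<iota> x \<oplus>\<^bsub>TM\<^esub> \<iota> y = \<iota> (x \<oplus>\<^bsub>M\<^esub> y)"
  "x \<in> carrier M \<Longrightarrow> act TM (\<iota> x) a = \<iota> (act M x a)"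
  by (simp_all add: transport_module_def transport_inverse)

lemma transport_graded_right_module: "graded_right_module R TM"
proof -
  have ab: "abelian_group TM"
  proof (rule abelian_groupI)
    show "\<exists>y\<in>carrier TM. y \<oplus>\<^bsub>TM\<^esub> x = \<zero>\<^bsub>TM\<^esub>" if "x \<in> carrier TM" for x
    proof -
      have "x \<in> \<iota> ` carrier M" using that by (simp add: transport_simps)
      then obtain a where "a \<in> carrier M" "x = \<iota> a" by blast
      then show ?thesis
        using transport_simps(4)[of "\<ominus>\<^bsub>M\<^esub> a" a] by (intro bexI[of _ "\<iota> (\<ominus>\<^bsub>M\<^esub> a)"]) (auto simp: transport_simps(1,2) M.l_neg)
    qed
  qed (auto simp: transport_simps M.a_ac)
  have gg: "graded_group TM"
    by (rule graded_group_transport[OF M.graded_group_axioms ab, of \<iota>])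
      (use \<iota> in \<open>auto simp: transport_simps bij_betw_def intro: additive_mapI\<close>)
  show ?thesis
    unfolding graded_right_module_def
  proof (intro conjI R.graded_ring_axioms gg graded_right_module_axioms.intro)
    fix x a i j assume "x \<in> component TM i" and a: "a \<in> component R j"
    then obtain y where "y \<in> component M i" "x = \<iota> y" by (auto simp: transport_simps)
    then show "act TM x a \<in> component TM (i + j)"
      using act_degree[of y i a j] a M.component_carrier by (simp add: transport_simps)
  qed (auto simp: transport_simps act_closed act_add_left act_add_right act_assoc act_one)
qed

lemma transport_back_gr_hom: "restrict \<kappa> (carrier TM) \<in> gr_hom R TM M"
proof (rule gr_homI)
  interpret TM: graded_right_module R TM by (rule transport_graded_right_module)
  show "restrict \<kappa> (carrier TM) (x \<oplus>\<^bsub>TM\<^esub> y) = restrict \<kappa> (carrier TM) x \<oplus>\<^bsub>M\<^esub> restrict \<kappa> (carrier TM) y"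
    if "x \<in> carrier TM" "y \<in> carrier TM" for x y
  proof -
    have "x \<in> \<iota> ` carrier M" "y \<in> \<iota> ` carrier M" using that by (simp_all add: transport_simps)
    then obtain a b where "a \<in> carrier M" "b \<in> carrier M" "x = \<iota> a" "y = \<iota> b" by blast
    then show ?thesis by (simp add: transport_simps transport_inverse)
  qed
  show "restrict \<kappa> (carrier TM) (act TM x a) = act M (restrict \<kappa> (carrier TM) x) a"
    if "x \<in> carrier TM" "a \<in> carrier R" for x a
  proof -
    have "x \<in> \<iota> ` carrier M" using that by (simp add: transport_simps)
    then obtain y where "y \<in> carrier M" "x = \<iota> y" by blast
    then show ?thesis using that(2) by (simp add: transport_simps transport_inverse act_closed)
  qed
  show "restrict \<kappa> (carrier TM) z \<in> component M i" if "z \<in> component TM i" for i z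
  proof -
    obtain y where "y \<in> component M i" "z = \<iota> y" using \<open>z \<in> component TM i\<close> by (auto simp: transport_simps)
    then show ?thesis using M.component_carrier by (simp add: transport_simps transport_inverse)
  qed
qed (auto simp: transport_simps transport_inverse)

lemma transport_in_G:
  assumes "in_G n m R M"
  shows "in_G n m R TM"
proof -
  interpret TM: graded_right_module R TM by (rule transport_graded_right_module)
  have gen: "generated_in_degrees R M (gen_degrees n m)"
    and tf: "\<And>d y. \<lbrakk>y \<in> component M d; y \<noteq> \<zero>\<^bsub>M\<^esub>\<rbrakk> \<Longrightarrow>
        \<exists>j. \<exists>b \<in> component R j. d + j \<in> degrees_S n m \<and> act M y b \<noteq> \<zero>\<^bsub>M\<^esub>"
    using assms unfolding in_G_iff by blast+
  show ?thesis
    unfolding TM.in_G_iff TM.generated_in_degrees_iff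
  proof (intro conjI allI ballI impI subsetI)
    fix d z assume "z \<in> component TM d"
    then obtain y where y: "y \<in> component M d" "z = \<iota> y" by (auto simp: transport_simps)
    have "\<iota> y \<in> generate (add_monoid TM) (homog_products R TM (gen_degrees n m) d)"
      using gen y(1)
    proof (induction rule: generated_component_induct)
      case zero
      then show ?case using TM.M.add_generate_zero by (simp add: transport_simps)
    next
      case (product i x a)
      have "\<iota> (act M x a) = act TM (\<iota> x) a" using product(2) M.component_carrier by (simp add: transport_simps)
      moreover have "\<iota> x \<in> component TM i" using product(2) by (simp add: transport_simps)
      ultimately have "\<iota> (act M x a) \<in> homog_products R TM (gen_degrees n m) d"
        using product(1,3) unfolding homog_products_def by blast
      then show ?case by (rule TM.M.add_generate_incl)
    next
      case (add x y)
      then show ?case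
        using TM.M.add_generate_add[OF add(3,4)] M.component_carrier by (simp add: transport_simps)
    qed
    then show "z \<in> generate (add_monoid TM) (homog_products R TM (gen_degrees n m) d)" using y by simp
  next
    fix d z assume "z \<in> component TM d" "z \<noteq> \<zero>\<^bsub>TM\<^esub>"
    then obtain y where y: "y \<in> component M d" "z = \<iota> y" "y \<noteq> \<zero>\<^bsub>M\<^esub>" by (auto simp: transport_simps)
    obtain j b where b: "b \<in> component R j" "d + j \<in> degrees_S n m" "act M y b \<noteq> \<zero>\<^bsub>M\<^esub>"
      using tf[OF y(1,3)] by blast
    have c: "y \<in> carrier M" "act M y b \<in> carrier M"
      using y(1) b(1) M.component_carrier R.component_carrier act_closed by blast+
    then have "act TM z b \<noteq> \<zero>\<^bsub>TM\<^esub>"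
      using b(3) inj_onD[OF \<iota>, of "act M y b" "\<zero>\<^bsub>M\<^esub>"] by (auto simp: y(2) transport_simps)
    then show "\<exists>j. \<exists>b \<in> component R j. d + j \<in> degrees_S n m \<and> act TM z b \<noteq> \<zero>\<^bsub>TM\<^esub>" using b by blast
  qed
qed

end

end

section \<open>Bijective graded morphisms are isomorphisms\<close>

lemma gr_hom_hpart:
  assumes "graded_group M" "graded_group N" and f: "f \<in> gr_hom R M N" and x: "x \<in> carrier M"
  shows "f (hpart M i x) = hpart N i (f x)"
proof -
  interpret M: graded_group M by fact
  interpret N: graded_group N by fact
  note fD = gr_homD[OF f]
  show ?thesis
  proof (rule M.additive_map_eqI[OF _ _ N.abelian_group_axioms _ x])
    show "additive_map M N (\<lambda>x. f (hpart M i x))"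
      by (rule M.additive_map_compose[OF M.hpart_additive fD(6)])
    show "additive_map M N (\<lambda>x. hpart N i (f x))"
      by (rule M.additive_map_compose[OF fD(6) N.hpart_additive])
    show "f (hpart M i z) = hpart N i (f z)" if "z \<in> component M j" for j z
      using N.hpart_of_component[OF fD(5)[OF that], of i] M.hpart_of_component[OF that, of i]
        additive_map_zero[OF M.abelian_group_axioms N.abelian_group_axioms fD(6)] by simp
  qed
qed

text \<open>Only the degrees of the inverse need thought: if f x is homogeneous of degree i, the
  other parts of x are sent to 0 and vanish by injectivity.\<close>

lemma bij_gr_hom_iso:
  assumes M: "graded_right_module R M" and N: "graded_right_module R N"
    and f: "f \<in> gr_hom R M N" and bij: "bij_betw f (carrier M) (carrier N)"
  shows "\<exists>g \<in> gr_hom R N M. compose (carrier M) g f = (\<lambda>x\<in>carrier M. x) \<and>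
    compose (carrier N) f g = (\<lambda>y\<in>carrier N. y)"
proof -
  interpret M: graded_right_module R M by fact
  interpret N: graded_right_module R N by fact
  note fD = gr_homD[OF f]
  let ?g = "restrict (inv_into (carrier M) f) (carrier N)"
  have surj: "carrier N = f ` carrier M" and inj: "inj_on f (carrier M)" using bij by (auto simp: bij_betw_def)
  have gf: "inv_into (carrier M) f (f x) = x" if "x \<in> carrier M" for x using inj that by simp
  have "?g \<in> gr_hom R N M"
  proof (rule gr_homI)
    show "?g z \<in> component M i" if z: "z \<in> component N i" for i z
    proof -
      have "z \<in> f ` carrier M" using z N.M.component_carrier surj by blast
      then obtain x where x: "x \<in> carrier M" "z = f x" by blast
      have "x \<in> component M i"
      proof (rule M.M.component_if_hparts_zero[OF x(1)])
        fix j assume "j \<noteq> i"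
        then have "f (hpart M j x) = \<zero>\<^bsub>N\<^esub>"
          using gr_hom_hpart[OF M.M.graded_group_axioms N.M.graded_group_axioms f x(1), of j]
            N.M.hpart_of_component[OF z, of j] x(2) by simp
        also have "\<dots> = f \<zero>\<^bsub>M\<^esub>"
          using additive_map_zero[OF M.M.abelian_group_axioms N.M.abelian_group_axioms fD(6)] by simp
        finally show "hpart M j x = \<zero>\<^bsub>M\<^esub>" using inj x(1) by (simp add: inj_on_eq_iff)
      qed
      then show ?thesis using x gf fD(2) by simp
    qed
    show "?g (x \<oplus>\<^bsub>N\<^esub> y) = ?g x \<oplus>\<^bsub>M\<^esub> ?g y" if xy: "x \<in> carrier N" "y \<in> carrier N" for x y
    proof -
      from xy surj have "x \<in> f ` carrier M" "y \<in> f ` carrier M" by auto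
      then obtain u v where uv: "u \<in> carrier M" "v \<in> carrier M" "x = f u" "y = f v" by blast
      then have "x \<oplus>\<^bsub>N\<^esub> y = f (u \<oplus>\<^bsub>M\<^esub> v)" using fD(3) by simp
      then show ?thesis using uv fD(2) gf by simp
    qed
    show "?g (act N x a) = act M (?g x) a" if xa: "x \<in> carrier N" "a \<in> carrier R" for x a
    proof -
      from xa surj have "x \<in> f ` carrier M" by auto
      then obtain u where u: "u \<in> carrier M" "x = f u" by blast
      then have "act N x a = f (act M u a)" using fD(4) xa(2) by simp
      then show ?thesis using u fD(2) gf xa(2) M.act_closed by simp
    qed
  qed (use surj gf in auto)
  moreover have "compose (carrier M) ?g f = (\<lambda>x\<in>carrier M. x)"
    using gf fD(2) by (auto simp: compose_def fun_eq_iff)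
  moreover have "compose (carrier N) f ?g = (\<lambda>y\<in>carrier N. y)"
    using bij by (auto simp: compose_def fun_eq_iff bij_betw_def f_inv_into_f)
  ultimately show ?thesis by blast
qed

section \<open>The equivalence\<close>

text \<open>The two conditions make \<open>'u\<close> large enough to contain a copy of the function
  module of any V with carrier in \<open>'u\<close>.\<close>

locale truncation_universe = truncation D E \<phi> n m
  for D :: "'a graded" and E :: "'e graded" and \<phi> :: "'a \<Rightarrow> 'e" and n :: nat and m :: int +
  fixes u :: "'u itself"
  assumes infinite: "infinite (UNIV :: 'u set)" and embeds: "\<exists>\<iota> :: 'a \<Rightarrow> 'u. inj_on \<iota> (carrier D)"
begin

text \<open>The generators \<theta> v a are indexed by pairs in V \<times> D, and these embed into
  \<open>'u\<close> by pairing. The group that they generate then embeds as well.\<close>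

lemma MV_embeds:
  assumes V: "graded_right_module E (V :: ('e, 'u) graded_module)"
  shows "\<exists>\<iota> :: ('a \<Rightarrow> 'u) \<Rightarrow> 'u. inj_on \<iota> (carrier (truncation_vmodule.MV D \<phi> n m V))"
proof -
  interpret truncation_vmodule D E \<phi> n m V by (intro truncation_vmodule.intro truncation_axioms V)
  obtain \<iota> :: "'a \<Rightarrow> 'u" where \<iota>: "inj_on \<iota> (carrier D)" using embeds by blast
  obtain p :: "'u \<times> 'u \<Rightarrow> 'u" where p: "inj p" using infinite_pair_injection[OF infinite] by blast
  let ?X = "\<Union>d. gens d"
  have "\<forall>f \<in> ?X. \<exists>q. fst q \<in> carrier V \<and> snd q \<in> carrier D \<and> f = \<theta> (fst q) (snd q)"
    using V.M.component_carrier D.component_carrier by (fastforce simp: gens_def)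
  then obtain q where q: "\<And>f. f \<in> ?X \<Longrightarrow> snd (q f) \<in> carrier D \<and> f = \<theta> (fst (q f)) (snd (q f))"
    by metis
  have "inj_on (\<lambda>f. p (fst (q f), \<iota> (snd (q f)))) ?X"
  proof (rule inj_onI)
    fix f g assume f: "f \<in> ?X" and g: "g \<in> ?X"
      and "p (fst (q f), \<iota> (snd (q f))) = p (fst (q g), \<iota> (snd (q g)))"
    then have "fst (q f) = fst (q g)" "\<iota> (snd (q f)) = \<iota> (snd (q g))" using p by (auto simp: inj_eq)
    moreover from this(2) have "snd (q f) = snd (q g)" using \<iota> q[OF f] q[OF g] by (simp add: inj_on_eq_iff)
    ultimately show "f = g" using q[OF f] q[OF g] by simp
  qed
  then show ?thesis
    unfolding MV_simps using group.generate_injection[OF CV.a_group infinite, of ?X] Gens_CV by simp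
qed

text \<open>Obtained from evaluation at 1 on a copy of \<open>MV\<close>. The injective case gives
  essential surjectivity of restriction; surjectivity without the condition on kernels is what will
  be applied to projective modules, for which that condition is still to be proved.\<close>

lemma cover_by_F:
  assumes V: "graded_right_module E (V :: ('e, 'u) graded_module)" and gen: "generated_in_degrees E V {i. even i}"
  shows "\<exists>M :: ('a, 'u) graded_module. \<exists>f. graded_right_module D M \<and> in_G n m D M \<and> f \<in> gr_hom E (F M) V \<and>
    f ` carrier (F M) = carrier V \<and> (kernel_condition n D \<phi> V \<longrightarrow> inj_on f (carrier (F M)))"
proof -
  interpret truncation_vmodule D E \<phi> n m V by (intro truncation_vmodule.intro truncation_axioms V)
  obtain \<iota> :: "('a \<Rightarrow> 'u) \<Rightarrow> 'u" where \<iota>: "inj_on \<iota> (carrier MV)" using MV_embeds[OF V] by blast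
  let ?M = "transport_module \<iota> MV" and ?\<kappa> = "inv_into (carrier MV) \<iota>"
  let ?k = "restrict ?\<kappa> (carrier ?M)"
  have M: "graded_right_module D ?M" by (rule MV.transport_graded_right_module[OF \<iota>])
  have G: "in_G n m D ?M" by (rule MV.transport_in_G[OF \<iota> in_G_MV])
  have k: "?k \<in> gr_hom D ?M MV" by (rule MV.transport_back_gr_hom[OF \<iota>])
  interpret M: graded_right_module D ?M by (rule M)
  let ?kS = "restrict ?k (homog_sum ?M S)"
  have kS: "?kS \<in> gr_hom E (F ?M) (F MV)" by (rule restrict_gr_hom[OF M graded_right_module_MV k])
  interpret TM: truncation_module D E \<phi> n m ?M by (intro truncation_module.intro truncation_axioms M)
  have FM: "graded_right_module E (F ?M)" by (rule TM.graded_right_module_F)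
  have car: "carrier (F ?M) = homog_sum ?M S" "carrier (F MV) = homog_sum MV S" by (simp_all add: F_simps)
  have bij: "bij_betw ?kS (carrier (F ?M)) (carrier (F MV))"
    unfolding bij_betw_def
  proof
    have kk: "?kS x = ?\<kappa> x" "x \<in> \<iota> ` carrier MV" if "x \<in> homog_sum ?M S" for x
      using that M.M.homog_sum_carrier[OF that] by (simp_all add: MV.transport_simps[OF \<iota>])
    show "inj_on ?kS (carrier (F ?M))"
      unfolding car by (rule inj_onI) (metis kk f_inv_into_f)
    show "?kS ` carrier (F ?M) = carrier (F MV)"
    proof
      show "?kS ` carrier (F ?M) \<subseteq> carrier (F MV)" using gr_homD(2)[OF kS] by blast
      show "carrier (F MV) \<subseteq> ?kS ` carrier (F ?M)"
      proof
        fix f assume "f \<in> carrier (F MV)"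
        then have f: "f \<in> homog_sum MV S" by (simp add: car)
        have fc: "f \<in> carrier MV" using f by (rule MV.M.homog_sum_carrier)
        have "\<iota> f \<in> homog_sum ?M S"
          using f
        proof (induction rule: MV.M.homog_sum_induct)
          case zero
          then show ?case using M.M.homog_sum_zero by (simp add: MV.transport_simps[OF \<iota>])
        next
          case (component i f)
          then show ?case
            by (intro M.M.homog_sum_component[of _ i]) (simp_all add: MV.transport_simps[OF \<iota>])
        next
          case (add f g)
          then show ?case
            using M.M.homog_sum_add[OF add(3,4)] MV.M.homog_sum_carrier by (simp add: MV.transport_simps[OF \<iota>])
        qed
        moreover from this have "?kS (\<iota> f) = f" using kk MV.transport_inverse[OF \<iota> fc] by simp
        ultimately show "f \<in> ?kS ` carrier (F ?M)" unfolding car by (metis image_eqI)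
      qed
    qed
  qed
  let ?f = "compose (carrier (F ?M)) ev ?kS"
  have f: "?f \<in> gr_hom E (F ?M) V" by (rule gr_hom_compose[OF FM kS ev_gr_hom])
  have img: "?f ` carrier (F ?M) = carrier V"
  proof -
    have "?f ` carrier (F ?M) = ev ` ?kS ` carrier (F ?M)" by (auto simp: compose_def image_image)
    then show ?thesis using bij ev_surj[OF gen] by (simp add: bij_betw_def)
  qed
  have inj: "inj_on ?f (carrier (F ?M))" if "kernel_condition n D \<phi> V"
  proof -
    have "inj_on (ev \<circ> ?kS) (carrier (F ?M))"
      using bij ev_inj[OF that] by (intro comp_inj_on) (auto simp: bij_betw_def)
    then show ?thesis by (rule inj_on_cong[THEN iffD1, rotated]) (simp add: compose_def)
  qed
  show ?thesis using M G f img inj by blast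
qed

theorem equivalence:
  "equivalent_categories
     (full_subcategory (Gr D) (in_G n m D) :: (('a, 'u) graded_module, 'u \<Rightarrow> 'u) category)
     (full_subcategory (Gr E) (in_L n D E \<phi>) :: (('e, 'u) graded_module, 'u \<Rightarrow> 'u) category)"
proof (rule equivalent_categoriesI)
  let ?C = "full_subcategory (Gr D) (in_G n m D) :: (('a, 'u) graded_module, 'u \<Rightarrow> 'u) category"
  let ?L = "full_subcategory (Gr E) (in_L n D E \<phi>) :: (('e, 'u) graded_module, 'u \<Rightarrow> 'u) category"
  let ?Fm = "\<lambda>M N f. restrict f (homog_sum M S)"
  have ObC: "M \<in> Ob ?C \<longleftrightarrow> graded_right_module D M \<and> in_G n m D M" for M
    by (simp add: full_subcategory_def Gr_def)
  have ObL: "V \<in> Ob ?L \<longleftrightarrow> graded_right_module E V \<and> in_L n D E \<phi> V" for V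
    by (simp add: full_subcategory_def Gr_def)
  have HomC: "Hom ?C M N = gr_hom D M N" for M N by (simp add: full_subcategory_def Gr_def)
  have HomL: "Hom ?L M N = gr_hom E M N" for M N by (simp add: full_subcategory_def Gr_def)
  have IdC: "Id ?C M = (\<lambda>x\<in>carrier M. x)" for M by (simp add: full_subcategory_def Gr_def)
  have IdL: "Id ?L M = (\<lambda>x\<in>carrier M. x)" for M by (simp add: full_subcategory_def Gr_def)
  have CompC: "Comp ?C L M N g f = compose (carrier L) g f" for L M N g f
    by (simp add: full_subcategory_def Gr_def)
  have CompL: "Comp ?L L M N g f = compose (carrier L) g f" for L M N g f
    by (simp add: full_subcategory_def Gr_def)
  have TM: "truncation_module D E \<phi> n M" if "M \<in> Ob ?C" for M
    using that truncation_axioms unfolding ObC by (intro truncation_module.intro) auto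
  have sub: "x \<in> carrier M" if "M \<in> Ob ?C" "x \<in> homog_sum M S" for M x
    using that graded_group.homog_sum_carrier[of M x S] unfolding ObC graded_right_module_def by blast
  have FOb: "F M \<in> Ob ?L" if M: "M \<in> Ob ?C" for M
  proof -
    interpret truncation_module D E \<phi> n m M by (rule TM[OF M])
    have "generated_in_degrees D M (gen_degrees n m)" using M M.in_G_iff unfolding ObC by blast
    then show ?thesis using in_L_F graded_right_module_F unfolding ObL by blast
  qed
  show "cat_functor ?C ?L F ?Fm"
  proof (intro cat_functor.intro category_Gr cat_functor_axioms.intro)
    show "F M \<in> Ob ?L" if "M \<in> Ob ?C" for M using FOb[OF that] .
    show fm: "?Fm M N f \<in> Hom ?L (F M) (F N)" if "M \<in> Ob ?C" "N \<in> Ob ?C" "f \<in> Hom ?C M N" for M N f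
      using that restrict_gr_hom unfolding ObC HomC HomL by blast
    show "?Fm M M (Id ?C M) = Id ?L (F M)" if "M \<in> Ob ?C" for M
      unfolding IdC IdL F_simps(1) by (intro ext) (simp add: restrict_def sub[OF that])
    show "?Fm L N (Comp ?C L M N g f) = Comp ?L (F L) (F M) (F N) (?Fm M N g) (?Fm L M f)"
      if "L \<in> Ob ?C" "M \<in> Ob ?C" "N \<in> Ob ?C" "f \<in> Hom ?C L M" "g \<in> Hom ?C M N" for L M N f g
    proof -
      have "f x \<in> homog_sum M S" if x: "x \<in> homog_sum L S" for x
        using gr_homD(2)[OF fm[OF \<open>L \<in> Ob ?C\<close> \<open>M \<in> Ob ?C\<close> \<open>f \<in> Hom ?C L M\<close>, unfolded HomL], of x] x
        by (simp add: F_simps)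
      then show ?thesis
        unfolding CompC CompL F_simps(1)
        by (intro ext) (simp add: compose_def restrict_def sub[OF \<open>L \<in> Ob ?C\<close>])
    qed
  qed
  show "bij_betw (?Fm M N) (Hom ?C M N) (Hom ?L (F M) (F N))" if M: "M \<in> Ob ?C" and N: "N \<in> Ob ?C" for M N
    unfolding bij_betw_def HomC HomL
  proof
    have gM: "graded_right_module D M" "in_G n m D M" and gN: "graded_right_module D N" "in_G n m D N"
      using M N unfolding ObC by auto
    have gen: "generated_in_degrees D M (gen_degrees n m)"
      using graded_right_module.in_G_iff[OF gM(1)] gM(2) by blast
    show "inj_on (?Fm M N) (gr_hom D M N)"
      by (rule inj_onI) (rule restrict_gr_hom_inj[OF gM(1) gN(1) gen])
    show "?Fm M N ` gr_hom D M N = gr_hom E (F M) (F N)"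
    proof
      show "?Fm M N ` gr_hom D M N \<subseteq> gr_hom E (F M) (F N)"
        using restrict_gr_hom[OF gM(1) gN(1)] by blast
      show "gr_hom E (F M) (F N) \<subseteq> ?Fm M N ` gr_hom D M N"
      proof
        fix g assume "g \<in> gr_hom E (F M) (F N)"
        then obtain f where "f \<in> gr_hom D M N" "restrict f (homog_sum M S) = g"
          using restrict_gr_hom_surj[OF gM(1) gN(1) gM(2) gN(2)] by blast
        then show "g \<in> ?Fm M N ` gr_hom D M N" by blast
      qed
    qed
  qed
  show "\<exists>M \<in> Ob ?C. iso_in ?L (F M) V \<noteq> {}" if V: "V \<in> Ob ?L" for V
  proof -
    have gV: "graded_right_module E V" "in_L n D E \<phi> V" using V unfolding ObL by auto
    interpret truncation_vmodule D E \<phi> n m V by (intro truncation_vmodule.intro truncation_axioms gV(1))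
    have gen: "generated_in_degrees E V {i. even i}" and ker: "kernel_condition n D \<phi> V"
      using gV(2) unfolding in_L_iff by auto
    obtain M :: "('a, 'u) graded_module" and f where M: "graded_right_module D M" "in_G n m D M"
      and f: "f \<in> gr_hom E (F M) V" "f ` carrier (F M) = carrier V" "inj_on f (carrier (F M))"
      using cover_by_F[OF gV(1) gen] ker by blast
    have MO: "M \<in> Ob ?C" using M ObC by blast
    then have "graded_right_module E (F M)" using FOb ObL by blast
    then obtain g where "g \<in> gr_hom E V (F M)" "compose (carrier (F M)) g f = (\<lambda>x\<in>carrier (F M). x)"
      "compose (carrier V) f g = (\<lambda>y\<in>carrier V. y)"
      using bij_gr_hom_iso[OF _ gV(1) f(1)] f(2,3) unfolding bij_betw_def by blast
    then have "f \<in> iso_in ?L (F M) V" using f(1) unfolding iso_in_def HomL CompL IdL by blast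
    then show ?thesis using MO by blast
  qed
qed

end

lemma (in abelian_group) eq_if_diff_zero:
  "\<lbrakk>x \<in> carrier G; y \<in> carrier G; x \<oplus> \<ominus> y = \<zero>\<rbrakk> \<Longrightarrow> x = y"
  by (metis add.inv_equality minus_minus a_inv_closed)

section \<open>Modules presented in even degrees\<close>

text \<open>Applies h to the first entries of a formal sum. The quantifier over \<open>g\<close>
  stands inside because the same \<open>t\<close> has to serve both sums in the condition on
  kernels.\<close>

lemma frag_push:
  assumes G: "comm_group G" and s: "Poly_Mapping.keys s \<subseteq> A \<times> B" and h: "\<And>v. v \<in> A \<Longrightarrow> h v \<in> A'"
  shows "\<exists>t. Poly_Mapping.keys t \<subseteq> A' \<times> B \<and>
    (\<forall>g. (\<forall>v\<in>A'. \<forall>b\<in>B. g v b \<in> carrier G) \<longrightarrow> frag_lift G g t = frag_lift G (\<lambda>v b. g (h v) b) s)" (is "?P s")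
  using s
proof (rule free_Abelian_group_induct)
  show "?P 0"
    by (rule exI[of _ 0]) (simp add: comm_group.frag_lift_zero[OF G])
next
  fix p assume p: "p \<in> A \<times> B"
  then obtain v b where vb: "p = (v, b)" "v \<in> A" "b \<in> B" by blast
  show "?P (frag_of p)"
  proof (intro exI[of _ "frag_of (h v, b)"] conjI allI impI)
    show "Poly_Mapping.keys (frag_of (h v, b)) \<subseteq> A' \<times> B" using h vb by (simp add: keys_frag_of)
    fix g
    assume g: "\<forall>v\<in>A'. \<forall>b\<in>B. g v b \<in> carrier G"
    then have c: "g (h v) b \<in> carrier G" using h vb by blast
    show "frag_lift G g (frag_of (h v, b)) = frag_lift G (\<lambda>v b. g (h v) b) (frag_of p)"
      using comm_group.frag_lift_of[OF G, of g "h v" b, OF c]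
        comm_group.frag_lift_of[OF G, of "\<lambda>v b. g (h v) b" v b, OF c] by (simp add: vb(1))
  qed
next
  fix x y
  assume xy: "Poly_Mapping.keys x \<subseteq> A \<times> B" "Poly_Mapping.keys y \<subseteq> A \<times> B" and "?P x" "?P y"
  then obtain t r where t: "Poly_Mapping.keys t \<subseteq> A' \<times> B" "Poly_Mapping.keys r \<subseteq> A' \<times> B"
    and eq: "\<And>g. \<forall>v\<in>A'. \<forall>b\<in>B. g v b \<in> carrier G \<Longrightarrow> frag_lift G g t = frag_lift G (\<lambda>v b. g (h v) b) x"
      "\<And>g. \<forall>v\<in>A'. \<forall>b\<in>B. g v b \<in> carrier G \<Longrightarrow> frag_lift G g r = frag_lift G (\<lambda>v b. g (h v) b) y"
    by metis
  show "?P (x - y)"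
  proof (intro exI[of _ "t - r"] conjI allI impI)
    show "Poly_Mapping.keys (t - r) \<subseteq> A' \<times> B" using keys_diff[of t r] t by blast
    fix g assume g: "\<forall>v\<in>A'. \<forall>b\<in>B. g v b \<in> carrier G"
    have "frag_lift G g (t - r) = frag_lift G g t \<otimes>\<^bsub>G\<^esub> inv\<^bsub>G\<^esub> (frag_lift G g r)"
      using comm_group.frag_lift_diff[OF G t, of g] g by simp
    also have "\<dots> = frag_lift G (\<lambda>v b. g (h v) b) x \<otimes>\<^bsub>G\<^esub> inv\<^bsub>G\<^esub> (frag_lift G (\<lambda>v b. g (h v) b) y)"
      using eq g by simp
    also have "\<dots> = frag_lift G (\<lambda>v b. g (h v) b) (x - y)"
      using comm_group.frag_lift_diff[OF G xy, of "\<lambda>v b. g (h v) b"] g h by simp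
    finally show "frag_lift G g (t - r) = frag_lift G (\<lambda>v b. g (h v) b) (x - y)" .
  qed
qed

section \<open>The condition on kernels for projectives and cokernels\<close>

context truncation
begin

lemma gr_hom_frag_lift:
  assumes M: "graded_right_module E M" and N: "graded_right_module E N" and f: "f \<in> gr_hom E M N"
    and s: "Poly_Mapping.keys s \<subseteq> component M i \<times> B" and \<beta>: "\<And>a. a \<in> B \<Longrightarrow> \<beta> a \<in> carrier E"
  shows "f (frag_lift (add_monoid M) (\<lambda>v a. act M v (\<beta> a)) s)
    = frag_lift (add_monoid N) (\<lambda>v a. act N (f v) (\<beta> a)) s"
proof -
  interpret M: graded_right_module E M by fact
  interpret N: graded_right_module E N by fact
  note fD = gr_homD[OF f]
  have hom: "f \<in> hom (add_monoid M) (add_monoid N)"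
    by (rule homI) (use fD in auto)
  have c: "act M v (\<beta> a) \<in> carrier (add_monoid M)" if "(v, a) \<in> component M i \<times> B" for v a
    using that M.act_closed M.M.component_carrier \<beta> by auto
  have "f (frag_lift (add_monoid M) (\<lambda>v a. act M v (\<beta> a)) s)
      = frag_lift (add_monoid N) (\<lambda>v a. f (act M v (\<beta> a))) s"
    by (rule comm_group.frag_lift_hom[OF M.M.a_comm_group N.M.a_group hom N.M.a_comm_group s]) (rule c)
  also have "\<dots> = frag_lift (add_monoid N) (\<lambda>v a. act N (f v) (\<beta> a)) s"
  proof (rule comm_group.frag_lift_cong[OF N.M.a_comm_group s])
    fix v a assume va: "(v, a) \<in> component M i \<times> B"
    then show "f (act M v (\<beta> a)) = act N (f v) (\<beta> a)" using fD(4) M.M.component_carrier \<beta> by auto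
    show "act N (f v) (\<beta> a) \<in> carrier (add_monoid N)"
      using va fD(2) M.M.component_carrier \<beta> N.act_closed by auto
  qed
  finally show ?thesis .
qed

lemma \<phi>_degree_1: "a \<in> component D 1 \<Longrightarrow> \<phi> a \<in> carrier E"
  using \<phi>_component[of a 1] E.component_carrier by (simp add: koszul_degree_def)

lemma \<phi>_degree_n: "\<lbrakk>a \<in> component D 1; b \<in> component D (int n - 1)\<rbrakk> \<Longrightarrow> \<phi> (a \<otimes>\<^bsub>D\<^esub> b) \<in> carrier E"
  using \<phi>_component[of "a \<otimes>\<^bsub>D\<^esub> b" 2] E.component_carrier D.mult_degree[of a 1 b "int n - 1"]
  by (simp add: koszul_degree_def)

text \<open>Both sums in M become, under h, the corresponding sums in N for the formal sum pushed
  forward; injectivity brings the conclusion back.\<close>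

lemma kernel_condition_retract:
  assumes M: "graded_right_module E M" and N: "graded_right_module E (N :: ('e, 'w) graded_module)"
    and h: "h \<in> gr_hom E M N" "inj_on h (carrier M)" and ker: "kernel_condition n D \<phi> N"
  shows "kernel_condition n D \<phi> (M :: ('e, 'u) graded_module)"
  unfolding kernel_condition_def
proof (intro allI ballI impI)
  interpret M: graded_right_module E M by fact
  interpret N: graded_right_module E N by fact
  note hD = gr_homD[OF h(1)]
  fix k b s
  let ?L = "\<lambda>V. frag_lift (add_monoid V) (\<lambda>v a. act V v (\<phi> a))"
  let ?Lb = "\<lambda>V. frag_lift (add_monoid V) (\<lambda>v a. act V v (\<phi> (a \<otimes>\<^bsub>D\<^esub> b)))"
  assume b: "b \<in> component D (int n - 1)" and s: "Poly_Mapping.keys s \<subseteq> component M (2 * k) \<times> component D 1"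
    and z: "?L M s = \<zero>\<^bsub>M\<^esub>"
  obtain t where t: "Poly_Mapping.keys t \<subseteq> component N (2 * k) \<times> component D 1"
    and eq: "\<And>g. \<forall>v\<in>component N (2 * k). \<forall>a\<in>component D 1. g v a \<in> carrier (add_monoid N)
      \<Longrightarrow> frag_lift (add_monoid N) g t = frag_lift (add_monoid N) (\<lambda>v a. g (h v) a) s"
    using frag_push[OF N.M.a_comm_group s, of h "component N (2 * k)"] hD(5) by blast
  have Nc: "act N v e \<in> carrier (add_monoid N)" if "v \<in> component N (2 * k)" "e \<in> carrier E" for v e
    using that N.act_closed N.M.component_carrier by simp
  have h0: "h \<zero>\<^bsub>M\<^esub> = \<zero>\<^bsub>N\<^esub>"
    by (rule additive_map_zero[OF M.M.abelian_group_axioms N.M.abelian_group_axioms hD(6)])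
  have "?L N t = frag_lift (add_monoid N) (\<lambda>v a. act N (h v) (\<phi> a)) s"
    by (rule eq) (use Nc \<phi>_degree_1 in auto)
  also have "\<dots> = h (?L M s)" by (rule gr_hom_frag_lift[OF M N h(1) s, symmetric]) (rule \<phi>_degree_1)
  finally have "?L N t = \<zero>\<^bsub>N\<^esub>" using z h0 by simp
  then have "?Lb N t = \<zero>\<^bsub>N\<^esub>" using ker b t unfolding kernel_condition_def by blast
  moreover have "?Lb N t = frag_lift (add_monoid N) (\<lambda>v a. act N (h v) (\<phi> (a \<otimes>\<^bsub>D\<^esub> b))) s"
    by (rule eq) (use Nc \<phi>_degree_n b in auto)
  moreover have "\<dots> = h (?Lb M s)" by (rule gr_hom_frag_lift[OF M N h(1) s, symmetric]) (rule \<phi>_degree_n[OF _ b])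
  ultimately have "h (?Lb M s) = h \<zero>\<^bsub>M\<^esub>" using h0 by simp
  moreover have "?Lb M s \<in> carrier (add_monoid M)"
    using s by (rule comm_group.frag_lift_closed[OF M.M.a_comm_group])
      (use M.act_closed M.M.component_carrier \<phi>_degree_n[OF _ b] in auto)
  ultimately show "?Lb M s = \<zero>\<^bsub>M\<^esub>" using h(2) by (simp add: inj_on_eq_iff)
qed

end

context truncation_universe
begin

text \<open>Projectivity splits the cover of P by a restricted module, so P embeds into a module for
  which the condition is known.\<close>

lemma kernel_condition_projective:
  assumes P: "gr_projective E (P :: ('e, 'u) graded_module)" and gen: "generated_in_degrees E P {i. even i}"
  shows "kernel_condition n D \<phi> P"
proof -
  have P': "graded_right_module E P" using P by (simp add: gr_projective_def)
  obtain M :: "('a, 'u) graded_module" and f where M: "graded_right_module D M" and f: "f \<in> gr_hom E (F M) P"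
    "f ` carrier (F M) = carrier P"
    using cover_by_F[OF P' gen] by blast
  interpret TM: truncation_module D E \<phi> n m M by (intro truncation_module.intro truncation_axioms M)
  have FM: "graded_right_module E (F M)" by (rule TM.graded_right_module_F)
  have "\<exists>h \<in> gr_hom E P (F M). compose (carrier P) f h = (\<lambda>x\<in>carrier P. x)"
    using P FM P' f gr_hom_id[OF P'] unfolding gr_projective_def by blast
  then obtain h where h: "h \<in> gr_hom E P (F M)" "compose (carrier P) f h = (\<lambda>x\<in>carrier P. x)" by blast
  have "f (h x) = x" if "x \<in> carrier P" for x
    using fun_cong[OF h(2), of x] that by (simp add: compose_def)
  then have "inj_on h (carrier P)" by (rule inj_on_inverseI)
  then show ?thesis by (rule kernel_condition_retract[OF P' FM h(1) _ TM.kernel_condition_F])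
qed

text \<open>A formal sum over V is lifted to P0, where its products with D_1 add up to an element f
  w instead of 0. Since P1 is generated in even degrees, w comes from a formal sum over P1;
  subtracting the image of that sum makes the condition for P0 applicable, and the correction
  disappears under g.\<close>

lemma presented_in_L:
  assumes V: "graded_right_module E (V :: ('e, 'u) graded_module)" and pres: "presented_in_even_degrees E V"
  shows "in_L n D E \<phi> V"
proof -
  obtain P0 P1 :: "('e, 'u) graded_module" and f g where
    P0: "gr_projective E P0" "generated_in_degrees E P0 {i. even i}" and
    P1: "gr_projective E P1" "generated_in_degrees E P1 {i. even i}" and
    f: "f \<in> gr_hom E P1 P0" and g: "g \<in> gr_hom E P0 V" and gs: "g ` carrier P0 = carrier V"
    and ex: "a_kernel P0 V g = f ` carrier P1"
    using pres unfolding presented_in_even_degrees_def by blast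
  have gP0: "graded_right_module E P0" and gP1: "graded_right_module E P1"
    using P0 P1 by (auto simp: gr_projective_def)
  interpret TV: truncation_vmodule D E \<phi> n m V by (intro truncation_vmodule.intro truncation_axioms V)
  interpret T1: truncation_vmodule D E \<phi> n m P1 by (intro truncation_vmodule.intro truncation_axioms gP1)
  interpret P0: graded_right_module E P0 by fact
  note fD = gr_homD[OF f] and gD = gr_homD[OF g]
  note ab = P0.M.abelian_group_axioms TV.V.M.abelian_group_axioms T1.V.M.abelian_group_axioms
  have lift: "\<exists>x \<in> component P0 d. g x = v" if v: "v \<in> component V d" for v d
  proof -
    have "v \<in> g ` carrier P0" using v gs TV.V.M.component_carrier by blast
    then obtain x where x: "x \<in> carrier P0" "g x = v" by blast
    have "g (hpart P0 d x) = v"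
      using gr_hom_hpart[OF P0.M.graded_group_axioms TV.V.M.graded_group_axioms g x(1), of d]
        TV.V.M.hpart_of_component[OF v, of d] x(2) by simp
    then show ?thesis using P0.M.hpart_component[OF x(1)] by blast
  qed
  have "generated_in_degrees E V {i. even i}"
    unfolding TV.V.generated_in_degrees_iff
  proof (intro allI subsetI)
    fix d v assume "v \<in> component V d"
    then obtain x where x: "x \<in> component P0 d" "g x = v" using lift by blast
    have "g x \<in> generate (add_monoid V) (homog_products E V {i. even i} d)"
      using P0(2) x(1)
    proof (induction rule: P0.generated_component_induct)
      case zero
      then show ?case using additive_map_zero[OF ab(1,2) gD(6)] by simp
    next
      case (product i x a)
      have "g (act P0 x a) = act V (g x) a"
        using gD(4) product P0.M.component_carrier E.component_carrier by blast
      then have "g (act P0 x a) \<in> homog_products E V {i. even i} d"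
        using gD(5)[OF product(2)] product(1,3) unfolding homog_products_def by blast
      then show ?case by (rule TV.V.M.add_generate_incl)
    next
      case (add x y)
      then show ?case using gD(3) P0.M.component_carrier TV.V.M.add_generate_add by simp
    qed
    then show "v \<in> generate (add_monoid V) (homog_products E V {i. even i} d)" using x by simp
  qed
  moreover have "kernel_condition n D \<phi> V"
    unfolding kernel_condition_def
  proof (intro allI ballI impI)
    fix k b s
    let ?L = "\<lambda>V. frag_lift (add_monoid V) (\<lambda>v a. act V v (\<phi> a))"
    let ?Lb = "\<lambda>V. frag_lift (add_monoid V) (\<lambda>v a. act V v (\<phi> (a \<otimes>\<^bsub>D\<^esub> b)))"
    let ?X = "component P0 (2 * k) \<times> component D 1"
    assume b: "b \<in> component D (int n - 1)" and s: "Poly_Mapping.keys s \<subseteq> component V (2 * k) \<times> component D 1"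
      and z: "?L V s = \<zero>\<^bsub>V\<^esub>"
    \<comment> \<open>Homogeneous preimages under g. They need not depend additively on v, since
      \<open>frag_push\<close> treats pairs one at a time.\<close>
    define \<sigma> where "\<sigma> v = (SOME x. x \<in> component P0 (2 * k) \<and> g x = v)" for v
    have \<sigma>: "\<sigma> v \<in> component P0 (2 * k) \<and> g (\<sigma> v) = v" if "v \<in> component V (2 * k)" for v
      unfolding \<sigma>_def by (rule someI_ex) (use lift[OF that] in blast)
    obtain t where t: "Poly_Mapping.keys t \<subseteq> ?X"
      and teq: "\<And>h. \<forall>v\<in>component P0 (2 * k). \<forall>a\<in>component D 1. h v a \<in> carrier (add_monoid V)
        \<Longrightarrow> frag_lift (add_monoid V) h t = frag_lift (add_monoid V) (\<lambda>v a. h (\<sigma> v) a) s"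
      using frag_push[OF TV.V.M.a_comm_group s, of \<sigma> "component P0 (2 * k)"] \<sigma> by blast
    have c0: "act P0 v e \<in> carrier P0" if "v \<in> component P0 i" "e \<in> carrier E" for v e i
      using that P0.act_closed P0.M.component_carrier by blast
    have cX: "act P0 v (\<beta> a) \<in> carrier P0" if "\<forall>a\<in>component D 1. \<beta> a \<in> carrier E" "(v, a) \<in> ?X" for \<beta> v a
      using that c0[of v "2 * k" "\<beta> a"] by simp
    have cV: "act V v e \<in> carrier V" if "v \<in> component V i" "e \<in> carrier E" for v e i
      using that TV.V.act_closed TV.V.M.component_carrier by blast
    have gt: "g (frag_lift (add_monoid P0) (\<lambda>v a. act P0 v (\<beta> a)) t) = frag_lift (add_monoid V) (\<lambda>v a. act V v (\<beta> a)) s"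
      if \<beta>: "\<And>a. a \<in> component D 1 \<Longrightarrow> \<beta> a \<in> carrier E" for \<beta>
    proof -
      have "g (frag_lift (add_monoid P0) (\<lambda>v a. act P0 v (\<beta> a)) t) = frag_lift (add_monoid V) (\<lambda>v a. act V (g v) (\<beta> a)) t"
        by (rule gr_hom_frag_lift[OF gP0 V g t \<beta>])
      also have "\<dots> = frag_lift (add_monoid V) (\<lambda>v a. act V (g (\<sigma> v)) (\<beta> a)) s"
        by (rule teq) (use cV[OF gD(5)] \<beta> in simp)
      also have "\<dots> = frag_lift (add_monoid V) (\<lambda>v a. act V v (\<beta> a)) s"
        by (rule comm_group.frag_lift_cong[OF TV.V.M.a_comm_group s]) (use \<sigma> cV \<beta> in auto)
      finally show ?thesis .
    qed
    let ?y = "?L P0 t"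
    have P0_closed: "frag_lift (add_monoid P0) (\<lambda>v a. act P0 v (\<beta> a)) r \<in> carrier P0"
      if "\<And>a. a \<in> component D 1 \<Longrightarrow> \<beta> a \<in> carrier E" "Poly_Mapping.keys r \<subseteq> ?X" for \<beta> r
      using comm_group.frag_lift_closed[OF P0.M.a_comm_group that(2), of "\<lambda>v a. act P0 v (\<beta> a)"] cX[of \<beta>] that(1) by simp
    have y_deg: "?y \<in> component P0 (2 * k + 1)"
      using t
    proof (rule free_Abelian_group_induct)
      show "?L P0 0 \<in> component P0 (2 * k + 1)"
        using comm_group.frag_lift_zero[OF P0.M.a_comm_group] by simp
    next
      fix p assume "p \<in> ?X"
      then obtain v a where p: "p = (v, a)" "v \<in> component P0 (2 * k)" "a \<in> component D 1" by blast
      have "act P0 v (\<phi> a) \<in> component P0 (2 * k + 1)"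
        using P0.act_degree[OF p(2) \<phi>_component[of a 1]] p(3) by (simp add: koszul_degree_def)
      moreover have "?L P0 (frag_of p) = act P0 v (\<phi> a)"
        using comm_group.frag_lift_of[OF P0.M.a_comm_group, of "\<lambda>v a. act P0 v (\<phi> a)" v a]
          c0[OF p(2) \<phi>_degree_1[OF p(3)]] by (simp add: p(1))
      ultimately show "?L P0 (frag_of p) \<in> component P0 (2 * k + 1)" by simp
    next
      fix x y assume xy: "Poly_Mapping.keys x \<subseteq> ?X" "Poly_Mapping.keys y \<subseteq> ?X"
        and c: "?L P0 x \<in> component P0 (2 * k + 1)" "?L P0 y \<in> component P0 (2 * k + 1)"
      have "?L P0 (x - y) = ?L P0 x \<oplus>\<^bsub>P0\<^esub> \<ominus>\<^bsub>P0\<^esub> ?L P0 y"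
        using comm_group.frag_lift_diff[OF P0.M.a_comm_group xy, of "\<lambda>v a. act P0 v (\<phi> a)"] cX[of \<phi>] \<phi>_degree_1
        by (simp add: a_inv_def)
      then show "?L P0 (x - y) \<in> component P0 (2 * k + 1)"
        using c P0.M.component_add P0.M.component_minus by simp
    qed
    have "g ?y = \<zero>\<^bsub>V\<^esub>" using gt[of \<phi>] \<phi>_degree_1 z by simp
    then have "?y \<in> a_kernel P0 V g" using y_deg P0.M.component_carrier by (simp add: a_kernel_def kernel_def)
    then obtain w where w: "w \<in> carrier P1" "f w = ?y" using ex by auto
    \<comment> \<open>f preserves degrees and \<open>?y\<close> is homogeneous, so w may be replaced
      by its part of degree 2 k + 1.\<close>
    let ?w = "hpart P1 (2 * k + 1) w"
    have fw: "f ?w = ?y"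
      using gr_hom_hpart[OF T1.V.M.graded_group_axioms P0.M.graded_group_axioms f w(1), of "2 * k + 1"]
        P0.M.hpart_of_component[OF y_deg, of "2 * k + 1"] w(2) by simp
    \<comment> \<open>The function module of P1 serves to express \<open>?w\<close> by products: a
      function of odd index with value \<open>?w\<close> at 1 is represented by a formal sum over
      degree 2k and D_1, and evaluating at 1 gives the expression.\<close>
    obtain q where q: "q \<in> component T1.MV (m + \<delta> (2 * k + 1))" "q \<one>\<^bsub>D\<^esub> = ?w"
      using T1.ev_component_surj[OF P1(2) T1.V.M.hpart_component[OF w(1)]] by blast
    have q': "q \<in> component T1.MV (m + int n * k + 1)" using q(1) unfolding \<delta>_odd by (simp add: add.assoc)
    obtain r where r: "Poly_Mapping.keys r \<subseteq> component P1 (2 * k) \<times> component D 1" "?w = ?L P1 r"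
      using T1.MV_odd_representation[OF q' b] q(2) unfolding T1.star_def[abs_def] by auto
    obtain t' where t': "Poly_Mapping.keys t' \<subseteq> ?X"
      and teq': "\<And>h. \<forall>v\<in>component P0 (2 * k). \<forall>a\<in>component D 1. h v a \<in> carrier (add_monoid P0)
        \<Longrightarrow> frag_lift (add_monoid P0) h t' = frag_lift (add_monoid P0) (\<lambda>v a. h (f v) a) r"
      using frag_push[OF P0.M.a_comm_group r(1), of f "component P0 (2 * k)"] fD(5) by blast
    have ft: "frag_lift (add_monoid P0) (\<lambda>v a. act P0 v (\<beta> a)) t' = f (frag_lift (add_monoid P1) (\<lambda>v a. act P1 v (\<beta> a)) r)"
      if \<beta>: "\<And>a. a \<in> component D 1 \<Longrightarrow> \<beta> a \<in> carrier E" for \<beta>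
    proof -
      have "frag_lift (add_monoid P0) (\<lambda>v a. act P0 v (\<beta> a)) t' = frag_lift (add_monoid P0) (\<lambda>v a. act P0 (f v) (\<beta> a)) r"
        by (rule teq') (use c0 \<beta> in simp)
      then show ?thesis using gr_hom_frag_lift[OF gP1 gP0 f r(1) \<beta>] by simp
    qed
    have diff: "frag_lift (add_monoid P0) (\<lambda>v a. act P0 v (\<beta> a)) (t - t')
        = frag_lift (add_monoid P0) (\<lambda>v a. act P0 v (\<beta> a)) t \<oplus>\<^bsub>P0\<^esub> \<ominus>\<^bsub>P0\<^esub> frag_lift (add_monoid P0) (\<lambda>v a. act P0 v (\<beta> a)) t'"
      if "\<And>a. a \<in> component D 1 \<Longrightarrow> \<beta> a \<in> carrier E" for \<beta>
      using comm_group.frag_lift_diff[OF P0.M.a_comm_group t t', of "\<lambda>v a. act P0 v (\<beta> a)"] cX[of \<beta>] that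
      by (simp add: a_inv_def)
    \<comment> \<open>So \<open>t\<close> and \<open>t'\<close> have the same sum of products with
      D_1, and their difference meets the hypothesis of the condition for P0.\<close>
    have "?L P0 t' = ?y" using ft[of \<phi>] \<phi>_degree_1 r(2) fw by simp
    then have "?L P0 (t - t') = \<zero>\<^bsub>P0\<^esub>"
      using diff[of \<phi>] \<phi>_degree_1 y_deg P0.M.component_carrier by (simp add: P0.M.r_neg)
    moreover have "Poly_Mapping.keys (t - t') \<subseteq> ?X" using keys_diff[of t t'] t t' by blast
    ultimately have "?Lb P0 (t - t') = \<zero>\<^bsub>P0\<^esub>"
      using kernel_condition_projective[OF P0] b unfolding kernel_condition_def by blast
    moreover have \<beta>n: "\<phi> (a \<otimes>\<^bsub>D\<^esub> b) \<in> carrier E" if "a \<in> component D 1" for a using \<phi>_degree_n[OF that b] .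
    moreover have cl: "?Lb P0 t \<in> carrier P0" "?Lb P0 t' \<in> carrier P0" using P0_closed[of "\<lambda>a. \<phi> (a \<otimes>\<^bsub>D\<^esub> b)"] \<beta>n t t' by simp_all
    ultimately have "?Lb P0 t \<oplus>\<^bsub>P0\<^esub> \<ominus>\<^bsub>P0\<^esub> ?Lb P0 t' = \<zero>\<^bsub>P0\<^esub>"
      using diff[of "\<lambda>a. \<phi> (a \<otimes>\<^bsub>D\<^esub> b)"] \<beta>n by simp
    then have eq: "?Lb P0 t = ?Lb P0 t'" by (rule P0.M.eq_if_diff_zero[OF cl])
    have c1: "act P1 v (\<phi> (a \<otimes>\<^bsub>D\<^esub> b)) \<in> carrier P1" if "(v, a) \<in> component P1 (2 * k) \<times> component D 1" for v a
      using that T1.V.act_closed[OF T1.V.M.component_carrier[of v "2 * k"] \<beta>n[of a]] by simp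
    have "?Lb P1 r \<in> carrier P1"
      using comm_group.frag_lift_closed[OF T1.V.M.a_comm_group r(1), of "\<lambda>v a. act P1 v (\<phi> (a \<otimes>\<^bsub>D\<^esub> b))"]
        c1 by simp
    then have "?Lb P0 t' \<in> a_kernel P0 V g" unfolding ex using ft[of "\<lambda>a. \<phi> (a \<otimes>\<^bsub>D\<^esub> b)"] \<beta>n by simp
    then have "g (?Lb P0 t) = \<zero>\<^bsub>V\<^esub>" using eq by (simp add: a_kernel_def kernel_def)
    then show "?Lb V s = \<zero>\<^bsub>V\<^esub>" using gt[of "\<lambda>a. \<phi> (a \<otimes>\<^bsub>D\<^esub> b)"] \<beta>n by simp
  qed
  ultimately show ?thesis using TV.in_L_iff by blast
qed

end

section \<open>The homogeneous dual\<close>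

lemma fin_digraph_opposite: "fin_digraph Q \<Longrightarrow> fin_digraph (opposite Q)"
  unfolding fin_digraph_def fin_digraph_axioms_def wf_digraph_def by (simp add: opposite_def)

text \<open>The relations are homogeneous, so the quotient map is a graded surjection. The vanishing
  of negative degrees and the factorization of degrees are inherited from the path algebra, where
  they concern single paths.\<close>

lemma homogeneous_dual_facts:
  fixes Q :: "('v, 'b) pre_digraph" and I :: "(('v \<times> 'b list) \<Rightarrow>\<^sub>0 'k::field) set"
  assumes Q: "fin_digraph Q" and D: "D = homogeneous_dual n Q I"
  shows homogeneous_dual_graded_ring: "graded_ring D"
    and homogeneous_dual_negative: "i < 0 \<Longrightarrow> component D i = {\<zero>\<^bsub>D\<^esub>}"
    and homogeneous_dual_generated: "\<lbrakk>0 \<le> i; 0 \<le> j\<rbrakk> \<Longrightarrow> component D (i + j) \<subseteq>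
      generate (add_monoid D) {a \<otimes>\<^bsub>D\<^esub> b | a b. a \<in> component D i \<and> b \<in> component D j}"
    and homogeneous_dual_embeds: "\<lbrakk>infinite (UNIV :: 'u set); inj (\<alpha> :: 'k \<Rightarrow> 'u)\<rbrakk> \<Longrightarrow>
      \<exists>\<iota> :: (('v \<times> 'b list) \<Rightarrow>\<^sub>0 'k) set \<Rightarrow> 'u. inj_on \<iota> (carrier D)"
proof -
  let ?G = "opposite Q"
  let ?A = "path_alg ?G :: (('v \<times> 'b list) \<Rightarrow>\<^sub>0 'k) graded"
  let ?S = "orthogonal n Q I"
  let ?p = "\<lambda>x. genideal ?A ?S +>\<^bsub>?A\<^esub> x"
  have G: "fin_digraph ?G" by (rule fin_digraph_opposite[OF Q])
  have A: "graded_ring ?A" by (rule graded_ring_PA[OF G])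
  interpret A: graded_ring ?A by (rule A)
  have S: "?S \<subseteq> (\<Union>i. component ?A i)" by (auto simp: orthogonal_def)
  have D': "D = graded_quotient ?A (genideal ?A ?S)" by (simp add: D homogeneous_dual_def)
  show graded_D: "graded_ring D" unfolding D' by (rule A.graded_quotient_graded_ring(1)[OF S])
  interpret D: graded_ring D by (rule graded_D)
  have "ring_hom_ring ?A D ?p" unfolding D' by (rule A.graded_quotient_graded_ring(2)[OF S])
  then interpret p: ring_hom_ring ?A D ?p .
  have comp: "component D i = ?p ` component ?A i" for i by (simp add: D' graded_quotient_def)
  have surj: "carrier D = ?p ` carrier ?A"
    unfolding D' graded_quotient_def FactRing_def A_RCOSETS_def' by auto
  have p_zero: "?p 0 = \<zero>\<^bsub>D\<^esub>" using p.hom_zero by (simp add: path_alg_simps(4)[OF G])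
  have padd: "?p (f + g) = ?p f \<oplus>\<^bsub>D\<^esub> ?p g" if "f \<in> carrier ?A" "g \<in> carrier ?A" for f g
    using p.hom_add[OF that] by (simp add: path_alg_simps(5)[OF G])
  show "component D i = {\<zero>\<^bsub>D\<^esub>}" if "i < 0"
    unfolding comp component_negative_PA[OF G that] using p_zero by simp
  show "component D (i + j) \<subseteq>
      generate (add_monoid D) {a \<otimes>\<^bsub>D\<^esub> b | a b. a \<in> component D i \<and> b \<in> component D j}"
    if ij: "0 \<le> i" "0 \<le> j"
  proof
    let ?X = "{p \<in> paths ?G. int (length (snd p)) = i + j}"
    let ?H = "{a \<otimes>\<^bsub>D\<^esub> b | a b. a \<in> component D i \<and> b \<in> component D j}"
    fix y assume "y \<in> component D (i + j)"
    then obtain f where f: "f \<in> component ?A (i + j)" "y = ?p f" unfolding comp by blast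
    have "Poly_Mapping.keys f \<subseteq> ?X" using f(1) by (simp add: path_alg_simps(6)[OF G])
    then have "?p f \<in> generate (add_monoid D) ?H"
    proof (induction rule: keys_induct)
      case zero
      then show ?case using p_zero by simp
    next
      case (single q c)
      then obtain g h where gh: "g \<in> component ?A i" "h \<in> component ?A j" "g \<otimes>\<^bsub>?A\<^esub> h = Poly_Mapping.single q c"
        using path_split[OF G, of q i j c] ij by blast
      have "?p (g \<otimes>\<^bsub>?A\<^esub> h) = ?p g \<otimes>\<^bsub>D\<^esub> ?p h"
        using p.hom_mult gh(1,2) A.component_carrier by blast
      then have "?p (Poly_Mapping.single q c) = ?p g \<otimes>\<^bsub>D\<^esub> ?p h" unfolding gh(3) .
      then show ?case using gh(1,2) unfolding comp by (intro D.add_generate_incl) blast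
    next
      case (add f g)
      have "f \<in> carrier ?A" "g \<in> carrier ?A" using add(1,2) by (auto simp: path_alg_simps(1)[OF G])
      then show ?case using D.add_generate_add[OF add(3,4)] padd by simp
    qed
    then show "y \<in> generate (add_monoid D) ?H" using f by simp
  qed
  show "\<exists>\<iota> :: (('v \<times> 'b list) \<Rightarrow>\<^sub>0 'k) set \<Rightarrow> 'u. inj_on \<iota> (carrier D)"
    if inf: "infinite (UNIV :: 'u set)" and \<alpha>: "inj (\<alpha> :: 'k \<Rightarrow> 'u)"
  proof -
    \<comment> \<open>Additive generators need all scalar multiples of paths. They are indexed by a
      countable set times the field, which fits into \<open>'u\<close>.\<close>
    let ?X = "{?p (Poly_Mapping.single q c) | q c. q \<in> paths ?G}"
    have sc: "Poly_Mapping.single q c \<in> carrier ?A" if "q \<in> paths ?G" for q c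
      using that by (simp add: path_alg_simps(1)[OF G])
    have X: "?X \<subseteq> carrier D" using sc surj by blast
    have gen: "carrier D \<subseteq> generate (add_monoid D) ?X"
    proof
      fix y assume "y \<in> carrier D"
      then obtain f where f: "f \<in> carrier ?A" "y = ?p f" using surj by blast
      have "Poly_Mapping.keys f \<subseteq> paths ?G" using f(1) by (simp add: path_alg_simps(1)[OF G])
      then have "?p f \<in> generate (add_monoid D) ?X"
      proof (induction rule: keys_induct)
        case zero
        then show ?case using p_zero by simp
      next
        case (single q c)
        then show ?case by (intro D.add_generate_incl) blast
      next
        case (add f g)
        have "f \<in> carrier ?A" "g \<in> carrier ?A" using add(1,2) by (auto simp: path_alg_simps(1)[OF G])
        then show ?case using D.add_generate_add[OF add(3,4)] padd by simp
      qed
      then show "y \<in> generate (add_monoid D) ?X" using f by simp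
    qed
    obtain \<pi> :: "'u \<times> 'u \<Rightarrow> 'u" where \<pi>: "inj \<pi>" using infinite_pair_injection[OF inf] by blast
    obtain \<nu> :: "nat \<Rightarrow> 'u" where \<nu>: "inj \<nu>" using inf infinite_countable_subset by blast
    have "\<forall>x \<in> ?X. \<exists>r. fst r \<in> paths ?G \<and> x = ?p (Poly_Mapping.single (fst r) (snd r))" by auto
    from bchoice[OF this] obtain r where
      r': "\<forall>x \<in> ?X. fst (r x) \<in> paths ?G \<and> x = ?p (Poly_Mapping.single (fst (r x)) (snd (r x)))" ..
    have r: "fst (r x) \<in> paths ?G \<and> x = ?p (Poly_Mapping.single (fst (r x)) (snd (r x)))" if "x \<in> ?X" for x
      using r' that by (rule bspec)
    let ?i = "\<lambda>x. \<pi> (\<nu> (to_nat_on (paths ?G) (fst (r x))), \<alpha> (snd (r x)))"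
    have "inj_on ?i ?X"
    proof (rule inj_onI)
      fix x y assume x: "x \<in> ?X" and y: "y \<in> ?X" and eq: "?i x = ?i y"
      then have e: "to_nat_on (paths ?G) (fst (r x)) = to_nat_on (paths ?G) (fst (r y))" "snd (r x) = snd (r y)"
        using \<pi> \<nu> \<alpha> by (auto simp: inj_eq)
      from e(1) have "fst (r x) = fst (r y)"
        by (rule inj_onD[OF inj_on_to_nat_on[OF countable_paths[OF G]] _ conjunct1[OF r[OF x]] conjunct1[OF r[OF y]]])
      then have "?p (Poly_Mapping.single (fst (r x)) (snd (r x))) = ?p (Poly_Mapping.single (fst (r y)) (snd (r y)))"
        using e(2) by (simp only:)
      then show "x = y" by (rule trans[OF trans[OF conjunct2[OF r[OF x]]] sym[OF conjunct2[OF r[OF y]]]])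
    qed
    from group.generate_injection[OF D.a_group inf _ this] X
    obtain \<iota> :: "(('v \<times> 'b list) \<Rightarrow>\<^sub>0 'k) set \<Rightarrow> 'u" where "inj_on \<iota> (generate (add_monoid D) ?X)" by auto
    then show ?thesis using inj_on_subset[OF _ gen] by blast
  qed
qed

section \<open>The zero of the Yoneda algebra\<close>

lemma mod_homD:
  assumes "f \<in> mod_hom R M N"
  shows "f \<in> extensional (carrier M)" "x \<in> carrier M \<Longrightarrow> f x \<in> carrier N"
    "\<lbrakk>x \<in> carrier M; y \<in> carrier M\<rbrakk> \<Longrightarrow> f (x \<oplus>\<^bsub>M\<^esub> y) = f x \<oplus>\<^bsub>N\<^esub> f y"
    "\<lbrakk>x \<in> carrier M; a \<in> carrier R\<rbrakk> \<Longrightarrow> f (act M x a) = act N (f x) a"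
  using assms by (auto simp: mod_hom_def PiE_def)

lemma mod_homI:
  assumes "f \<in> extensional (carrier M)" "\<And>x. x \<in> carrier M \<Longrightarrow> f x \<in> carrier N"
    "\<And>x y. \<lbrakk>x \<in> carrier M; y \<in> carrier M\<rbrakk> \<Longrightarrow> f (x \<oplus>\<^bsub>M\<^esub> y) = f x \<oplus>\<^bsub>N\<^esub> f y"
    "\<And>x a. \<lbrakk>x \<in> carrier M; a \<in> carrier R\<rbrakk> \<Longrightarrow> f (act M x a) = act N (f x) a"
  shows "f \<in> mod_hom R M N"
  using assms by (auto simp: mod_hom_def PiE_def)

lemma mod_hom_add:
  assumes "graded_right_module R M" "graded_right_module R N" "f \<in> mod_hom R M N" "g \<in> mod_hom R M N"
  shows "(\<lambda>x\<in>carrier M. f x \<oplus>\<^bsub>N\<^esub> g x) \<in> mod_hom R M N"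
proof -
  interpret M: graded_right_module R M by fact
  interpret N: graded_right_module R N by fact
  show ?thesis
    by (rule mod_homI)
      (use mod_homD[OF assms(3)] mod_homD[OF assms(4)] in
        \<open>simp_all add: M.act_closed N.act_add_left N.M.a_ac\<close>)
qed

lemma mod_hom_zero:
  assumes "graded_right_module R M" "graded_right_module R N"
  shows "(\<lambda>x\<in>carrier M. \<zero>\<^bsub>N\<^esub>) \<in> mod_hom R M N"
proof -
  interpret M: graded_right_module R M by fact
  interpret N: graded_right_module R N by fact
  show ?thesis by (rule mod_homI) (simp_all add: M.act_closed)
qed

context
  fixes R :: "('r, 'x) graded_scheme" and P :: "nat \<Rightarrow> ('r, 'u) graded_module" and d :: "nat \<Rightarrow> 'u \<Rightarrow> 'u"
  assumes P: "\<And>i. graded_right_module R (P i)" and d: "\<And>i. d i \<in> gr_hom R (P (Suc i)) (P i)"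
begin

abbreviation "CE \<equiv> chain_endo_ring R P d"
abbreviation "NH \<equiv> null_homotopic R P d"

lemma CE_carrierI:
  assumes "\<And>i p. f i p \<in> mod_hom R (P (p + i)) (P p)"
    and "\<And>i p x. x \<in> carrier (P (Suc (p + i))) \<Longrightarrow> f i p (d (p + i) x) = d p (f i (Suc p) x)"
    and "finite {i. f i \<noteq> (\<lambda>p. \<lambda>x\<in>carrier (P (p + i)). \<zero>\<^bsub>P p\<^esub>)}"
  shows "f \<in> carrier CE"
  using assms by (simp add: chain_endo_ring_def Let_def)

lemma CE_carrierD:
  assumes "f \<in> carrier CE"
  shows "f i p \<in> mod_hom R (P (p + i)) (P p)"
    and "x \<in> carrier (P (Suc (p + i))) \<Longrightarrow> f i p (d (p + i) x) = d p (f i (Suc p) x)"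
    and "finite {i. f i \<noteq> (\<lambda>p. \<lambda>x\<in>carrier (P (p + i)). \<zero>\<^bsub>P p\<^esub>)}"
  using assms by (simp_all add: chain_endo_ring_def Let_def)

lemma CE_add: "f \<oplus>\<^bsub>CE\<^esub> g = (\<lambda>i p. \<lambda>x\<in>carrier (P (p + i)). f i p x \<oplus>\<^bsub>P p\<^esub> g i p x)"
  and CE_zero: "\<zero>\<^bsub>CE\<^esub> = (\<lambda>i p. \<lambda>x\<in>carrier (P (p + i)). \<zero>\<^bsub>P p\<^esub>)"
  by (simp_all add: chain_endo_ring_def Let_def)

lemma P_ab: "abelian_group (P i)"
  using P[of i] by (simp add: graded_right_module_def graded_group_def)

lemma P_zero: "x \<in> carrier (P i) \<Longrightarrow> x \<oplus>\<^bsub>P i\<^esub> \<zero>\<^bsub>P i\<^esub> = x" "\<zero>\<^bsub>P i\<^esub> \<oplus>\<^bsub>P i\<^esub> \<zero>\<^bsub>P i\<^esub> = \<zero>\<^bsub>P i\<^esub>" "\<zero>\<^bsub>P i\<^esub> \<in> carrier (P i)"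
proof -
  interpret abelian_group "P i" by (rule P_ab)
  show "x \<in> carrier (P i) \<Longrightarrow> x \<oplus>\<^bsub>P i\<^esub> \<zero>\<^bsub>P i\<^esub> = x" "\<zero>\<^bsub>P i\<^esub> \<oplus>\<^bsub>P i\<^esub> \<zero>\<^bsub>P i\<^esub> = \<zero>\<^bsub>P i\<^esub>" "\<zero>\<^bsub>P i\<^esub> \<in> carrier (P i)"
    by simp_all
qed

lemma d_zero: "d i \<zero>\<^bsub>P (Suc i)\<^esub> = \<zero>\<^bsub>P i\<^esub>"
  by (rule additive_map_zero[OF P_ab P_ab gr_homD(6)[OF d]])

lemma CE_zero_closed: "\<zero>\<^bsub>CE\<^esub> \<in> carrier CE"
proof (rule CE_carrierI)
  show "\<zero>\<^bsub>CE\<^esub> i p (d (p + i) x) = d p (\<zero>\<^bsub>CE\<^esub> i (Suc p) x)" if "x \<in> carrier (P (Suc (p + i)))" for i p x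
    using that gr_homD(2)[OF d that] by (simp add: CE_zero d_zero)
qed (simp_all add: CE_zero mod_hom_zero[OF P P])

lemma CE_add_zero: "f \<in> carrier CE \<Longrightarrow> f \<oplus>\<^bsub>CE\<^esub> \<zero>\<^bsub>CE\<^esub> = f"
proof (intro ext)
  fix i p x assume f: "f \<in> carrier CE"
  note fD = mod_homD[OF CE_carrierD(1)[OF f, of i p]]
  show "(f \<oplus>\<^bsub>CE\<^esub> \<zero>\<^bsub>CE\<^esub>) i p x = f i p x"
    using fD(1,2) P_zero(1)[OF fD(2)] by (cases "x \<in> carrier (P (p + i))") (auto simp: CE_add CE_zero extensional_def)
qed

lemma CE_add_closed:
  assumes f: "f \<in> carrier CE" and g: "g \<in> carrier CE"
  shows "f \<oplus>\<^bsub>CE\<^esub> g \<in> carrier CE"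
proof (rule CE_carrierI)
  show "(f \<oplus>\<^bsub>CE\<^esub> g) i p \<in> mod_hom R (P (p + i)) (P p)" for i p
    unfolding CE_add by (rule mod_hom_add[OF P P CE_carrierD(1)[OF f] CE_carrierD(1)[OF g]])
  show "(f \<oplus>\<^bsub>CE\<^esub> g) i p (d (p + i) x) = d p ((f \<oplus>\<^bsub>CE\<^esub> g) i (Suc p) x)"
    if x: "x \<in> carrier (P (Suc (p + i)))" for i p x
    using x gr_homD(2)[OF d x] CE_carrierD(2)[OF f x] CE_carrierD(2)[OF g x]
      gr_homD(3)[OF d, of "f i (Suc p) x" p "g i (Suc p) x"]
      mod_homD(2)[OF CE_carrierD(1)[OF f, of i "Suc p"], of x]
      mod_homD(2)[OF CE_carrierD(1)[OF g, of i "Suc p"], of x]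
    by (simp add: CE_add)
  let ?Z = "\<lambda>i p. \<lambda>x\<in>carrier (P (p + i)). \<zero>\<^bsub>P p\<^esub>"
  have "(f \<oplus>\<^bsub>CE\<^esub> g) i = ?Z i" if "f i = ?Z i" "g i = ?Z i" for i
    using that by (auto simp: CE_add P_zero fun_eq_iff)
  then have "{i. (f \<oplus>\<^bsub>CE\<^esub> g) i \<noteq> ?Z i} \<subseteq> {i. f i \<noteq> ?Z i} \<union> {i. g i \<noteq> ?Z i}" by blast
  then show "finite {i. (f \<oplus>\<^bsub>CE\<^esub> g) i \<noteq> ?Z i}"
    using CE_carrierD(3)[OF f] CE_carrierD(3)[OF g] by (auto intro: finite_subset)
qed

definition homotopy :: "(nat \<Rightarrow> nat \<Rightarrow> 'u \<Rightarrow> 'u) \<Rightarrow> (nat \<Rightarrow> nat \<Rightarrow> 'u \<Rightarrow> 'u) \<Rightarrow> bool" where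
  "homotopy f h \<longleftrightarrow> (\<forall>i p. p + i > 0 \<longrightarrow> h i p \<in> mod_hom R (P (p + i - 1)) (P p)) \<and>
       (\<forall>i p. \<forall>x\<in>carrier (P (p + i)).
          f i p x = d p (h i (Suc p) x) \<oplus>\<^bsub>P p\<^esub>
            (if p + i = 0 then \<zero>\<^bsub>P p\<^esub> else h i p (d (p + i - 1) x)))"

lemma NH_iff: "f \<in> NH \<longleftrightarrow> f \<in> carrier CE \<and> (\<exists>h. homotopy f h)"
  by (simp add: null_homotopic_def homotopy_def)

lemma d_pred: "\<lbrakk>x \<in> carrier (P (p + i)); p + i > 0\<rbrakk> \<Longrightarrow> d (p + i - 1) x \<in> carrier (P (p + i - 1))"
  using gr_homD(2)[OF d, of x "p + i - 1"] by simp

lemma homotopy_zero: "homotopy \<zero>\<^bsub>CE\<^esub> (\<lambda>i p. \<lambda>x\<in>carrier (P (p + i - 1)). \<zero>\<^bsub>P p\<^esub>)"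
  unfolding homotopy_def
proof (intro conjI allI impI ballI)
  show "(\<lambda>x\<in>carrier (P (p + i - 1)). \<zero>\<^bsub>P p\<^esub>) \<in> mod_hom R (P (p + i - 1)) (P p)" for i p
    by (rule mod_hom_zero[OF P P])
  show "\<zero>\<^bsub>CE\<^esub> i p x = d p ((\<lambda>x\<in>carrier (P (Suc p + i - 1)). \<zero>\<^bsub>P (Suc p)\<^esub>) x) \<oplus>\<^bsub>P p\<^esub>
      (if p + i = 0 then \<zero>\<^bsub>P p\<^esub> else (\<lambda>x\<in>carrier (P (p + i - 1)). \<zero>\<^bsub>P p\<^esub>) (d (p + i - 1) x))"
    if "x \<in> carrier (P (p + i))" for i p x
    using that d_pred[OF that] by (simp add: CE_zero d_zero P_zero)
qed

lemma homotopy_add: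
  assumes f: "homotopy f h" and g: "homotopy g k"
  shows "homotopy (f \<oplus>\<^bsub>CE\<^esub> g) (\<lambda>i p. \<lambda>x\<in>carrier (P (p + i - 1)). h i p x \<oplus>\<^bsub>P p\<^esub> k i p x)"
proof -
  have hm: "h i p \<in> mod_hom R (P (p + i - 1)) (P p)" "k i p \<in> mod_hom R (P (p + i - 1)) (P p)"
    if "p + i > 0" for i p
    using f g that by (auto simp: homotopy_def)
  have fe: "f i p x = d p (h i (Suc p) x) \<oplus>\<^bsub>P p\<^esub> (if p + i = 0 then \<zero>\<^bsub>P p\<^esub> else h i p (d (p + i - 1) x))"
    and ge: "g i p x = d p (k i (Suc p) x) \<oplus>\<^bsub>P p\<^esub> (if p + i = 0 then \<zero>\<^bsub>P p\<^esub> else k i p (d (p + i - 1) x))"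
    if "x \<in> carrier (P (p + i))" for i p x
    using f g that unfolding homotopy_def by blast+
  show ?thesis
    unfolding homotopy_def
  proof (intro conjI allI impI ballI)
    show "(\<lambda>x\<in>carrier (P (p + i - 1)). h i p x \<oplus>\<^bsub>P p\<^esub> k i p x) \<in> mod_hom R (P (p + i - 1)) (P p)" if "p + i > 0" for i p
      by (rule mod_hom_add[OF P P hm[OF that]])
    fix i p x assume x: "x \<in> carrier (P (p + i))"
    interpret abelian_group "P p" by (rule P_ab)
    have s: "h i (Suc p) x \<in> carrier (P (Suc p))" "k i (Suc p) x \<in> carrier (P (Suc p))"
      using mod_homD(2)[OF hm(1)[of "Suc p" i]] mod_homD(2)[OF hm(2)[of "Suc p" i]] x by auto
    have ds: "d p (h i (Suc p) x) \<in> carrier (P p)" "d p (k i (Suc p) x) \<in> carrier (P p)"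
      "d p (h i (Suc p) x \<oplus>\<^bsub>P (Suc p)\<^esub> k i (Suc p) x) = d p (h i (Suc p) x) \<oplus>\<^bsub>P p\<^esub> d p (k i (Suc p) x)"
      using gr_homD(2,3)[OF d] s by auto
    have t: "h i p (d (p + i - 1) x) \<in> carrier (P p)" "k i p (d (p + i - 1) x) \<in> carrier (P p)" if "p + i > 0"
      using mod_homD(2)[OF hm(1)[OF that] d_pred[OF x that]] mod_homD(2)[OF hm(2)[OF that] d_pred[OF x that]] by auto
    show "(f \<oplus>\<^bsub>CE\<^esub> g) i p x = d p ((\<lambda>x\<in>carrier (P (Suc p + i - 1)). h i (Suc p) x \<oplus>\<^bsub>P (Suc p)\<^esub> k i (Suc p) x) x) \<oplus>\<^bsub>P p\<^esub>
      (if p + i = 0 then \<zero>\<^bsub>P p\<^esub> else (\<lambda>x\<in>carrier (P (p + i - 1)). h i p x \<oplus>\<^bsub>P p\<^esub> k i p x) (d (p + i - 1) x))"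
    \<comment> \<open>At p + i = 0 the second term is zero by the convention P (-1) = 0. The case is
      separated because subtraction of natural numbers would give P 0 there.\<close>
    proof (cases "p + i = 0")
      case True
      then show ?thesis
        using x fe[OF x] ge[OF x] ds r_zero[OF ds(1)] r_zero[OF ds(2)] r_zero[OF a_closed[OF ds(1,2)]]
        by (simp add: CE_add)
    next
      case False
      then have pos: "p + i > 0" by simp
      show ?thesis
        using x fe[OF x] ge[OF x] ds t[OF pos] d_pred[OF x pos]
        unfolding if_not_P[OF False] by (simp add: CE_add a_ac)
    qed
  qed
qed

lemma NH_zero: "\<zero>\<^bsub>CE\<^esub> \<in> NH"
  unfolding NH_iff using CE_zero_closed homotopy_zero by blast

lemma NH_coset_zero: "NH +>\<^bsub>CE\<^esub> \<zero>\<^bsub>CE\<^esub> = NH"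
  using CE_add_zero by (auto simp: a_r_coset_def' NH_iff)

text \<open>Homotopies add, and the zero cochain is null-homotopic. Idempotence of \<open>NH\<close>
  for the addition of cosets stands in for the statement that it is the zero of a group.\<close>

lemma NH_set_add: "NH <+>\<^bsub>CE\<^esub> NH = NH"
proof
  show "NH <+>\<^bsub>CE\<^esub> NH \<subseteq> NH"
    using CE_add_closed homotopy_add by (fastforce simp: set_add_def' NH_iff)
  show "NH \<subseteq> NH <+>\<^bsub>CE\<^esub> NH"
  proof
    fix f assume f: "f \<in> NH"
    then have "f = f \<oplus>\<^bsub>CE\<^esub> \<zero>\<^bsub>CE\<^esub>" using CE_add_zero by (simp add: NH_iff)
    then show "f \<in> NH <+>\<^bsub>CE\<^esub> NH" using f NH_zero unfolding set_add_def' by blast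
  qed
qed

lemma yoneda_zero:
  assumes T: "abelian_group T" and \<phi>: "\<phi> \<in> ring_iso T (yoneda_algebra R P d)"
  shows "\<phi> \<zero>\<^bsub>T\<^esub> = \<zero>\<^bsub>yoneda_algebra R P d\<^esub>"
proof -
  let ?E = "yoneda_algebra R P d"
  interpret T: abelian_group T by (rule T)
  note iso = ring_iso_memE[OF \<phi>]
  have E: "carrier ?E = a_rcosets\<^bsub>CE\<^esub> NH" "\<zero>\<^bsub>?E\<^esub> = NH" "X \<oplus>\<^bsub>?E\<^esub> Y = X <+>\<^bsub>CE\<^esub> Y" for X Y
    by (simp_all add: yoneda_algebra_def graded_quotient_def FactRing_def)
  have "NH \<in> carrier ?E" unfolding E A_RCOSETS_def' using CE_zero_closed NH_coset_zero by blast
  then have "NH \<in> \<phi> ` carrier T" using iso(5) by (simp add: bij_betw_def)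
  then obtain y where y: "y \<in> carrier T" "\<phi> y = NH" by blast
  have "\<phi> (y \<oplus>\<^bsub>T\<^esub> y) = \<phi> y" using iso(3)[OF y(1) y(1)] y NH_set_add by (simp add: E)
  then have "y \<oplus>\<^bsub>T\<^esub> y = y" using iso(5) y by (auto simp: bij_betw_def inj_on_def)
  then have "y = \<zero>\<^bsub>T\<^esub>" using y(1) by (simp add: T.add.l_cancel_one)
  then show ?thesis using y E(2) by simp
qed

end

theorem mainTheorem18:
  fixes Q :: "('v, 'b) pre_digraph"
    and I :: "(('v \<times> 'b list) \<Rightarrow>\<^sub>0 'k::field) set"
    and P :: "nat \<Rightarrow> ((('v \<times> 'b list) \<Rightarrow>\<^sub>0 'k) set, 'u) graded_module"
    and d :: "nat \<Rightarrow> 'u \<Rightarrow> 'u"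
    and e :: "'u \<Rightarrow> (('v \<times> 'b list) \<Rightarrow>\<^sub>0 'k) set"
    and \<Lambda> D :: "(('v \<times> 'b list) \<Rightarrow>\<^sub>0 'k) set graded"
    and E :: "(nat \<Rightarrow> nat \<Rightarrow> 'u \<Rightarrow> 'u) set graded"
    and \<phi> :: "(('v \<times> 'b list) \<Rightarrow>\<^sub>0 'k) set \<Rightarrow> (nat \<Rightarrow> nat \<Rightarrow> 'u \<Rightarrow> 'u) set"
    and n :: nat and m :: int
  assumes universe: "infinite (UNIV :: 'u set)" "\<exists>j :: 'k \<Rightarrow> 'u. inj j"
    and "n > 2"
    and "n_Koszul n Q I P d e"
    and "\<Lambda> = graded_quotient (path_alg Q) I"
    and "D = homogeneous_dual n Q I"
    and "E = yoneda_algebra \<Lambda> P d"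
    and identification: "\<phi> \<in> graded_ring_iso (truncated_ring n D) E"
  shows "equivalent_categories
           (full_subcategory (Gr D) (in_G n m D) ::
              (((('v \<times> 'b list) \<Rightarrow>\<^sub>0 'k) set, 'u) graded_module, 'u \<Rightarrow> 'u) category)
           (full_subcategory (Gr E) (in_L n D E \<phi>) ::
              (((nat \<Rightarrow> nat \<Rightarrow> 'u \<Rightarrow> 'u) set, 'u) graded_module, 'u \<Rightarrow> 'u) category)
       \<and> (\<forall>V :: ((nat \<Rightarrow> nat \<Rightarrow> 'u \<Rightarrow> 'u) set, 'u) graded_module.
            V \<in> Ob (Gr E) \<and> presented_in_even_degrees E V \<longrightarrow> in_L n D E \<phi> V)"
proof -
  have Q: "fin_digraph Q" and res: "graded_projective_resolution \<Lambda> (degree_zero_module \<Lambda>) P d e"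
    using assms(4,5) by (auto simp: n_Koszul_def minimal_resolution_def Let_def)
  have P: "graded_right_module \<Lambda> (P i)" and d: "d i \<in> gr_hom \<Lambda> (P (Suc i)) (P i)" for i
    using res by (auto simp: graded_projective_resolution_def gr_projective_def)
  note dual = homogeneous_dual_facts[OF Q assms(6)]
  have T: "graded_ring (truncated_ring n D)" by (rule graded_ring_truncated[OF dual(1) assms(3)])
  have Tab: "abelian_group (truncated_ring n D)"
    using T by (simp add: graded_ring_def graded_group_def)
  have \<phi>: "\<phi> \<in> ring_iso (truncated_ring n D) (yoneda_algebra \<Lambda> P d)"
    using identification assms(7) by (simp add: graded_ring_iso_def)
  \<comment> \<open>This is needed before E can be treated as a ring, because the identification
    itself does not mention zero.\<close>
  have zero: "\<phi> \<zero>\<^bsub>D\<^esub> = \<zero>\<^bsub>E\<^esub>"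
    using yoneda_zero[OF P d Tab \<phi>] assms(7) by (simp add: truncated_ring_simps)
  obtain \<alpha> :: "'k \<Rightarrow> 'u" where "inj \<alpha>" using universe(2) by blast
  then have emb: "\<exists>\<iota> :: (('v \<times> 'b list) \<Rightarrow>\<^sub>0 'k) set \<Rightarrow> 'u. inj_on \<iota> (carrier D)"
    using dual(4)[OF universe(1)] by blast
  interpret truncation_universe D E \<phi> n m "TYPE('u)"
    by (intro truncation_universe.intro truncation.intro truncation_universe_axioms.intro
        dual(1) assms(3) identification zero universe(1) emb dual(2) dual(3))
  show ?thesis
  proof (intro conjI allI impI)
    fix V :: "((nat \<Rightarrow> nat \<Rightarrow> 'u \<Rightarrow> 'u) set, 'u) graded_module"
    assume "V \<in> Ob (Gr E) \<and> presented_in_even_degrees E V"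
    then show "in_L n D E \<phi> V" by (intro presented_in_L) (auto simp: Gr_def)
  qed (rule equivalence)
qed

end
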